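(* Let $V=(V,\nabla)$ be an $\mathcal{H}_W$-supermodule, and write $\mathcal{P}:=\mathcal{P}^{\mathrm{cl}N_W=N}_{\Pi^{N+1}V}$ for the $N_W=N$ SUSY coisson operad of $\Pi^{N+1}V$. (1) For an odd Maurer–Cartan solution $X\in \mathrm{MC}(L(\mathcal{P}))_{\bar 1}$, define linear maps $\{\cdot_\Lambda\cdot\}_X\colon V\otimes V\to V[\Lambda]$ and $\mu_X\colon V\otimes V\to V$ by $$\{a_\Lambda b\}_X := (-1)^{p(a)(N+1)}X^{\bullet\ \ \bullet}_{\Lambda,-\Lambda-\nabla}(a\otimes b),\qquad \mu_X(a\otimes b):=(-1)^{p(a)(N+1)}\operatorname{Res}_\Lambda\bigl(\lambda^{-1}X^{\bullet\to\bullet}_{\Lambda,-\Lambda-\nabla}(a\otimes b)\bigr)$$ for $a,b\in V$, where $p$ is the parity of $V$. Then $(V,\nabla,\{\cdot_\Lambda\cdot\}_X,\mu_X)$ is a non-unital $N_W=N$ SUSY Poisson vertex algebra. (2) The map $X\mapsto(\{\cdot_\Lambda\cdot\}_X,\mu_X)$ gives a bijection $$\mathrm{MC}(L(\mathcal{P}))_{\bar 1}\ \xrightarrow{\ \sim\ }\ \{\text{non-unital } N_W=N \text{ SUSY Poisson vertex algebra structures on }(V,\nabla)\}.$$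
   Context: **Conventions.** $\mathbb{K}$ is a field of characteristic $0$; $N\ge 0$ is a fixed integer; $\mathbb{N}=\{0,1,2,\dots\}$; $[n]=\{1,\dots,n\}$. Superspaces are $\mathbb{Z}/2$-graded with parity $p$, and the Koszul sign rule is used. $\Pi$ is parity change; $\Pi^{N+1}V$ is the same space with parity shifted by $N+1$ and the same operators. **Supervariables.** A $(1|N)_W$-supervariable is $\Lambda=(\lambda,\theta^1,\dots,\theta^N)$. $\mathbb{K}[\Lambda_k]_{k=1}^n$ is the free supercommutative algebra on even $\lambda_k$ and odd $\theta_k^i$. Put $\theta^I=\theta^{i_1}\cdots\theta^{i_r}$ for $I=\{i_1<\dots<i_r\}\subset[N]$, $\Lambda^{m|I}=\lambda^m\theta^I$, and $V[\Lambda_k]_{k=1}^n=\mathbb{K}[\Lambda_k]_{k=1}^n\otimes V$. Sums and negatives of supervariables are componentwise. $\operatorname{Res}_\Lambda(\lambda^{-1}\Lambda^{m|I}v)=\delta_{m,0}\delta_{I,[N]}v$. **$\mathcal{H}_W$.** The free supercommutative algebra on even $T$ and odd $S^1,\dots,S^N$; $\nabla=(T,S^1,\dots,S^N)$. $\mathbb{K}[\Lambda_k]_{k=1}^n$ is a right $\mathcal{H}_W$-supermodule by $a\cdot T=a(-\sum_k\lambda_k)$, $a\cdot S^i=a(-\sum_k\theta^i_k)$. For an $\mathcal{H}_W$-supermodule $V$ put $V_\nabla[\Lambda_k]_{k=1}^n=\mathbb{K}[\Lambda_k]_{k=1}^n\otimes_{\mathcal{H}_W}V$. For $n\ge1$ there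 is an isomorphism $V_\nabla[\Lambda_k]_{k=1}^n\cong V[\Lambda_k]_{k=1}^{n-1}$, $a(\Lambda_1,\dots,\Lambda_n)\otimes v\mapsto a(\Lambda_1,\dots,\Lambda_{n-1},-\Lambda_1-\dots-\Lambda_{n-1}-\nabla)v$. For $n=2$ the image of $X_{\Lambda_1,\Lambda_2}(\cdot)$ in $V[\Lambda]$, $\Lambda=\Lambda_1$, is written $X_{\Lambda,-\Lambda-\nabla}(\cdot)$. For an operator $\varphi$ on $V$, $\varphi^{(k)}$ is $\varphi$ acting on the $k$-th factor of $V^{\otimes n}$. **Quivers.** An $n$-quiver is a finite directed multigraph with vertex set $[n]$ (edges unlabeled, i.e. considered up to renaming edges). $\mathcal{Q}(n)$ is the set of $n$-quivers without loops; $\mathcal{Q}_{\mathrm{ac}}(n)$ the subset whose underlying undirected multigraph $\underline{Q}$ is a forest. $Q\setminus\alpha$ is $Q$ with edge $\alpha$ removed. $\sigma\in\mathfrak{S}_n$ acts by relabeling vertices $i\mapsto\sigma(i)$. For $n=2$: $\bullet\ \ \bullet$ is the quiver with no edge, $\bullet\to\bullet$ the quiver with one edge from $1$ to $2$. **Operations.** $\mathcal{P}^{\mathrm{cl}N_W=N}_V(n)$ is the superspace of linear maps $X\colon V^{\otimes n}\otimes\mathbb{K}\mathcal{Q}(n)\to V_\nabla[\Lambda_k]_{k=1}^n$ such that, with $X^Q:=X(-\otimes Q)$, for all $Q\in\mathcal{Q}(n)$: (i) $X^Q=0$ if $Q\notin\mathcal{Q}_{\mathrm{ac}}(n)$; and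 $\sum_{q=1}^rX^{Q\setminus\alpha_q}=0$ for every directed cycle $(\alpha_1,\dots,\alpha_r)$ of $Q$; (ii) for every connected component $I$ of $\underline{Q}$ and $v\in V^{\otimes n}$: $(\partial_{\lambda_k}-\partial_{\lambda_l})X^Q(v)=0$ for $k,l\in I$, and $\sum_{k\in I}X^Q(T^{(k)}v)=-\sum_{k\in I}\lambda_kX^Q(v)$; and for every $k\in[n]$, $i\in[N]$: $X^Q((S^i)^{(k)}v)=-(-1)^{p(X)}\theta_k^iX^Q(v)$. Right $\mathfrak{S}_n$-action: $(X^\sigma)^Q(v_1\otimes\dots\otimes v_n)=X^{\sigma Q}_{\Lambda_{\sigma^{-1}(1)},\dots,\Lambda_{\sigma^{-1}(n)}}(\sigma(v_1\otimes\dots\otimes v_n))$, where $\sigma(v_1\otimes\dots\otimes v_n)=\prod_{k<l,\ \sigma(k)>\sigma(l)}(-1)^{p(v_k)p(v_l)}\,v_{\sigma^{-1}(1)}\otimes\dots\otimes v_{\sigma^{-1}(n)}$. **Cocomposition of quivers.** For $\nu=(n_1,\dots,n_m)\in\mathbb{N}^m$ with $\sum n_j=n$, put $N_0=0$, $N_j=n_1+\dots+n_j$; the $j$-th block is $\{N_{j-1}+1,\dots,N_j\}$. For $Q\in\mathcal{Q}(n)$, $\Delta^\nu_j(Q)\in\mathcal{Q}(n_j)$ is the full subquiver on the $j$-th block (shifted to $[n_j]$), and $\Delta^\nu_0(Q)\in\mathcal{Q}(m)$ is obtained by collapsing each block $j$ to the vertex $j$, deleting edges inside blocks. For $k\in[n]$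 lying in block $b$, $\mathcal{E}^\nu_Q(k)\subset[m]$ is the set of $i$ such that $\underline{\Delta_0^\nu(Q)}$ has a walk of length $\ge1$ without repeated edges from $i$ to $b$ containing an edge which, as an edge of $Q$, has $k$ as an endpoint. **Composition.** For $X\in\mathcal{P}(m)$, $Y_j\in\mathcal{P}(n_j)$, $v=v_1\otimes\dots\otimes v_n$, let $w_j=v_{N_{j-1}+1}\otimes\dots\otimes v_{N_j}$, $\Lambda'_j=\Lambda_{N_{j-1}+1}+\dots+\Lambda_{N_j}$. Write (as a sum of such terms) $(Y_j)^{\Delta^\nu_j(Q)}_{\Lambda_{N_{j-1}+1},\dots,\Lambda_{N_j}}(w_j)=a_ju_j$ with $a_j\in\mathbb{K}[\Lambda_k]_{N_{j-1}<k<N_j}$, $u_j\in V$, using the isomorphism above. Let $$A=\prod_{i<j}(-1)^{p(w_i)p(Y_j)}\prod_{i<j}(-1)^{p(u_i)p(a_j)}\,(a_1\cdots a_m)\big|_{\Lambda_k\mapsto\Lambda_k+\sum_{i\in\mathcal{E}^\nu_Q(k)}(\Lambda_i'+\nabla^{(i)})}(u_1\otimes\dots\otimes u_m)\in\mathbb{K}[\Lambda_k]_{k=1}^n\otimes V^{\otimes m}.$$ Then $(X\circ(Y_1\odot\dots\odot Y_m))^Q(v)$ is the image of $A$ under $b\otimes u\mapsto(-1)^{p(X)p(b)}\,b\,X^{\Delta_0^\nu(Q)}_{\Lambda'_1,\dots,\Lambda'_m}(u)$. The unit is $\mathrm{id}_V$, and $X\circ_1Y:=X\circ(Y\odot\mathrm{id}\odot\dots\odot\mathrm{id})$.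 This is the $N_W=N$ SUSY coisson operad of $V$. **Maurer–Cartan solutions.** For a superoperad $\mathcal{P}$: $L^1(\mathcal{P})=\{X\in\mathcal{P}(2)\mid X^\sigma=X\ \forall\sigma\in\mathfrak{S}_2\}$; $X\square X=\sum_{\sigma}(X\circ_1X)^{\sigma^{-1}}\in\mathcal{P}(3)$, sum over $\sigma\in\mathfrak{S}_3$ with $\sigma(1)<\sigma(2)$; $\mathrm{MC}(L(\mathcal{P}))=\{X\in L^1(\mathcal{P})\mid X\square X=0\}$; subscript $\bar1$ denotes odd elements. **SUSY Poisson vertex algebras.** An $N_W=N$ SUSY Lie conformal algebra is an $\mathcal{H}_W$-supermodule $(V,\nabla)$ with a linear map $\{\cdot_\Lambda\cdot\}\colon V\otimes V\to V[\Lambda]$ of parity $N$ satisfying $\{Ta_\Lambda b\}=-\lambda\{a_\Lambda b\}$, $\{a_\Lambda Tb\}=(\lambda+T)\{a_\Lambda b\}$, $\{S^ia_\Lambda b\}=-(-1)^N\theta^i\{a_\Lambda b\}$, $\{a_\Lambda S^ib\}=(-1)^{p(a)+N}(\theta^i+S^i)\{a_\Lambda b\}$; $\{b_\Lambda a\}=-(-1)^{p(a)p(b)+N}\{a_{-\Lambda-\nabla}b\}$; $\{a_{\Lambda_1}\{b_{\Lambda_2}c\}\}=(-1)^{(p(a)+N)N}\{\{a_{\Lambda_1}b\}_{\Lambda_1+\Lambda_2}c\}+(-1)^{(p(a)+N)(p(b)+N)}\{b_{\Lambda_2}\{a_{\Lambda_1}c\}\}$ (coefficients in the supervariables are pulled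 to the left by the Koszul rule, the bracket having parity $N$). A non-unital $N_W=N$ SUSY Poisson vertex algebra is such a Lie conformal algebra with an even linear map $\mu\colon V\otimes V\to V$, $ab=\mu(a\otimes b)$, which is supercommutative and associative, for which $T$ and the $S^i$ are derivations ($T(ab)=(Ta)b+a(Tb)$, $S^i(ab)=(S^ia)b+(-1)^{p(a)}a(S^ib)$), and with $\{a_\Lambda bc\}=\{a_\Lambda b\}c+(-1)^{(p(a)+N)p(b)}b\{a_\Lambda c\}$. A structure on $(V,\nabla)$ is a pair $(\{\cdot_\Lambda\cdot\},\mu)$. *)

theory Defs
  imports
    Complex_Main
    "HOL-Library.Poly_Mapping"
    "HOL-Library.Multiset"
    "HOL-Library.Product_Lexorder"
    "HOL-Library.Z2"
    "HOL-Combinatorics.Permutations"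
begin

text \<open>
  Conventions. Parities live in the type \<open>bit\<close> of integers mod 2. All index sets start at \<open>0\<close>: the
  supervariables \<open>\<Lambda>\<^sub>1, \<dots>, \<Lambda>\<^sub>n\<close> carry the indices \<open>0, \<dots>, n - 1\<close>, the odd directions
  \<open>1, \<dots>, N\<close> the indices \<open>0, \<dots>, N - 1\<close>, and \<open>n\<close>-quivers have the vertex set \<open>{..<n}\<close>.
\<close>

section \<open>Superspaces and supermodules over the algebra generated by \<open>T\<close> and \<open>S\<close>\<close>

definition ksgn :: "bit \<Rightarrow> 'a::group_add \<Rightarrow> 'a"
  where "ksgn p x = (if p = 0 then x else - x)"

record ('k, 'v) hw_module =
  scl :: "'k \<Rightarrow> 'v \<Rightarrow> 'v"
  hpart :: "bit \<Rightarrow> 'v set"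
  opT :: "'v \<Rightarrow> 'v"
  opS :: "nat \<Rightarrow> 'v \<Rightarrow> 'v"

definition superspace :: "('k::field \<Rightarrow> 'v::ab_group_add \<Rightarrow> 'v) \<Rightarrow> (bit \<Rightarrow> 'v set) \<Rightarrow> bool"
  where "superspace s P \<longleftrightarrow>
    vector_space s \<and> (\<forall>p. module.subspace s (P p)) \<and>
    P 0 \<inter> P 1 = {0} \<and> (\<forall>v. \<exists>v0\<in>P 0. \<exists>v1\<in>P 1. v = v0 + v1)"

text \<open>
  A supermodule over the free supercommutative algebra on an even generator and \<open>N\<close> odd generators
  is given by operators satisfying the relations of that algebra. The operators
  \<open>opS M i\<close> with \<open>i \<ge> N\<close> are irrelevant.
\<close>

definition HW_supermodule :: "nat \<Rightarrow> ('k::field, 'v::ab_group_add) hw_module \<Rightarrow> bool"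
  where "HW_supermodule N M \<longleftrightarrow>
    superspace (scl M) (hpart M) \<and>
    Vector_Spaces.linear (scl M) (scl M) (opT M) \<and>
    (\<forall>p. \<forall>v\<in>hpart M p. opT M v \<in> hpart M p) \<and>
    (\<forall>i<N. Vector_Spaces.linear (scl M) (scl M) (opS M i) \<and>
      (\<forall>p. \<forall>v\<in>hpart M p. opS M i v \<in> hpart M (p + 1)) \<and>
      (\<forall>v. opT M (opS M i v) = opS M i (opT M v))) \<and>
    (\<forall>i<N. \<forall>j<N. \<forall>v. opS M i (opS M j v) = - opS M j (opS M i v))"

definition Pi_pow :: "nat \<Rightarrow> ('k, 'v) hw_module \<Rightarrow> ('k, 'v) hw_module"
  where "Pi_pow r M = M\<lparr>hpart := \<lambda>p. hpart M (p + of_nat r)\<rparr>"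

definition proj :: "('k, 'v::ab_group_add) hw_module \<Rightarrow> bit \<Rightarrow> 'v \<Rightarrow> 'v"
  where "proj M p v = (THE x. x \<in> hpart M p \<and> v - x \<in> hpart M (p + 1))"

text \<open>The linear extension of \<open>v \<mapsto> (-1)\<^sup>p\<^sup>(\<^sup>v\<^sup>) v\<close>.\<close>

definition parity_aut :: "('k, 'v::ab_group_add) hw_module \<Rightarrow> 'v \<Rightarrow> 'v"
  where "parity_aut M v = proj M 0 v - proj M 1 v"

text \<open>
  The multilinear extension of \<open>f\<close> from tuples of homogeneous vectors; the first argument
  of \<open>f\<close> lists their parities.
\<close>

definition by_parity ::
    "('k, 'v::ab_group_add) hw_module \<Rightarrow> (bit list \<Rightarrow> 'v list \<Rightarrow> 'w::comm_monoid_add) \<Rightarrow> 'v list \<Rightarrow> 'w"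
  where "by_parity M f vs = (\<Sum>ps\<in>{ps. length ps = length vs}. f ps (map2 (proj M) ps vs))"

text \<open>\<open>slot_op M p \<phi> k\<close> is \<open>\<phi>\<^sup>(\<^sup>k\<^sup>)\<close> for an operator \<open>\<phi>\<close> of parity \<open>p\<close>, with its Koszul sign.\<close>

definition slot_op ::
    "('k, 'v::ab_group_add) hw_module \<Rightarrow> bit \<Rightarrow> ('v \<Rightarrow> 'v) \<Rightarrow> nat \<Rightarrow> 'v list \<Rightarrow> 'v list"
  where "slot_op M p \<phi> k vs =
    (if p = 0 then take k vs else map (parity_aut M) (take k vs)) @ \<phi> (vs ! k) # drop (Suc k) vs"

section \<open>Superpolynomials with coefficients in \<open>V\<close>\<close>

text \<open>
  The monomial \<open>(A, J)\<close> is the product of the \<open>\<lambda>\<^sub>k\<close> over the multiset \<open>A\<close> times the product of the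
  \<open>\<theta>\<^sub>k\<^sup>i\<close> over \<open>(k, i) \<in> J\<close>, the latter in increasing lexicographic order. The coefficient space
  \<open>'w\<close> of a superpolynomial stands to the right of the variables.
\<close>

type_synonym mono = "nat multiset \<times> (nat \<times> nat) set"
type_synonym 'w spoly = "mono \<Rightarrow>\<^sub>0 'w"

definition odeg :: "mono \<Rightarrow> bit"
  where "odeg m = of_nat (card (snd m))"

definition const :: "'w::zero \<Rightarrow> 'w spoly"
  where "const w = Poly_Mapping.single ({#}, {}) w"

definition lext :: "('a \<Rightarrow> 'v::zero \<Rightarrow> 'w::comm_monoid_add) \<Rightarrow> ('a \<Rightarrow>\<^sub>0 'v) \<Rightarrow> 'w"
  where "lext F f = (\<Sum>m\<in>Poly_Mapping.keys f. F m (Poly_Mapping.lookup f m))"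

definition lam :: "nat \<Rightarrow> 'w::ab_group_add spoly \<Rightarrow> 'w spoly"
  where "lam k = lext (\<lambda>(A, J) w. Poly_Mapping.single (add_mset k A, J) w)"

definition tht :: "nat \<Rightarrow> nat \<Rightarrow> 'w::ab_group_add spoly \<Rightarrow> 'w spoly"
  where "tht k i = lext (\<lambda>(A, J) w. if (k, i) \<in> J then 0
    else Poly_Mapping.single (A, insert (k, i) J) (ksgn (of_nat (card {x\<in>J. x < (k, i)})) w))"

definition pscl :: "('k \<Rightarrow> 'w::ab_group_add \<Rightarrow> 'w) \<Rightarrow> 'k \<Rightarrow> 'w spoly \<Rightarrow> 'w spoly"
  where "pscl s c = lext (\<lambda>m w. Poly_Mapping.single m (s c w))"

definition dlam :: "('k::field, 'v::ab_group_add) hw_module \<Rightarrow> nat \<Rightarrow> 'v spoly \<Rightarrow> 'v spoly"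
  where "dlam M k =
    lext (\<lambda>(A, J) w. Poly_Mapping.single (A - {#k#}, J) (scl M (of_nat (count A k)) w))"

text \<open>
  \<open>monop L Od m\<close> is the monomial \<open>m\<close> with each \<open>\<lambda>\<^sub>k\<close> replaced by the operator \<open>L k\<close> and each
  \<open>\<theta>\<^sub>k\<^sup>i\<close> by \<open>Od k i\<close>, multiplied (composed) in the order of \<open>m\<close>. Thus \<open>monop lam tht m\<close> is left
  multiplication by \<open>m\<close>, and \<open>psubst L Od\<close> substitutes operators for the variables of a superpolynomial
  and applies the result to the coefficients.
\<close>

definition monop ::
    "(nat \<Rightarrow> 'a \<Rightarrow> 'a) \<Rightarrow> (nat \<Rightarrow> nat \<Rightarrow> 'a \<Rightarrow> 'a) \<Rightarrow> mono \<Rightarrow> 'a \<Rightarrow> 'a"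
  where "monop L Od m x =
    foldr L (sorted_list_of_multiset (fst m))
      (foldr (\<lambda>(k, i). Od k i) (sorted_list_of_set (snd m)) x)"

definition psubst ::
    "(nat \<Rightarrow> 'w spoly \<Rightarrow> 'w spoly) \<Rightarrow> (nat \<Rightarrow> nat \<Rightarrow> 'w spoly \<Rightarrow> 'w spoly)
      \<Rightarrow> 'w::ab_group_add spoly \<Rightarrow> 'w spoly"
  where "psubst L Od = lext (\<lambda>m w. monop L Od m (const w))"

text \<open>The substitution of \<open>\<Sum>\<^bsub>l \<in> B k\<^esub> \<Lambda>\<^sub>l\<close> for \<open>\<Lambda>\<^sub>k\<close>.\<close>

definition vsub :: "(nat \<Rightarrow> nat set) \<Rightarrow> 'w::ab_group_add spoly \<Rightarrow> 'w spoly"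
  where "vsub B = psubst (\<lambda>k f. \<Sum>l\<in>B k. lam l f) (\<lambda>k i f. \<Sum>l\<in>B k. tht l i f)"

text \<open>
  The Koszul extension \<open>b \<otimes> w \<mapsto> (-1)\<^sup>s\<^sup>p\<^sup>(\<^sup>b\<^sup>) b F(w)\<close> of a linear map \<open>F\<close> of parity \<open>s\<close>, and its special case
  of an operator \<open>\<phi>\<close> on coefficients.
\<close>

definition kext :: "bit \<Rightarrow> ('w::zero \<Rightarrow> 'u::ab_group_add spoly) \<Rightarrow> 'w spoly \<Rightarrow> 'u spoly"
  where "kext s F = lext (\<lambda>m w. ksgn (s * odeg m) (monop lam tht m (F w)))"

definition coeff_op :: "bit \<Rightarrow> ('w::zero \<Rightarrow> 'u::ab_group_add) \<Rightarrow> 'w spoly \<Rightarrow> 'u spoly"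
  where "coeff_op s \<phi> = kext s (\<lambda>w. const (\<phi> w))"

definition mono_set :: "nat \<Rightarrow> nat \<Rightarrow> mono set"
  where "mono_set N n = {(A, J). set_mset A \<subseteq> {..<n} \<and> J \<subseteq> {..<n} \<times> {..<N}}"

definition Vpoly :: "nat \<Rightarrow> nat \<Rightarrow> 'v::zero spoly set"
  where "Vpoly N n = {f. Poly_Mapping.keys f \<subseteq> mono_set N n}"

definition Vpoly_par ::
    "nat \<Rightarrow> ('k, 'v::zero) hw_module \<Rightarrow> nat \<Rightarrow> bit \<Rightarrow> 'v spoly set"
  where "Vpoly_par N M n p =
    {f \<in> Vpoly N n. \<forall>m. Poly_Mapping.lookup f m \<in> hpart M (p + odeg m)}"

section \<open>The quotient \<open>V\<^sub>\<nabla>[\<Lambda>\<^sub>1, \<dots>, \<Lambda>\<^sub>n]\<close>\<close>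

text \<open>
  The relations \<open>a \<cdot> h \<otimes> v - a \<otimes> h v\<close> of the tensor product over the algebra generated by \<open>T\<close> and
  the \<open>S\<^sup>i\<close>. The sign in the second family comes from writing right multiplication by \<open>- \<Sum>\<^sub>k \<theta>\<^sub>k\<^sup>i\<close>
  as left multiplication. Elements of the quotient are cosets; \<open>rep\<close> picks a representative, and all
  maps applied to representatives below preserve the relations.
\<close>

definition nabla_rel :: "nat \<Rightarrow> ('k::field, 'v::ab_group_add) hw_module \<Rightarrow> nat \<Rightarrow> 'v spoly set"
  where "nabla_rel N M n = module.span (pscl (scl M))
    ({- (\<Sum>k<n. lam k (Poly_Mapping.single m v)) - Poly_Mapping.single m (opT M v) | m v.
        m \<in> mono_set N n} \<union>
     {- ksgn (odeg m) (\<Sum>k<n. tht k i (Poly_Mapping.single m v))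
        - Poly_Mapping.single m (opS M i v) | m v i. m \<in> mono_set N n \<and> i < N})"

definition cls ::
    "nat \<Rightarrow> ('k::field, 'v::ab_group_add) hw_module \<Rightarrow> nat \<Rightarrow> 'v spoly \<Rightarrow> 'v spoly set"
  where "cls N M n f = {g. g - f \<in> nabla_rel N M n}"

definition rep :: "'a set \<Rightarrow> 'a"
  where "rep C = (SOME f. f \<in> C)"

text \<open>
  The isomorphism of \<open>V\<^sub>\<nabla>[\<Lambda>\<^sub>1, \<dots>, \<Lambda>\<^sub>n]\<close> with \<open>V[\<Lambda>\<^sub>1, \<dots>, \<Lambda>\<^bsub>n-1\<^esub>]\<close> for \<open>n \<ge> 1\<close>, on representatives:
  substitute \<open>- \<Lambda>\<^sub>1 - \<dots> - \<Lambda>\<^bsub>n-1\<^esub> - \<nabla>\<close> for the last variable. For \<open>n = 0\<close> nothing is substituted.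
\<close>

definition nf :: "('k, 'v::ab_group_add) hw_module \<Rightarrow> nat \<Rightarrow> 'v spoly \<Rightarrow> 'v spoly"
  where "nf M n = psubst
    (\<lambda>k f. if Suc k = n then - (\<Sum>l<k. lam l f) - coeff_op 0 (opT M) f else lam k f)
    (\<lambda>k i f. if Suc k = n then - (\<Sum>l<k. tht l i f) - coeff_op 1 (opS M i) f else tht k i f)"

section \<open>Quivers\<close>

text \<open>A quiver with unlabeled edges is the multiset of its edges (source, target).\<close>

type_synonym quiver = "(nat \<times> nat) multiset"

definition quivers :: "nat \<Rightarrow> quiver set"
  where "quivers n = {Q. \<forall>(s, t)\<in>set_mset Q. s < n \<and> t < n \<and> s \<noteq> t}"

text \<open>
  A walk without repeated edges in the undirected multigraph obtained from \<open>Q\<close> by mapping its vertices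
  along \<open>f\<close>: \<open>xs\<close> lists the vertices and \<open>es\<close> the edges, as edges of \<open>Q\<close>.
\<close>

definition trail :: "(nat \<Rightarrow> nat) \<Rightarrow> quiver \<Rightarrow> nat list \<Rightarrow> (nat \<times> nat) list \<Rightarrow> bool"
  where "trail f Q xs es \<longleftrightarrow>
    length xs = Suc (length es) \<and> mset es \<subseteq># Q \<and>
    (\<forall>q<length es. {f (fst (es ! q)), f (snd (es ! q))} = {xs ! q, xs ! Suc q})"

definition forest :: "quiver \<Rightarrow> bool"
  where "forest Q \<longleftrightarrow>
    \<not> (\<exists>xs es. trail id Q xs es \<and> es \<noteq> [] \<and> hd xs = last xs \<and> distinct (tl xs))"

definition directed_cycle :: "quiver \<Rightarrow> (nat \<times> nat) list \<Rightarrow> bool"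
  where "directed_cycle Q es \<longleftrightarrow>
    es \<noteq> [] \<and> mset es \<subseteq># Q \<and> distinct (map fst es) \<and>
    (\<forall>q<length es. snd (es ! q) = fst (es ! (Suc q mod length es)))"

definition component :: "quiver \<Rightarrow> nat \<Rightarrow> nat set"
  where "component Q k = {l. (k, l) \<in> (set_mset Q \<union> (set_mset Q)\<inverse>)\<^sup>*}"

section \<open>The operations of the coisson operad\<close>

type_synonym 'v operation = "quiver \<Rightarrow> 'v list \<Rightarrow> 'v spoly set"

definition multilinear ::
    "nat \<Rightarrow> ('k::field, 'v::ab_group_add) hw_module \<Rightarrow> nat \<Rightarrow> ('v list \<Rightarrow> 'v spoly set) \<Rightarrow> bool"
  where "multilinear N M n F \<longleftrightarrow> (\<forall>vs k a b c. length vs = n \<and> k < n \<longrightarrow>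
    F (vs[k := a + b]) = cls N M n (rep (F (vs[k := a])) + rep (F (vs[k := b]))) \<and>
    F (vs[k := scl M c a]) = cls N M n (pscl (scl M) c (rep (F (vs[k := a])))))"

text \<open>
  \<open>operations N M n p\<close> is the parity \<open>p\<close> part of the superspace of \<open>n\<close>-ary operations. A linear map on
  the tensor product of the \<open>n\<close>-th tensor power of \<open>V\<close> with the span of the quivers is a family, indexed by
  quivers, of multilinear maps on lists of length \<open>n\<close>; outside this domain the value is \<open>{}\<close>.
\<close>

definition operations ::
    "nat \<Rightarrow> ('k::field, 'v::ab_group_add) hw_module \<Rightarrow> nat \<Rightarrow> bit \<Rightarrow> 'v operation set"
  where "operations N M n p = {X.
    (\<forall>Q vs. Q \<notin> quivers n \<or> length vs \<noteq> n \<longrightarrow> X Q vs = {}) \<and>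
    (\<forall>Q\<in>quivers n.
      (\<forall>vs. length vs = n \<longrightarrow> X Q vs \<in> cls N M n ` Vpoly N n) \<and>
      multilinear N M n (X Q) \<and>
      (\<forall>vs ps. length vs = n \<and> length ps = n \<and> (\<forall>k<n. vs ! k \<in> hpart M (ps ! k)) \<longrightarrow>
        X Q vs \<in> cls N M n ` Vpoly_par N M n (p + sum_list ps)) \<and>
      (\<forall>vs. length vs = n \<longrightarrow>
        (\<not> forest Q \<longrightarrow> X Q vs = cls N M n 0) \<and>
        (\<forall>es. directed_cycle Q es \<longrightarrow>
          cls N M n (\<Sum>q<length es. rep (X (Q - {#es ! q#}) vs)) = cls N M n 0) \<and>
        (\<forall>k<n. \<forall>l\<in>component Q k.
          cls N M n (dlam M k (rep (X Q vs)) - dlam M l (rep (X Q vs))) = cls N M n 0) \<and>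
        (\<forall>j<n. let I = component Q j in
          cls N M n (\<Sum>k\<in>I. rep (X Q (slot_op M 0 (opT M) k vs)))
            = cls N M n (- (\<Sum>k\<in>I. lam k (rep (X Q vs))))) \<and>
        (\<forall>k<n. \<forall>i<N. X Q (slot_op M 1 (opS M i) k vs)
            = cls N M n (- ksgn p (tht k i (rep (X Q vs)))))))}"

definition zero_operation ::
    "nat \<Rightarrow> ('k::field, 'v::ab_group_add) hw_module \<Rightarrow> nat \<Rightarrow> 'v operation"
  where "zero_operation N M n Q vs =
    (if Q \<in> quivers n \<and> length vs = n then cls N M n 0 else {})"

definition sum_operation ::
    "nat \<Rightarrow> ('k::field, 'v::ab_group_add) hw_module \<Rightarrow> nat \<Rightarrow> ('a \<Rightarrow> 'v operation) \<Rightarrow> 'a set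
      \<Rightarrow> 'v operation"
  where "sum_operation N M n F B Q vs =
    (if Q \<in> quivers n \<and> length vs = n then cls N M n (\<Sum>b\<in>B. rep (F b Q vs)) else {})"

definition id_operation :: "nat \<Rightarrow> ('k::field, 'v::ab_group_add) hw_module \<Rightarrow> 'v operation"
  where "id_operation N M Q vs =
    (if Q \<in> quivers 1 \<and> length vs = 1 then cls N M 1 (const (hd vs)) else {})"

definition perm_sign :: "nat \<Rightarrow> (nat \<Rightarrow> nat) \<Rightarrow> bit list \<Rightarrow> bit"
  where "perm_sign n \<sigma> ps = (\<Sum>(k, l)\<in>{(k, l). k < l \<and> l < n \<and> \<sigma> k > \<sigma> l}. ps ! k * ps ! l)"

definition perm_act ::
    "nat \<Rightarrow> ('k::field, 'v::ab_group_add) hw_module \<Rightarrow> nat \<Rightarrow> 'v operation \<Rightarrow> (nat \<Rightarrow> nat) \<Rightarrow> 'v operation"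
  where "perm_act N M n X \<sigma> Q vs =
    (if Q \<in> quivers n \<and> length vs = n
     then cls N M n (by_parity M (\<lambda>ps us. ksgn (perm_sign n \<sigma> ps)
       (vsub (\<lambda>k. {inv \<sigma> k})
         (rep (X (image_mset (map_prod \<sigma> \<sigma>) Q) (map (\<lambda>k. us ! inv \<sigma> k) [0..<n]))))) vs)
     else {})"

section \<open>Cocomposition of quivers and composition\<close>

definition offset :: "nat list \<Rightarrow> nat \<Rightarrow> nat"
  where "offset \<nu> j = sum_list (take j \<nu>)"

definition block :: "nat list \<Rightarrow> nat \<Rightarrow> nat set"
  where "block \<nu> j = {offset \<nu> j..<offset \<nu> (Suc j)}"

definition seg :: "nat list \<Rightarrow> nat \<Rightarrow> 'a list \<Rightarrow> 'a list"
  where "seg \<nu> j xs = take (\<nu> ! j) (drop (offset \<nu> j) xs)"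

definition block_of :: "nat list \<Rightarrow> nat \<Rightarrow> nat"
  where "block_of \<nu> k = (LEAST j. k < offset \<nu> (Suc j))"

definition subquiver :: "nat list \<Rightarrow> nat \<Rightarrow> quiver \<Rightarrow> quiver"
  where "subquiver \<nu> j Q = image_mset (\<lambda>(s, t). (s - offset \<nu> j, t - offset \<nu> j))
    (filter_mset (\<lambda>(s, t). s \<in> block \<nu> j \<and> t \<in> block \<nu> j) Q)"

definition outer_edges :: "nat list \<Rightarrow> quiver \<Rightarrow> quiver"
  where "outer_edges \<nu> Q = filter_mset (\<lambda>(s, t). block_of \<nu> s \<noteq> block_of \<nu> t) Q"

definition collapse :: "nat list \<Rightarrow> quiver \<Rightarrow> quiver"
  where "collapse \<nu> Q = image_mset (map_prod (block_of \<nu>) (block_of \<nu>)) (outer_edges \<nu> Q)"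

definition reach :: "nat list \<Rightarrow> quiver \<Rightarrow> nat \<Rightarrow> nat set"
  where "reach \<nu> Q k = {i. i < length \<nu> \<and>
    (\<exists>xs es. trail (block_of \<nu>) (outer_edges \<nu> Q) xs es \<and> es \<noteq> [] \<and>
      hd xs = i \<and> last xs = block_of \<nu> k \<and> (\<exists>e\<in>set es. fst e = k \<or> snd e = k))}"

text \<open>
  Elements of the \<open>m\<close>-th tensor power of \<open>V\<close> are represented by formal linear combinations of lists of length
  \<open>m\<close>, and elements of its tensor product with superpolynomials by superpolynomials with such coefficients.
\<close>

definition tens_op :: "('a \<Rightarrow> 'a) \<Rightarrow> ('a \<Rightarrow>\<^sub>0 'k::comm_monoid_add) \<Rightarrow> ('a \<Rightarrow>\<^sub>0 'k)"
  where "tens_op g = lext (\<lambda>u c. Poly_Mapping.single (g u) c)"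

definition comp_even ::
    "('k::field, 'v::ab_group_add) hw_module \<Rightarrow> nat list \<Rightarrow> quiver \<Rightarrow> nat
      \<Rightarrow> ('v list \<Rightarrow>\<^sub>0 'k) spoly \<Rightarrow> ('v list \<Rightarrow>\<^sub>0 'k) spoly"
  where "comp_even M \<nu> Q k f = lam k f + (\<Sum>i\<in>reach \<nu> Q k.
    (\<Sum>l\<in>block \<nu> i. lam l f) + coeff_op 0 (tens_op (slot_op M 0 (opT M) i)) f)"

definition comp_odd ::
    "('k::field, 'v::ab_group_add) hw_module \<Rightarrow> nat list \<Rightarrow> quiver \<Rightarrow> nat \<Rightarrow> nat
      \<Rightarrow> ('v list \<Rightarrow>\<^sub>0 'k) spoly \<Rightarrow> ('v list \<Rightarrow>\<^sub>0 'k) spoly"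
  where "comp_odd M \<nu> Q k s f = tht k s f + (\<Sum>i\<in>reach \<nu> Q k.
    (\<Sum>l\<in>block \<nu> i. tht l s f) + coeff_op 1 (tens_op (slot_op M 1 (opS M s) i)) f)"

definition mono_shift :: "nat \<Rightarrow> mono \<Rightarrow> mono"
  where "mono_shift d m = (image_mset (\<lambda>k. k + d) (fst m), (\<lambda>(k, i). (k + d, i)) ` snd m)"

text \<open>
  \<open>comp_arg\<close> is the element \<open>A\<close> of the composition formula for homogeneous \<open>vs\<close> with parities \<open>ps\<close>. The inner
  sum runs over the terms \<open>a\<^sub>j u\<^sub>j\<close>, one from each factor, with \<open>a\<^sub>j\<close> a monomial (\<open>as ! j\<close>, not yet shifted to
  the variables of its block) and \<open>u\<^sub>j\<close> homogeneous; \<open>qs\<close> are the parities of the \<open>Ys\<close>.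
\<close>

definition comp_arg ::
    "('k::field, 'v::ab_group_add) hw_module \<Rightarrow> nat list \<Rightarrow> ('v operation \<times> bit) list \<Rightarrow> quiver
      \<Rightarrow> bit list \<Rightarrow> 'v list \<Rightarrow> ('v list \<Rightarrow>\<^sub>0 'k) spoly"
  where "comp_arg M \<nu> Ys Q ps vs =
    (let m = length \<nu>;
         ys = map (\<lambda>j. nf M (\<nu> ! j) (rep (fst (Ys ! j) (subquiver \<nu> j Q) (seg \<nu> j vs)))) [0..<m]
     in \<Sum>as\<in>listset (map Poly_Mapping.keys ys).
          by_parity M (\<lambda>ds us.
            ksgn (\<Sum>j<m. \<Sum>i<j. sum_list (seg \<nu> i ps) * snd (Ys ! j) + ds ! i * odeg (as ! j))
              (foldr (\<lambda>j. monop (comp_even M \<nu> Q) (comp_odd M \<nu> Q) (mono_shift (offset \<nu> j) (as ! j)))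
                [0..<m] (const (Poly_Mapping.single us 1))))
            (map2 Poly_Mapping.lookup ys as))"

text \<open>
  The composition of an operation \<open>X\<close> of parity \<open>p\<close> with operations \<open>Ys\<close>, each paired with its parity,
  of arities \<open>\<nu>\<close>. Parities are arguments since the zero operation has both.
\<close>

definition compose ::
    "nat \<Rightarrow> ('k::field, 'v::ab_group_add) hw_module \<Rightarrow> nat list \<Rightarrow> 'v operation \<Rightarrow> bit
      \<Rightarrow> ('v operation \<times> bit) list \<Rightarrow> 'v operation"
  where "compose N M \<nu> X p Ys Q vs =
    (let n = sum_list \<nu> in
     if Q \<in> quivers n \<and> length vs = n
     then cls N M n (by_parity M (\<lambda>ps us.
       kext p (lext (\<lambda>u c. pscl (scl M) c (vsub (block \<nu>) (rep (X (collapse \<nu> Q) u)))))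
         (comp_arg M \<nu> Ys Q ps us)) vs)
     else {})"

section \<open>Odd Maurer--Cartan solutions\<close>

definition box_square ::
    "nat \<Rightarrow> ('k::field, 'v::ab_group_add) hw_module \<Rightarrow> 'v operation \<Rightarrow> 'v operation"
  where "box_square N M X = sum_operation N M 3
    (\<lambda>\<sigma>. perm_act N M 3 (compose N M [2, 1] X 1 [(X, 1), (id_operation N M, 0)]) (inv \<sigma>))
    {\<sigma>. \<sigma> permutes {..<3} \<and> \<sigma> 0 < \<sigma> 1}"

definition MC_odd :: "nat \<Rightarrow> ('k::field, 'v::ab_group_add) hw_module \<Rightarrow> 'v operation set"
  where "MC_odd N M = {X \<in> operations N M 2 1.
    (\<forall>\<sigma>. \<sigma> permutes {..<2} \<longrightarrow> perm_act N M 2 X \<sigma> = X) \<and>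
    box_square N M X = zero_operation N M 3}"

section \<open>Non-unital SUSY Poisson vertex algebras\<close>

definition bilinear_map :: "('k::field \<Rightarrow> 'v::ab_group_add \<Rightarrow> 'v) \<Rightarrow> ('k \<Rightarrow> 'w::ab_group_add \<Rightarrow> 'w)
      \<Rightarrow> ('v \<Rightarrow> 'v \<Rightarrow> 'w) \<Rightarrow> bool"
  where "bilinear_map s t B \<longleftrightarrow>
    (\<forall>a. Vector_Spaces.linear s t (B a)) \<and> (\<forall>b. Vector_Spaces.linear s t (\<lambda>a. B a b))"

text \<open>
  The value of the bracket is a superpolynomial in the supervariable with index \<open>0\<close>. In the Jacobi
  identity \<open>\<Lambda>\<^sub>1\<close> and \<open>\<Lambda>\<^sub>2\<close> have the indices \<open>0\<close> and \<open>1\<close>, and \<open>vsub (\<lambda>_. K)\<close> inserts the sum of the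
  supervariables with indices in \<open>K\<close> for \<open>\<Lambda>\<close>.
\<close>

definition SUSY_LCA ::
    "nat \<Rightarrow> ('k::field, 'v::ab_group_add) hw_module \<Rightarrow> ('v \<Rightarrow> 'v \<Rightarrow> 'v spoly) \<Rightarrow> bool"
  where "SUSY_LCA N M br \<longleftrightarrow>
    bilinear_map (scl M) (pscl (scl M)) br \<and>
    (\<forall>a b. br a b \<in> Vpoly N 1) \<and>
    (\<forall>p q. \<forall>a\<in>hpart M p. \<forall>b\<in>hpart M q. br a b \<in> Vpoly_par N M 1 (p + q + of_nat N)) \<and>
    (\<forall>a b. br (opT M a) b = - lam 0 (br a b) \<and>
      br a (opT M b) = lam 0 (br a b) + coeff_op 0 (opT M) (br a b)) \<and>
    (\<forall>i<N. \<forall>p. \<forall>a\<in>hpart M p. \<forall>b.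
      br (opS M i a) b = - ksgn (of_nat N) (tht 0 i (br a b)) \<and>
      br a (opS M i b) =
        ksgn (p + of_nat N) (tht 0 i (br a b) + coeff_op 1 (opS M i) (br a b))) \<and>
    (\<forall>p q. \<forall>a\<in>hpart M p. \<forall>b\<in>hpart M q.
      br b a = - ksgn (p * q + of_nat N)
        (psubst (\<lambda>_ f. - lam 0 f - coeff_op 0 (opT M) f)
          (\<lambda>_ i f. - tht 0 i f - coeff_op 1 (opS M i) f) (br a b))) \<and>
    (\<forall>p q r. \<forall>a\<in>hpart M p. \<forall>b\<in>hpart M q. \<forall>c\<in>hpart M r.
      kext (p + of_nat N) (\<lambda>d. vsub (\<lambda>_. {0}) (br a d)) (vsub (\<lambda>_. {1}) (br b c)) =
        ksgn ((p + of_nat N) * of_nat N)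
          (kext (of_nat N) (\<lambda>d. vsub (\<lambda>_. {0, 1}) (br d c)) (vsub (\<lambda>_. {0}) (br a b))) +
        ksgn ((p + of_nat N) * (q + of_nat N))
          (kext (q + of_nat N) (\<lambda>d. vsub (\<lambda>_. {1}) (br b d)) (vsub (\<lambda>_. {0}) (br a c))))"

definition SUSY_PVA ::
    "nat \<Rightarrow> ('k::field, 'v::ab_group_add) hw_module
      \<Rightarrow> ('v \<Rightarrow> 'v \<Rightarrow> 'v spoly) \<Rightarrow> ('v \<Rightarrow> 'v \<Rightarrow> 'v) \<Rightarrow> bool"
  where "SUSY_PVA N M br mu \<longleftrightarrow>
    SUSY_LCA N M br \<and>
    bilinear_map (scl M) (scl M) mu \<and>
    (\<forall>p q. \<forall>a\<in>hpart M p. \<forall>b\<in>hpart M q. mu a b \<in> hpart M (p + q)) \<and>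
    (\<forall>p q. \<forall>a\<in>hpart M p. \<forall>b\<in>hpart M q. mu a b = ksgn (p * q) (mu b a)) \<and>
    (\<forall>a b c. mu (mu a b) c = mu a (mu b c)) \<and>
    (\<forall>a b. opT M (mu a b) = mu (opT M a) b + mu a (opT M b)) \<and>
    (\<forall>i<N. \<forall>p. \<forall>a\<in>hpart M p. \<forall>b.
      opS M i (mu a b) = mu (opS M i a) b + ksgn p (mu a (opS M i b))) \<and>
    (\<forall>p q. \<forall>a\<in>hpart M p. \<forall>b\<in>hpart M q. \<forall>c.
      br a (mu b c) =
        coeff_op 0 (\<lambda>d. mu d c) (br a b) +
        ksgn ((p + of_nat N) * q) (coeff_op q (mu b) (br a c)))"

section \<open>From operations to brackets and products\<close>

text \<open>The map \<open>f \<mapsto> Res\<^sub>\<Lambda> (\<lambda>\<^sup>-\<^sup>1 f)\<close> on superpolynomials in the supervariable with index \<open>0\<close>.\<close>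

definition Res_inv :: "nat \<Rightarrow> 'v::zero spoly \<Rightarrow> 'v"
  where "Res_inv N f = Poly_Mapping.lookup f ({#}, {0} \<times> {..<N})"

text \<open>In the following, \<open>M\<close> is the original supermodule, whose parity determines the signs.\<close>

definition op_bracket :: "nat \<Rightarrow> ('k::field, 'v::ab_group_add) hw_module \<Rightarrow> 'v operation
      \<Rightarrow> 'v \<Rightarrow> 'v \<Rightarrow> 'v spoly"
  where "op_bracket N M X a b =
    (\<Sum>p\<in>UNIV. ksgn (p * of_nat (Suc N)) (nf M 2 (rep (X {#} [proj M p a, b]))))"

definition op_product :: "nat \<Rightarrow> ('k::field, 'v::ab_group_add) hw_module \<Rightarrow> 'v operation
      \<Rightarrow> 'v \<Rightarrow> 'v \<Rightarrow> 'v"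
  where "op_product N M X a b =
    (\<Sum>p\<in>UNIV. ksgn (p * of_nat (Suc N))
      (Res_inv N (nf M 2 (rep (X {#(0, 1)#} [proj M p a, b])))))"

end

theory Submission imports Defs
begin

text \<open>
  For \<open>n = 2\<close>, normal forms identify a symmetric odd operation with a pair \<open>(\<beta>, y)\<close>, its values on the quivers
  without edges and with the edge \<open>1 \<rightarrow> 2\<close>; the values on \<open>2 \<rightarrow> 1\<close> are \<open>- y\<close> and all others vanish, and \<open>y\<close> is free
  of \<open>\<lambda>\<close>. By symmetry, the Maurer--Cartan equation needs to be checked only on the quivers with vertices \<open>1, 2, 3\<close> and no
  edge, one edge, or two edges forming a path, which gives the Jacobi identity, a
  Leibniz rule and an associativity law for \<open>(\<beta>, y)\<close>. Every identity involving \<open>y\<close> is stable up to sign under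
  multiplication by the odd variables, since these correspond to the action of the \<open>S\<^sup>i\<close> on the arguments. As an
  exterior algebra is a Frobenius algebra, such an identity is equivalent to its residue, which is an identity
  for the product \<open>Res (\<lambda>\<^sup>-\<^sup>1 y)\<close>; and \<open>y\<close> is recovered from its residue in the same way.
\<close>

text \<open>Two obstacles shape the argument. First, values of operations are cosets with chosen
  representatives. Everything is therefore read off through the elimination \<open>nn n\<close> of
  the last supervariable, which vanishes exactly on the relations, so that equations of cosets
  become equations of superpolynomials. Second, the composition formula shifts \<Lambda>_1 by
  \<Lambda>_3 + \<nabla>^(2) inside formal tensors. Along an outer edge the outer operation
  satisfies a Leibniz rule for \<nabla>; together with the elimination of \<Lambda>_3 this turns the
  shift into \<Lambda>_1 -> -\<Lambda>_2 - \<nabla> in the inner value alone. That is the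
  substitution of skew-symmetry, so exchanging the two inner vertices switches the shift on or off.
  This is the source of the symmetry of the square, and the representative quivers can be placed so
  that the shift never has to be evaluated. All of this happens in the parity of \<Pi>^{N+1}V, where
  the operation is odd; the return to V is composition with an involution \<open>sg\<close> in the
  first argument, and the remaining signs are checked by running through all parities.\<close>

section \<open>Sign exponents and additive maps\<close>

declare add_bit_eq_xor [simp del] mult_bit_eq_and [simp del]

text \<open>Sign exponents are computed in the field with two elements. With the rewriting into bit
  operations switched off, these rules, associativity and commutativity normalize sums of
  exponents.\<close>

lemma bit_add_self [simp]: "(p::bit) + p = 0" "p + (p + q) = q"
  by (cases p; cases q; simp)+

lemma bit_mult_self [simp]: "(p::bit) * p = p"
  by (cases p; simp)

lemma ksgn_simps [simp]:
  "ksgn 0 x = x" "ksgn 1 x = - x" "ksgn p 0 = 0" "ksgn p (ksgn q x) = ksgn (p + q) x"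
  by (cases p; cases q; simp add: ksgn_def)+

lemma ksgn_add: "ksgn p (x + y) = ksgn p x + ksgn p (y::'a::ab_group_add)"
  by (simp add: ksgn_def)

lemma ksgn_minus: "ksgn p (- x) = - ksgn p (x::'a::ab_group_add)"
  by (simp add: ksgn_def)

lemma ksgn_one_add [simp]: "ksgn (1 + p) x = - ksgn p x" "ksgn (p + 1) x = - ksgn p (x::'a::ab_group_add)"
  by (cases p; simp)+

lemma ksgn_sum: "ksgn p (sum f A) = (\<Sum>x\<in>A. ksgn p (f x :: 'a::ab_group_add))"
  by (simp add: ksgn_def sum_negf)

lemma ksgn_eq_0_iff [simp]: "ksgn p x = 0 \<longleftrightarrow> x = (0::'a::ab_group_add)"
  by (simp add: ksgn_def)

lemma ksgn_eq_iff: "ksgn p x = y \<longleftrightarrow> x = ksgn p (y::'a::ab_group_add)"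
  by (auto simp: ksgn_def)

lemma additive_ksgn [simp]: "additive (ksgn p :: 'a::ab_group_add \<Rightarrow> 'a)"
  by unfold_locales (rule ksgn_add)

lemma additive_ksgn_commute: "additive f \<Longrightarrow> f (ksgn p x) = ksgn p (f x)"
  by (simp add: ksgn_def additive.minus)

lemma additive_comp: "additive f \<Longrightarrow> additive g \<Longrightarrow> additive (\<lambda>x. f (g x))"
  by (simp add: additive_def)

lemma additive_simps [simp]:
  "additive (\<lambda>x. x)" "additive (\<lambda>x. 0)"
  "additive f \<Longrightarrow> additive g \<Longrightarrow> additive (\<lambda>x. f x + g x)"
  "additive f \<Longrightarrow> additive (\<lambda>x. - f x)"
  "additive f \<Longrightarrow> additive g \<Longrightarrow> additive (\<lambda>x. f x - g x)"
  "(\<And>i. additive (h i)) \<Longrightarrow> additive (\<lambda>x. \<Sum>i\<in>I. h i x)"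
  by (simp_all add: additive_def sum.distrib)

lemma additive_if [simp]: "additive f \<Longrightarrow> additive g \<Longrightarrow> additive (\<lambda>x. if b then f x else g x)"
  by (cases b) simp_all

lemmas additive_ksgn_comp [simp] = additive_comp[OF additive_ksgn]

lemma additive_foldr: "(\<And>k. k \<in> set xs \<Longrightarrow> additive (F k)) \<Longrightarrow> additive (foldr F xs)"
  by (induction xs) (simp_all add: additive_def)

section \<open>Superpolynomials\<close>

text \<open>Different superpolynomials have different supports; a common finite superset makes their
  sums comparable term by term.\<close>

lemma lext_eq_sum:
  assumes "finite K" "Poly_Mapping.keys f \<subseteq> K" "\<And>m. F m 0 = 0"
  shows "lext F f = (\<Sum>m\<in>K. F m (Poly_Mapping.lookup f m))"
  unfolding lext_def using assms
  by (intro sum.mono_neutral_left) (auto simp: in_keys_iff)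

lemma additive_lext:
  fixes F :: "'a \<Rightarrow> 'v::ab_group_add \<Rightarrow> 'w::ab_group_add"
  assumes "\<And>m. additive (F m)"
  shows "additive (lext F)"
proof
  fix f g :: "'a \<Rightarrow>\<^sub>0 'v"
  let ?K = "Poly_Mapping.keys f \<union> Poly_Mapping.keys g"
  have z: "F m 0 = 0" for m using assms by (rule additive.zero)
  have "lext F (f + g) = (\<Sum>m\<in>?K. F m (Poly_Mapping.lookup (f + g) m))"
    using Poly_Mapping.keys_add[of f g] by (intro lext_eq_sum z) auto
  also have "\<dots> = (\<Sum>m\<in>?K. F m (Poly_Mapping.lookup f m)) + (\<Sum>m\<in>?K. F m (Poly_Mapping.lookup g m))"
    by (simp add: Poly_Mapping.lookup_add additive.add[OF assms] sum.distrib)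
  also have "\<dots> = lext F f + lext F g"
    by (subst (1 2) lext_eq_sum[where K="?K"]) (auto simp: z)
  finally show "lext F (f + g) = lext F f + lext F g" .
qed

lemma lext_single:
  "F m 0 = 0 \<Longrightarrow> lext F (Poly_Mapping.single m w) = F m w"
  by (cases "w = 0") (simp_all add: lext_def)

lemma poly_mapping_sum_singles: "f = (\<Sum>m\<in>Poly_Mapping.keys f. Poly_Mapping.single m (Poly_Mapping.lookup f m))"
  by (rule poly_mapping_eqI) (auto simp: lookup_sum lookup_single when_def in_keys_iff)

text \<open>Additivity is enough, without linearity over scalars, because a single monomial carries
  its whole coefficient.\<close>

lemma additive_eq_on_singles:
  assumes "additive F" "additive G"
    "\<And>m w. m \<in> Poly_Mapping.keys f \<Longrightarrow> F (Poly_Mapping.single m w) = G (Poly_Mapping.single m w)"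
  shows "F f = G f"
proof -
  have "F f = (\<Sum>m\<in>Poly_Mapping.keys f. F (Poly_Mapping.single m (Poly_Mapping.lookup f m)))"
    by (subst poly_mapping_sum_singles[of f]) (rule additive.sum[OF assms(1)])
  also have "\<dots> = (\<Sum>m\<in>Poly_Mapping.keys f. G (Poly_Mapping.single m (Poly_Mapping.lookup f m)))"
    using assms(3) by simp
  also have "\<dots> = G f"
    by (subst (2) poly_mapping_sum_singles[of f]) (rule additive.sum[OF assms(2), symmetric])
  finally show ?thesis .
qed

lemma additive_single [simp]: "additive (Poly_Mapping.single m :: 'w::ab_group_add \<Rightarrow> _)"
  by unfold_locales (rule single_add)

lemma single_ksgn: "Poly_Mapping.single m (ksgn p (w::'w::ab_group_add)) = ksgn p (Poly_Mapping.single m w)"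
  by (simp add: additive_ksgn_commute)

lemma lam_single: "lam k (Poly_Mapping.single (A, J) w) = Poly_Mapping.single (add_mset k A, J) w"
  by (simp add: lam_def lext_single)

text \<open>The Koszul exponent of an odd variable: the parity of the number of factors that it
  passes on its way from the left to its place in the ordered monomial.\<close>

definition cnt :: "(nat \<times> nat) set \<Rightarrow> nat \<times> nat \<Rightarrow> bit"
  where "cnt J x = of_nat (card {z\<in>J. z < x})"

lemma tht_single: "tht k i (Poly_Mapping.single (A, J) w) = (if (k, i) \<in> J then 0
    else ksgn (cnt J (k, i)) (Poly_Mapping.single (A, insert (k, i) J) w))"
  by (simp add: tht_def lext_single single_ksgn cnt_def)

lemma additive_lam [simp]: "additive (lam k)"
  unfolding lam_def by (rule additive_lext) (auto simp: additive_def single_add)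

lemma additive_tht [simp]: "additive (tht k i)"
  unfolding tht_def by (rule additive_lext) (auto simp: additive_def single_add ksgn_add)

lemma additive_const [simp]: "additive const"
  by (simp add: const_def additive_def single_add)

lemmas additive_comps [simp] = additive_comp[OF additive_single] additive_comp[OF additive_lam]
  additive_comp[OF additive_tht] additive_comp[OF additive_const]

lemma const_0 [simp]: "const 0 = 0"
  by (simp add: const_def)

text \<open>Even and odd variables are treated uniformly: \<open>None\<close> stands for \<open>\<lambda>\<close>, and \<open>Some i\<close> for \<open>\<theta>\<^sup>i\<close>.\<close>

definition opr :: "(nat \<Rightarrow> 'a \<Rightarrow> 'a) \<Rightarrow> (nat \<Rightarrow> nat \<Rightarrow> 'a \<Rightarrow> 'a) \<Rightarrow> nat \<Rightarrow> nat option \<Rightarrow> 'a \<Rightarrow> 'a"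
  where "opr L Od k l = (case l of None \<Rightarrow> L k | Some i \<Rightarrow> Od k i)"

abbreviation var :: "nat \<Rightarrow> nat option \<Rightarrow> 'w::ab_group_add spoly \<Rightarrow> 'w spoly"
  where "var \<equiv> opr lam tht"

definition lpar :: "nat option \<Rightarrow> bit"
  where "lpar l = (case l of None \<Rightarrow> 0 | Some _ \<Rightarrow> 1)"

definition lv :: "nat \<Rightarrow> nat option \<Rightarrow> bool"
  where "lv N l = (case l of None \<Rightarrow> True | Some i \<Rightarrow> i < N)"

lemma opr_simps [simp]: "opr L Od k None = L k" "opr L Od k (Some i) = Od k i"
  by (simp_all add: opr_def)

lemma lpar_simps [simp]: "lpar None = 0" "lpar (Some i) = 1"
  by (simp_all add: lpar_def)

lemma lv_simps [simp]: "lv N None" "lv N (Some i) \<longleftrightarrow> i < N"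
  by (simp_all add: lv_def)

lemma additive_var [simp]: "additive (var k l)"
  by (cases l) auto

lemmas additive_var_comp [simp] = additive_comp[OF additive_var]

text \<open>The type \<open>mono\<close> admits infinite sets of odd variables, on which
  \<open>sorted_list_of_set\<close> carries no information. They are excluded here, so even
  \<open>over UNIV\<close> is a genuine restriction.\<close>

definition over :: "(nat \<times> nat option) set \<Rightarrow> 'w::zero spoly set"
  where "over S = {f. \<forall>(A, J)\<in>Poly_Mapping.keys f.
    finite J \<and> (\<forall>k\<in>#A. (k, None) \<in> S) \<and> (\<forall>(k, i)\<in>J. (k, Some i) \<in> S)}"

lemma over_mono: "S \<subseteq> S' \<Longrightarrow> over S \<subseteq> over S'"
  unfolding over_def by fast

lemma over_0 [simp]: "0 \<in> over S"
  by (simp add: over_def)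

lemma over_add: "f \<in> over S \<Longrightarrow> g \<in> over S \<Longrightarrow> f + g \<in> over S"
  using Poly_Mapping.keys_add[of f g] unfolding over_def by fastforce

lemma over_minus [simp]: "- f \<in> over S \<longleftrightarrow> f \<in> over (S :: _ set)" for f :: "'w::ab_group_add spoly"
  by (simp add: over_def)

lemma over_diff: "f \<in> over S \<Longrightarrow> g \<in> over S \<Longrightarrow> f - g \<in> over S" for f :: "'w::ab_group_add spoly"
  using over_add[of f S "- g"] by simp

lemma over_sum: "(\<And>x. x \<in> B \<Longrightarrow> F x \<in> over S) \<Longrightarrow> sum F B \<in> over S"
  by (induction B rule: infinite_finite_induct) (auto intro: over_add)

lemma over_ksgn [simp]: "ksgn p f \<in> over S \<longleftrightarrow> f \<in> over S" for f :: "'w::ab_group_add spoly"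
  by (simp add: ksgn_def)

lemma over_single: "finite J \<Longrightarrow> \<forall>k\<in>#A. (k, None) \<in> S \<Longrightarrow> \<forall>(k, i)\<in>J. (k, Some i) \<in> S \<Longrightarrow>
    Poly_Mapping.single (A, J) w \<in> over S"
  unfolding over_def by (simp add: keys_single)

lemma over_const [simp]: "const w \<in> over S"
  by (simp add: const_def over_single)

lemma over_keysD:
  assumes "f \<in> over S" "(A, J) \<in> Poly_Mapping.keys f"
  shows "finite J" "\<forall>k\<in>#A. (k, None) \<in> S" "\<forall>(k, i)\<in>J. (k, Some i) \<in> S"
  using assms by (fastforce simp: over_def)+

lemma over_additive_single:
  assumes "additive F" "f \<in> over S"
    "\<And>A J w. finite J \<Longrightarrow> \<forall>k\<in>#A. (k, None) \<in> S \<Longrightarrow> \<forall>(k, i)\<in>J. (k, Some i) \<in> S \<Longrightarrow>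
      F (Poly_Mapping.single (A, J) w) \<in> over T"
  shows "F f \<in> over T"
proof -
  have "F f = (\<Sum>m\<in>Poly_Mapping.keys f. F (Poly_Mapping.single m (Poly_Mapping.lookup f m)))"
    by (subst poly_mapping_sum_singles[of f]) (rule additive.sum[OF assms(1)])
  moreover have "F (Poly_Mapping.single m (Poly_Mapping.lookup f m)) \<in> over T" if "m \<in> Poly_Mapping.keys f" for m
  proof (cases m)
    case (Pair A J)
    then show ?thesis
      using that over_keysD[OF assms(2), of A J] by (simp add: assms(3))
  qed
  ultimately show ?thesis by (auto intro!: over_sum)
qed

lemma over_var: "(k, l) \<in> S \<Longrightarrow> f \<in> over S \<Longrightarrow> var k l f \<in> over S"
  by (erule over_additive_single[rotated]) (cases l; auto simp: lam_single tht_single intro!: over_single)+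

text \<open>Every monomial arises from a constant by multiplying with one variable at a time. This
  gives an induction in which ordered monomials and their signs no longer appear.\<close>

lemma over_induct [consumes 1, case_names zero add const var]:
  assumes f: "f \<in> over S"
    and z: "P 0"
    and a: "\<And>f g. f \<in> over S \<Longrightarrow> g \<in> over S \<Longrightarrow> P f \<Longrightarrow> P g \<Longrightarrow> P (f + g)"
    and c: "\<And>w. P (const w)"
    and v: "\<And>k l f. (k, l) \<in> S \<Longrightarrow> f \<in> over S \<Longrightarrow> P f \<Longrightarrow> P (var k l f)"
  shows "P f"
proof -
  have odd_part: "P (Poly_Mapping.single ({#}, J) w)" if "finite J" "\<forall>(k, i)\<in>J. (k, Some i) \<in> S" for J w
    using that
  proof (induction J arbitrary: w)
    case empty
    then show ?case using c[of w] by (simp add: const_def)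
  next
    case (insert x J)
    obtain k i where x: "x = (k, i)" by (cases x)
    \<comment> \<open>The coefficient is given in advance the sign that multiplication by the new
      odd variable produces, so that the two cancel.\<close>
    let ?w = "ksgn (cnt J (k, i)) w"
    have "P (var k (Some i) (Poly_Mapping.single ({#}, J) ?w))"
      using insert x by (intro v over_single) auto
    then show ?case
      using insert x by (simp add: tht_single single_ksgn additive_ksgn_commute[OF additive_tht])
  qed
  have mono: "P (Poly_Mapping.single (A, J) w)"
    if "finite J" "\<forall>k\<in>#A. (k, None) \<in> S" "\<forall>(k, i)\<in>J. (k, Some i) \<in> S" for A J w
    using that
  proof (induction A)
    case empty
    then show ?case by (simp add: odd_part)
  next
    case (add k A)
    have "P (var k None (Poly_Mapping.single (A, J) w))"
      using add by (intro v over_single) auto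
    then show ?case by (simp add: lam_single)
  qed
  have "P (\<Sum>m\<in>K. Poly_Mapping.single m (Poly_Mapping.lookup f m)) \<and>
      (\<Sum>m\<in>K. Poly_Mapping.single m (Poly_Mapping.lookup f m)) \<in> over S"
    if "finite K" "K \<subseteq> Poly_Mapping.keys f" for K
    using that
  proof (induction K)
    case empty
    then show ?case using z by simp
  next
    case (insert m K)
    obtain A J where m: "m = (A, J)" by (cases m)
    have "(A, J) \<in> Poly_Mapping.keys f" using insert m by auto
    then have "finite J" "\<forall>k\<in>#A. (k, None) \<in> S" "\<forall>(k, i)\<in>J. (k, Some i) \<in> S"
      using f unfolding over_def by fastforce+
    then have "P (Poly_Mapping.single m (Poly_Mapping.lookup f m))"
      "Poly_Mapping.single m (Poly_Mapping.lookup f m) \<in> over S"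
      unfolding m by (auto intro!: mono over_single)
    then show ?case using insert by (auto intro: a over_add)
  qed
  from this[of "Poly_Mapping.keys f"] show ?thesis
    by (simp add: poly_mapping_sum_singles[symmetric])
qed

text \<open>Most operator identities below are proved by this rule: it remains to see how both sides
  commute with a single variable.\<close>

lemma over_additive_eq [consumes 3, case_names const var]:
  assumes "f \<in> over S" "additive F" "additive G"
    and "\<And>w. F (const w) = G (const w)"
    and "\<And>k l f. (k, l) \<in> S \<Longrightarrow> f \<in> over S \<Longrightarrow> F f = G f \<Longrightarrow> F (var k l f) = G (var k l f)"
  shows "F f = G f"
  using assms(1) by (induction rule: over_induct)
    (simp_all add: assms additive.add[OF assms(2)] additive.add[OF assms(3)] additive.zero[OF assms(2)] additive.zero[OF assms(3)])

lemma over_additive_in [consumes 2, case_names const var]: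
  assumes "f \<in> over S" "additive F"
    and "\<And>w. F (const w) \<in> over T"
    and "\<And>k l f. (k, l) \<in> S \<Longrightarrow> f \<in> over S \<Longrightarrow> F f \<in> over T \<Longrightarrow> F (var k l f) \<in> over T"
  shows "F f \<in> over T"
  using assms(1) by (induction rule: over_induct)
    (simp_all add: assms additive.add[OF assms(2)] additive.zero[OF assms(2)] over_add)

lemma cnt_insert:
  assumes "finite J" "x \<notin> J"
  shows "cnt (insert x J) y = (if x < y then 1 else 0) + cnt J y"
proof -
  have "{z\<in>insert x J. z < y} = (if x < y then insert x {z\<in>J. z < y} else {z\<in>J. z < y})" by auto
  then show ?thesis using assms by (simp add: cnt_def)
qed

lemma tht_tht_same [simp]: "tht k i (tht k i f) = 0"
proof -
  have "tht k i (tht k i f) = (\<lambda>_. 0) f"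
    by (rule additive_eq_on_singles) (auto intro!: additive_comp simp: additive_def tht_single additive.zero[OF additive_tht] additive.add[OF additive_tht] additive_ksgn_commute)
  then show ?thesis by simp
qed

lemma var_commute:
  assumes "f \<in> over UNIV"
  shows "var k l (var k' l' f) = ksgn (lpar l * lpar l') (var k' l' (var k l f))"
proof (rule additive_eq_on_singles[where f=f])
  fix m w assume "m \<in> Poly_Mapping.keys f"
  then obtain A J where m: "m = (A, J)" and J: "finite J" using assms by (cases m) (fastforce simp: over_def)
  show "var k l (var k' l' (Poly_Mapping.single m w)) = ksgn (lpar l * lpar l') (var k' l' (var k l (Poly_Mapping.single m w)))"
  proof (cases l; cases l')
    fix i i' assume l: "l = Some i" "l' = Some i'"
    obtain x x' where x: "x = (k, i)" "x' = (k', i')" by simp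
    show ?thesis
    proof (cases "x = x'")
      case False
      \<comment> \<open>Of two distinct odd variables exactly one precedes the other, which accounts
        for the one extra sign between the two orders of multiplication.\<close>
      have "(if x < x' then 1 else 0) = 1 + (if x' < x then 1 else (0::bit))"
        using False by auto
      moreover have "insert x (insert x' J) = insert x' (insert x J)" by auto
      ultimately show ?thesis
        using False J unfolding l m opr_simps tht_single x[symmetric]
        by (simp add: additive.zero[OF additive_tht] additive_ksgn_commute[OF additive_tht]
            tht_single[of k i, folded x] tht_single[of k' i', folded x] cnt_insert ksgn_minus ac_simps)
    qed (use l x in simp)
  qed (auto simp: m lam_single tht_single add_mset_commute additive.zero[OF additive_lam] additive_ksgn_commute[OF additive_lam])
qed simp_all

section \<open>Substitution of supercommuting operators\<close>

abbreviation fin :: "'w::zero spoly set" where "fin \<equiv> over UNIV"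

lemma over_fin: "f \<in> over S \<Longrightarrow> f \<in> fin"
  using over_mono[of S UNIV] by auto

text \<open>These are the relations of a free supercommutative algebra, which make substitution for
  its variables consistent. The instances are the variables themselves, sums of variables and the
  elimination of a supervariable. Squares of odd operators are listed separately because
  supercommutation alone gives only that twice the square vanishes, and the coefficient group may
  have 2-torsion.\<close>

locale superops =
  fixes op :: "nat \<Rightarrow> nat option \<Rightarrow> 'w::ab_group_add spoly \<Rightarrow> 'w spoly"
  assumes op_additive: "additive (op k l)"
    and op_closed: "f \<in> fin \<Longrightarrow> op k l f \<in> fin"
    and op_commute: "f \<in> fin \<Longrightarrow> op k l (op k' l' f) = ksgn (lpar l * lpar l') (op k' l' (op k l f))"
    and op_square: "f \<in> fin \<Longrightarrow> op k (Some i) (op k (Some i) f) = 0"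
begin

abbreviation "L k \<equiv> op k None"
abbreviation "Od k i \<equiv> op k (Some i)"
abbreviation "mop \<equiv> monop (\<lambda>k. op k None) (\<lambda>k i. op k (Some i))"
abbreviation "psub \<equiv> psubst (\<lambda>k. op k None) (\<lambda>k i. op k (Some i))"

lemma foldr_L_fin: "f \<in> fin \<Longrightarrow> foldr L xs f \<in> fin"
  by (induction xs) (auto intro: op_closed)

lemma foldr_Od_fin: "f \<in> fin \<Longrightarrow> foldr (\<lambda>(k, i). Od k i) xs f \<in> fin"
  by (induction xs) (auto intro: op_closed)

lemma op_foldr_L: "f \<in> fin \<Longrightarrow> op k l (foldr L xs f) = foldr L xs (op k l f)"
proof (induction xs)
  case (Cons x xs)
  have "op k l (foldr L (x # xs) f) = L x (op k l (foldr L xs f))"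
    using op_commute[of "foldr L xs f" k l x None] Cons.prems by (simp add: foldr_L_fin)
  then show ?case using Cons by simp
qed simp

lemma foldr_L_insort: "f \<in> fin \<Longrightarrow> foldr L (insort k xs) f = L k (foldr L xs f)"
proof (induction xs)
  case (Cons x xs)
  have "L x (L k (foldr L xs f)) = L k (L x (foldr L xs f))"
    using op_commute[of "foldr L xs f" x None k None] Cons.prems by (simp add: foldr_L_fin)
  then show ?case using Cons by simp
qed simp

text \<open>Multiplication by an odd operator is one pass of insertion sort. Each exchange costs a
  sign, and \<open>cnt\<close> counts the exchanges.\<close>

lemma Od_foldr_Od:
  assumes "f \<in> fin"
  shows "sorted js \<Longrightarrow> distinct js \<Longrightarrow> Od k i (foldr (\<lambda>(k, i). Od k i) js f) =
    (if (k, i) \<in> set js then 0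
     else ksgn (cnt (set js) (k, i)) (foldr (\<lambda>(k, i). Od k i) (insort (k, i) js) f))"
proof (induction js)
  case Nil
  then show ?case by (simp add: cnt_def)
next
  case (Cons j js)
  obtain k' i' where j: "j = (k', i')" by (cases j)
  let ?g = "foldr (\<lambda>(k, i). Od k i) js f"
  have g: "?g \<in> fin" using assms by (rule foldr_Od_fin)
  consider "(k, i) = j" | "(k, i) < j" | "j < (k, i)" by (metis neqE)
  then show ?case
  proof cases
    case 1
    then show ?thesis using op_square[OF g, of k i] j by simp
  next
    case 2
    then have n: "(k, i) \<notin> set (j # js)" using Cons.prems by force
    have "z \<notin> set (j # js)" if "z < (k, i)" for z using 2 that Cons.prems by force
    then have "{z \<in> set (j # js). z < (k, i)} = {}" by blast
    then have "cnt (set (j # js)) (k, i) = 0" by (simp only: cnt_def) simp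
    moreover have "insort (k, i) (j # js) = (k, i) # j # js" using 2 by (simp add: less_imp_le)
    ultimately show ?thesis using n by simp
  next
    case 3
    have nj: "j \<notin> set js" using Cons.prems by simp
    have "Od k i (foldr (\<lambda>(k, i). Od k i) (j # js) f) = - Od k' i' (Od k i ?g)"
      using op_commute[OF g, of k "Some i" k' "Some i'"] by (simp add: j)
    also have "\<dots> = (if (k, i) \<in> set js then 0
     else - ksgn (cnt (set js) (k, i)) (Od k' i' (foldr (\<lambda>(k, i). Od k i) (insort (k, i) js) f)))"
      using Cons by (simp add: additive.zero[OF op_additive] additive_ksgn_commute[OF op_additive])
    finally show ?thesis
      using 3 nj by (auto simp: cnt_insert j[symmetric] not_le) (auto simp: j)
  qed
qed

lemma mop_additive: "additive (mop m)"
  unfolding monop_def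
  by (rule additive_comp[OF additive_foldr additive_foldr]) (auto simp: op_additive)

lemma mop_fin: "f \<in> fin \<Longrightarrow> mop m f \<in> fin"
  by (simp add: monop_def foldr_L_fin foldr_Od_fin)

lemma L_mop: "f \<in> fin \<Longrightarrow> L k (mop (A, J) f) = mop (add_mset k A, J) f"
  by (simp add: monop_def foldr_L_insort foldr_Od_fin)

lemma Od_mop:
  assumes "f \<in> fin" "finite J"
  shows "Od k i (mop (A, J) f) = (if (k, i) \<in> J then 0 else ksgn (cnt J (k, i)) (mop (A, insert (k, i) J) f))"
proof -
  have ad: "additive (foldr L xs)" for xs by (intro additive_foldr op_additive)
  show ?thesis
    using assms Od_foldr_Od[OF assms(1), of "sorted_list_of_set J" k i]
    by (simp add: monop_def op_foldr_L foldr_Od_fin additive.zero[OF ad] additive_ksgn_commute[OF ad])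
qed

lemma psub_additive: "additive psub"
  unfolding psubst_def by (intro additive_lext additive_comp[OF mop_additive]) simp

lemma psub_single: "psub (Poly_Mapping.single m w) = mop m (const w)"
  unfolding psubst_def by (rule lext_single) (simp add: additive.zero[OF mop_additive])

lemma psub_const: "psub (const w) = const w"
  unfolding const_def by (simp add: psub_single) (simp add: monop_def const_def)

lemma psub_fin: "f \<in> fin \<Longrightarrow> psub f \<in> fin"
  by (rule over_additive_single[OF psub_additive]) (simp_all add: psub_single mop_fin)

text \<open>A variable enters the ordered monomial with the same sign with which its image enters
  the ordered product of operators; hence substitution is multiplicative in single letters.\<close>

lemma psub_var:
  assumes "f \<in> fin"
  shows "psub (var k l f) = op k l (psub f)"
proof (rule additive_eq_on_singles[where f=f])
  fix m w assume "m \<in> Poly_Mapping.keys f"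
  then obtain A J where m: "m = (A, J)" and J: "finite J" using over_keysD[OF assms] by (cases m) auto
  show "psub (var k l (Poly_Mapping.single m w)) = op k l (psub (Poly_Mapping.single m w))"
  proof (cases l)
    case None
    then show ?thesis by (simp add: m lam_single psub_single L_mop)
  next
    case (Some i)
    then show ?thesis
      by (simp add: m tht_single psub_single Od_mop J additive.zero[OF psub_additive] additive_ksgn_commute[OF psub_additive])
  qed
qed (simp_all add: additive_comp[OF psub_additive] additive_comp[OF op_additive] psub_additive)

lemma psub_over:
  assumes "f \<in> over S" "\<And>k l g. (k, l) \<in> S \<Longrightarrow> g \<in> over T \<Longrightarrow> op k l g \<in> over T"
  shows "psub f \<in> over T"
  using assms(1) psub_additive
proof (induction rule: over_additive_in)
  case (var k l f)
  then show ?case by (simp add: psub_var over_fin assms(2))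
qed (simp add: psub_const)

end

interpretation var: superops var
proof
  show "f \<in> fin \<Longrightarrow> var k l (var k' l' f) = ksgn (lpar l * lpar l') (var k' l' (var k l f))" for k l k' l' f
    by (rule var_commute)
qed (auto intro: over_var additive.add[OF additive_var])

lemma mop_var_single: "monop lam tht m (const w) = Poly_Mapping.single m w" if "finite (snd m)"
proof -
  obtain A J where m: "m = (A, J)" by (cases m)
  have "monop lam tht ({#}, J) (const w) = Poly_Mapping.single ({#}, J) w" if "finite J" for J w
    using that
  proof (induction J arbitrary: w)
    case empty
    then show ?case by (simp add: monop_def const_def)
  next
    case (insert x J)
    obtain k i where x: "x = (k, i)" by (cases x)
    have "ksgn (cnt J x) (monop lam tht ({#}, insert x J) (const w)) = tht k i (monop lam tht ({#}, J) (const w))"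
      using insert var.Od_mop[of "const w" J k i "{#}"] by (simp add: x)
    also have "\<dots> = ksgn (cnt J x) (Poly_Mapping.single ({#}, insert x J) w)"
      using insert by (simp add: tht_single x)
    finally show ?case by (simp add: ksgn_eq_iff)
  qed
  then have "monop lam tht ({#}, J) (const w) = Poly_Mapping.single ({#}, J) w" using that m by simp
  then have "monop lam tht (A, J) (const w) = Poly_Mapping.single (A, J) w"
  proof (induction A)
    case (add k A)
    then show ?case using var.L_mop[of "const w" k A J] by (simp add: lam_single)
  qed simp
  then show ?thesis by (simp add: m)
qed

lemma odeg_insert: "finite J \<Longrightarrow> x \<notin> J \<Longrightarrow> odeg (A, insert x J) = 1 + odeg (B, J)"
  by (simp add: odeg_def)

subsection \<open>Koszul extensions\<close>

lemmas mop_var_additive = var.mop_additive[simplified]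

lemma additive_kext [simp]: "additive F \<Longrightarrow> additive (kext s F)"
  unfolding kext_def by (intro additive_lext additive_ksgn_comp additive_comp[OF mop_var_additive])

lemmas additive_kext_comp [simp] = additive_comp[OF additive_kext]

lemma kext_single: "additive F \<Longrightarrow> kext s F (Poly_Mapping.single m w) = ksgn (s * odeg m) (monop lam tht m (F w))"
  unfolding kext_def by (rule lext_single) (simp add: additive.zero additive.zero[OF mop_var_additive])

lemma kext_const: "additive F \<Longrightarrow> kext s F (const w) = F w"
  unfolding const_def by (simp add: kext_single) (simp add: monop_def odeg_def)

lemma kext_var:
  assumes F: "additive F" "\<And>w. F w \<in> fin" and f: "f \<in> fin"
  shows "kext s F (var k l f) = ksgn (s * lpar l) (var k l (kext s F f))"
proof (rule additive_eq_on_singles[where f=f])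
  fix m w assume "m \<in> Poly_Mapping.keys f"
  then obtain A J where m: "m = (A, J)" and J: "finite J" using over_keysD[OF f] by (cases m) auto
  show "kext s F (var k l (Poly_Mapping.single m w)) = ksgn (s * lpar l) (var k l (kext s F (Poly_Mapping.single m w)))"
  proof (cases l)
    case None
    then show ?thesis
      using var.L_mop[of "F w" k A J] F
      by (simp add: m lam_single kext_single additive_ksgn_commute[OF additive_lam] odeg_def)
  next
    case (Some i)
    then show ?thesis
      using var.Od_mop[of "F w" J k i A] F J
      by (simp add: m tht_single kext_single additive.zero[OF additive_kext] additive_ksgn_commute[OF additive_kext]
        additive.zero[OF additive_tht] additive_ksgn_commute[OF additive_tht] odeg_insert[of _ _ A A] ring_distribs ac_simps)
  qed
qed (use F in simp_all)

lemma kext_over: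
  assumes "additive F" "\<And>w. F w \<in> over S" "f \<in> over S"
  shows "kext s F f \<in> over S"
proof -
  have F: "F w \<in> fin" for w using assms(2) by (rule over_fin)
  show ?thesis using assms(3) additive_kext[OF assms(1)]
  proof (induction rule: over_additive_in)
    case (var k l f)
    then show ?case using assms F by (simp add: kext_var over_fin over_var)
  qed (simp add: kext_const assms)
qed

lemma kext_fin: "additive F \<Longrightarrow> (\<And>w. F w \<in> fin) \<Longrightarrow> f \<in> fin \<Longrightarrow> kext s F f \<in> fin"
  by (rule kext_over)

text \<open>To reach the values of \<open>F\<close>, the operator \<open>H\<close> of parity
  \<open>t\<close> passes the monomials of \<open>f\<close>. The sign of this passage has the same
  form as that of the extension, so the two parities add.\<close>

lemma kext_op_commute:
  fixes F :: "'a::ab_group_add \<Rightarrow> 'b::ab_group_add spoly" and H :: "'b spoly \<Rightarrow> 'c::ab_group_add spoly"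
  assumes H: "additive H" and F: "additive F" "\<And>w. F w \<in> fin" and G: "additive G" "\<And>w. G w \<in> fin"
    and hv: "\<And>k l g. (k, l) \<in> S \<Longrightarrow> g \<in> fin \<Longrightarrow> H (var k l g) = ksgn (t * lpar l) (var k l (H g))"
    and hF: "\<And>w. H (F w) = G w" and f: "f \<in> over S"
  shows "H (kext s F f) = kext (s + t) G f"
  using f
proof (rule over_additive_eq)
  fix k l and f :: "'a spoly" assume a: "(k, l) \<in> S" "f \<in> over S" "H (kext s F f) = kext (s + t) G f"
  show "H (kext s F (var k l f)) = kext (s + t) G (var k l f)"
    using a F G by (simp add: kext_var over_fin additive_ksgn_commute[OF H] hv kext_fin ring_distribs)
qed (auto simp: kext_const F G hF additive_comp[OF H])

lemma var_kext:
  assumes F: "additive F" "\<And>w. F w \<in> fin" and f: "f \<in> fin"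
  shows "var k l (kext s F f) = kext (s + lpar l) (\<lambda>w. var k l (F w)) f"
proof (rule kext_op_commute[where S=UNIV])
  show "g \<in> fin \<Longrightarrow> var k l (var k' l' g) = ksgn (lpar l * lpar l') (var k' l' (var k l g))" for g :: "'b spoly" and k' l'
    by (rule var_commute)
qed (use assms in \<open>auto intro!: over_var\<close>)

lemma kext_kext:
  assumes F: "additive F" "\<And>w. F w \<in> fin" and G: "additive G" "\<And>w. G w \<in> fin" and f: "f \<in> fin"
  shows "kext t G (kext s F f) = kext (s + t) (\<lambda>w. kext t G (F w)) f"
  by (rule kext_op_commute[where S=UNIV]) (use assms in \<open>auto intro!: kext_fin simp: kext_var\<close>)

lemma kext_ksgn: "additive F \<Longrightarrow> kext s (\<lambda>w. ksgn p (F w)) f = ksgn p (kext s F f)"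
  by (cases p) (simp_all add: kext_def lext_def sum_negf additive.minus[OF mop_var_additive] ksgn_minus)

lemma kext_plus: "kext s (\<lambda>w. F w + G w) f = kext s F f + kext s G f"
  by (simp add: kext_def lext_def sum.distrib additive.add[OF mop_var_additive] ksgn_add)

lemma kext_uminus: "kext s (\<lambda>w. - F w) f = - kext s F f"
  by (simp add: kext_def lext_def sum_negf additive.minus[OF mop_var_additive] ksgn_minus)

lemma kext_0 [simp]: "kext s (\<lambda>w. 0) f = 0"
  by (simp add: kext_def lext_def additive.zero[OF mop_var_additive])

subsection \<open>Operators on coefficients\<close>

lemma additive_coeff_op [simp]: "additive \<phi> \<Longrightarrow> additive (coeff_op s \<phi>)"
  unfolding coeff_op_def by simp

lemmas additive_coeff_op_comp [simp] = additive_comp[OF additive_coeff_op]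

lemma coeff_op_const: "additive \<phi> \<Longrightarrow> coeff_op s \<phi> (const w) = const (\<phi> w)"
  unfolding coeff_op_def by (simp add: kext_const)

lemma coeff_op_var: "additive \<phi> \<Longrightarrow> f \<in> fin \<Longrightarrow>
    coeff_op s \<phi> (var k l f) = ksgn (s * lpar l) (var k l (coeff_op s \<phi> f))"
  unfolding coeff_op_def by (rule kext_var) auto

lemma coeff_op_over: "additive \<phi> \<Longrightarrow> f \<in> over S \<Longrightarrow> coeff_op s \<phi> f \<in> over S"
  unfolding coeff_op_def by (rule kext_over) auto

lemma kext_coeff_op:
  assumes "additive F" "\<And>w. F w \<in> fin" "additive \<phi>" "f \<in> fin"
  shows "kext s F (coeff_op t \<phi> f) = kext (s + t) (\<lambda>w. F (\<phi> w)) f"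
  unfolding coeff_op_def using assms
  by (subst kext_kext) (auto simp: kext_const add.commute)

lemma coeff_op_kext:
  assumes "additive F" "\<And>w. F w \<in> fin" "additive \<phi>" "f \<in> fin"
  shows "coeff_op t \<phi> (kext s F f) = kext (s + t) (\<lambda>w. coeff_op t \<phi> (F w)) f"
  unfolding coeff_op_def using assms by (subst kext_kext) auto

lemma coeff_op_coeff_op:
  "additive \<phi> \<Longrightarrow> additive \<psi> \<Longrightarrow> f \<in> fin \<Longrightarrow> coeff_op s \<phi> (coeff_op t \<psi> f) = coeff_op (s + t) (\<lambda>w. \<phi> (\<psi> w)) f"
  by (simp add: coeff_op_def kext_kext kext_const add.commute)

lemma coeff_op_uminus: "coeff_op s (\<lambda>w. - \<phi> w) f = - coeff_op s (\<phi> :: 'w::zero \<Rightarrow> 'u::ab_group_add) f"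
  by (simp add: coeff_op_def additive.minus[OF additive_const] kext_uminus)

lemma coeff_op_plus: "coeff_op s (\<lambda>w. \<phi> w + \<psi> w) f = coeff_op s \<phi> f + coeff_op s (\<psi> :: 'w::zero \<Rightarrow> 'u::ab_group_add) f"
  by (simp add: coeff_op_def additive.add[OF additive_const] kext_plus)

lemma coeff_op_zero [simp]: "coeff_op s (\<lambda>w. 0) f = 0"
  by (simp add: coeff_op_def)

subsection \<open>Substitution of sums of variables\<close>

lemma superops_vsub: "superops (\<lambda>k l f. \<Sum>j\<in>B k. var j l f)"
proof
  fix k l k' l' and f :: "'a spoly" assume f: "f \<in> fin"
  have "(\<Sum>j\<in>B k. \<Sum>j'\<in>B k'. var j l (var j' l' f)) = ksgn (lpar l * lpar l') (\<Sum>j'\<in>B k'. \<Sum>j\<in>B k. var j' l' (var j l f))"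
    by (subst sum.swap) (simp only: ksgn_sum var_commute[OF f, of _ l _ l'])
  then show "(\<Sum>j\<in>B k. var j l (\<Sum>j'\<in>B k'. var j' l' f)) = ksgn (lpar l * lpar l') (\<Sum>j\<in>B k'. var j l' (\<Sum>j\<in>B k. var j l f))"
    by (simp add: additive.sum[OF additive_var])
next
  fix k i and f :: "'a spoly" assume f: "f \<in> fin"
  \<comment> \<open>The squares vanish and the cross terms cancel in pairs, so the square of a sum
    of odd variables is zero without a division by 2.\<close>
  have sq: "(\<Sum>j\<in>B. tht j i (\<Sum>j\<in>B. tht j i f)) = 0" if "finite B" for B
    using that
  proof (induction B)
    case (insert x B)
    let ?s = "\<Sum>j\<in>B. tht j i f"
    have "(\<Sum>j\<in>B. tht j i (tht x i f)) = - tht x i ?s"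
      using var_commute[OF f, of _ "Some i" x "Some i"] by (simp add: additive.sum[OF additive_tht] sum_negf)
    then show ?case using insert
      by (simp add: additive.add[OF additive_tht] sum.distrib)
  qed simp
  show "(\<Sum>j\<in>B k. var j (Some i) (\<Sum>j\<in>B k. var j (Some i) f)) = 0"
    using sq[of "B k"] by (cases "finite (B k)") (auto simp: additive.zero[OF additive_tht])
qed (auto intro!: over_sum over_var sum.distrib[symmetric] simp: additive.add[OF additive_var] sum.distrib)

lemma vsub_eq: "vsub B = psubst (\<lambda>k f. \<Sum>j\<in>B k. var j None f) (\<lambda>k i f. \<Sum>j\<in>B k. var j (Some i) f)"
  by (simp add: vsub_def)

lemma additive_vsub [simp]: "additive (vsub B)"
  unfolding vsub_eq by (rule superops.psub_additive[OF superops_vsub])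

lemmas additive_vsub_comp [simp] = additive_comp[OF additive_vsub]

lemma vsub_const [simp]: "vsub B (const w) = const w"
  unfolding vsub_eq by (rule superops.psub_const[OF superops_vsub])

lemma vsub_var: "f \<in> fin \<Longrightarrow> vsub B (var k l f) = (\<Sum>j\<in>B k. var j l (vsub B f))"
  unfolding vsub_eq by (rule superops.psub_var[OF superops_vsub])

lemma vsub_over:
  assumes "f \<in> over S" "\<And>k l j. (k, l) \<in> S \<Longrightarrow> j \<in> B k \<Longrightarrow> (j, l) \<in> T"
  shows "vsub B f \<in> over T"
  unfolding vsub_eq using assms(1)
  by (rule superops.psub_over[OF superops_vsub]) (auto intro!: over_sum over_var assms(2))

lemma vsub_fin [simp]: "f \<in> fin \<Longrightarrow> vsub B f \<in> fin"
  by (erule vsub_over) auto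

lemma vsub_kext:
  assumes F: "additive F" "\<And>w. F w \<in> fin" and f: "f \<in> fin"
  shows "vsub B (kext s F f) = kext s (\<lambda>w. vsub B (F w)) (vsub B f)"
  using f
proof (rule over_additive_eq)
  fix k l and f :: "'a spoly" assume a: "f \<in> fin" "vsub B (kext s F f) = kext s (\<lambda>w. vsub B (F w)) (vsub B f)"
  show "vsub B (kext s F (var k l f)) = kext s (\<lambda>w. vsub B (F w)) (vsub B (var k l f))"
    using a F by (simp add: kext_var additive_ksgn_commute[OF additive_vsub] vsub_var kext_fin
       additive.sum[OF additive_kext] ksgn_sum)
qed (auto simp: kext_const F)

lemma vsub_coeff_op: "additive \<phi> \<Longrightarrow> f \<in> fin \<Longrightarrow> vsub B (coeff_op s \<phi> f) = coeff_op s \<phi> (vsub B f)"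
  by (simp add: coeff_op_def vsub_kext)

lemma vsub_eq_if:
  assumes "f \<in> over S" "additive F" "\<And>w. F (const w) = const w"
    "\<And>k l f. (k, l) \<in> S \<Longrightarrow> f \<in> over S \<Longrightarrow> F (var k l f) = (\<Sum>j\<in>B k. var j l (F f))"
  shows "vsub B f = F f"
  using assms(1)
  by (rule over_additive_eq) (auto simp: assms vsub_var over_fin)

text \<open>Disjointness enters because \<open>C k\<close> is a set and cannot record that a
  variable is inserted twice.\<close>

lemma vsub_vsub:
  assumes "f \<in> over S" "\<And>k l. (k, l) \<in> S \<Longrightarrow> finite (B' k) \<and> disjoint_family_on B (B' k) \<and> (\<forall>j\<in>B' k. finite (B j))"
    "\<And>k l. (k, l) \<in> S \<Longrightarrow> C k = (\<Union>j\<in>B' k. B j)"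
  shows "vsub B (vsub B' f) = vsub C f"
proof (rule vsub_eq_if[symmetric, OF assms(1)])
  fix k l and f :: "'a spoly" assume k: "(k, l) \<in> S" "f \<in> over S"
  have "(\<Sum>j\<in>B' k. \<Sum>i\<in>B j. var i l g) = (\<Sum>i\<in>C k. var i l g)" for g :: "'a spoly"
    using assms(2)[OF k(1)] unfolding assms(3)[OF k(1)]
    by (subst sum.UNION_disjoint) (auto simp: disjoint_family_on_def)
  then show "vsub B (vsub B' (var k l f)) = (\<Sum>j\<in>C k. var j l (vsub B (vsub B' f)))"
    using k by (simp add: vsub_var over_fin additive.sum[OF additive_vsub])
qed auto

lemma vsub_cong:
  assumes "f \<in> over S" "\<And>k l. (k, l) \<in> S \<Longrightarrow> B k = C k"
  shows "vsub B f = vsub C f"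
  by (rule vsub_eq_if[OF assms(1)]) (auto simp: vsub_var over_fin assms(2))

lemma vsub_id:
  assumes "f \<in> over S" "\<And>k l. (k, l) \<in> S \<Longrightarrow> B k = {k}"
  shows "vsub B f = f"
  by (rule vsub_eq_if[OF assms(1)]) (auto simp: assms(2))

subsection \<open>Residues\<close>

text \<open>The left derivative with respect to \<theta>_k^i: the sign is that of moving the
  variable to the front before it is removed.\<close>

definition dth :: "nat \<Rightarrow> nat \<Rightarrow> 'w::ab_group_add spoly \<Rightarrow> 'w spoly"
  where "dth k i = lext (\<lambda>(A, J) w. if (k, i) \<in> J
    then Poly_Mapping.single (A, J - {(k, i)}) (ksgn (cnt J (k, i)) w) else 0)"

lemma additive_dth [simp]: "additive (dth k i)"
  unfolding dth_def by (rule additive_lext) (auto simp: additive_def single_add ksgn_add)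

lemmas additive_dth_comp [simp] = additive_comp[OF additive_dth]

lemma dth_single: "dth k i (Poly_Mapping.single (A, J) w) = (if (k, i) \<in> J
    then ksgn (cnt J (k, i)) (Poly_Mapping.single (A, J - {(k, i)}) w) else 0)"
  by (simp add: dth_def lext_single single_ksgn)

lemma dth_const [simp]: "dth k i (const w) = 0"
  by (simp add: const_def dth_single)

lemma dth_over: "f \<in> over S \<Longrightarrow> dth k i f \<in> over S"
  by (erule over_additive_single[rotated]) (auto simp: dth_single intro!: over_single)

lemma cnt_remove: "finite J \<Longrightarrow> x \<in> J \<Longrightarrow> cnt J y = (if x < y then 1 else 0) + cnt (J - {x}) y"
  using cnt_insert[of "J - {x}" x y] by (simp add: insert_absorb)

text \<open>The Leibniz rule of an odd left derivation.\<close>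

lemma dth_var:
  fixes f :: "'w::ab_group_add spoly"
  assumes "f \<in> fin"
  shows "dth k i (var k' l f) = (if k' = k \<and> l = Some i then f else 0) + ksgn (lpar l) (var k' l (dth k i f))"
proof (rule additive_eq_on_singles[where f=f])
  fix m and w :: 'w assume "m \<in> Poly_Mapping.keys f"
  then obtain A J where m: "m = (A, J)" and J: "finite J" using over_keysD[OF assms] by (cases m) auto
  let ?f = "Poly_Mapping.single m w"
  show "dth k i (var k' l ?f) = (if k' = k \<and> l = Some i then ?f else 0) + ksgn (lpar l) (var k' l (dth k i ?f))"
  proof (cases l)
    case None
    then show ?thesis by (auto simp: m lam_single dth_single additive.zero[OF additive_lam] additive_ksgn_commute[OF additive_lam])
  next
    case (Some i')
    obtain x x' where x: "x = (k, i)" "x' = (k', i')" by simp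
    have e: "k' = k \<and> l = Some i \<longleftrightarrow> x' = x" using Some x by auto
    note S = tht_single[of k' i', folded x] dth_single[of k i, folded x]
      additive.zero[OF additive_tht] additive_ksgn_commute[OF additive_tht]
      additive.zero[OF additive_dth] additive_ksgn_commute[OF additive_dth]
    show ?thesis
    proof (cases "x' = x")
      case True
      then have "k' = k" "i' = i" using x by auto
      then show ?thesis
        using J cnt_remove[OF J, of x x] Some
        by (auto simp: tht_single[of k i, folded x(1)] S m cnt_insert insert_absorb)
    next
      case False
      have "(if x < x' then 1 else 0) = 1 + (if x' < x then 1 else (0::bit))"
        using False by auto
      moreover have "insert x' J - {x} = insert x' (J - {x})" using False by auto
      ultimately show ?thesis
        using J False cnt_remove[OF J, of x x'] unfolding e unfolding Some
        by (auto simp: S m cnt_insert ac_simps)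
    qed
  qed
qed simp_all

lemma lookup_dth:
  fixes f :: "'w::ab_group_add spoly"
  assumes "(k, i) \<notin> J"
  shows "Poly_Mapping.lookup (dth k i f) (A, J) = ksgn (cnt (insert (k, i) J) (k, i)) (Poly_Mapping.lookup f (A, insert (k, i) J))"
proof (rule additive_eq_on_singles[where f=f])
  fix m :: mono and w :: 'w
  obtain B I where m: "m = (B, I)" by (cases m)
  show "Poly_Mapping.lookup (dth k i (Poly_Mapping.single m w)) (A, J) =
    ksgn (cnt (insert (k, i) J) (k, i)) (Poly_Mapping.lookup (Poly_Mapping.single m w) (A, insert (k, i) J))"
    using assms by (auto simp: m dth_single lookup_single when_def single_ksgn[symmetric] insert_absorb)
qed (auto simp: additive_def Poly_Mapping.lookup_add additive.add[OF additive_dth] ksgn_add)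

text \<open>The Berezin integral over the odd variables with index \<open>k\<close>. The derivatives
  are applied in increasing order, so that each of them removes the first remaining \<theta>_k^i of
  an ordered monomial.\<close>

definition resid :: "nat \<Rightarrow> nat \<Rightarrow> 'w::ab_group_add spoly \<Rightarrow> 'w spoly"
  where "resid N k = fold (dth k) [0..<N]"

lemma resid_0 [simp]: "resid 0 k f = f"
  by (simp add: resid_def)

lemma resid_Suc [simp]: "resid (Suc N) k f = dth k N (resid N k f)"
  by (simp add: resid_def)

lemma additive_resid [simp]: "additive (resid N k)"
  by (induction N) (simp_all add: additive_def additive.add[OF additive_dth])

lemma resid_over: "f \<in> over S \<Longrightarrow> resid N k f \<in> over S"
  by (induction N) (auto intro: dth_over)

lemma lookup_eq_0_if_fold_dth:
  assumes "fold (dth k) is f = 0" "distinct is" "{k} \<times> set is \<subseteq> J"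
  shows "Poly_Mapping.lookup f (A, J) = 0"
  using assms
proof (induction "is" arbitrary: f J)
  case (Cons i "is")
  have "Poly_Mapping.lookup (dth k i f) (A, J - {(k, i)}) = 0"
    using Cons by (intro Cons.IH) auto
  then show ?case using Cons.prems by (simp add: lookup_dth insert_absorb)
qed simp

lemma lookup_eq_0_if_resid: "resid N k f = 0 \<Longrightarrow> {k} \<times> {..<N} \<subseteq> J \<Longrightarrow> Poly_Mapping.lookup f (A, J) = 0"
  by (rule lookup_eq_0_if_fold_dth[of k "[0..<N]"]) (auto simp: resid_def)

lemma resid_eq_const:
  assumes "f \<in> over {(0, Some i) | i. i < N}"
  shows "resid N 0 f = const (Res_inv N f)"
proof (rule additive_eq_on_singles[where f=f])
  fix m w assume "m \<in> Poly_Mapping.keys f"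
  then obtain A J where m: "m = (A, J)" and J: "finite J" "\<forall>k\<in>#A. False" "J \<subseteq> {0} \<times> {..<N}"
    using over_keysD[OF assms] by (cases m) fastforce
  have A: "A = {#}" using J(2) by (cases A) auto
  have "resid n 0 (Poly_Mapping.single (A, J) w) =
    (if {0} \<times> {..<n} \<subseteq> J then Poly_Mapping.single (A, J - {0} \<times> {..<n}) w else 0)" for n
  proof (induction n)
    case (Suc n)
    show ?case
    proof (cases "{0} \<times> {..<Suc n} \<subseteq> J")
      case True
      then have "{0} \<times> {..<n} \<subseteq> J" "(0, n) \<in> J" "J - {0} \<times> {..<n} - {(0, n)} = J - {0} \<times> {..<Suc n}"
        by (auto simp: less_Suc_eq)
      moreover have "{z \<in> J - {0} \<times> {..<n}. z < (0, n)} = {}" using J by auto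
      then have "cnt (J - {0} \<times> {..<n}) (0, n) = 0" by (simp only: cnt_def) simp
      ultimately show ?thesis using True Suc by (simp add: dth_single)
    next
      case False
      moreover have "{0::nat} \<times> {..<Suc n} = insert (0, n) ({0} \<times> {..<n})" by auto
      ultimately have "\<not> {0} \<times> {..<n} \<subseteq> J \<or> (0, n) \<notin> J" by auto
      moreover have "(0, n) \<in> J - {0} \<times> {..<n} \<longleftrightarrow> (0, n) \<in> J" by auto
      ultimately show ?thesis using Suc False by (cases "{0} \<times> {..<n} \<subseteq> J") (simp_all add: dth_single additive.zero[OF additive_dth])
    qed
  qed simp
  from this[of N] show "resid N 0 (Poly_Mapping.single m w) = const (Res_inv N (Poly_Mapping.single m w))"
    using J by (auto simp: m A const_def Res_inv_def lookup_single when_def)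
qed (auto simp: additive_def Res_inv_def Poly_Mapping.lookup_add additive.add[OF additive_const] additive.add[OF additive_resid])

text \<open>As \<open>f\<close> is free of \<Lambda>_k, the derivative passes its monomials and acts
  on the values of \<open>F\<close>; the passage raises the parity of the extension by one.\<close>

lemma dth_kext_outer:
  assumes "additive F" "\<And>w. F w \<in> fin" "f \<in> over S" "\<And>l. (k, l) \<notin> S"
  shows "dth k i (kext s F f) = kext (s + 1) (\<lambda>w. dth k i (F w)) f"
  by (rule kext_op_commute[OF _ assms(1,2) _ _ _ _ assms(3)])
    (use assms in \<open>auto simp: dth_var intro: dth_over\<close>)

lemma resid_kext_outer:
  assumes "additive F" "\<And>w. F w \<in> fin" "f \<in> over S" "\<And>l. (k, l) \<notin> S"
  shows "resid N k (kext s F f) = kext (s + of_nat N) (\<lambda>w. resid N k (F w)) f"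
proof (induction N)
  case (Suc N)
  have "additive (\<lambda>w. resid N k (F w))" by (rule additive_comp) (auto simp: assms)
  then show ?case
    using Suc assms by (simp add: dth_kext_outer resid_over ac_simps)
qed simp

lemma dth_free: "f \<in> over S \<Longrightarrow> (\<And>l. (k, l) \<notin> S) \<Longrightarrow> dth k i f = 0"
  by (erule over_additive_eq[where G="\<lambda>_. 0"]) (auto simp: dth_var over_fin additive.zero[OF additive_var])

text \<open>Now the values of \<open>F\<close> are free of \<Lambda>_k. The derivative lowers the
  odd degree of the monomials of \<open>f\<close> by one, which changes the sign of the extension by
  \<open>ksgn s\<close>.\<close>

lemma dth_kext_inner:
  assumes F: "additive F" "\<And>w. F w \<in> over S" "\<And>l. (k, l) \<notin> S" and f: "f \<in> fin"
  shows "dth k i (kext s F f) = ksgn s (kext s F (dth k i f))"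
  using f
proof (rule over_additive_eq)
  show "dth k i (kext s F (const w)) = ksgn s (kext s F (dth k i (const w)))" for w
    using F dth_free[OF F(2)] by (simp add: kext_const additive.zero[OF additive_kext])
  have Ff: "F w \<in> fin" for w using F(2) by (rule over_fin)
  fix k' l and f :: "'a spoly"
  assume f: "f \<in> fin" and eq: "dth k i (kext s F f) = ksgn s (kext s F (dth k i f))"
  have "dth k i (kext s F (var k' l f)) = ksgn (s * lpar l) (dth k i (var k' l (kext s F f)))"
    using f Ff F(1) by (simp add: kext_var additive_ksgn_commute)
  also have "\<dots> = ksgn (s * lpar l) (if k' = k \<and> l = Some i then kext s F f else 0) +
    ksgn (s * lpar l + lpar l + s) (var k' l (kext s F (dth k i f)))"
    using f Ff F(1) by (simp add: dth_var kext_fin eq ksgn_add additive_ksgn_commute ac_simps)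
  also have "\<dots> = ksgn s (kext s F (dth k i (var k' l f)))"
    using f Ff F(1) by (simp add: dth_var kext_var dth_over additive.add[OF additive_kext]
      additive.zero[OF additive_kext] additive_ksgn_commute[OF additive_kext] ksgn_add ac_simps)
  finally show "dth k i (kext s F (var k' l f)) = ksgn s (kext s F (dth k i (var k' l f)))" .
qed (use F in auto)

lemma resid_kext_inner:
  assumes F: "additive F" "\<And>w. F w \<in> over S" "\<And>l. (k, l) \<notin> S" and f: "f \<in> fin"
  shows "resid N k (kext s F f) = ksgn (s * of_nat N) (kext s F (resid N k f))"
proof (induction N)
  case (Suc N)
  show ?case
    using dth_kext_inner[OF F resid_over[OF f]] F
    by (simp add: Suc additive_ksgn_commute ring_distribs ac_simps)
qed simp

text \<open>The chain rule in the case where \<Lambda>_j occurs in the image of \<Lambda>_k and in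
  no other image.\<close>

lemma dth_vsub:
  assumes "f \<in> over S" "finite (B k)" "j \<in> B k" "\<And>k' l. (k', l) \<in> S \<Longrightarrow> k' \<noteq> k \<Longrightarrow> j \<notin> B k'"
  shows "dth j i (vsub B f) = vsub B (dth k i f)"
  using assms(1)
proof (rule over_additive_eq)
  fix k' l and f :: "'a spoly" assume a: "(k', l) \<in> S" "f \<in> over S" "dth j i (vsub B f) = vsub B (dth k i f)"
  have f: "f \<in> fin" using a(2) by (rule over_fin)
  have "dth j i (vsub B (var k' l f)) = (\<Sum>x\<in>B k'. if x = j \<and> l = Some i then vsub B f else 0)
      + ksgn (lpar l) (\<Sum>x\<in>B k'. var x l (vsub B (dth k i f)))"
    using f by (simp add: vsub_var additive.sum[OF additive_dth] dth_var a(3) sum.distrib ksgn_sum)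
  also have "(\<Sum>x\<in>B k'. if x = j \<and> l = Some i then vsub B f else 0) = (if k' = k \<and> l = Some i then vsub B f else 0)"
  proof (cases "k' = k")
    case False
    then have "j \<notin> B k'" using assms(4) a(1) by blast
    then have "x \<in> B k' \<Longrightarrow> x \<noteq> j" for x by auto
    then show ?thesis using False by (auto intro: sum.neutral)
  qed (use assms(2,3) in \<open>cases "l = Some i"; simp add: sum.delta'\<close>)
  also have "\<dots> + ksgn (lpar l) (\<Sum>x\<in>B k'. var x l (vsub B (dth k i f))) = vsub B (dth k i (var k' l f))"
    using f by (simp add: dth_var vsub_var dth_over additive.add[OF additive_vsub] additive_ksgn_commute[OF additive_vsub]
      additive.zero[OF additive_vsub])
  finally show "dth j i (vsub B (var k' l f)) = vsub B (dth k i (var k' l f))" .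
qed (auto simp: additive.zero[OF additive_vsub])

lemma resid_vsub:
  assumes "f \<in> over S" "finite (B k)" "j \<in> B k" "\<And>k' l. (k', l) \<in> S \<Longrightarrow> k' \<noteq> k \<Longrightarrow> j \<notin> B k'"
  shows "resid N j (vsub B f) = vsub B (resid N k f)"
  by (induction N) (simp_all add: dth_vsub[of _ S B k j, OF resid_over[OF assms(1)] assms(2-4)])

lemma lookup_tht:
  fixes f :: "'w::ab_group_add spoly"
  shows "(k, i) \<notin> J \<Longrightarrow> Poly_Mapping.lookup (tht k i f) (A, insert (k, i) J) = ksgn (cnt J (k, i)) (Poly_Mapping.lookup f (A, J))"
proof (rule additive_eq_on_singles[where f=f])
  fix m :: mono and w :: 'w
  assume n: "(k, i) \<notin> J"
  obtain B I where m: "m = (B, I)" by (cases m)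
  have "I = J" if "(k, i) \<notin> I" "insert (k, i) I = insert (k, i) J" using n that by auto
  then show "Poly_Mapping.lookup (tht k i (Poly_Mapping.single m w)) (A, insert (k, i) J) =
    ksgn (cnt J (k, i)) (Poly_Mapping.lookup (Poly_Mapping.single m w) (A, J))"
    using n by (auto simp: m tht_single lookup_single when_def single_ksgn[symmetric])
qed (auto simp: additive_def Poly_Mapping.lookup_add additive.add[OF additive_tht] ksgn_add)

text \<open>The exterior algebra is a Frobenius algebra: a nonzero element has a multiple with nonzero
  top coefficient.\<close>

lemma frobenius_zero:
  assumes S: "finite S"
    and stable: "\<And>f k i. f \<in> D \<Longrightarrow> (k, i) \<in> S \<Longrightarrow> tht k i f \<in> D \<or> - tht k i f \<in> D"
    and top: "\<And>f A J. f \<in> D \<Longrightarrow> S \<subseteq> J \<Longrightarrow> Poly_Mapping.lookup f (A, J) = 0"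
    and f: "f \<in> D"
  shows "f = 0"
proof (rule poly_mapping_eqI)
  have "Poly_Mapping.lookup f (A, J) = 0" if "f \<in> D" for f A J
    using that
  \<comment> \<open>Induction on the number of variables missing from \<open>J\<close>: up to sign,
    the coefficient of \<open>f\<close> at \<open>J\<close> is that of \<theta> f at a set with one
    more variable, and \<theta> f lies in \<open>D\<close> up to sign.\<close>
  proof (induction "card (S - J)" arbitrary: f J)
    case 0
    then have "S \<subseteq> J" using S by simp
    then show ?case using 0 top by blast
  next
    case (Suc n)
    then obtain k i where ki: "(k, i) \<in> S" "(k, i) \<notin> J"
      by (metis Diff_iff card.empty ex_in_conv old.prod.exhaust Suc_neq_Zero)
    have "card (S - insert (k, i) J) = n"
    proof -
      have "S - insert (k, i) J = (S - J) - {(k, i)}" by auto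
      then show ?thesis using Suc(2) ki S by simp
    qed
    then have "Poly_Mapping.lookup g (A, insert (k, i) J) = 0" if "g \<in> D" for g
      using Suc(1) that by blast
    then have "Poly_Mapping.lookup (tht k i f) (A, insert (k, i) J) = 0"
      using stable[OF Suc(3) ki(1)] by (metis Poly_Mapping.lookup_uminus neg_equal_0_iff_equal)
    then show ?case using lookup_tht[OF ki(2)] by (metis ksgn_eq_0_iff)
  qed
  then show "Poly_Mapping.lookup f m = Poly_Mapping.lookup 0 m" for m
    using f by (cases m) simp
qed

subsection \<open>The supermodule\<close>

lemma coeff_op_single: "additive \<phi> \<Longrightarrow> finite (snd m) \<Longrightarrow>
    coeff_op s \<phi> (Poly_Mapping.single m w) = ksgn (s * odeg m) (Poly_Mapping.single m (\<phi> w))"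
  by (simp add: coeff_op_def kext_single mop_var_single)

lemma linear_additive: "Vector_Spaces.linear s t f \<Longrightarrow> additive f"
  by (simp add: additive_def Vector_Spaces.linear_iff)

definition parp :: "('k, 'v::ab_group_add) hw_module \<Rightarrow> bit \<Rightarrow> 'v spoly \<Rightarrow> bool"
  where "parp M p f \<longleftrightarrow> (\<forall>m. Poly_Mapping.lookup f m \<in> hpart M (p + odeg m))"

definition vr :: "nat \<Rightarrow> nat \<Rightarrow> (nat \<times> nat option) set"
  where "vr N n = {(k, l). k < n \<and> lv N l}"

lemma vr_iff [simp]: "(k, l) \<in> vr N n \<longleftrightarrow> k < n \<and> lv N l"
  by (simp add: vr_def)

lemma Vpoly_eq: "Vpoly N n = over (vr N n)"
proof -
  have "(A, J) \<in> mono_set N n \<longleftrightarrow> finite J \<and> (\<forall>k\<in>#A. (k, None) \<in> vr N n) \<and> (\<forall>(k, i)\<in>J. (k, Some i) \<in> vr N n)" for A J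
    unfolding mono_set_def by (auto intro: finite_subset[of J "{..<n} \<times> {..<N}"])
  then have "m \<in> mono_set N n \<longleftrightarrow> (case m of (A, J) \<Rightarrow>
    finite J \<and> (\<forall>k\<in>#A. (k, None) \<in> vr N n) \<and> (\<forall>(k, i)\<in>J. (k, Some i) \<in> vr N n))" for m
    by (cases m) simp
  then show ?thesis unfolding Vpoly_def over_def subset_iff Ball_def by simp
qed

lemma Vpoly_par_eq: "Vpoly_par N M n p = {f \<in> over (vr N n). parp M p f}"
  by (simp add: Vpoly_par_def Vpoly_eq parp_def)

lemma Pi_pow_simps [simp]: "scl (Pi_pow r M) = scl M" "opT (Pi_pow r M) = opT M" "opS (Pi_pow r M) = opS M"
  "hpart (Pi_pow r M) p = hpart M (p + of_nat r)"
  by (simp_all add: Pi_pow_def)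

lemma HW_supermodule_Pi_pow: "HW_supermodule N M \<Longrightarrow> HW_supermodule N (Pi_pow r M)"
proof -
  assume h: "HW_supermodule N M"
  have r: "(of_nat r :: bit) = 0 \<or> (of_nat r :: bit) = 1" by (cases "of_nat r :: bit") auto
  have "superspace (scl M) (\<lambda>p. hpart M (p + of_nat r))"
    using h r unfolding HW_supermodule_def superspace_def
    by (auto simp: Int_commute) (metis add.commute)
  moreover have "hpart (Pi_pow r M) = (\<lambda>p. hpart M (p + of_nat r))" by (simp add: fun_eq_iff)
  moreover have "p + 1 + of_nat r = p + of_nat r + (1::bit)" for p by simp
  ultimately show ?thesis using h unfolding HW_supermodule_def Pi_pow_simps by metis
qed

text \<open>The main theorem instantiates this locale with the parity-shifted module, so from here
  on \<open>M\<close> stands for \<Pi>^{N+1} V. The module V itself returns as \<open>P\<close> in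
  the section on the change of parity.\<close>

locale hwmodule =
  fixes N :: nat and M :: "('k::field_char_0, 'v::ab_group_add) hw_module"
  assumes hw: "HW_supermodule N M"
begin

lemma hwD:
  "superspace (scl M) (hpart M)"
  "Vector_Spaces.linear (scl M) (scl M) (opT M)"
  "v \<in> hpart M p \<Longrightarrow> opT M v \<in> hpart M p"
  "i < N \<Longrightarrow> Vector_Spaces.linear (scl M) (scl M) (opS M i)"
  "i < N \<Longrightarrow> v \<in> hpart M p \<Longrightarrow> opS M i v \<in> hpart M (p + 1)"
  "i < N \<Longrightarrow> opT M (opS M i v) = opS M i (opT M v)"
  "i < N \<Longrightarrow> j < N \<Longrightarrow> opS M i (opS M j v) = - opS M j (opS M i v)"
  using hw unfolding HW_supermodule_def by blast+

text \<open>Nothing is known about \<open>opS M i\<close> for i \<ge> N. With zero in its place the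
  supercommutation relations hold for all letters, without side conditions on indices.\<close>

definition nab :: "nat option \<Rightarrow> 'v \<Rightarrow> 'v"
  where "nab l = (case l of None \<Rightarrow> opT M | Some i \<Rightarrow> if i < N then opS M i else (\<lambda>_. 0))"

lemma vs: "vector_space (scl M)"
  using hwD(1) by (simp add: superspace_def)

sublocale vs: vector_space "scl M" by (rule vs)

lemma nab_linear: "Vector_Spaces.linear (scl M) (scl M) (nab l)"
  using hwD(2,4) by (cases l) (auto simp: nab_def Vector_Spaces.linear_iff vs)

lemma additive_nab [simp]: "additive (nab l)"
  by (rule linear_additive[OF nab_linear])

lemmas additive_nab_comp [simp] = additive_comp[OF additive_nab]

lemma additive_scl [simp]: "additive (scl M c)"
  by (simp add: additive_def vs.scale_right_distrib)

lemmas additive_scl_comp [simp] = additive_comp[OF additive_scl]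

lemma nab_scl: "nab l (scl M c v) = scl M c (nab l v)"
  using nab_linear[of l] by (simp add: Vector_Spaces.linear_iff)

lemma subspace_hpart: "vs.subspace (hpart M p)"
  using hwD(1) by (simp add: superspace_def)

lemma hpart_0 [simp]: "0 \<in> hpart M p"
  by (rule vs.subspace_0[OF subspace_hpart])

lemma hpart_add: "u \<in> hpart M p \<Longrightarrow> v \<in> hpart M p \<Longrightarrow> u + v \<in> hpart M p"
  by (rule vs.subspace_add[OF subspace_hpart])

lemma hpart_minus [simp]: "- u \<in> hpart M p \<longleftrightarrow> u \<in> hpart M p"
  using vs.subspace_neg[OF subspace_hpart, of u p] vs.subspace_neg[OF subspace_hpart, of "- u" p] by auto

lemma hpart_diff: "u \<in> hpart M p \<Longrightarrow> v \<in> hpart M p \<Longrightarrow> u - v \<in> hpart M p"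
  by (rule vs.subspace_diff[OF subspace_hpart])

lemma hpart_scl: "u \<in> hpart M p \<Longrightarrow> scl M c u \<in> hpart M p"
  by (rule vs.subspace_scale[OF subspace_hpart])

lemma hpart_ksgn [simp]: "ksgn q u \<in> hpart M p \<longleftrightarrow> u \<in> hpart M p"
  by (simp add: ksgn_def)

lemma hpart_inter: "v \<in> hpart M p \<Longrightarrow> v \<in> hpart M (p + 1) \<Longrightarrow> v = 0"
  using hwD(1) unfolding superspace_def by (cases p) auto

lemma hpart_decomp: "\<exists>x. x \<in> hpart M p \<and> v - x \<in> hpart M (p + 1)"
proof -
  have "\<forall>v. \<exists>v0\<in>hpart M 0. \<exists>v1\<in>hpart M 1. v = v0 + v1"
    using hwD(1) unfolding superspace_def by (elim conjE)
  then obtain v0 v1 where "v0 \<in> hpart M 0" "v1 \<in> hpart M 1" "v = v0 + v1" by blast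
  then have "v0 \<in> hpart M 0 \<and> v - v0 \<in> hpart M (0 + 1)" "v1 \<in> hpart M 1 \<and> v - v1 \<in> hpart M (1 + 1)"
    by simp_all
  then show ?thesis by (cases p) (simp only:, blast)+
qed

lemma proj_eqI:
  assumes "x \<in> hpart M p" "v - x \<in> hpart M (p + 1)"
  shows "proj M p v = x"
  unfolding proj_def
proof (rule the_equality)
  fix y assume y: "y \<in> hpart M p \<and> v - y \<in> hpart M (p + 1)"
  then have "x - y \<in> hpart M p" "(v - y) - (v - x) \<in> hpart M (p + 1)"
    using assms by (blast intro: hpart_diff)+
  then show "y = x" using hpart_inter[of "x - y" p] by simp
qed (use assms in auto)

lemma proj_hpart [simp]: "proj M p v \<in> hpart M p" and proj_compl: "v - proj M p v \<in> hpart M (p + 1)"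
  using hpart_decomp[of p v] proj_eqI[of _ p v] by auto

lemma proj_id: "v \<in> hpart M p \<Longrightarrow> proj M p v = v"
  by (rule proj_eqI) auto

lemma proj_other: "v \<in> hpart M p \<Longrightarrow> q \<noteq> p \<Longrightarrow> proj M q v = 0"
  by (rule proj_eqI) (cases p; cases q; auto)+

lemma additive_proj [simp]: "additive (proj M p)"
proof
  fix u v
  have "u + v - (proj M p u + proj M p v) = (u - proj M p u) + (v - proj M p v)" by simp
  then show "proj M p (u + v) = proj M p u + proj M p v"
    by (intro proj_eqI hpart_add proj_hpart) (simp only:, intro hpart_add proj_compl)
qed

lemma proj_scl: "proj M p (scl M c v) = scl M c (proj M p v)"
  by (rule proj_eqI) (auto intro: hpart_scl simp: proj_compl vs.scale_right_diff_distrib[symmetric])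

lemma proj_sum: "(\<Sum>p\<in>UNIV. proj M p v) = v"
proof -
  have "proj M 1 v = v - proj M 0 v"
    using proj_compl[of v 0] by (intro proj_eqI) auto
  then have "(\<Sum>p\<in>{0, 1}. proj M p v) = v" by simp
  moreover have "(UNIV :: bit set) = {0, 1}" using bit.exhaust by auto
  ultimately show ?thesis by (simp only:)
qed

lemma hom_eqI:
  assumes "additive F" "additive G" "\<And>p a. a \<in> hpart M p \<Longrightarrow> F a = G a"
  shows "F a = G a"
proof -
  have "F a = (\<Sum>p\<in>UNIV. F (proj M p a))" "G a = (\<Sum>p\<in>UNIV. G (proj M p a))"
    using additive.sum[OF assms(1), of "\<lambda>p. proj M p a" UNIV] additive.sum[OF assms(2), of "\<lambda>p. proj M p a" UNIV]
    by (simp_all add: proj_sum)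
  then show ?thesis using assms(3)[OF proj_hpart] by simp
qed

lemma parity_aut_hom: "v \<in> hpart M p \<Longrightarrow> parity_aut M v = ksgn p v"
  by (cases p) (auto simp: parity_aut_def proj_id proj_other)

lemma additive_parity_aut [simp]: "additive (parity_aut M)"
  unfolding parity_aut_def by (simp add: additive_def additive.add[OF additive_proj])

lemmas additive_parity_aut_comp [simp] = additive_comp[OF additive_parity_aut]

lemma parity_aut_hpart [simp]: "v \<in> hpart M p \<Longrightarrow> parity_aut M v \<in> hpart M p"
  by (simp add: parity_aut_hom)

lemma nab_hpart: "v \<in> hpart M p \<Longrightarrow> nab l v \<in> hpart M (p + lpar l)"
  using hwD(3,5) by (cases l) (auto simp: nab_def)

text \<open>Characteristic 0 enters here: an odd operator that anticommutes with itself has a square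
  equal to its own negative, hence square zero.\<close>

lemma half: "(v::'v) + v = 0 \<Longrightarrow> v = 0"
proof -
  assume "v + v = 0"
  then have "scl M (2::'k) v = 0" using vs.scale_left_distrib[of 1 1 v] by simp
  then show "v = 0" by simp
qed

lemma nab_commute: "nab l (nab l' v) = ksgn (lpar l * lpar l') (nab l' (nab l v))"
proof (cases l)
  case None
  then show ?thesis using hwD(6) additive.zero[OF linear_additive[OF hwD(2)]] by (cases l') (auto simp: nab_def)
next
  case l: (Some i)
  show ?thesis
  proof (cases l')
    case None
    then show ?thesis using l hwD(6) additive.zero[OF linear_additive[OF hwD(2)]] by (auto simp: nab_def)
  next
    case (Some j)
    then show ?thesis
      using l hwD(7)[of i j v] additive.zero[OF linear_additive[OF hwD(4)]] by (auto simp: nab_def)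
  qed
qed

lemma nab_square: "nab (Some i) (nab (Some i) v) = 0"
  using nab_commute[of "Some i" "Some i" v, unfolded lpar_simps mult_1_right ksgn_simps]
  by (metis half add.right_inverse)

lemma nab_parity_aut: "nab l (parity_aut M v) = ksgn (lpar l) (parity_aut M (nab l v))"
  by (rule hom_eqI[of "\<lambda>v. nab l (parity_aut M v)"])
    (auto simp: parity_aut_hom parity_aut_hom[OF nab_hpart] additive_ksgn_commute)

lemma parity_aut_parity_aut [simp]: "parity_aut M (parity_aut M v) = v"
  by (rule hom_eqI[of "\<lambda>v. parity_aut M (parity_aut M v)"])
    (auto simp: parity_aut_hom additive_ksgn_commute)

subsection \<open>Elimination of a supervariable\<close>

text \<open>The variables with index in \<open>K\<close> are replaced by \<open>- \<Sum>\<^bsub>j\<in>J\<^esub> \<Lambda>\<^sub>j - \<nabla>\<close>.\<close>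

definition sop :: "nat set \<Rightarrow> nat set \<Rightarrow> nat \<Rightarrow> nat option \<Rightarrow> 'v spoly \<Rightarrow> 'v spoly"
  where "sop K J k l f = (if k \<in> K then - (\<Sum>j\<in>J. var j l f) - coeff_op (lpar l) (nab l) f else var k l f)"

lemma additive_sop [simp]: "additive (sop K J k l)"
  unfolding sop_def by simp

lemmas additive_sop_comp [simp] = additive_comp[OF additive_sop]

lemma sop_over: "f \<in> over S \<Longrightarrow> (k \<notin> K \<Longrightarrow> (k, l) \<in> S) \<Longrightarrow> (\<And>j. k \<in> K \<Longrightarrow> j \<in> J \<Longrightarrow> (j, l) \<in> S) \<Longrightarrow> sop K J k l f \<in> over S"
  unfolding sop_def by (auto intro!: over_diff over_sum over_var coeff_op_over)

lemma sop_fin: "f \<in> fin \<Longrightarrow> sop K J k l f \<in> fin"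
  by (rule sop_over) auto

lemma coeff_nab_var: "f \<in> fin \<Longrightarrow> coeff_op (lpar l) (nab l) (var k l' f) = ksgn (lpar l * lpar l') (var k l' (coeff_op (lpar l) (nab l) f))"
  by (simp add: coeff_op_var)

lemma coeff_op_ksgn: "additive \<phi> \<Longrightarrow> coeff_op s (\<lambda>w. ksgn p (\<phi> w)) f = ksgn p (coeff_op s \<phi> f)"
  by (cases p) (simp_all add: coeff_op_uminus)

lemma coeff_op_sop:
  assumes f: "f \<in> fin" and \<phi>: "additive \<phi>" "\<And>l v. \<phi> (nab l v) = ksgn (s * lpar l) (nab l (\<phi> v))"
  shows "coeff_op s \<phi> (sop K J k l f) = ksgn (s * lpar l) (sop K J k l (coeff_op s \<phi> f))"
proof -
  have "coeff_op s \<phi> (coeff_op (lpar l) (nab l) f) = ksgn (s * lpar l) (coeff_op (lpar l) (nab l) (coeff_op s \<phi> f))"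
    using assms by (simp add: coeff_op_coeff_op coeff_op_ksgn add.commute)
  then show ?thesis
    using f \<phi>(1) by (simp add: sop_def coeff_op_var additive.diff[OF additive_coeff_op] additive.minus[OF additive_coeff_op]
      additive.sum[OF additive_coeff_op] additive.diff[OF additive_ksgn] ksgn_minus ksgn_sum)
qed

lemma coeff_nab_sop: "f \<in> fin \<Longrightarrow> coeff_op (lpar l) (nab l) (sop K J k l' f) = ksgn (lpar l * lpar l') (sop K J k l' (coeff_op (lpar l) (nab l) f))"
  by (rule coeff_op_sop) (auto intro: nab_commute)

lemma var_sop:
  assumes f: "f \<in> fin"
  shows "var k l (sop K J k' l' f) = ksgn (lpar l * lpar l') (sop K J k' l' (var k l f))"
proof -
  have "var k l (var j l' f) = ksgn (lpar l * lpar l') (var j l' (var k l f))" for j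
    by (rule var_commute[OF f])
  then show ?thesis
    using coeff_nab_var[OF f, of l' k l]
    by (simp add: sop_def additive.diff[OF additive_var] additive.minus[OF additive_var]
      additive.sum[OF additive_var] additive.diff[OF additive_ksgn] ksgn_minus ksgn_sum mult.commute)
qed

lemma sop_commute:
  assumes f: "f \<in> fin"
  shows "sop K J k l (sop K J k' l' f) = ksgn (lpar l * lpar l') (sop K J k' l' (sop K J k l f))"
proof -
  have "sop K J k l (sop K J k' l' f) = (if k \<in> K then
    - (\<Sum>j\<in>J. var j l (sop K J k' l' f)) - coeff_op (lpar l) (nab l) (sop K J k' l' f) else var k l (sop K J k' l' f))"
    by (simp add: sop_def)
  also have "\<dots> = ksgn (lpar l * lpar l') (sop K J k' l' (sop K J k l f))"
    using f by (simp add: var_sop coeff_nab_sop sop_def[of K J k l] additive.diff[OF additive_sop] additive.minus[OF additive_sop]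
      additive.sum[OF additive_sop] additive.diff[OF additive_ksgn] ksgn_minus ksgn_sum)
  finally show ?thesis .
qed

sublocale sop: superops "sop K J" for K J
proof
  show "sop K J k (Some i) (sop K J k (Some i) f) = 0" if "f \<in> fin" for k i f
  proof -
    have "g + g = 0 \<Longrightarrow> g = 0" for g :: "'v spoly"
      by (metis half Poly_Mapping.lookup_add lookup_zero poly_mapping_eqI)
    moreover have "sop K J k (Some i) (sop K J k (Some i) f) = - sop K J k (Some i) (sop K J k (Some i) f)"
      using sop_commute[OF that, of K J k "Some i" k "Some i"] by simp
    ultimately show ?thesis by (metis add.right_inverse)
  qed
qed (auto intro: sop_fin sop_commute additive.add[OF additive_sop])

definition sub :: "nat set \<Rightarrow> nat set \<Rightarrow> 'v spoly \<Rightarrow> 'v spoly"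
  where "sub K J = psubst (\<lambda>k. sop K J k None) (\<lambda>k i. sop K J k (Some i))"

lemma additive_sub [simp]: "additive (sub K J)"
  unfolding sub_def by (rule sop.psub_additive)

lemmas additive_sub_comp [simp] = additive_comp[OF additive_sub]

lemma sub_const [simp]: "sub K J (const w) = const w"
  unfolding sub_def by (rule sop.psub_const)

lemma sub_var: "f \<in> fin \<Longrightarrow> sub K J (var k l f) = sop K J k l (sub K J f)"
  unfolding sub_def by (rule sop.psub_var)

lemma sub_fin [simp]: "f \<in> fin \<Longrightarrow> sub K J f \<in> fin"
  unfolding sub_def by (rule sop.psub_fin)

text \<open>The substitution inserts \<nabla> to the left of the coefficients, so a coefficient
  operator passes through it as soon as it supercommutes with \<nabla>.\<close>

lemma sub_coeff_op:
  assumes f: "f \<in> fin" and \<phi>: "additive \<phi>" "\<And>l v. \<phi> (nab l v) = ksgn (s * lpar l) (nab l (\<phi> v))"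
  shows "sub K J (coeff_op s \<phi> f) = coeff_op s \<phi> (sub K J f)"
  using f
proof (rule over_additive_eq)
  fix k l and f :: "'v spoly" assume f: "f \<in> fin" and eq: "sub K J (coeff_op s \<phi> f) = coeff_op s \<phi> (sub K J f)"
  show "sub K J (coeff_op s \<phi> (var k l f)) = coeff_op s \<phi> (sub K J (var k l f))"
    using f \<phi>(1) by (simp add: coeff_op_var sub_var additive_ksgn_commute[OF additive_sub] coeff_op_over eq coeff_op_sop \<phi>(2))
qed (use \<phi> in \<open>simp_all add: coeff_op_const\<close>)

lemma sub_coeff_nab: "f \<in> fin \<Longrightarrow> sub K J (coeff_op (lpar l) (nab l) f) = coeff_op (lpar l) (nab l) (sub K J f)"
  by (rule sub_coeff_op) (auto intro: nab_commute)

lemma sub_free: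
  assumes "f \<in> over S" "\<And>k l. (k, l) \<in> S \<Longrightarrow> k \<notin> K"
  shows "sub K J f = f"
  using assms(1) by (rule over_additive_eq) (use assms(2) in \<open>auto simp: sub_var over_fin sop_def\<close>)

text \<open>The operators \<open>opS M i\<close> with \<open>i \<ge> N\<close> are arbitrary; superpolynomials in \<open>over (vr N n)\<close> do
  not see them.\<close>

lemma psubst_eq_sub:
  assumes f: "f \<in> over S" "\<And>k l. (k, l) \<in> S \<Longrightarrow> lv N l"
    and L: "\<And>k. (k, None) \<in> S \<Longrightarrow> L k = sop K J k None"
    and Od: "\<And>k i. (k, Some i) \<in> S \<Longrightarrow> Od k i = sop K J k (Some i)"
  shows "psubst L Od f = sub K J f"
proof -
  have "monop L Od m x = monop (\<lambda>k. sop K J k None) (\<lambda>k i. sop K J k (Some i)) m x" if m: "m \<in> Poly_Mapping.keys f" for m x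
  proof -
    obtain A I where m: "m = (A, I)" "finite I" "\<forall>k\<in>#A. (k, None) \<in> S" "\<forall>(k, i)\<in>I. (k, Some i) \<in> S"
      using over_keysD[OF f(1)] m by (cases m) auto
    have "foldr (\<lambda>(k, i). Od k i) (sorted_list_of_set I) x = foldr (\<lambda>(k, i). sop K J k (Some i)) (sorted_list_of_set I) x"
      using m by (intro foldr_cong) (auto simp: Od)
    then show ?thesis
      unfolding monop_def m(1) using m by (auto intro!: foldr_cong simp: L)
  qed
  then show ?thesis unfolding psubst_def sub_def lext_def by simp
qed

text \<open>The normal form of a class in n supervariables. The set \<open>{k. Suc k = n}\<close> is
  empty for n = 0, where nothing can be eliminated.\<close>

abbreviation nn :: "nat \<Rightarrow> 'v spoly \<Rightarrow> 'v spoly"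
  where "nn n \<equiv> sub {k. Suc k = n} {j. Suc j < n}"

text \<open>The substitution \<Lambda> -> -\<Lambda>_j - \<nabla> in a superpolynomial in a single
  supervariable, whichever index that variable has.\<close>

abbreviation flip :: "nat \<Rightarrow> 'v spoly \<Rightarrow> 'v spoly"
  where "flip j \<equiv> sub UNIV {j}"

lemma nf_eq: "f \<in> over (vr N n') \<Longrightarrow> nf M n f = nn n f"
  unfolding nf_def
proof (rule psubst_eq_sub)
  have "{..<k} = {j. j < k}" for k :: nat by auto
  then show "(\<lambda>f. if Suc k = n then - (\<Sum>l<k. lam l f) - coeff_op 0 (opT M) f else lam k f) = sop {k. Suc k = n} {j. Suc j < n} k None" for k
    by (auto simp: sop_def nab_def fun_eq_iff)
  show "(k, Some i) \<in> vr N n' \<Longrightarrow> (\<lambda>f. if Suc k = n then - (\<Sum>l<k. tht l i f) - coeff_op 1 (opS M i) f else tht k i f) =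
      sop {k. Suc k = n} {j. Suc j < n} k (Some i)" for k i
    using \<open>\<And>k. {..<k} = {j. j < k}\<close> by (auto simp: sop_def nab_def fun_eq_iff)
qed auto

lemma flip_eq: "f \<in> over (vr N n') \<Longrightarrow> psubst (\<lambda>_ f. - lam 0 f - coeff_op 0 (opT M) f)
    (\<lambda>_ i f. - tht 0 i f - coeff_op 1 (opS M i) f) f = flip 0 f"
  by (rule psubst_eq_sub) (auto simp: sop_def nab_def fun_eq_iff)

text \<open>The images of all n variables add up to -\<nabla>, which is the relation that defines
  the quotient.\<close>

lemma nn_var_last: "f \<in> fin \<Longrightarrow> n > 0 \<Longrightarrow>
    (\<Sum>j<n. sop {k. Suc k = n} {j. Suc j < n} j l f) + coeff_op (lpar l) (nab l) f = 0"
proof -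
  assume "n > 0"
  then obtain m where m: "n = Suc m" by (cases n) auto
  have "{j. Suc j < n} = {..<m}" by (auto simp: m)
  then show ?thesis by (simp add: m sop_def)
qed

lemma nn_over: "f \<in> over (vr N n) \<Longrightarrow> nn n f \<in> over (vr N (n - 1))"
  unfolding sub_def
proof (erule sop.psub_over)
  fix k l and g :: "'v spoly" assume "(k, l) \<in> vr N n" "g \<in> over (vr N (n - 1))"
  then show "sop {k. Suc k = n} {j. Suc j < n} k l g \<in> over (vr N (n - 1))"
    by (intro sop_over) auto
qed

lemma vr_mono: "n \<le> n' \<Longrightarrow> f \<in> over (vr N n) \<Longrightarrow> f \<in> over (vr N n')"
  by (rule subsetD[OF over_mono]) (auto simp: vr_def)

lemma nn_vsub:
  assumes f: "f \<in> over (vr N n)" and n: "n > 0" "n' > 0"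
    and B: "(\<Union>k<n. B k) = {..<n'}" "disjoint_family_on B {..<n}" "\<And>k. k < n \<Longrightarrow> finite (B k)"
  shows "nn n' (vsub B (nn n f)) = nn n' (vsub B f)"
  using f
proof (rule over_additive_eq)
  let ?s = "sop {k. Suc k = n'} {j. Suc j < n'}"
  fix k l and f assume k: "(k, l) \<in> vr N n" "f \<in> over (vr N n)" and IH: "nn n' (vsub B (nn n f)) = nn n' (vsub B f)"
  have f: "f \<in> fin" using k(2) by (rule over_fin)
  let ?g = "nn n f" let ?G = "nn n' (vsub B ?g)"
  have v: "nn n' (vsub B (var j l h)) = (\<Sum>i\<in>B j. ?s i l (nn n' (vsub B h)))" if "h \<in> fin" for j h
    using that by (simp add: vsub_var additive.sum[OF additive_sub] sub_var)
  show "nn n' (vsub B (nn n (var k l f))) = nn n' (vsub B (var k l f))"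
  proof (cases "Suc k = n")
    case False
    then show ?thesis using f v[of f k] v[of ?g k] IH by (simp add: sub_var sop_def)
  next
    case True
    have "nn n' (vsub B (nn n (var k l f))) = - (\<Sum>j<k. \<Sum>i\<in>B j. ?s i l ?G) - coeff_op (lpar l) (nab l) ?G"
    proof -
      have "{j. Suc j < n} = {..<k}" using True by auto
      then show ?thesis using True f
        by (simp add: sub_var sop_def[of "{k. Suc k = n}"] additive.diff[OF additive_vsub] additive.minus[OF additive_vsub]
         additive.sum[OF additive_vsub] additive.diff[OF additive_sub] additive.minus[OF additive_sub]
         additive.sum[OF additive_sub] v vsub_coeff_op sub_coeff_nab)
    qed
    also have "\<dots> = (\<Sum>i\<in>B k. ?s i l ?G)"
    proof -
      have "(\<Sum>j<n. \<Sum>i\<in>B j. ?s i l ?G) = (\<Sum>i<n'. ?s i l ?G)"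
        unfolding B(1)[symmetric] using B(2,3) by (intro sum.UNION_disjoint[symmetric]) (auto simp: disjoint_family_on_def)
      moreover have "(\<Sum>j<n. \<Sum>i\<in>B j. ?s i l ?G) = (\<Sum>j<k. \<Sum>i\<in>B j. ?s i l ?G) + (\<Sum>i\<in>B k. ?s i l ?G)"
        unfolding True[symmetric] by simp
      moreover have "(\<Sum>i<n'. ?s i l ?G) + coeff_op (lpar l) (nab l) ?G = 0"
        using f n by (intro nn_var_last) auto
      moreover have "a + b + c = 0 \<Longrightarrow> - a - c = b" for a b c :: "'v spoly"
      proof -
        assume "a + b + c = 0"
        moreover have "- a - c = b - (a + b + c)" by simp
        ultimately show "- a - c = b" by simp
      qed
      ultimately show ?thesis by metis
    qed
    finally show ?thesis using v[OF f, of k] IH by simp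
  qed
qed simp_all

subsection \<open>The quotient\<close>

abbreviation rel :: "nat \<Rightarrow> 'v spoly set" where "rel \<equiv> nabla_rel N M"

lemma lookup_pscl: "Poly_Mapping.lookup (pscl (scl M) c f) m = scl M c (Poly_Mapping.lookup f m)"
proof (rule additive_eq_on_singles[where f=f])
  have "additive (pscl (scl M) c)" unfolding pscl_def
    by (rule additive_lext) (simp add: additive_def single_add vs.scale_right_distrib)
  then show "additive (\<lambda>f. Poly_Mapping.lookup (pscl (scl M) c f) m)"
    by (simp add: additive_def Poly_Mapping.lookup_add)
  show "additive (\<lambda>f. scl M c (Poly_Mapping.lookup f m))"
    by (simp add: additive_def Poly_Mapping.lookup_add vs.scale_right_distrib)
qed (simp add: pscl_def lext_single lookup_single when_def)

lemma module_pscl: "module (pscl (scl M))"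
  by unfold_locales (auto intro!: poly_mapping_eqI simp: lookup_pscl Poly_Mapping.lookup_add vs.scale_right_distrib vs.scale_left_distrib)

sublocale pm: module "pscl (scl M)" by (rule module_pscl)

lemma pscl_eq: "f \<in> fin \<Longrightarrow> pscl (scl M) c f = coeff_op 0 (scl M c) f"
proof (rule additive_eq_on_singles[where f=f])
  show "additive (pscl (scl M) c)" by (simp add: additive_def pm.scale_right_distrib)
  fix m w assume "f \<in> fin" "m \<in> Poly_Mapping.keys f"
  then have "finite (snd m)" using over_keysD(1)[of f UNIV "fst m" "snd m"] by simp
  then show "pscl (scl M) c (Poly_Mapping.single m w) = coeff_op 0 (scl M c) (Poly_Mapping.single m w)"
    by (simp add: pscl_def lext_single coeff_op_single)
qed simp_all

lemma pscl_over: "f \<in> over S \<Longrightarrow> pscl (scl M) c f \<in> over S"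
  by (simp add: pscl_eq over_fin coeff_op_over)

lemma pscl_sub: "f \<in> fin \<Longrightarrow> sub K J (pscl (scl M) c f) = pscl (scl M) c (sub K J f)"
  by (simp add: pscl_eq) (rule sub_coeff_op, auto simp: nab_scl)

lemma pscl_var: "f \<in> fin \<Longrightarrow> var k l (pscl (scl M) c f) = pscl (scl M) c (var k l f)"
  by (simp add: pscl_eq coeff_op_var over_var)

text \<open>Up to sign the generators of \<open>nabla_rel\<close>, as one operator for the even and
  the odd directions that applies to arbitrary superpolynomials and not only to monomials.\<close>

definition gen :: "nat \<Rightarrow> nat option \<Rightarrow> 'v spoly \<Rightarrow> 'v spoly"
  where "gen n l f = (\<Sum>k<n. var k l f) + coeff_op (lpar l) (nab l) f"

lemma additive_gen [simp]: "additive (gen n l)"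
  unfolding gen_def by simp

lemma span_ksgn: "x \<in> pm.span B \<Longrightarrow> ksgn p x \<in> pm.span B"
  by (simp add: ksgn_def pm.span_neg)

lemma rel_eq_span: "rel n = pm.span {gen n l (Poly_Mapping.single m v) | l m v. m \<in> mono_set N n \<and> lv N l}"
proof -
  have fin: "finite (snd m)" if "m \<in> mono_set N n" for m
    using that finite_subset[of "snd m" "{..<n} \<times> {..<N}"] unfolding mono_set_def by auto
  let ?A = "{- (\<Sum>k<n. lam k (Poly_Mapping.single m v)) - Poly_Mapping.single m (opT M v) | m v.
        m \<in> mono_set N n} \<union>
     {- ksgn (odeg m) (\<Sum>k<n. tht k i (Poly_Mapping.single m v))
        - Poly_Mapping.single m (opS M i v) | m v i. m \<in> mono_set N n \<and> i < N}"
  let ?B = "{gen n l (Poly_Mapping.single m v) | l m v. m \<in> mono_set N n \<and> lv N l}"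
  have e: "- (\<Sum>k<n. lam k (Poly_Mapping.single m v)) - Poly_Mapping.single m (opT M v) = - gen n None (Poly_Mapping.single m v)"
    if "m \<in> mono_set N n" for m v
    using fin[OF that] by (simp add: gen_def coeff_op_single) (simp add: nab_def)
  have o: "- ksgn (odeg m) (\<Sum>k<n. tht k i (Poly_Mapping.single m v)) - Poly_Mapping.single m (opS M i v)
     = - ksgn (odeg m) (gen n (Some i) (Poly_Mapping.single m v))"
    if "m \<in> mono_set N n" "i < N" for m v i
    using fin[OF that(1)] that(2) by (simp add: gen_def coeff_op_single ksgn_add) (simp add: nab_def)
  have g: "gen n l (Poly_Mapping.single m v) \<in> pm.span ?B" if "m \<in> mono_set N n" "lv N l" for l m v
    using that by (intro pm.span_base) blast
  have "?A \<subseteq> pm.span ?B"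
  proof
    fix x assume "x \<in> ?A"
    then consider (ev) m v where "m \<in> mono_set N n" "x = - gen n None (Poly_Mapping.single m v)"
      | (od) m v i where "m \<in> mono_set N n" "i < N" "x = - ksgn (odeg m) (gen n (Some i) (Poly_Mapping.single m v))"
      using e o by blast
    then show "x \<in> pm.span ?B"
    proof cases
      case ev
      show ?thesis unfolding ev(2) by (rule pm.span_neg, rule g) (use ev in auto)
    next
      case od
      have "gen n (Some i) (Poly_Mapping.single m v) \<in> pm.span ?B" by (rule g) (use od in auto)
      then show ?thesis unfolding od(3) by (intro pm.span_neg span_ksgn)
    qed
  qed
  moreover have "?B \<subseteq> pm.span ?A"
  proof
    fix x assume "x \<in> ?B"
    then obtain l m v where x: "x = gen n l (Poly_Mapping.single m v)" "m \<in> mono_set N n" "lv N l" by auto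
    show "x \<in> pm.span ?A"
    proof (cases l)
      case None
      then have "x = - (- (\<Sum>k<n. lam k (Poly_Mapping.single m v)) - Poly_Mapping.single m (opT M v))"
        using x by (simp add: e)
      then show ?thesis using x(2) by (simp only:) (rule pm.span_neg, rule pm.span_base, blast)
    next
      case (Some i)
      let ?y = "- ksgn (odeg m) (\<Sum>k<n. tht k i (Poly_Mapping.single m v)) - Poly_Mapping.single m (opS M i v)"
      have "x = - ksgn (odeg m) ?y"
        using x Some by (simp add: o ksgn_minus)
      moreover have "?y \<in> pm.span ?A" using x(2,3) Some by (intro pm.span_base UnI2 CollectI exI[of _ m] exI[of _ v] exI[of _ i]) simp
      ultimately show ?thesis by (simp only:) (intro pm.span_neg span_ksgn)
    qed
  qed
  ultimately show ?thesis unfolding nabla_rel_def by (metis (no_types, lifting) pm.span_eq)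
qed

end

lemma UNIV_bit: "(UNIV :: bit set) = {0, 1}"
  using bit.exhaust by auto

lemma by_parity_Nil [simp]: "by_parity M f [] = f [] []"
  by (simp add: by_parity_def)

lemma by_parity_Cons [simp]: "by_parity M f (v # vs) =
    (\<Sum>p\<in>UNIV. by_parity M (\<lambda>ps us. f (p # ps) (proj M p v # us)) vs)"
proof -
  have "{ps :: bit list. length ps = Suc (length vs)} = (\<lambda>(p, ps). p # ps) ` (UNIV \<times> {ps. length ps = length vs})"
    by (auto simp: image_def length_Suc_conv)
  then have "by_parity M f (v # vs) = (\<Sum>(p, ps)\<in>UNIV \<times> {ps. length ps = length vs}. f (p # ps) (map2 (proj M) (p # ps) (v # vs)))"
    unfolding by_parity_def by (simp add: sum.reindex inj_on_def case_prod_unfold)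
  also have "\<dots> = (\<Sum>p\<in>UNIV. \<Sum>ps\<in>{ps. length ps = length vs}. f (p # ps) (map2 (proj M) (p # ps) (v # vs)))"
    by (rule sum.cartesian_product[symmetric])
  finally show ?thesis by (simp add: by_parity_def)
qed

lemma additive_by_parity: "additive H \<Longrightarrow> H (by_parity M f vs) = by_parity M (\<lambda>ps us. H (f ps us)) vs"
  by (simp add: by_parity_def additive.sum)

context hwmodule
begin

lemma by_parity_hom:
  assumes "list_all2 (\<lambda>p v. v \<in> hpart M p) ps vs"
    and "\<And>qs us. length qs = length vs \<Longrightarrow> length us = length vs \<Longrightarrow> 0 \<in> set us \<Longrightarrow> f qs us = 0"
  shows "by_parity M f vs = f ps vs"
  using assms
proof (induction ps vs arbitrary: f rule: list_all2_induct)
  case (Cons p ps v vs)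
  have "by_parity M (\<lambda>ps us. f (q # ps) (proj M q v # us)) vs = (if q = p then f (p # ps) (v # vs) else 0)" for q
  proof (cases "q = p")
    case True
    then show ?thesis
      using Cons.IH[of "\<lambda>ps us. f (q # ps) (proj M q v # us)"] Cons by (simp add: proj_id)
  next
    case False
    then have "proj M q v = 0" using Cons by (simp add: proj_other)
    then show ?thesis using Cons.prems False by (simp add: by_parity_def)
  qed
  moreover have "finite (UNIV :: bit set)" unfolding UNIV_bit by simp
  ultimately show ?case by simp
qed simp

subsection \<open>Normal forms in the quotient\<close>

lemma gen_in_rel:
  assumes "f \<in> over (vr N n)" "lv N l"
  shows "gen n l f \<in> rel n"
proof -
  have "gen n l f = (\<Sum>m\<in>Poly_Mapping.keys f. gen n l (Poly_Mapping.single m (Poly_Mapping.lookup f m)))"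
    by (subst poly_mapping_sum_singles[of f]) (rule additive.sum[OF additive_gen])
  moreover have "m \<in> mono_set N n" if "m \<in> Poly_Mapping.keys f" for m
    using that assms(1) unfolding Vpoly_eq[symmetric] Vpoly_def by auto
  moreover have "gen n l (Poly_Mapping.single m v) \<in> rel n" if "m \<in> mono_set N n" for m v
    unfolding rel_eq_span using that assms(2) by (intro pm.span_base) blast
  ultimately show ?thesis
    unfolding rel_eq_span by (metis (no_types, lifting) pm.span_sum)
qed

lemma rel_0 [simp]: "0 \<in> rel n"
  unfolding rel_eq_span by (rule pm.span_zero)

lemma rel_add: "f \<in> rel n \<Longrightarrow> g \<in> rel n \<Longrightarrow> f + g \<in> rel n"
  unfolding rel_eq_span by (rule pm.span_add)

lemma rel_diff: "f \<in> rel n \<Longrightarrow> g \<in> rel n \<Longrightarrow> f - g \<in> rel n"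
  unfolding rel_eq_span by (rule pm.span_diff)

lemma rel_ksgn: "f \<in> rel n \<Longrightarrow> ksgn p f \<in> rel n"
  unfolding rel_eq_span by (rule span_ksgn)

lemma gen_single_over: "m \<in> mono_set N n \<Longrightarrow> Poly_Mapping.single m v \<in> over (vr N n)"
  unfolding Vpoly_eq[symmetric] Vpoly_def by simp

lemma gen_over: "f \<in> over (vr N n) \<Longrightarrow> lv N l \<Longrightarrow> gen n l f \<in> over (vr N n)"
  unfolding gen_def by (auto intro!: over_add over_sum over_var coeff_op_over)

lemma rel_induct:
  assumes "f \<in> rel n" "pm.subspace {f. P f}" "\<And>l f. f \<in> over (vr N n) \<Longrightarrow> lv N l \<Longrightarrow> P (gen n l f)"
  shows "P f"
proof -
  have "rel n \<subseteq> {f. P f}"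
    unfolding rel_eq_span by (rule pm.span_minimal[OF _ assms(2)]) (auto intro!: assms(3) gen_single_over)
  then show ?thesis using assms(1) by auto
qed

lemma rel_over: "f \<in> rel n \<Longrightarrow> f \<in> over (vr N n)"
  by (erule rel_induct) (auto intro!: pm.subspaceI over_add pscl_over gen_over)

lemma nn_rel: "f \<in> rel n \<Longrightarrow> n > 0 \<Longrightarrow> nn n f = 0"
proof -
  assume f: "f \<in> rel n" and n: "n > 0"
  from f have "nn n f = 0 \<and> f \<in> fin"
  proof (rule rel_induct)
    show "pm.subspace {f. nn n f = 0 \<and> f \<in> fin}"
      by (rule pm.subspaceI) (auto simp: additive.zero[OF additive_sub] additive.add[OF additive_sub] pscl_sub
        intro: over_add pscl_over)
    fix l and f :: "'v spoly" assume f: "f \<in> over (vr N n)" "lv N l"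
    then have fin: "f \<in> fin" by (simp add: over_fin)
    have "nn n (gen n l f) = (\<Sum>j<n. sop {k. Suc k = n} {j. Suc j < n} j l (nn n f)) + coeff_op (lpar l) (nab l) (nn n f)"
      using fin by (simp add: gen_def additive.add[OF additive_sub] additive.sum[OF additive_sub] sub_var sub_coeff_nab)
    then show "nn n (gen n l f) = 0 \<and> gen n l f \<in> fin"
      using nn_var_last[of "nn n f" n l] n fin gen_over[OF f] by (auto simp: over_fin)
  qed
  then show ?thesis by simp
qed

lemma var_gen: "f \<in> fin \<Longrightarrow> var k l' (gen n l f) = ksgn (lpar l * lpar l') (gen n l (var k l' f))"
proof -
  assume f: "f \<in> fin"
  have "var k l' (var j l f) = ksgn (lpar l * lpar l') (var j l (var k l' f))" for j
    using var_commute[OF f, of k l' j l] by (simp add: mult.commute)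
  then show ?thesis
    using coeff_nab_var[OF f, of l k l']
    by (simp add: gen_def additive.add[OF additive_var] additive.sum[OF additive_var] ksgn_add ksgn_sum)
qed

lemma var_rel:
  assumes "f \<in> rel n" "k < n" "lv N l"
  shows "var k l f \<in> rel n"
proof -
  have "var k l f \<in> rel n \<and> f \<in> fin"
    using assms(1)
  proof (rule rel_induct)
    have s: "pscl (scl M) c f \<in> rel n" if "f \<in> rel n" for f c
      using that unfolding rel_eq_span by (rule pm.span_scale)
    show "pm.subspace {f. var k l f \<in> rel n \<and> f \<in> fin}"
      by (rule pm.subspaceI) (auto simp: additive.zero[OF additive_var] additive.add[OF additive_var] pscl_var
        intro: over_add pscl_over rel_add s)
    fix l' and f :: "'v spoly" assume f: "f \<in> over (vr N n)" "lv N l'"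
    then show "var k l (gen n l' f) \<in> rel n \<and> gen n l' f \<in> fin"
      using assms(2,3) by (auto simp: var_gen over_fin gen_over intro!: rel_ksgn gen_in_rel over_var intro: over_fin[OF gen_over])
  qed
  then show ?thesis by simp
qed

lemma diff_nn_rel:
  assumes "f \<in> over (vr N n)" "n > 0"
  shows "f - nn n f \<in> rel n"
  using assms(1)
proof (induction rule: over_induct)
  case (add f g)
  have "f + g - nn n (f + g) = (f - nn n f) + (g - nn n g)"
    by (simp add: additive.add[OF additive_sub])
  then show ?case using add by (simp only:) (rule rel_add)
next
  case (var k l f)
  let ?g = "nn n f"
  have fin: "f \<in> fin" using var by (simp add: over_fin)
  have "?g \<in> over (vr N n)" using var by (intro vr_mono[OF _ nn_over]) auto
  then have g: "gen n l ?g \<in> rel n" using var by (intro gen_in_rel) auto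
  \<comment> \<open>For the last variable, multiplying by it and substituting for it differ by
    exactly one generator applied to the normal form.\<close>
  have "var k l f - nn n (var k l f) = var k l (f - ?g) + (if Suc k = n then gen n l ?g else 0)"
  proof (cases "Suc k = n")
    case True
    then have "(\<Sum>j<n. var j l ?g) = (\<Sum>j | Suc j < n. var j l ?g) + var k l ?g"
    proof -
      have "{j. Suc j < n} = {..<k}" using True by auto
      then show ?thesis unfolding True[symmetric] by simp
    qed
    then show ?thesis using fin True by (simp add: sub_var sop_def gen_def additive.diff[OF additive_var])
  qed (use fin in \<open>simp add: sub_var sop_def additive.diff[OF additive_var]\<close>)
  then show ?case using var g by (auto intro!: rel_add var_rel)
qed (simp_all add: additive.zero[OF additive_sub])

text \<open>The injectivity of the isomorphism with V[\<Lambda>_1, ..., \<Lambda>_{n-1}]. A class is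
  determined by its normal form, which makes the choice made by \<open>rep\<close> harmless.\<close>

lemma rel_iff: "n > 0 \<Longrightarrow> f \<in> rel n \<longleftrightarrow> f \<in> over (vr N n) \<and> nn n f = 0"
  using diff_nn_rel[of f n] nn_rel[of f n] rel_over[of f n] by auto

lemma cls_eq_iff:
  assumes "n > 0" "f \<in> over (vr N n)" "g \<in> over (vr N n)"
  shows "cls N M n f = cls N M n g \<longleftrightarrow> nn n f = nn n g"
proof
  assume "cls N M n f = cls N M n g"
  moreover have "f \<in> cls N M n f" by (simp add: cls_def)
  ultimately have "f \<in> cls N M n g" by metis
  then show "nn n f = nn n g" using assms(1) by (simp add: cls_def rel_iff additive.diff[OF additive_sub])
next
  assume "nn n f = nn n g"
  then have fg: "f - g \<in> rel n" using assms by (simp add: rel_iff additive.diff[OF additive_sub] over_diff)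
  have "x - f \<in> rel n \<longleftrightarrow> x - g \<in> rel n" for x
  proof
    show "x - f \<in> rel n \<Longrightarrow> x - g \<in> rel n" using rel_add[OF _ fg, of "x - f"] by simp
    show "x - g \<in> rel n \<Longrightarrow> x - f \<in> rel n" using rel_diff[OF _ fg, of "x - g"] by simp
  qed
  then show "cls N M n f = cls N M n g" unfolding cls_def by (rule Collect_cong)
qed

lemma rep_cls:
  assumes "n > 0" "f \<in> over (vr N n)"
  shows "rep (cls N M n f) \<in> over (vr N n)" "nn n (rep (cls N M n f)) = nn n f"
proof -
  have "rep (cls N M n f) \<in> cls N M n f"
    unfolding rep_def by (rule someI[of _ f]) (simp add: cls_def)
  then have "rep (cls N M n f) - f \<in> rel n" by (simp add: cls_def)
  then have r: "rep (cls N M n f) - f \<in> over (vr N n)" "nn n (rep (cls N M n f) - f) = 0"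
    using assms by (simp_all add: rel_iff)
  show "nn n (rep (cls N M n f)) = nn n f" using r(2) by (simp add: additive.diff[OF additive_sub])
  show "rep (cls N M n f) \<in> over (vr N n)" using over_add[OF r(1) assms(2)] by simp
qed

lemma nn_idem: "f \<in> over (vr N (n - 1)) \<Longrightarrow> nn n f = f"
  by (erule sub_free) auto

subsection \<open>Parity\<close>

lemma parp_add: "parp M p f \<Longrightarrow> parp M p g \<Longrightarrow> parp M p (f + g)"
  by (simp add: parp_def Poly_Mapping.lookup_add hpart_add)

lemma parp_0 [simp]: "parp M p 0"
  by (simp add: parp_def)

lemma parp_minus [simp]: "parp M p (- f) \<longleftrightarrow> parp M p f"
  by (simp add: parp_def)

lemma parp_diff: "parp M p f \<Longrightarrow> parp M p g \<Longrightarrow> parp M p (f - g)"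
  by (simp add: parp_def lookup_minus hpart_diff)

lemma parp_ksgn [simp]: "parp M p (ksgn q f) \<longleftrightarrow> parp M p f"
  by (simp add: ksgn_def)

lemma parp_sum: "(\<And>i. i \<in> I \<Longrightarrow> parp M p (f i)) \<Longrightarrow> parp M p (sum f I)"
  by (induction I rule: infinite_finite_induct) (auto intro: parp_add)

lemma parp_single: "w \<in> hpart M (p + odeg m) \<Longrightarrow> parp M p (Poly_Mapping.single m w)"
  unfolding parp_def by (auto simp: lookup_single when_def simp del: split_paired_All)

lemma parp_const: "w \<in> hpart M p \<Longrightarrow> parp M p (const w)"
  unfolding const_def by (rule parp_single) (simp add: odeg_def)

lemma parp_additive:
  assumes "additive F" "parp M p f" "f \<in> over S"
    "\<And>m w. finite (snd m) \<Longrightarrow> m \<in> Poly_Mapping.keys f \<Longrightarrow> w \<in> hpart M (p + odeg m) \<Longrightarrow> parp M q (F (Poly_Mapping.single m w))"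
  shows "parp M q (F f)"
proof -
  have "F f = (\<Sum>m\<in>Poly_Mapping.keys f. F (Poly_Mapping.single m (Poly_Mapping.lookup f m)))"
    by (subst poly_mapping_sum_singles[of f]) (rule additive.sum[OF assms(1)])
  moreover have "finite (snd m)" if "m \<in> Poly_Mapping.keys f" for m
    using over_keysD(1)[OF assms(3), of "fst m" "snd m"] that by simp
  ultimately show ?thesis
    using assms(2) by (auto simp del: split_paired_All simp: parp_def[of M p] intro!: parp_sum assms(4))
qed

lemma parp_var: "f \<in> fin \<Longrightarrow> parp M p f \<Longrightarrow> parp M (p + lpar l) (var k l f)"
proof (rule parp_additive[where F="var k l" and S=UNIV and p=p and f=f])
  fix m w assume m: "finite (snd m)" and w: "w \<in> hpart M (p + odeg m)"
  obtain A J where mm: "m = (A, J)" by (cases m)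
  show "parp M (p + lpar l) (var k l (Poly_Mapping.single m w))"
    using m w by (cases l) (auto simp: mm lam_single tht_single odeg_def ac_simps intro!: parp_single)
qed auto

lemma parp_coeff_nab: "f \<in> fin \<Longrightarrow> parp M p f \<Longrightarrow> parp M (p + lpar l) (coeff_op s (nab l) f)"
proof (rule parp_additive[where F="coeff_op s (nab l)" and S=UNIV and p=p and f=f])
  fix m w assume m: "finite (snd m)" and w: "w \<in> hpart M (p + odeg m)"
  show "parp M (p + lpar l) (coeff_op s (nab l) (Poly_Mapping.single m w))"
    using m nab_hpart[OF w, of l] by (auto simp: coeff_op_single ac_simps intro!: parp_single)
qed auto

lemma parp_sop: "f \<in> fin \<Longrightarrow> parp M p f \<Longrightarrow> parp M (p + lpar l) (sop K J k l f)"
  unfolding sop_def by (auto intro!: parp_diff parp_sum parp_var parp_coeff_nab)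

lemma parp_sub:
  assumes "f \<in> fin" "parp M p f"
  shows "parp M p (sub K J f)"
  using assms(2,1)
proof (rule parp_additive[OF additive_sub])
  fix m w assume m: "finite (snd m)" and w: "w \<in> hpart M (p + odeg m)"
  have Od: "parp M (q + of_nat (length js)) (foldr (\<lambda>(k, i). sop K J k (Some i)) js f)"
    if "parp M q f" "f \<in> fin" for js q f
    using that
  proof (induction js)
    case (Cons j js)
    have "foldr (\<lambda>(k, i). sop K J k (Some i)) js f \<in> fin" using Cons.prems by (intro sop.foldr_Od_fin)
    from parp_sop[OF this Cons.IH[OF Cons.prems], of "Some (snd j)" K J "fst j"] show ?case
      by (simp add: case_prod_unfold ac_simps)
  qed simp
  have L: "parp M q (foldr (\<lambda>k. sop K J k None) ks f)" if "parp M q f" "f \<in> fin" for ks q f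
    using that
  proof (induction ks)
    case (Cons k ks)
    have "foldr (\<lambda>k. sop K J k None) ks f \<in> fin" using Cons.prems by (intro sop.foldr_L_fin)
    from parp_sop[OF this Cons.IH[OF Cons.prems], of None K J k] show ?case by simp
  qed simp
  have "parp M ((p + odeg m) + of_nat (length (sorted_list_of_set (snd m))))
     (sub K J (Poly_Mapping.single m w))"
    unfolding sub_def sop.psub_single monop_def
    by (intro L Od parp_const w sop.foldr_Od_fin) auto
  then show "parp M p (sub K J (Poly_Mapping.single m w))"
    by (simp add: odeg_def ac_simps)
qed

text \<open>In a superpolynomial of total parity \<open>p\<close> the parity of a coefficient
  determines that of its monomial. Hence a sign depending on the coefficient can be traded for a
  different parity of the extension. The later sign comparisons inside nested brackets rest on this
  exchange.\<close>

lemma kext_cong_parp: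
  assumes "parp M p f" "\<And>d u. u \<in> hpart M (p + d) \<Longrightarrow> ksgn (s * d) (F u) = ksgn (t * d) (G u)"
  shows "kext s F f = kext t G f"
  unfolding kext_def lext_def
proof (rule sum.cong)
  fix m
  have "ksgn (s * odeg m) (F (Poly_Mapping.lookup f m)) = ksgn (t * odeg m) (G (Poly_Mapping.lookup f m))"
    using assms(1) unfolding parp_def by (intro assms(2)) blast
  then show "ksgn (s * odeg m) (monop lam tht m (F (Poly_Mapping.lookup f m))) = ksgn (t * odeg m) (monop lam tht m (G (Poly_Mapping.lookup f m)))"
    using additive_ksgn_commute[OF mop_var_additive] by metis
qed simp

end

subsection \<open>Quivers with two vertices\<close>

lemma forest_size_le_1:
  assumes "Q \<in> quivers n" "size Q \<le> 1"
  shows "forest Q"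
proof -
  have False if t: "trail id Q xs es" "es \<noteq> []" "hd xs = last xs" for xs es
  proof -
    have l: "length xs = Suc (length es)" and s: "mset es \<subseteq># Q"
      and e: "\<forall>q<length es. {fst (es ! q), snd (es ! q)} = {xs ! q, xs ! Suc q}"
      using t(1) by (auto simp: trail_def)
    have "length es \<le> 1" using size_mset_mono[OF s] assms(2) by simp
    then obtain x where es: "es = [x]" using t(2) by (cases es) auto
    then obtain y z where xs: "xs = [y, z]" using l by (auto simp: length_Suc_conv)
    have "{fst x, snd x} = {y, z}" using e es xs by auto
    moreover have "y = z" using t(3) xs by simp
    moreover have "x \<in># Q" using s es by simp
    then have "fst x \<noteq> snd x" using assms(1) by (auto simp: quivers_def)
    ultimately show False by auto
  qed
  then show ?thesis unfolding forest_def by blast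
qed

lemma quivers_2_edge: "Q \<in> quivers 2 \<Longrightarrow> e \<in># Q \<Longrightarrow> e = (0, 1) \<or> e = (1, 0)"
  by (cases e) (force simp: quivers_def numeral_2_eq_2 less_Suc_eq)

lemma not_forest_2:
  assumes "Q \<in> quivers 2" "2 \<le> size Q"
  shows "\<not> forest Q"
proof -
  obtain e Q' where Q: "Q = add_mset e Q'" using assms(2) by (cases Q) auto
  then obtain f Q'' where Q': "Q' = add_mset f Q''" using assms(2) by (cases Q') auto
  have "e \<in># Q" "f \<in># Q" using Q Q' by auto
  then have e: "{fst e, snd e} = {0, 1}" "{fst f, snd f} = {1, 0}"
    using quivers_2_edge[OF assms(1), of e] quivers_2_edge[OF assms(1), of f] by auto
  \<comment> \<open>Whatever their directions, two edges between the only two vertices can be walked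
    forth and back.\<close>
  have "trail id Q [0, 1, 0] [e, f]"
    unfolding trail_def Q Q' using e by (auto simp: less_Suc_eq numeral_2_eq_2)
  then show ?thesis unfolding forest_def by (intro notI) (auto dest!: spec[of _ "[0,1,0]"])
qed

lemma forest_2_iff: "Q \<in> quivers 2 \<Longrightarrow> forest Q \<longleftrightarrow> size Q \<le> 1"
  using forest_size_le_1[of Q 2] not_forest_2[of Q] by force

lemma quivers_2_cases:
  assumes "Q \<in> quivers 2"
  obtains "Q = {#}" | "Q = {#(0, 1)#}" | "Q = {#(1, 0)#}" | "2 \<le> size Q"
proof (cases "2 \<le> size Q")
  case False
  then consider "size Q = 0" | "size Q = 1" by linarith
  then show ?thesis
  proof cases
    case 2
    then obtain e where "Q = {#e#}" by (meson size_1_singleton_mset)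
    then show ?thesis using quivers_2_edge[OF assms, of e] that by auto
  qed (use that in auto)
qed (use that in auto)

lemma quivers_2_simps [simp]: "{#} \<in> quivers n" "{#(0, Suc 0)#} \<in> quivers 2" "{#(Suc 0, 0)#} \<in> quivers 2"
  by (auto simp: quivers_def)

lemma component_empty [simp]: "component {#} k = {k}"
  by (auto simp: component_def)

lemma component_2:
  assumes "Q \<in> quivers 2" "Q \<noteq> {#}" "k < 2"
  shows "component Q k = {0, 1}"
proof -
  let ?E = "set_mset Q \<union> (set_mset Q)\<inverse>"
  obtain e where "e \<in># Q" using assms(2) by (cases Q) auto
  then have E: "(0, 1) \<in> ?E" "(1, 0) \<in> ?E" using quivers_2_edge[OF assms(1), of e] by auto
  have sub: "?E \<subseteq> {(0, 1), (1, 0)}"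
  proof
    fix x assume "x \<in> ?E"
    then have "x \<in># Q \<or> prod.swap x \<in># Q" by (cases x) auto
    then show "x \<in> {(0, 1), (1, 0)}"
      using quivers_2_edge[OF assms(1), of x] quivers_2_edge[OF assms(1), of "prod.swap x"] by (cases x) auto
  qed
  have k: "k = 0 \<or> k = 1" using assms(3) by auto
  have "(k, l) \<in> ?E\<^sup>*" if "l \<in> {0, 1}" for l
    using E k that by (cases "k = l") auto
  moreover have "l \<in> {0, 1}" if "(k, l) \<in> ?E\<^sup>*" for l
    using that k sub by (induction rule: rtrancl_induct) auto
  ultimately show ?thesis unfolding component_def by blast
qed

lemma directed_cycle_2:
  assumes "Q \<in> quivers 2" "directed_cycle Q es"
  shows "es = [(0, 1), (1, 0)] \<or> es = [(1, 0), (0, 1)]"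
proof -
  have s: "mset es \<subseteq># Q" and d: "distinct (map fst es)" and n: "es \<noteq> []"
    and c: "\<forall>q<length es. snd (es ! q) = fst (es ! (Suc q mod length es))"
    using assms(2) by (auto simp: directed_cycle_def)
  have e: "x = (0, 1) \<or> x = (1, 0)" if "x \<in> set es" for x
    using that s quivers_2_edge[OF assms(1)] by (meson mset_subset_eqD set_mset_mset in_multiset_in_set)
  have "fst ` set es \<subseteq> {0, 1}" using e by force
  then have "card (fst ` set es) \<le> card {0, 1::nat}" by (rule card_mono[rotated]) simp
  then have "length es \<le> 2" using distinct_card[OF d] by simp
  moreover have "length es \<noteq> 1" 
  proof
    assume l: "length es = 1"
    then obtain x where x: "es = [x]" by (auto simp: length_Suc_conv)
    show False using c e[of x] by (auto simp: x)
  qed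
  moreover have "length es \<noteq> 0" using n by simp
  ultimately have "length es = 2" by linarith
  then obtain x y where xy: "es = [x, y]" by (auto simp: length_Suc_conv numeral_2_eq_2)
  then show ?thesis using e[of x] e[of y] d by auto
qed

lemma all_less_2: "(\<forall>k<2::nat. P k) \<longleftrightarrow> P 0 \<and> P 1"
  by (auto simp: numeral_2_eq_2 less_Suc_eq)

lemma all_lists_2: "(\<forall>vs. length vs = 2 \<longrightarrow> P vs) \<longleftrightarrow> (\<forall>a b. P [a, b])"
  by (auto simp: length_Suc_conv numeral_2_eq_2)

subsection \<open>Binary operations\<close>

definition even_free :: "nat \<Rightarrow> (nat \<times> nat option) set"
  where "even_free N = {(0, Some i) | i. i < N}"

context hwmodule
begin

lemmas additive_zeros [simp] = additive.zero[OF additive_sub] additive.zero[OF additive_vsub] additive.zero[OF additive_var]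
  additive.zero[OF additive_lam] additive.zero[OF additive_tht] additive.zero[OF additive_coeff_op[OF additive_nab]]
  additive.zero[OF additive_nab] additive.zero[OF additive_parity_aut] additive.zero[OF additive_resid]

lemma dlam_single: "dlam M k (Poly_Mapping.single (A, J) w) = Poly_Mapping.single (A - {#k#}, J) (scl M (of_nat (count A k)) w)"
  by (simp add: dlam_def lext_single)

lemma additive_dlam [simp]: "additive (dlam M k)"
  unfolding dlam_def by (rule additive_lext) (auto simp: additive_def single_add vs.scale_right_distrib)

lemmas additive_dlam_comp [simp] = additive_comp[OF additive_dlam]

lemma dlam_const [simp]: "dlam M k (const w) = 0"
  by (simp add: const_def dlam_single)

lemma dlam_fin: "f \<in> over S \<Longrightarrow> dlam M k f \<in> over S"
proof (erule over_additive_single[OF additive_dlam])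
  fix A J w assume "finite J" "\<forall>k\<in>#A. (k, None) \<in> S" "\<forall>(k, i)\<in>J. (k, Some i) \<in> S"
  then show "dlam M k (Poly_Mapping.single (A, J) w) \<in> over S"
    by (auto simp: dlam_single intro!: over_single dest: in_diffD)
qed

lemma dlam_var:
  assumes "f \<in> fin"
  shows "dlam M k (var k' l f) = (if k' = k \<and> l = None then f else 0) + var k' l (dlam M k f)"
proof (rule additive_eq_on_singles[where f=f])
  fix m :: mono and w :: 'v
  obtain A J where m: "m = (A, J)" by (cases m)
  let ?f = "Poly_Mapping.single m w"
  show "dlam M k (var k' l ?f) = (if k' = k \<and> l = None then ?f else 0) + var k' l (dlam M k ?f)"
  proof (cases l)
    case (Some i)
    then show ?thesis
      by (auto simp: m tht_single dlam_single additive.zero[OF additive_dlam] additive_ksgn_commute[OF additive_dlam])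
  next
    case None
    show ?thesis
    proof (cases "k' = k")
      case True
      show ?thesis
      proof (cases "k \<in># A")
        case True
        then show ?thesis using None \<open>k' = k\<close>
          by (simp add: m lam_single dlam_single single_add vs.scale_left_distrib)
      next
        case False
        then have "count A k = 0" by (simp add: not_in_iff)
        then show ?thesis using None \<open>k' = k\<close>
          by (simp add: m lam_single dlam_single additive.zero[OF additive_lam])
      qed
    next
      case False
      then show ?thesis using None by (auto simp: m lam_single dlam_single diff_add_mset_swap)
    qed
  qed
qed simp_all

lemma dlam_coeff_nab: "f \<in> fin \<Longrightarrow> dlam M k (coeff_op (lpar l) (nab l) f) = coeff_op (lpar l) (nab l) (dlam M k f)"
proof (erule over_additive_eq)
  fix k' l' and f :: "'v spoly"
  assume f: "f \<in> fin" "dlam M k (coeff_op (lpar l) (nab l) f) = coeff_op (lpar l) (nab l) (dlam M k f)"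
  have c: "coeff_op (lpar l) (nab l) (if b then f else 0) = (if b then coeff_op (lpar l) (nab l) f else 0)" for b f
    by (simp add: additive.zero)
  have d: "ksgn (lpar l * lpar l') (if k' = k \<and> l' = None then g else 0) = (if k' = k \<and> l' = None then g else 0)" for g :: "'v spoly"
    by simp
  show "dlam M k (coeff_op (lpar l) (nab l) (var k' l' f)) = coeff_op (lpar l) (nab l) (dlam M k (var k' l' f))"
    using f by (simp add: coeff_op_var dlam_var dlam_fin coeff_op_over additive_ksgn_commute[OF additive_dlam]
      additive.add[OF additive_coeff_op] ksgn_add c d del: if_split)
qed (auto simp: coeff_op_const additive.zero)

text \<open>The chain rule: with \<lambda>_2 = -\<lambda>_1 - T inserted, the derivative in the
  remaining variable is the difference of the two partial derivatives.\<close>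

lemma nn_dlam: "f \<in> over (vr N 2) \<Longrightarrow> nn 2 (dlam M 0 f - dlam M 1 f) = dlam M 0 (nn 2 f)"
proof (erule over_additive_eq)
  fix k l and f :: "'v spoly"
  assume k: "(k, l) \<in> vr N 2" "f \<in> over (vr N 2)" and IH: "nn 2 (dlam M 0 f - dlam M 1 f) = dlam M 0 (nn 2 f)"
  then have f: "f \<in> fin" by (simp add: over_fin)
  have J: "{j. Suc j < 2} = {0}" by auto
  have IH': "nn 2 (dlam M 0 f) = dlam M 0 (nn 2 f) + nn 2 (dlam M 1 f)"
    using IH by (simp add: additive.diff[OF additive_sub] algebra_simps)
  have "k = 0 \<or> k = 1" using k(1) by auto
  then show "nn 2 (dlam M 0 (var k l f) - dlam M 1 (var k l f)) = dlam M 0 (nn 2 (var k l f))"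
    using f IH' by (auto simp: J dlam_var sub_var dlam_fin sop_def additive.diff[OF additive_sub] additive.add[OF additive_sub]
      additive.diff[OF additive_dlam] additive.minus[OF additive_dlam] dlam_coeff_nab additive.add[OF additive_var] additive.add[OF additive_coeff_op])
qed auto

lemma lookup_dlam: "Poly_Mapping.lookup (dlam M k f) (A, J) = scl M (of_nat (Suc (count A k))) (Poly_Mapping.lookup f (add_mset k A, J))"
proof (rule additive_eq_on_singles[where f=f])
  fix m :: mono and w :: 'v
  obtain B I where m: "m = (B, I)" by (cases m)
  show "Poly_Mapping.lookup (dlam M k (Poly_Mapping.single m w)) (A, J) =
    scl M (of_nat (Suc (count A k))) (Poly_Mapping.lookup (Poly_Mapping.single m w) (add_mset k A, J))"
  proof (cases "k \<in># B")
    case True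
    then obtain B' where "B = add_mset k B'" by (meson multi_member_split)
    then show ?thesis by (auto simp: m dlam_single lookup_single when_def)
  next
    case False
    then have "count B k = 0" "B \<noteq> add_mset k A" by (auto simp: not_in_iff)
    then show ?thesis by (auto simp: m dlam_single lookup_single when_def)
  qed
qed (simp_all add: additive_def Poly_Mapping.lookup_add additive.add[OF additive_dlam] vs.scale_right_distrib)

text \<open>In characteristic 0 the derivative multiplies each coefficient of a monomial containing
  \<lambda> by a nonzero integer, so none of them is lost.\<close>

lemma dlam_eq_0_iff:
  assumes "f \<in> over (vr N 1)"
  shows "dlam M 0 f = 0 \<longleftrightarrow> f \<in> over (even_free N)"
proof
  assume d: "dlam M 0 f = 0"
  have "\<not> k \<in># A" if AJ: "(A, J) \<in> Poly_Mapping.keys f" for A J k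
  proof
    assume k: "k \<in># A"
    then have "k = 0" using over_keysD(2)[OF assms AJ] by auto
    then obtain B where B: "A = add_mset 0 B" using k by (meson multi_member_split)
    have "Poly_Mapping.lookup (dlam M 0 f) (B, J) = 0" using d by simp
    then have "Poly_Mapping.lookup f (A, J) = 0" unfolding lookup_dlam B[symmetric] 
      by (metis of_nat_eq_0_iff nat.distinct(1) vs.scale_eq_0_iff)
    then show False using AJ by (simp add: in_keys_iff)
  qed
  then show "f \<in> over (even_free N)"
    using over_keysD(1,3)[OF assms] unfolding over_def by (fastforce simp: even_free_def)
next
  assume "f \<in> over (even_free N)"
  then show "dlam M 0 f = 0"
    by (rule over_additive_eq[where G="\<lambda>_. 0"]) (auto simp: even_free_def dlam_var over_fin additive.zero[OF additive_tht])
qed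

text \<open>The superpolynomial X^Q_{\<Lambda>,-\<Lambda>-\<nabla>}(a \<otimes> b).\<close>

definition opval :: "'v operation \<Rightarrow> quiver \<Rightarrow> 'v \<Rightarrow> 'v \<Rightarrow> 'v spoly"
  where "opval X Q a b = nn 2 (rep (X Q [a, b]))"

lemma Suc_less_2: "{j. Suc j < 2} = {0}" by auto

lemma slot_op_2: "slot_op M p \<phi> 0 [a, b] = [\<phi> a, b]"
  "slot_op M p \<phi> (Suc 0) [a, b] = [if p = 0 then a else parity_aut M a, \<phi> b]"
  by (simp_all add: slot_op_def)

definition well_valued :: "'v operation \<Rightarrow> bool"
  where "well_valued X \<longleftrightarrow> (\<forall>Q\<in>quivers 2. \<forall>a b. X Q [a, b] \<in> cls N M 2 ` over (vr N 2))"

lemma well_valuedD: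
  assumes "well_valued X" "Q \<in> quivers 2"
  shows "rep (X Q [a, b]) \<in> over (vr N 2)" "X Q [a, b] = cls N M 2 (rep (X Q [a, b]))"
    "opval X Q a b \<in> over (vr N 1)"
proof -
  obtain f where f: "f \<in> over (vr N 2)" "X Q [a, b] = cls N M 2 f" using assms unfolding well_valued_def by blast
  then show r: "rep (X Q [a, b]) \<in> over (vr N 2)" by (simp add: rep_cls)
  show "X Q [a, b] = cls N M 2 (rep (X Q [a, b]))"
    using cls_eq_iff[of 2 "rep (X Q [a, b])" f] rep_cls(2)[of 2 f] r f by simp
  show "opval X Q a b \<in> over (vr N 1)" using nn_over[OF r] by (simp add: opval_def)
qed

lemma cls_opval:
  assumes "well_valued X" "Q \<in> quivers 2"
  shows "X Q [a, b] = cls N M 2 (opval X Q a b)"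
proof -
  have o: "opval X Q a b \<in> over (vr N 1)" by (rule well_valuedD[OF assms])
  then have "opval X Q a b \<in> over (vr N 2)" by (rule vr_mono[rotated]) simp
  moreover have "nn 2 (opval X Q a b) = opval X Q a b" using o by (intro nn_idem) simp
  ultimately have "cls N M 2 (rep (X Q [a, b])) = cls N M 2 (opval X Q a b)"
    using well_valuedD(1)[OF assms] by (subst cls_eq_iff) (auto simp: opval_def)
  then show ?thesis using well_valuedD(2)[OF assms] by simp
qed

lemma opval_eq_iff:
  assumes "well_valued X" "Q \<in> quivers 2" "f \<in> over (vr N 2)"
  shows "X Q [a, b] = cls N M 2 f \<longleftrightarrow> opval X Q a b = nn 2 f"
  using well_valuedD[OF assms(1,2), of a b] assms(3) cls_eq_iff[of 2 "rep (X Q [a, b])" f]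
  by (simp add: opval_def)

lemma over_1_2: "f \<in> over (vr N 1) \<Longrightarrow> f \<in> over (vr N 2)"
  by (rule vr_mono[of 1]) simp

lemma nn_2_id: "f \<in> over (vr N (Suc 0)) \<Longrightarrow> nn 2 f = f"
  by (rule nn_idem) simp

lemma cls_2_eq_0_iff: "f \<in> over (vr N 2) \<Longrightarrow> cls N M 2 f = cls N M 2 0 \<longleftrightarrow> nn 2 f = 0"
  by (subst cls_eq_iff) auto

lemma multilinear_iff:
  assumes W: "well_valued X" "Q \<in> quivers 2"
  shows "multilinear N M 2 (X Q) \<longleftrightarrow>
    (\<forall>a. additive (opval X Q a)) \<and> (\<forall>b. additive (\<lambda>a. opval X Q a b)) \<and>
    (\<forall>c a b. opval X Q (scl M c a) b = pscl (scl M) c (opval X Q a b) \<and> opval X Q a (scl M c b) = pscl (scl M) c (opval X Q a b))"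
proof -
  note r = well_valuedD(1)[OF W]
  have k: "k < 2 \<longleftrightarrow> k = 0 \<or> k = Suc 0" for k :: nat by auto
  have p: "X Q [a, b] = cls N M 2 (rep (X Q [c, d]) + rep (X Q [e, f])) \<longleftrightarrow> opval X Q a b = opval X Q c d + opval X Q e f"
    for a b c d e f by (simp add: opval_eq_iff W r over_add additive.add[OF additive_sub]) (simp add: opval_def)
  have s: "X Q [a, b] = cls N M 2 (pscl (scl M) c (rep (X Q [d, e]))) \<longleftrightarrow> opval X Q a b = pscl (scl M) c (opval X Q d e)"
    for a b c d e by (simp add: opval_eq_iff W r pscl_over pscl_sub over_fin[OF r]) (simp add: opval_def)
  have "multilinear N M 2 (X Q) \<longleftrightarrow> (\<forall>u v k a b c. (k = 0 \<or> k = Suc 0) \<longrightarrow>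
    X Q ([u, v][k := a + b]) = cls N M 2 (rep (X Q ([u, v][k := a])) + rep (X Q ([u, v][k := b]))) \<and>
    X Q ([u, v][k := scl M c a]) = cls N M 2 (pscl (scl M) c (rep (X Q ([u, v][k := a])))))"
  proof -
    have "multilinear N M 2 (X Q) \<longleftrightarrow> (\<forall>vs. length vs = 2 \<longrightarrow> (\<forall>k a b c. (k = 0 \<or> k = Suc 0) \<longrightarrow>
      X Q (vs[k := a + b]) = cls N M 2 (rep (X Q (vs[k := a])) + rep (X Q (vs[k := b]))) \<and>
      X Q (vs[k := scl M c a]) = cls N M 2 (pscl (scl M) c (rep (X Q (vs[k := a]))))))"
      unfolding multilinear_def k by blast
    then show ?thesis unfolding all_lists_2 by blast
  qed
  also have "\<dots> \<longleftrightarrow> (\<forall>v a b c.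
     opval X Q (a + b) v = opval X Q a v + opval X Q b v \<and> opval X Q (scl M c a) v = pscl (scl M) c (opval X Q a v)) \<and>
     (\<forall>u a b c.
     opval X Q u (a + b) = opval X Q u a + opval X Q u b \<and> opval X Q u (scl M c a) = pscl (scl M) c (opval X Q u a))"
    unfolding p[symmetric] s[symmetric] by (intro iffI allI impI conjI; (elim disjE)?; force)
  also have "\<dots> \<longleftrightarrow> (\<forall>a. additive (opval X Q a)) \<and> (\<forall>b. additive (\<lambda>a. opval X Q a b)) \<and>
    (\<forall>c a b. opval X Q (scl M c a) b = pscl (scl M) c (opval X Q a b) \<and> opval X Q a (scl M c b) = pscl (scl M) c (opval X Q a b))"
    unfolding additive_def by blast
  finally show ?thesis .
qed

lemma parity_iff:
  assumes W: "well_valued X" "Q \<in> quivers 2"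
  shows "(\<forall>vs ps. length vs = 2 \<and> length ps = 2 \<and> (\<forall>k<2. vs ! k \<in> hpart M (ps ! k)) \<longrightarrow>
      X Q vs \<in> cls N M 2 ` Vpoly_par N M 2 (1 + sum_list ps)) \<longleftrightarrow>
    (\<forall>p q. \<forall>a\<in>hpart M p. \<forall>b\<in>hpart M q. parp M (1 + p + q) (opval X Q a b))" (is "?L \<longleftrightarrow> ?R")
proof -
  have e: "X Q [a, b] \<in> cls N M 2 ` Vpoly_par N M 2 r \<longleftrightarrow> parp M r (opval X Q a b)" for a b r
  proof
    assume "X Q [a, b] \<in> cls N M 2 ` Vpoly_par N M 2 r"
    then obtain g where g: "g \<in> over (vr N 2)" "parp M r g" "X Q [a, b] = cls N M 2 g" by (auto simp: Vpoly_par_eq)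
    then have "opval X Q a b = nn 2 g" using opval_eq_iff[OF W g(1)] by simp
    then show "parp M r (opval X Q a b)" using g by (simp add: parp_sub over_fin)
  next
    assume "parp M r (opval X Q a b)"
    then show "X Q [a, b] \<in> cls N M 2 ` Vpoly_par N M 2 r"
      using cls_opval[OF W, of a b] over_1_2[OF well_valuedD(3)[OF W]] by (auto simp: Vpoly_par_eq)
  qed
  have "?L \<longleftrightarrow> (\<forall>a b p q. a \<in> hpart M p \<and> b \<in> hpart M q \<longrightarrow> X Q [a, b] \<in> cls N M 2 ` Vpoly_par N M 2 (1 + (p + q)))"
  proof -
    have "?L \<longleftrightarrow> (\<forall>vs. length vs = 2 \<longrightarrow> (\<forall>ps. length ps = 2 \<longrightarrow> (\<forall>k<2. vs ! k \<in> hpart M (ps ! k)) \<longrightarrow>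
      X Q vs \<in> cls N M 2 ` Vpoly_par N M 2 (1 + sum_list ps)))"
      by blast
    then show ?thesis unfolding all_lists_2 all_less_2 by simp
  qed
  also have "\<dots> \<longleftrightarrow> ?R" unfolding e by (auto simp: ac_simps)
  finally show ?thesis .
qed

lemma dlam_iff:
  assumes W: "well_valued X" "Q \<in> quivers 2"
  shows "(\<forall>k<2. \<forall>l\<in>component Q k. cls N M 2 (dlam M k (rep (X Q [a, b])) - dlam M l (rep (X Q [a, b]))) = cls N M 2 0) \<longleftrightarrow>
    (Q \<noteq> {#} \<longrightarrow> opval X Q a b \<in> over (even_free N))"
proof -
  let ?r = "rep (X Q [a, b])"
  note r = well_valuedD(1)[OF W, of a b]
  have d: "dlam M k ?r \<in> over (vr N 2)" for k by (rule dlam_fin[OF r])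
  have c: "cls N M 2 (dlam M k ?r - dlam M l ?r) = cls N M 2 0 \<longleftrightarrow> nn 2 (dlam M k ?r - dlam M l ?r) = 0" for k l
    by (rule cls_2_eq_0_iff) (intro over_diff d)
  have e: "nn 2 (dlam M 0 ?r - dlam M 1 ?r) = 0 \<longleftrightarrow> opval X Q a b \<in> over (even_free N)"
    using nn_dlam[OF r] dlam_eq_0_iff[OF well_valuedD(3)[OF W]] by (simp add: opval_def)
  have e': "nn 2 (dlam M 1 ?r - dlam M 0 ?r) = 0 \<longleftrightarrow> nn 2 (dlam M 0 ?r - dlam M 1 ?r) = 0"
    by (auto simp: additive.diff[OF additive_sub])
  show ?thesis
  proof (cases "Q = {#}")
    case False
    have "(\<forall>k<2. \<forall>l\<in>component Q k. nn 2 (dlam M k ?r - dlam M l ?r) = 0) \<longleftrightarrow>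
      (\<forall>k\<in>{0, 1}. \<forall>l\<in>{0, 1}. nn 2 (dlam M k ?r - dlam M l ?r) = 0)"
      using component_2[OF W(2) False] by (auto simp: numeral_2_eq_2 less_Suc_eq)
    also have "\<dots> \<longleftrightarrow> nn 2 (dlam M 0 ?r - dlam M 1 ?r) = 0" using e' by auto
    finally show ?thesis using False unfolding c e by simp
  qed simp
qed

text \<open>Without edges each vertex is a component, so the condition splits into one rule for each
  argument. Along an edge only the sum over both vertices is constrained; there \<lambda>_1 +
  \<lambda>_2 acts as -T, and a derivation rule results.\<close>

lemma T_iff:
  assumes W: "well_valued X" "Q \<in> quivers 2"
  shows "(\<forall>j<2. let I = component Q j in
          cls N M 2 (\<Sum>k\<in>I. rep (X Q (slot_op M 0 (opT M) k [a, b])))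
            = cls N M 2 (- (\<Sum>k\<in>I. lam k (rep (X Q [a, b]))))) \<longleftrightarrow>
    (if Q = {#} then opval X Q (nab None a) b = - lam 0 (opval X Q a b) \<and>
       opval X Q a (nab None b) = lam 0 (opval X Q a b) + coeff_op 0 (nab None) (opval X Q a b)
     else opval X Q (nab None a) b + opval X Q a (nab None b) = coeff_op 0 (nab None) (opval X Q a b))"
proof -
  note r = well_valuedD(1)[OF W]
  have T: "opT M = nab None" by (simp add: nab_def)
  have v: "var k None (rep (X Q [a, b])) \<in> over (vr N 2)" if "k < 2" for k by (rule over_var) (use that r in auto)
  have l0: "nn 2 (var 0 None (rep (X Q [a, b]))) = lam 0 (opval X Q a b)"
    and l1: "nn 2 (var 1 None (rep (X Q [a, b]))) = - lam 0 (opval X Q a b) - coeff_op 0 (nab None) (opval X Q a b)"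
    unfolding opval_def using over_fin[OF r] by (subst sub_var; simp add: sop_def Suc_less_2)+
  show ?thesis
  proof (cases "Q = {#}")
    case True
    have "cls N M 2 (rep (X Q c)) = cls N M 2 (- lam k (rep (X Q [a, b]))) \<longleftrightarrow> nn 2 (rep (X Q c)) = - nn 2 (var k None (rep (X Q [a, b])))"
      if "rep (X Q c) \<in> over (vr N 2)" "k < 2" for c k
      using that v[OF that(2)] by (subst cls_eq_iff) (auto simp: additive.minus[OF additive_sub])
    from this[of "[nab None a, b]" 0] this[of "[a, nab None b]" 1] True show ?thesis
      unfolding l0 l1 using r by (auto simp: numeral_2_eq_2 less_Suc_eq Let_def slot_op_2 T opval_def)
  next
    case False
    have "cls N M 2 (rep (X Q [nab None a, b]) + rep (X Q [a, nab None b])) =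
        cls N M 2 (- (var 0 None (rep (X Q [a, b])) + var 1 None (rep (X Q [a, b])))) \<longleftrightarrow>
      opval X Q (nab None a) b + opval X Q a (nab None b) = coeff_op 0 (nab None) (opval X Q a b)"
      using r v[of 0] v[of 1] l0 l1
      by (subst cls_eq_iff) (auto simp: additive.minus[OF additive_sub] additive.diff[OF additive_sub] additive.add[OF additive_sub] opval_def intro: over_add over_diff)
    then show ?thesis
      using False component_2[OF W(2) False] by (auto simp: numeral_2_eq_2 less_Suc_eq Let_def slot_op_2 T)
  qed
qed

lemma S_iff:
  assumes W: "well_valued X" "Q \<in> quivers 2"
  shows "(\<forall>k<2. \<forall>i<N. X Q (slot_op M 1 (opS M i) k [a, b])
            = cls N M 2 (- ksgn 1 (tht k i (rep (X Q [a, b]))))) \<longleftrightarrow>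
    (\<forall>i<N. opval X Q (nab (Some i) a) b = tht 0 i (opval X Q a b) \<and>
       opval X Q (parity_aut M a) (nab (Some i) b) = - tht 0 i (opval X Q a b) - coeff_op 1 (nab (Some i)) (opval X Q a b))"
proof -
  note r = well_valuedD(1)[OF W]
  have S: "opS M i = nab (Some i)" if "i < N" for i using that by (simp add: nab_def)
  have v: "var k (Some i) (rep (X Q [a, b])) \<in> over (vr N 2)" if "k < 2" "i < N" for k i by (rule over_var) (use that r in auto)
  have l: "nn 2 (var 0 (Some i) (rep (X Q [a, b]))) = tht 0 i (opval X Q a b)"
    "nn 2 (var 1 (Some i) (rep (X Q [a, b]))) = - tht 0 i (opval X Q a b) - coeff_op 1 (nab (Some i)) (opval X Q a b)" for i
    unfolding opval_def using over_fin[OF r] by (subst sub_var; simp add: sop_def Suc_less_2)+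
  have c: "X Q [c, d] = cls N M 2 (tht k i (rep (X Q [a, b]))) \<longleftrightarrow> opval X Q c d = nn 2 (var k (Some i) (rep (X Q [a, b])))"
    if "k < 2" "i < N" for c d k i
    using opval_eq_iff[OF W v[OF that], of c d] by simp
  have "(\<forall>k<2. \<forall>i<N. X Q (slot_op M 1 (opS M i) k [a, b]) = cls N M 2 (- ksgn 1 (tht k i (rep (X Q [a, b]))))) \<longleftrightarrow>
    (\<forall>i<N. X Q [nab (Some i) a, b] = cls N M 2 (tht 0 i (rep (X Q [a, b]))) \<and>
      X Q [parity_aut M a, nab (Some i) b] = cls N M 2 (tht 1 i (rep (X Q [a, b]))))"
    by (auto simp: numeral_2_eq_2 less_Suc_eq slot_op_2 S)
  also have "\<dots> \<longleftrightarrow> (\<forall>i<N. opval X Q (nab (Some i) a) b = tht 0 i (opval X Q a b) \<and>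
       opval X Q (parity_aut M a) (nab (Some i) b) = - tht 0 i (opval X Q a b) - coeff_op 1 (nab (Some i)) (opval X Q a b))"
  proof (intro all_cong1 imp_cong refl)
    fix i assume i: "i < N"
    show "(X Q [nab (Some i) a, b] = cls N M 2 (tht 0 i (rep (X Q [a, b]))) \<and>
      X Q [parity_aut M a, nab (Some i) b] = cls N M 2 (tht 1 i (rep (X Q [a, b])))) \<longleftrightarrow>
      opval X Q (nab (Some i) a) b = tht 0 i (opval X Q a b) \<and>
       opval X Q (parity_aut M a) (nab (Some i) b) = - tht 0 i (opval X Q a b) - coeff_op 1 (nab (Some i)) (opval X Q a b)"
      unfolding One_nat_def c[OF _ i, of 0, simplified] c[OF _ i, of 1, simplified] using l[of i] by simp
  qed
  finally show ?thesis .
qed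

text \<open>The axioms of an odd binary operation that are the same on all quivers, in normal form.
  The rules for the two arguments look different because the second supervariable has been
  eliminated; \<open>parity_aut\<close> is the Koszul sign of S^i passing the first
  argument.\<close>

definition bil :: "('v \<Rightarrow> 'v \<Rightarrow> 'v spoly) \<Rightarrow> bool"
  where "bil F \<longleftrightarrow> (\<forall>a. additive (F a)) \<and> (\<forall>b. additive (\<lambda>a. F a b)) \<and>
    (\<forall>c a b. F (scl M c a) b = pscl (scl M) c (F a b) \<and> F a (scl M c b) = pscl (scl M) c (F a b)) \<and>
    (\<forall>a b. F a b \<in> over (vr N 1)) \<and>
    (\<forall>p q. \<forall>a\<in>hpart M p. \<forall>b\<in>hpart M q. parp M (1 + p + q) (F a b)) \<and>
    (\<forall>i<N. \<forall>a b. F (nab (Some i) a) b = tht 0 i (F a b) \<and>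
       F (parity_aut M a) (nab (Some i) b) = - tht 0 i (F a b) - coeff_op 1 (nab (Some i)) (F a b))"

definition skew :: "bit \<Rightarrow> ('v \<Rightarrow> 'v \<Rightarrow> 'v spoly) \<Rightarrow> bool"
  where "skew s F \<longleftrightarrow> (\<forall>p q. \<forall>a\<in>hpart M p. \<forall>b\<in>hpart M q. F b a = ksgn (p * q + s) (flip 0 (F a b)))"

definition coisson_pair :: "('v \<Rightarrow> 'v \<Rightarrow> 'v spoly) \<Rightarrow> ('v \<Rightarrow> 'v \<Rightarrow> 'v spoly) \<Rightarrow> bool"
  where "coisson_pair \<beta> y \<longleftrightarrow> bil \<beta> \<and> bil y \<and> skew 0 \<beta> \<and> skew 1 y \<and>
    (\<forall>a b. \<beta> (nab None a) b = - lam 0 (\<beta> a b) \<and> \<beta> a (nab None b) = lam 0 (\<beta> a b) + coeff_op 0 (nab None) (\<beta> a b)) \<and>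
    (\<forall>a b. y a b \<in> over (even_free N)) \<and>
    (\<forall>a b. y (nab None a) b + y a (nab None b) = coeff_op 0 (nab None) (y a b))"

definition pval :: "('v \<Rightarrow> 'v \<Rightarrow> 'v spoly) \<Rightarrow> ('v \<Rightarrow> 'v \<Rightarrow> 'v spoly) \<Rightarrow> quiver \<Rightarrow> 'v \<Rightarrow> 'v \<Rightarrow> 'v spoly"
  where "pval \<beta> y Q a b = (if Q = {#} then \<beta> a b else if Q = {#(0, 1)#} then y a b
    else if Q = {#(1, 0)#} then - y a b else 0)"

definition pair_op :: "('v \<Rightarrow> 'v \<Rightarrow> 'v spoly) \<Rightarrow> ('v \<Rightarrow> 'v \<Rightarrow> 'v spoly) \<Rightarrow> 'v operation"
  where "pair_op \<beta> y Q vs = (if Q \<in> quivers 2 \<and> length vs = 2 then cls N M 2 (pval \<beta> y Q (vs ! 0) (vs ! 1)) else {})"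

definition sym_op :: "'v operation \<Rightarrow> bool"
  where "sym_op X \<longleftrightarrow> X \<in> operations N M 2 1 \<and> (\<forall>\<sigma>. \<sigma> permutes {..<2} \<longrightarrow> perm_act N M 2 X \<sigma> = X)"

definition qswap :: "quiver \<Rightarrow> quiver"
  where "qswap Q = image_mset (map_prod (transpose 0 1) (transpose 0 1)) Q"

lemma qswap_simps [simp]: "qswap {#} = {#}" "qswap {#(0, Suc 0)#} = {#(Suc 0, 0)#}" "qswap {#(Suc 0, 0)#} = {#(0, Suc 0)#}"
  "size (qswap Q) = size Q"
  by (simp_all add: qswap_def)

lemma qswap_quivers: "Q \<in> quivers 2 \<Longrightarrow> qswap Q \<in> quivers 2"
proof -
  assume Q: "Q \<in> quivers 2"
  have "s < 2 \<and> t < 2 \<and> s \<noteq> t" if st: "(s, t) \<in># qswap Q" for s t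
  proof -
    obtain e where e: "e \<in># Q" "(s, t) = map_prod (transpose 0 1) (transpose 0 1) e" using st unfolding qswap_def by auto
    then show ?thesis using quivers_2_edge[OF Q e(1)] by auto
  qed
  then show "qswap Q \<in> quivers 2" unfolding quivers_def by blast
qed

lemma size_2_pval: "2 \<le> size Q \<Longrightarrow> pval \<beta> y Q a b = 0"
  by (auto simp: pval_def)

text \<open>The logical rearrangements needed in \<open>operations_iff\<close>, stated for opaque
  predicates so that the unfolded axioms do not enter the search.\<close>

lemma ball_regroup:
  "A \<Longrightarrow> \<forall>Q\<in>S. B Q \<Longrightarrow> (A \<and> (\<forall>Q\<in>S. B Q \<and> C Q)) = (\<forall>Q\<in>S. C Q)"
  "(\<forall>Q\<in>S. m Q \<and> p Q \<and> (\<forall>a b. f Q a b \<and> c Q a b \<and> R Q a b)) \<longleftrightarrow>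
    (\<forall>Q\<in>S. m Q \<and> p Q \<and> (\<forall>a b. R Q a b)) \<and> (\<forall>Q\<in>S. \<forall>a b. f Q a b \<and> c Q a b)"
  "\<forall>Q\<in>S. \<forall>a b. w Q a b \<Longrightarrow>
    ((\<forall>Q\<in>S. (m1 Q \<and> m2 Q \<and> m3 Q) \<and> p Q \<and> (\<forall>a b. e Q a b \<and> t Q a b \<and> (\<forall>i<n. s Q i a b))) \<and> (\<forall>Q\<in>S. \<forall>a b. v Q a b)) \<longleftrightarrow>
    (\<forall>Q\<in>S. (m1 Q \<and> m2 Q \<and> m3 Q \<and> (\<forall>a b. w Q a b) \<and> p Q \<and> (\<forall>i<n. \<forall>a b. s Q i a b)) \<and>
      (\<forall>a b. v Q a b) \<and> (\<forall>a b. t Q a b) \<and> (\<forall>a b. e Q a b))"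
  for n :: nat
  by blast+

lemma operations_iff:
  assumes W: "well_valued X" and X0: "\<forall>Q vs. Q \<notin> quivers 2 \<or> length vs \<noteq> 2 \<longrightarrow> X Q vs = {}"
  shows "X \<in> operations N M 2 1 \<longleftrightarrow> (\<forall>Q\<in>quivers 2. bil (opval X Q) \<and>
    (\<forall>a b. opval X Q a b = pval (opval X {#}) (opval X {#(0, 1)#}) Q a b) \<and>
    (\<forall>a b. if Q = {#} then opval X Q (nab None a) b = - lam 0 (opval X Q a b) \<and>
       opval X Q a (nab None b) = lam 0 (opval X Q a b) + coeff_op 0 (nab None) (opval X Q a b)
     else opval X Q (nab None a) b + opval X Q a (nab None b) = coeff_op 0 (nab None) (opval X Q a b)) \<and>
    (\<forall>a b. Q \<noteq> {#} \<longrightarrow> opval X Q a b \<in> over (even_free N)))"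
proof -
  have cyc: "(\<forall>Q\<in>quivers 2. (\<forall>a b. (\<not> forest Q \<longrightarrow> X Q [a, b] = cls N M 2 0) \<and>
      (\<forall>es. directed_cycle Q es \<longrightarrow> cls N M 2 (\<Sum>q<length es. rep (X (Q - {#es ! q#}) [a, b])) = cls N M 2 0))) \<longleftrightarrow>
    (\<forall>Q\<in>quivers 2. (\<forall>a b. opval X Q a b = pval (opval X {#}) (opval X {#(0, 1)#}) Q a b))" (is "?L \<longleftrightarrow> ?R")
  proof
    assume L: ?L
    have f: "opval X Q a b = 0" if "Q \<in> quivers 2" "2 \<le> size Q" for Q a b
      using L that not_forest_2[OF that] opval_eq_iff[OF W that(1), of 0] by auto
    \<comment> \<open>Deleting either edge of the 2-cycle leaves the other one, so the cycle
      relation forces opposite values on the two orientations of an edge.\<close>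
    have dc: "directed_cycle {#(0, 1), (1, 0)#} [(0, 1), (1, 0)]" "{#(0, 1), (1, 0)#} \<in> quivers 2"
      by (auto simp: directed_cycle_def quivers_def less_Suc_eq numeral_2_eq_2)
    have c: "cls N M 2 (rep (X {#(1, 0)#} [a, b]) + rep (X {#(0, 1)#} [a, b])) = cls N M 2 0" for a b
      using L[THEN bspec, OF dc(2), THEN spec[of _ a], THEN spec[of _ b], THEN conjunct2, THEN spec, THEN mp, OF dc(1)]
      by (simp add: numeral_2_eq_2)
    have "opval X {#(1, 0)#} a b + opval X {#(0, 1)#} a b = 0" for a b
      using c[of a b] well_valuedD(1)[OF W]
      by (subst (asm) cls_2_eq_0_iff) (auto simp: additive.add[OF additive_sub] opval_def intro: over_add)
    then have g: "opval X {#(1, 0)#} a b = - opval X {#(0, 1)#} a b" for a b by (metis add_eq_0_iff2)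
    show ?R
    proof (intro ballI allI)
      fix Q a b assume Q: "Q \<in> quivers 2"
      show "opval X Q a b = pval (opval X {#}) (opval X {#(0, 1)#}) Q a b"
        by (cases rule: quivers_2_cases[OF Q]) (use f[OF Q] g[of a b] in \<open>auto simp: pval_def\<close>)
    qed
  next
    assume R: ?R
    have z: "opval X Q a b = 0" if "Q \<in> quivers 2" "2 \<le> size Q" for Q a b
      by (rule trans[OF R[THEN bspec, OF that(1), THEN spec, THEN spec] size_2_pval[OF that(2)]])
    show ?L
    proof (intro ballI allI conjI impI)
      fix Q a b assume Q: "Q \<in> quivers 2" "\<not> forest Q"
      then have "opval X Q a b = 0" by (intro z) (auto simp: forest_2_iff)
      then show "X Q [a, b] = cls N M 2 0" using opval_eq_iff[OF W Q(1), of 0] by simp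
    next
      fix Q a b es assume Q: "Q \<in> quivers 2" "directed_cycle Q es"
      have e: "es = [(0, 1), (1, 0)] \<or> es = [(1, 0), (0, 1)]" by (rule directed_cycle_2[OF Q])
      have "mset es \<subseteq># Q" using Q(2) by (simp add: directed_cycle_def)
      then have sub: "{#(0, 1), (1, 0)#} \<subseteq># Q" using e by (auto simp: add_mset_commute)
      then obtain Q' where Q': "Q = {#(0, 1), (1, 0)#} + Q'" by (metis mset_subset_eq_exists_conv)
      have q: "Q - {#(0, 1)#} \<in> quivers 2" "Q - {#(1, 0)#} \<in> quivers 2"
        using Q(1) by (auto simp: quivers_def dest: in_diffD)
      have s: "opval X (Q - {#(0, 1)#}) a b + opval X (Q - {#(1, 0)#}) a b = 0"
      proof (cases "Q' = {#}")
        case True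
        then have "Q - {#(0, 1)#} = {#(1, 0)#}" "Q - {#(1, 0)#} = {#(0, 1)#}" using Q' by simp_all
        moreover have "opval X {#(1, 0)#} a b = - opval X {#(0, 1)#} a b"
          using R[THEN bspec, of "{#(1, 0)#}", THEN spec[of _ a], THEN spec[of _ b]] by (simp add: pval_def)
        ultimately show ?thesis by simp
      next
        case False
        \<comment> \<open>A further edge besides the 2-cycle leaves at least two edges after each
          deletion, so both terms vanish separately.\<close>
        then have "size Q' \<ge> 1" by (simp add: Suc_leI nonempty_has_size)
        then have "2 \<le> size (Q - {#(0, 1)#})" "2 \<le> size (Q - {#(1, 0)#})" using Q' by simp_all
        then show ?thesis using z q by simp
      qed
      show "cls N M 2 (\<Sum>q<length es. rep (X (Q - {#es ! q#}) [a, b])) = cls N M 2 0"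
        using e s[unfolded opval_def] well_valuedD(1)[OF W q(1), of a b] well_valuedD(1)[OF W q(2), of a b]
        by (subst cls_2_eq_0_iff) (auto simp: additive.add[OF additive_sub] numeral_2_eq_2 add.commute intro: over_add)
    qed
  qed
  have h2: "\<forall>Q\<in>quivers 2. \<forall>a b. X Q [a, b] \<in> cls N M 2 ` Vpoly N 2"
    using W unfolding well_valued_def Vpoly_eq .
  have h3: "\<forall>Q\<in>quivers 2. \<forall>a b. opval X Q a b \<in> over (vr N 1)" using well_valuedD(3)[OF W] by blast
  have "X \<in> operations N M 2 1 \<longleftrightarrow> (\<forall>Q\<in>quivers 2. multilinear N M 2 (X Q) \<and>
      (\<forall>vs ps. length vs = 2 \<and> length ps = 2 \<and> (\<forall>k<2. vs ! k \<in> hpart M (ps ! k)) \<longrightarrow>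
        X Q vs \<in> cls N M 2 ` Vpoly_par N M 2 (1 + sum_list ps)) \<and>
      (\<forall>a b. (\<not> forest Q \<longrightarrow> X Q [a, b] = cls N M 2 0) \<and>
        (\<forall>es. directed_cycle Q es \<longrightarrow> cls N M 2 (\<Sum>q<length es. rep (X (Q - {#es ! q#}) [a, b])) = cls N M 2 0) \<and>
        (\<forall>k<2. \<forall>l\<in>component Q k. cls N M 2 (dlam M k (rep (X Q [a, b])) - dlam M l (rep (X Q [a, b]))) = cls N M 2 0) \<and>
        (\<forall>j<2. let I = component Q j in
          cls N M 2 (\<Sum>k\<in>I. rep (X Q (slot_op M 0 (opT M) k [a, b])))
            = cls N M 2 (- (\<Sum>k\<in>I. lam k (rep (X Q [a, b]))))) \<and>
        (\<forall>k<2. \<forall>i<N. X Q (slot_op M 1 (opS M i) k [a, b])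
            = cls N M 2 (- ksgn 1 (tht k i (rep (X Q [a, b])))))))"
    unfolding operations_def mem_Collect_eq all_lists_2 by (rule ball_regroup(1)[OF X0 h2])
  also have "\<dots> \<longleftrightarrow> (\<forall>Q\<in>quivers 2. multilinear N M 2 (X Q) \<and>
      (\<forall>vs ps. length vs = 2 \<and> length ps = 2 \<and> (\<forall>k<2. vs ! k \<in> hpart M (ps ! k)) \<longrightarrow>
        X Q vs \<in> cls N M 2 ` Vpoly_par N M 2 (1 + sum_list ps)) \<and>
      (\<forall>a b. (\<forall>k<2. \<forall>l\<in>component Q k. cls N M 2 (dlam M k (rep (X Q [a, b])) - dlam M l (rep (X Q [a, b]))) = cls N M 2 0) \<and>
        (\<forall>j<2. let I = component Q j in
          cls N M 2 (\<Sum>k\<in>I. rep (X Q (slot_op M 0 (opT M) k [a, b])))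
            = cls N M 2 (- (\<Sum>k\<in>I. lam k (rep (X Q [a, b]))))) \<and>
        (\<forall>k<2. \<forall>i<N. X Q (slot_op M 1 (opS M i) k [a, b])
            = cls N M 2 (- ksgn 1 (tht k i (rep (X Q [a, b]))))))) \<and>
      (\<forall>Q\<in>quivers 2. (\<forall>a b. opval X Q a b = pval (opval X {#}) (opval X {#(0, 1)#}) Q a b))"
    unfolding cyc[symmetric] by (rule ball_regroup(2))
  also have "\<dots> \<longleftrightarrow> (\<forall>Q\<in>quivers 2. ((\<forall>a. additive (opval X Q a)) \<and> (\<forall>b. additive (\<lambda>a. opval X Q a b)) \<and>
    (\<forall>c a b. opval X Q (scl M c a) b = pscl (scl M) c (opval X Q a b) \<and> opval X Q a (scl M c b) = pscl (scl M) c (opval X Q a b))) \<and>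
    (\<forall>p q. \<forall>a\<in>hpart M p. \<forall>b\<in>hpart M q. parp M (1 + p + q) (opval X Q a b)) \<and>
    (\<forall>a b. (Q \<noteq> {#} \<longrightarrow> opval X Q a b \<in> over (even_free N)) \<and>
     (if Q = {#} then opval X Q (nab None a) b = - lam 0 (opval X Q a b) \<and>
       opval X Q a (nab None b) = lam 0 (opval X Q a b) + coeff_op 0 (nab None) (opval X Q a b)
     else opval X Q (nab None a) b + opval X Q a (nab None b) = coeff_op 0 (nab None) (opval X Q a b)) \<and>
    (\<forall>i<N. opval X Q (nab (Some i) a) b = tht 0 i (opval X Q a b) \<and>
       opval X Q (parity_aut M a) (nab (Some i) b) = - tht 0 i (opval X Q a b) - coeff_op 1 (nab (Some i)) (opval X Q a b)))) \<and>
      (\<forall>Q\<in>quivers 2. (\<forall>a b. opval X Q a b = pval (opval X {#}) (opval X {#(0, 1)#}) Q a b))"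
    by (rule arg_cong2[where f="(\<and>)", OF ball_cong[OF refl] refl], intro arg_cong2[where f="(\<and>)"] all_cong1
      multilinear_iff[OF W] parity_iff[OF W] dlam_iff[OF W] T_iff[OF W] S_iff[OF W])
  also have "\<dots> \<longleftrightarrow> (\<forall>Q\<in>quivers 2. bil (opval X Q) \<and>
    (\<forall>a b. opval X Q a b = pval (opval X {#}) (opval X {#(0, 1)#}) Q a b) \<and>
    (\<forall>a b. if Q = {#} then opval X Q (nab None a) b = - lam 0 (opval X Q a b) \<and>
       opval X Q a (nab None b) = lam 0 (opval X Q a b) + coeff_op 0 (nab None) (opval X Q a b)
     else opval X Q (nab None a) b + opval X Q a (nab None b) = coeff_op 0 (nab None) (opval X Q a b)) \<and>
    (\<forall>a b. Q \<noteq> {#} \<longrightarrow> opval X Q a b \<in> over (even_free N)))"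
    unfolding bil_def by (rule ball_regroup(3)[OF h3])
  finally show ?thesis .
qed

end

section \<open>The action of the symmetric group on binary operations\<close>

lemma by_parity_cong:
  assumes "\<And>ps us. length ps = length vs \<Longrightarrow> length us = length vs \<Longrightarrow> f ps us = g ps us"
  shows "by_parity M f vs = by_parity M g vs"
  unfolding by_parity_def by (rule sum.cong) (auto intro: assms)

lemma permutes_2: "\<sigma> permutes {..<2::nat} \<Longrightarrow> \<sigma> = id \<or> \<sigma> = transpose 0 1"
proof -
  assume s: "\<sigma> permutes {..<2}"
  have "\<sigma> 0 < 2" "\<sigma> 1 < 2" using permutes_in_image[OF s, of 0] permutes_in_image[OF s, of 1] by auto
  moreover have "\<sigma> 0 \<noteq> \<sigma> 1" using permutes_inj[OF s] by (metis injD zero_neq_one)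
  ultimately consider "\<sigma> 0 = 0" "\<sigma> 1 = 1" | "\<sigma> 0 = 1" "\<sigma> 1 = 0" by linarith
  moreover have o: "\<sigma> k = k" if "k \<noteq> 0" "k \<noteq> 1" for k
    using s that by (auto simp: permutes_def)
  ultimately show ?thesis
  proof cases
    case 1
    have "\<sigma> k = id k" for k using 1 o[of k] by (cases "k = 0"; cases "k = 1") auto
    then show ?thesis by blast
  next
    case 2
    have "\<sigma> k = transpose 0 1 k" for k using 2 o[of k] by (cases "k = 0"; cases "k = 1") auto
    then show ?thesis by blast
  qed
qed

lemma perm_sign_id: "perm_sign n id ps = 0"
  unfolding perm_sign_def by (rule sum.neutral) auto

lemma perm_sign_swap: "perm_sign 2 (transpose 0 1) [p, q] = p * q"
proof -
  have "{(k, l). k < l \<and> l < 2 \<and> transpose 0 1 k > transpose 0 (1::nat) l} = {(0, 1)}"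
    by (auto simp: numeral_2_eq_2 less_Suc_eq)
  then show ?thesis unfolding perm_sign_def by simp
qed

context hwmodule
begin

lemma by_parity_additive_2:
  assumes "\<And>a. additive (F a)" "\<And>b. additive (\<lambda>a. F a b)"
  shows "by_parity M (\<lambda>ps us. F (us ! 0) (us ! 1)) [a, b] = F a b"
proof -
  have F2: "F c b = (\<Sum>q\<in>UNIV. F c (proj M q b))" for c
    using additive.sum[OF assms(1)[of c], of "\<lambda>q. proj M q b" UNIV] by (simp add: proj_sum)
  have "F a b = (\<Sum>p\<in>UNIV. F (proj M p a) b)"
    using additive.sum[OF assms(2), of "\<lambda>p. proj M p a" UNIV] by (simp add: proj_sum)
  also have "\<dots> = (\<Sum>p\<in>UNIV. \<Sum>q\<in>UNIV. F (proj M p a) (proj M q b))"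
    by (rule sum.cong[OF refl F2])
  finally show ?thesis by simp
qed

text \<open>The exchange sends \<Lambda>_1 to \<Lambda>_2, which the normal form replaces by
  -\<Lambda>_1 - \<nabla>.\<close>

lemma nn_vsub_swap: "f \<in> over (vr N 1) \<Longrightarrow> nn 2 (vsub (\<lambda>k. {transpose 0 1 k}) f) = flip 0 f"
proof (erule over_additive_eq)
  fix k l and f :: "'v spoly"
  assume k: "(k, l) \<in> vr N 1" "f \<in> over (vr N 1)" "nn 2 (vsub (\<lambda>k. {transpose 0 1 k}) f) = flip 0 f"
  then have k0: "k = 0" and f: "f \<in> fin" by (auto simp: over_fin)
  show "nn 2 (vsub (\<lambda>k. {transpose 0 1 k}) (var k l f)) = flip 0 (var k l f)"
    using f k(3) by (simp add: k0 vsub_var sub_var sop_def Suc_less_2)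
qed auto

lemma swap_partition: "(\<Union>k<2. {transpose 0 (1::nat) k}) = {..<2}" "disjoint_family_on (\<lambda>k. {transpose 0 (1::nat) k}) {..<2}"
  by (auto simp: disjoint_family_on_def numeral_2_eq_2 less_Suc_eq lessThan_Suc)

lemma perm_act_swap:
  assumes W: "well_valued X" "Q \<in> quivers 2"
  obtains G where "G \<in> over (vr N 2)" "perm_act N M 2 X (transpose 0 1) Q [a, b] = cls N M 2 G"
    "nn 2 G = by_parity M (\<lambda>ps us. ksgn (ps ! 0 * ps ! 1) (flip 0 (opval X (qswap Q) (us ! 1) (us ! 0)))) [a, b]"
proof
  let ?\<tau> = "transpose 0 (1::nat)"
  let ?f = "\<lambda>ps us. ksgn (perm_sign 2 ?\<tau> ps) (vsub (\<lambda>k. {?\<tau> k}) (rep (X (qswap Q) [us ! 1, us ! 0])))"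
  let ?G = "by_parity M ?f [a, b]"
  have Q': "qswap Q \<in> quivers 2" by (rule qswap_quivers[OF W(2)])
  have r: "rep (X (qswap Q) [c, d]) \<in> over (vr N 2)" for c d by (rule well_valuedD(1)[OF W(1) Q'])
  have "vsub (\<lambda>k. {?\<tau> k}) (rep (X (qswap Q) [c, d])) \<in> over (vr N 2)" for c d
    by (rule vsub_over[OF r]) (auto simp: transpose_def)
  then show "?G \<in> over (vr N 2)" by (auto intro!: over_sum)
  show "perm_act N M 2 X ?\<tau> Q [a, b] = cls N M 2 ?G"
    using W(2) by (simp add: perm_act_def qswap_def numeral_2_eq_2)
  have "nn 2 ?G = by_parity M (\<lambda>ps us. nn 2 (?f ps us)) [a, b]"
    by (rule additive_by_parity) simp
  also have "\<dots> = by_parity M (\<lambda>ps us. ksgn (ps ! 0 * ps ! 1) (flip 0 (opval X (qswap Q) (us ! 1) (us ! 0)))) [a, b]"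
  proof (rule by_parity_cong)
    fix ps :: "bit list" and us :: "'v list" assume "length ps = length [a, b]"
    then obtain p q where ps: "ps = [p, q]" by (auto simp: length_Suc_conv)
    have "nn 2 (vsub (\<lambda>k. {?\<tau> k}) (rep (X (qswap Q) [c, d]))) = flip 0 (opval X (qswap Q) c d)" for c d
      using nn_vsub[OF r, of 2 "\<lambda>k. {?\<tau> k}" c d] swap_partition nn_vsub_swap[OF well_valuedD(3)[OF W(1) Q']]
      by (simp add: opval_def)
    then show "nn 2 (?f ps us) = ksgn (ps ! 0 * ps ! 1) (flip 0 (opval X (qswap Q) (us ! 1) (us ! 0)))"
      unfolding ps perm_sign_swap by (simp add: additive_ksgn_commute[OF additive_sub])
  qed
  finally show "nn 2 ?G = by_parity M (\<lambda>ps us. ksgn (ps ! 0 * ps ! 1) (flip 0 (opval X (qswap Q) (us ! 1) (us ! 0)))) [a, b]" .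
qed

lemma bilD:
  assumes "bil F"
  shows "additive (F a)" "additive (\<lambda>a. F a b)" "F (scl M c a) b = pscl (scl M) c (F a b)" "F a (scl M c b) = pscl (scl M) c (F a b)"
    "F a b \<in> over (vr N 1)" "a \<in> hpart M p \<Longrightarrow> b \<in> hpart M q \<Longrightarrow> parp M (1 + p + q) (F a b)"
    "i < N \<Longrightarrow> F (nab (Some i) a) b = tht 0 i (F a b)"
    "i < N \<Longrightarrow> F (parity_aut M a) (nab (Some i) b) = - tht 0 i (F a b) - coeff_op 1 (nab (Some i)) (F a b)"
  using assms unfolding bil_def by blast+

lemma perm_act_id:
  assumes W: "well_valued X" "Q \<in> quivers 2" and b: "bil (opval X Q)"
  shows "perm_act N M 2 X id Q [a, b] = X Q [a, b]"
proof -
  note r = well_valuedD(1)[OF W]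
  let ?f = "\<lambda>ps us. rep (X Q [us ! 0, us ! 1])"
  have "vsub (\<lambda>k. {k}) (rep (X Q [c, d])) = rep (X Q [c, d])" for c d by (rule vsub_id[OF r]) simp
  moreover have "image_mset (map_prod id id) Q = Q" by (induction Q) auto
  ultimately have "perm_act N M 2 X id Q [a, b] = cls N M 2 (by_parity M ?f [a, b])"
    using W(2) by (simp add: perm_act_def perm_sign_id numeral_2_eq_2)
  moreover have "by_parity M ?f [a, b] \<in> over (vr N 2)" by (auto intro!: over_sum r)
  moreover have "nn 2 (by_parity M ?f [a, b]) = by_parity M (\<lambda>ps us. opval X Q (us ! 0) (us ! 1)) [a, b]"
    unfolding opval_def by (rule additive_by_parity) simp
  moreover have "\<dots> = opval X Q a b"
    by (rule by_parity_additive_2) (rule bilD[OF b])+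
  ultimately show ?thesis using opval_eq_iff[OF W, of "by_parity M ?f [a, b]" a b] by simp
qed

lemma perm_act_eq_iff:
  assumes W: "well_valued X" and X0: "\<forall>Q vs. Q \<notin> quivers 2 \<or> length vs \<noteq> 2 \<longrightarrow> X Q vs = {}"
    and bb: "\<forall>Q\<in>quivers 2. bil (opval X Q)"
  shows "(\<forall>\<sigma>. \<sigma> permutes {..<2} \<longrightarrow> perm_act N M 2 X \<sigma> = X) \<longleftrightarrow>
    (\<forall>Q\<in>quivers 2. \<forall>p q. \<forall>a\<in>hpart M p. \<forall>b\<in>hpart M q. opval X Q a b = ksgn (p * q) (flip 0 (opval X (qswap Q) b a)))"
    (is "?L \<longleftrightarrow> ?R")
proof -
  have b: "bil (opval X Q)" if "Q \<in> quivers 2" for Q using bb that by blast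
  have ext: "perm_act N M 2 X \<sigma> = X \<longleftrightarrow> (\<forall>Q\<in>quivers 2. \<forall>a b. perm_act N M 2 X \<sigma> Q [a, b] = X Q [a, b])" for \<sigma>
  proof
    assume h: "\<forall>Q\<in>quivers 2. \<forall>a b. perm_act N M 2 X \<sigma> Q [a, b] = X Q [a, b]"
    show "perm_act N M 2 X \<sigma> = X"
    proof (intro ext)
      fix Q vs
      show "perm_act N M 2 X \<sigma> Q vs = X Q vs"
      proof (cases "Q \<in> quivers 2 \<and> length vs = 2")
        case True
        then obtain a b where "vs = [a, b]" by (auto simp: length_Suc_conv numeral_2_eq_2)
        then show ?thesis using h True by blast
      next
        case False
        then have "X Q vs = {}" using X0 by blast
        then show ?thesis using False unfolding perm_act_def by (simp only: if_False)
      qed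
    qed
  qed simp
  have sw: "perm_act N M 2 X (transpose 0 1) Q [a, b] = X Q [a, b] \<longleftrightarrow>
    opval X Q a b = by_parity M (\<lambda>ps us. ksgn (ps ! 0 * ps ! 1) (flip 0 (opval X (qswap Q) (us ! 1) (us ! 0)))) [a, b]"
    if Q: "Q \<in> quivers 2" for Q a b
  proof -
    obtain G where G: "G \<in> over (vr N 2)" "perm_act N M 2 X (transpose 0 1) Q [a, b] = cls N M 2 G"
      "nn 2 G = by_parity M (\<lambda>ps us. ksgn (ps ! 0 * ps ! 1) (flip 0 (opval X (qswap Q) (us ! 1) (us ! 0)))) [a, b]"
      by (rule perm_act_swap[OF W Q])
    have "perm_act N M 2 X (transpose 0 1) Q [a, b] = X Q [a, b] \<longleftrightarrow> X Q [a, b] = cls N M 2 G"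
      unfolding G(2) by (rule eq_commute)
    also have "\<dots> \<longleftrightarrow> opval X Q a b = nn 2 G" by (rule opval_eq_iff[OF W Q G(1)])
    finally show ?thesis unfolding G(3) .
  qed
  have "?L \<longleftrightarrow> perm_act N M 2 X (transpose 0 1) = X"
  proof
    have "transpose 0 1 permutes {..<2::nat}" by (rule permutes_swap_id) auto
    then show "?L \<Longrightarrow> perm_act N M 2 X (transpose 0 1) = X" by blast
    have "perm_act N M 2 X id = X" unfolding ext using perm_act_id[OF W _ b] by blast
    then show "perm_act N M 2 X (transpose 0 1) = X \<Longrightarrow> ?L" using permutes_2 by metis
  qed
  also have "\<dots> \<longleftrightarrow> ?R"
  proof
    assume h: "perm_act N M 2 X (transpose 0 1) = X"
    show ?R
    proof (intro ballI allI)
      fix Q p q a c assume Q: "Q \<in> quivers 2" and ac: "a \<in> hpart M p" "c \<in> hpart M q"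
      note bs = b[OF qswap_quivers[OF Q]]
      have "opval X Q a c = by_parity M (\<lambda>ps us. ksgn (ps ! 0 * ps ! 1) (flip 0 (opval X (qswap Q) (us ! 1) (us ! 0)))) [a, c]"
        using sw[OF Q, of a c] h by simp
      also have "\<dots> = ksgn ([p, q] ! 0 * [p, q] ! 1) (flip 0 (opval X (qswap Q) ([a, c] ! 1) ([a, c] ! 0)))"
      proof (rule by_parity_hom)
        fix qs :: "bit list" and us :: "'v list" assume "length us = length [a, c]" "0 \<in> set us"
        then have "us ! 0 = 0 \<or> us ! 1 = 0" by (auto simp: length_Suc_conv)
        then show "ksgn (qs ! 0 * qs ! 1) (flip 0 (opval X (qswap Q) (us ! 1) (us ! 0))) = 0"
          using additive.zero[OF bilD(1)[OF bs]] additive.zero[OF bilD(2)[OF bs]] by auto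
      qed (use ac in simp)
      finally show "opval X Q a c = ksgn (p * q) (flip 0 (opval X (qswap Q) c a))" by simp
    qed
  next
    assume R: ?R
    show "perm_act N M 2 X (transpose 0 1) = X"
      unfolding ext
    proof (intro ballI allI)
      fix Q a c assume Q: "Q \<in> quivers 2"
      have "by_parity M (\<lambda>ps us. ksgn (ps ! 0 * ps ! 1) (flip 0 (opval X (qswap Q) (us ! 1) (us ! 0)))) [a, c] =
        by_parity M (\<lambda>ps us. opval X Q (us ! 0) (us ! 1)) [a, c]"
      proof -
        have "ksgn (p * q) (flip 0 (opval X (qswap Q) (proj M q c) (proj M p a))) = opval X Q (proj M p a) (proj M q c)" for p q
          using R[THEN bspec, OF Q, THEN spec[of _ p], THEN spec[of _ q]] proj_hpart by metis
        then show ?thesis by simp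
      qed
      also have "\<dots> = opval X Q a c" by (rule by_parity_additive_2) (rule bilD[OF b[OF Q]])+
      finally show "perm_act N M 2 X (transpose 0 1) Q [a, c] = X Q [a, c]" unfolding sw[OF Q] ..
    qed
  qed
  finally show ?thesis .
qed

lemma operations_well_valued:
  assumes "X \<in> operations N M 2 1"
  shows "well_valued X" "\<forall>Q vs. Q \<notin> quivers 2 \<or> length vs \<noteq> 2 \<longrightarrow> X Q vs = {}"
proof -
  note o = assms[unfolded operations_def mem_Collect_eq all_lists_2]
  show "well_valued X" unfolding well_valued_def
  proof (intro ballI allI)
    fix Q a b assume "Q \<in> quivers 2"
    from o[THEN conjunct2, THEN bspec, OF this, THEN conjunct1, THEN spec, THEN spec]
    show "X Q [a, b] \<in> cls N M 2 ` over (vr N 2)" unfolding Vpoly_eq .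
  qed
  show "\<forall>Q vs. Q \<notin> quivers 2 \<or> length vs \<noteq> 2 \<longrightarrow> X Q vs = {}" by (rule o[THEN conjunct1])
qed

lemma skew_iff: "skew s F \<longleftrightarrow> (\<forall>p q. \<forall>a\<in>hpart M p. \<forall>b\<in>hpart M q. F a b = ksgn (p * q + s) (flip 0 (F b a)))"
  unfolding skew_def by (metis mult.commute)

lemma pval_simps: "pval \<beta> y {#} = \<beta>" "pval \<beta> y {#(0, Suc 0)#} = y" "pval \<beta> y {#(Suc 0, 0)#} = (\<lambda>a b. - y a b)"
  by (auto simp: pval_def fun_eq_iff)

text \<open>The exchange of the vertices reverses the edge, on whose two orientations the values are
  \<open>y\<close> and its negative; this is where the additional sign in \<open>skew 1 y\<close>
  comes from.\<close>

lemma sym_iff_skew: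
  assumes x: "\<forall>Q\<in>quivers 2. \<forall>a b. x Q a b = pval \<beta> y Q a b"
  shows "(\<forall>Q\<in>quivers 2. \<forall>p q. \<forall>a\<in>hpart M p. \<forall>b\<in>hpart M q. x Q a b = ksgn (p * q) (flip 0 (x (qswap Q) b a)))
    \<longleftrightarrow> skew 0 \<beta> \<and> skew 1 y" (is "?L \<longleftrightarrow> ?R")
proof -
  have e: "x Q a b = pval \<beta> y Q a b" if "Q \<in> quivers 2" for Q a b using x that by blast
  have "?L \<longleftrightarrow> (\<forall>Q\<in>quivers 2. \<forall>p q. \<forall>a\<in>hpart M p. \<forall>b\<in>hpart M q.
    pval \<beta> y Q a b = ksgn (p * q) (flip 0 (pval \<beta> y (qswap Q) b a)))" (is "_ \<longleftrightarrow> ?L'")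
    by (intro ball_cong all_cong1 refl) (simp only: e qswap_quivers)
  also have "?L' \<longleftrightarrow> ?R"
proof
  assume ?L'
  then have "\<forall>p q. \<forall>a\<in>hpart M p. \<forall>b\<in>hpart M q. pval \<beta> y Q a b = ksgn (p * q) (flip 0 (pval \<beta> y (qswap Q) b a))" if "Q \<in> quivers 2" for Q
    using that by blast
  from this[OF quivers_2_simps(1)] this[OF quivers_2_simps(2)] show ?R
    unfolding skew_iff qswap_simps pval_simps additive.minus[OF additive_sub] ksgn_minus ksgn_one_add add_0_right
    by (rule conjI)
next
  assume R: ?R
  show ?L'
  proof (intro ballI allI)
    fix Q p q a b assume Q: "Q \<in> quivers 2" and ab: "a \<in> hpart M p" "b \<in> hpart M q"
    have e: "\<beta> a b = ksgn (p * q) (flip 0 (\<beta> b a))" "y a b = - ksgn (p * q) (flip 0 (y b a))"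
      using R ab unfolding skew_iff by (metis add.right_neutral, metis ksgn_one_add(2))
    show "pval \<beta> y Q a b = ksgn (p * q) (flip 0 (pval \<beta> y (qswap Q) b a))"
    proof (cases rule: quivers_2_cases[OF Q])
      case 4
      then have "2 \<le> size (qswap Q)" by simp
      then show ?thesis unfolding size_2_pval[OF 4] size_2_pval[OF \<open>2 \<le> size (qswap Q)\<close>] by simp
    next
      case 1
      show ?thesis unfolding 1 qswap_simps pval_simps by (rule e)
    next
      case 2
      then have Q: "Q = {#(0, Suc 0)#}" by simp
      show ?thesis unfolding Q qswap_simps pval_simps additive.minus[OF additive_sub] ksgn_minus by (rule e)
    next
      case 3
      then have Q: "Q = {#(Suc 0, 0)#}" by simp
      show ?thesis unfolding Q qswap_simps pval_simps by (subst e(2)) simp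
    qed
  qed
qed
  finally show ?thesis .
qed

text \<open>Together with \<open>pair_op_sym\<close> this identifies symmetric odd operations with
  coisson pairs. That an operation is recovered from its pair is the first half of the injectivity
  in the theorem.\<close>

lemma sym_op_pair:
  assumes "sym_op X"
  shows "coisson_pair (opval X {#}) (opval X {#(0, 1)#})"
    "Q \<in> quivers 2 \<Longrightarrow> opval X Q a b = pval (opval X {#}) (opval X {#(0, 1)#}) Q a b"
    "X = pair_op (opval X {#}) (opval X {#(0, 1)#})" "well_valued X"
proof -
  have X: "X \<in> operations N M 2 1" and s: "\<forall>\<sigma>. \<sigma> permutes {..<2} \<longrightarrow> perm_act N M 2 X \<sigma> = X"
    using assms by (auto simp: sym_op_def)
  note W = operations_well_valued[OF X]
  show "well_valued X" by (rule W)
  note Z = operations_iff[OF W, THEN iffD1, OF X, THEN bspec]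
  note o1 = Z[THEN conjunct1] and o2 = Z[THEN conjunct2, THEN conjunct1, THEN spec, THEN spec]
    and o3 = Z[THEN conjunct2, THEN conjunct2, THEN conjunct1, THEN spec, THEN spec]
    and o4 = Z[THEN conjunct2, THEN conjunct2, THEN conjunct2, THEN spec, THEN spec, THEN mp]
  show v: "opval X Q a b = pval (opval X {#}) (opval X {#(0, 1)#}) Q a b" if "Q \<in> quivers 2" for Q a b
    by (rule o2[OF that])
  have "skew 0 (opval X {#}) \<and> skew 1 (opval X {#(0, 1)#})"
    using s perm_act_eq_iff[OF W] sym_iff_skew[of "opval X"] o1 v by blast
  then show "coisson_pair (opval X {#}) (opval X {#(0, 1)#})"
    unfolding coisson_pair_def using o1[of "{#}"] o3[of "{#}"] o1[of "{#(0, 1)#}"] o3[of "{#(0, 1)#}"] o4[of "{#(0, 1)#}"] by simp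
  show "X = pair_op (opval X {#}) (opval X {#(0, 1)#})"
  proof (intro ext)
    fix Q vs
    show "X Q vs = pair_op (opval X {#}) (opval X {#(0, 1)#}) Q vs"
    proof (cases "Q \<in> quivers 2 \<and> length vs = 2")
      case True
      then obtain a b where "vs = [a, b]" by (auto simp: length_Suc_conv numeral_2_eq_2)
      then show ?thesis using True cls_opval[OF W(1), of Q a b] v[of Q a b] by (simp add: pair_op_def)
    next
      case False
      then show ?thesis using W(2) unfolding pair_op_def by (metis (full_types))
    qed
  qed
qed

lemma pair_op_sym:
  assumes "coisson_pair \<beta> y"
  shows "sym_op (pair_op \<beta> y)" "Q \<in> quivers 2 \<Longrightarrow> opval (pair_op \<beta> y) Q a b = pval \<beta> y Q a b"
proof -
  let ?X = "pair_op \<beta> y"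
  have c: "bil \<beta>" "bil y" "skew 0 \<beta>" "skew 1 y"
    "\<And>a b. \<beta> (nab None a) b = - lam 0 (\<beta> a b) \<and> \<beta> a (nab None b) = lam 0 (\<beta> a b) + coeff_op 0 (nab None) (\<beta> a b)"
    "\<And>a b. y a b \<in> over (even_free N)" "\<And>a b. y (nab None a) b + y a (nab None b) = coeff_op 0 (nab None) (y a b)"
    using assms unfolding coisson_pair_def by blast+
  have bm: "bil (\<lambda>a b. - y a b)"
    using c(2) unfolding bil_def
    by (simp add: additive.minus[OF additive_tht] additive.minus[OF additive_coeff_op])
  have b0: "bil (\<lambda>a b. 0)" unfolding bil_def by simp
  have bp: "bil (pval \<beta> y Q)" for Q
    unfolding pval_def by (cases "Q = {#}"; cases "Q = {#(0, 1)#}"; cases "Q = {#(1, 0)#}") (simp_all add: c bm b0)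
  have po: "pval \<beta> y Q a b \<in> over (vr N 1)" for Q a b by (rule bilD(5)[OF bp])
  have W: "well_valued ?X"
    unfolding well_valued_def pair_op_def using over_1_2[OF po] by simp
  have X0: "\<forall>Q vs. Q \<notin> quivers 2 \<or> length vs \<noteq> 2 \<longrightarrow> ?X Q vs = {}"
    unfolding pair_op_def by (metis (full_types))
  show v: "opval ?X Q a b = pval \<beta> y Q a b" if "Q \<in> quivers 2" for Q a b
    using that rep_cls(2)[OF _ over_1_2[OF po], of Q a b] nn_2_id[OF po[simplified], of Q a b]
    by (simp add: opval_def pair_op_def)
  have v': "opval ?X Q = pval \<beta> y Q" if "Q \<in> quivers 2" for Q using v[OF that] by blast
  have v0: "opval ?X {#} = \<beta>" "opval ?X {#(0, 1)#} = y"
    using v'[of "{#}"] v'[of "{#(0, 1)#}"] by (auto simp: pval_def fun_eq_iff)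
  have o: "?X \<in> operations N M 2 1"
    unfolding operations_iff[OF W X0] v0
  proof (intro ballI conjI allI)
    fix Q a b assume Q: "Q \<in> quivers 2"
    show "bil (opval ?X Q)" unfolding v'[OF Q] by (rule bp)
    show "opval ?X Q a b = pval \<beta> y Q a b" by (rule v[OF Q])
    show "Q \<noteq> {#} \<longrightarrow> opval ?X Q a b \<in> over (even_free N)"
      unfolding v'[OF Q] by (auto simp: pval_def c)
    show "if Q = {#} then opval ?X Q (nab None a) b = - lam 0 (opval ?X Q a b) \<and>
       opval ?X Q a (nab None b) = lam 0 (opval ?X Q a b) + coeff_op 0 (nab None) (opval ?X Q a b)
     else opval ?X Q (nab None a) b + opval ?X Q a (nab None b) = coeff_op 0 (nab None) (opval ?X Q a b)"
      unfolding v'[OF Q] using c(5)[of a b] c(7)[of a b, symmetric]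
      by (auto simp: pval_def additive.minus[OF additive_coeff_op])
  qed
  have "\<forall>\<sigma>. \<sigma> permutes {..<2} \<longrightarrow> perm_act N M 2 ?X \<sigma> = ?X"
    using perm_act_eq_iff[OF W X0] sym_iff_skew[of "opval ?X" \<beta> y] v v' bp c(3,4) by simp
  then show "sym_op ?X" using o by (simp add: sym_op_def)
qed

end

subsection \<open>Cocomposition for the partition \<open>(2, 1)\<close>\<close>

text \<open>A constant instead of the literal list, so that offsets and blocks are rewritten by the
  values recorded below.\<close>

definition nu :: "nat list"
  where "nu = [2, 1]"

lemma offset_21 [simp]: "offset nu 0 = 0" "offset nu (Suc 0) = 2" "offset nu 2 = 3" "offset nu (Suc (Suc 0)) = 3"
  by (simp_all add: offset_def nu_def numeral_2_eq_2)

lemma nu_simps [simp]: "length nu = 2" "sum_list nu = 3" "nu ! 0 = 2" "nu ! Suc 0 = 1"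
  by (simp_all add: nu_def)

lemma block_21 [simp]: "block nu 0 = {0, 1}" "block nu (Suc 0) = {2}"
  by (auto simp: block_def)

lemma block_of_21 [simp]: "block_of nu 0 = 0" "block_of nu (Suc 0) = 0" "block_of nu 2 = 1"
proof -
  show "block_of nu 0 = 0" "block_of nu (Suc 0) = 0"
    unfolding block_of_def by (rule Least_equality; simp)+
  show "block_of nu 2 = 1"
    unfolding block_of_def
  proof (rule Least_equality)
    fix y assume "2 < offset nu (Suc y)"
    then show "1 \<le> y" by (cases y) auto
  qed simp
qed

lemma quivers_3_edge: "Q \<in> quivers 3 \<Longrightarrow> e \<in># Q \<Longrightarrow> fst e \<in> {0, 1, 2} \<and> snd e \<in> {0, 1, 2} \<and> fst e \<noteq> snd e"
  by (cases e) (force simp: quivers_def eval_nat_numeral less_Suc_eq)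

abbreviation oe :: "quiver \<Rightarrow> quiver" where "oe \<equiv> outer_edges nu"
abbreviation co :: "quiver \<Rightarrow> quiver" where "co \<equiv> collapse nu"
abbreviation sq :: "quiver \<Rightarrow> quiver" where "sq \<equiv> subquiver nu 0"

lemma oe_edge:
  assumes "Q \<in> quivers 3" "e \<in># oe Q"
  shows "e \<in> {(0, 2), (2, 0), (1, 2), (2, 1)}"
proof -
  have "e \<in># Q" "block_of nu (fst e) \<noteq> block_of nu (snd e)"
    using assms(2) by (auto simp: outer_edges_def)
  then show ?thesis using quivers_3_edge[OF assms(1), of e] by (cases e) auto
qed

lemma co_quivers:
  assumes "Q \<in> quivers 3"
  shows "co Q \<in> quivers 2"
proof -
  have "s < 2 \<and> t < 2 \<and> s \<noteq> t" if st: "(s, t) \<in># co Q" for s t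
  proof -
    obtain e where e: "e \<in># oe Q" "(s, t) = map_prod (block_of nu) (block_of nu) e"
      using st unfolding collapse_def by auto
    then show ?thesis using oe_edge[OF assms e(1)] by auto
  qed
  then show ?thesis unfolding quivers_def by blast
qed

lemma sq_eq:
  assumes "Q \<in> quivers 3"
  shows "sq Q = filter_mset (\<lambda>(s, t). s < 2 \<and> t < 2) Q" "subquiver nu (Suc 0) Q = {#}"
proof -
  have "sq Q = image_mset (\<lambda>x. x) (filter_mset (\<lambda>(s, t). s \<in> block nu 0 \<and> t \<in> block nu 0) Q)"
    unfolding subquiver_def by (intro image_mset_cong) auto
  then show "sq Q = filter_mset (\<lambda>(s, t). s < 2 \<and> t < 2) Q"
    by (simp add: less_2_cases_iff)
  have "{#e \<in># Q. (case e of (s, t) \<Rightarrow> s \<in> block nu (Suc 0) \<and> t \<in> block nu (Suc 0))#} = {#e \<in># Q. False#}"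
  proof (rule filter_mset_cong[OF refl])
    fix e assume "e \<in># Q"
    then show "(case e of (s, t) \<Rightarrow> s \<in> block nu (Suc 0) \<and> t \<in> block nu (Suc 0)) \<longleftrightarrow> False"
      using quivers_3_edge[OF assms, of e] by (cases e) auto
  qed
  then show "subquiver nu (Suc 0) Q = {#}" unfolding subquiver_def by simp
qed

lemma sq_quivers: "Q \<in> quivers 3 \<Longrightarrow> sq Q \<in> quivers 2"
  by (auto simp: sq_eq quivers_def)

lemmas sq_1 = sq_eq(2)

lemma size_co: "size (co Q) = size (oe Q)"
  by (simp add: collapse_def)

text \<open>Only the set attached to vertex 0 is ever computed: the inner value is in normal form
  and contains no variable but the one with index 0, and the value of the identity is
  constant.\<close>

lemma reach_empty:
  assumes "\<And>e. e \<in># oe Q \<Longrightarrow> fst e \<noteq> 0 \<and> snd e \<noteq> 0"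
  shows "reach nu Q 0 = {}"
proof -
  have "e \<in># oe Q" if "trail f (oe Q) xs es" "e \<in> set es" for f xs es e
    using that unfolding trail_def by (metis mset_subset_eqD in_multiset_in_set)
  then show ?thesis using assms unfolding reach_def by blast
qed

text \<open>With a single edge between the blocks, a nonempty walk without repeated edges uses
  exactly that edge, so a walk ending in the first block starts in the second.\<close>

lemma reach_single:
  assumes "Q \<in> quivers 3" "oe Q = {#e#}" "fst e = 0 \<or> snd e = 0"
  shows "reach nu Q 0 = {1}"
proof -
  have e: "e = (0, 2) \<or> e = (2, 0)" using oe_edge[OF assms(1), of e] assms(2,3) by auto
  have b: "{block_of nu (fst e), block_of nu (snd e)} = {0, 1}" using e by auto
  have "i = 1" if t: "trail (block_of nu) (oe Q) xs es" "es \<noteq> []" "hd xs = i" "last xs = 0" for xs es i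
  proof -
    have s: "mset es \<subseteq># {#e#}" and l: "length xs = Suc (length es)"
      and q: "\<forall>q<length es. {block_of nu (fst (es ! q)), block_of nu (snd (es ! q))} = {xs ! q, xs ! Suc q}"
      using t(1) unfolding trail_def assms(2) by auto
    have "length es \<le> 1" using size_mset_mono[OF s] by simp
    then have "es = [e]" using t(2) s by (cases es) auto
    moreover then obtain y z where "xs = [y, z]" using l by (auto simp: length_Suc_conv)
    ultimately have "{0, 1} = {i, 0}" using q b t(3,4) by auto
    then show "i = 1" by (simp add: doubleton_eq_iff)
  qed
  moreover have "trail (block_of nu) (oe Q) [1, 0] [e]"
    using b unfolding trail_def assms(2) by (auto simp: insert_commute)
  then have "1 \<in> reach nu Q 0"
    unfolding reach_def using assms(3) by (auto intro!: exI[of _ "[1, 0]"] exI[of _ "[e]"])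
  moreover have "reach nu Q 0 \<subseteq> {1}"
    using calculation(1) unfolding reach_def by auto
  ultimately show ?thesis by auto
qed

subsection \<open>Formal tensors\<close>

lemma additive_tens_op [simp]: "additive (tens_op g :: _ \<Rightarrow> _ \<Rightarrow>\<^sub>0 'k::ab_group_add)"
  unfolding tens_op_def by (rule additive_lext) simp

lemmas additive_tens_op_comp [simp] = additive_comp[OF additive_tens_op]

lemma tens_op_single [simp]: "tens_op g (Poly_Mapping.single u c) = Poly_Mapping.single (g u) c"
  by (simp add: tens_op_def lext_single)

text \<open>Formal tensors may contain lists of any length, but an operation takes the value
  \<open>{}\<close> on lists of length other than 2, and a representative of \<open>{}\<close> is
  arbitrary. The truncation makes statements about all formal tensors possible.\<close>

definition pairs_only :: "('v list \<Rightarrow>\<^sub>0 'k::ab_group_add) \<Rightarrow> ('v list \<Rightarrow>\<^sub>0 'k)"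
  where "pairs_only = lext (\<lambda>u c. if length u = 2 then Poly_Mapping.single u c else 0)"

lemma additive_pairs_only [simp]: "additive pairs_only"
  unfolding pairs_only_def by (rule additive_lext) simp

lemmas additive_pairs_only_comp [simp] = additive_comp[OF additive_pairs_only]

lemma pairs_only_single: "pairs_only (Poly_Mapping.single u c) = (if length u = 2 then Poly_Mapping.single u c else 0)"
  by (simp add: pairs_only_def lext_single)

text \<open>Meant for \<open>F\<close> equal to the extended outer operation
  \<open>\<Psi> Q\<close>, whose values on lists of the wrong length need not be finite; the proof
  therefore goes through monomials.\<close>

lemma kext_coeff_op_0:
  assumes "additive F" "additive \<phi>" "f \<in> fin"
  shows "kext s F (coeff_op 0 \<phi> f) = kext s (\<lambda>w. F (\<phi> w)) f"
proof (rule additive_eq_on_singles[where f=f])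
  show "additive (\<lambda>f. kext s F (coeff_op 0 \<phi> f))" using assms by simp
  show "additive (kext s (\<lambda>w. F (\<phi> w)))" using additive_comp[OF assms(1,2)] by simp
  fix m w assume "m \<in> Poly_Mapping.keys f"
  then have "finite (snd m)" using over_keysD(1)[OF assms(3), of "fst m" "snd m"] by simp
  then show "kext s F (coeff_op 0 \<phi> (Poly_Mapping.single m w)) = kext s (\<lambda>w. F (\<phi> w)) (Poly_Mapping.single m w)"
    using assms additive_comp[OF assms(1,2)] by (simp add: coeff_op_single kext_single)
qed

lemma foldr_op_commute:
  assumes "\<And>w g. w \<in> set ws \<Longrightarrow> g \<in> D \<Longrightarrow> H (C w g) = ksgn (t * lpar w) (C w (H g))"
    and "\<And>w g. w \<in> set ws \<Longrightarrow> g \<in> D \<Longrightarrow> C w g \<in> D" and C: "\<And>w. additive (C w)" and "f \<in> D"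
  shows "H (foldr C ws f) = ksgn (t * sum_list (map lpar ws)) (foldr C ws (H f)) \<and> foldr C ws f \<in> D"
  using assms(1,2)
proof (induction ws)
  case (Cons w ws)
  then have "H (foldr C ws f) = ksgn (t * sum_list (map lpar ws)) (foldr C ws (H f)) \<and> foldr C ws f \<in> D" by simp
  then show ?case using Cons.prems by (simp add: additive_ksgn_commute[OF C] ring_distribs)
qed (use assms(4) in simp)

section \<open>The composite of a symmetric operation with itself\<close>

locale symmetric_operation = hwmodule +
  fixes X :: "'b operation"
  assumes sym: "sym_op X"
begin

definition \<Phi> :: "quiver \<Rightarrow> 'b list \<Rightarrow> 'b spoly"
  where "\<Phi> Q u = vsub (block nu) (rep (X (co Q) u))"

definition \<Psi> :: "quiver \<Rightarrow> ('b list \<Rightarrow>\<^sub>0 'a) \<Rightarrow> 'b spoly"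
  where "\<Psi> Q = lext (\<lambda>u c. pscl (scl M) c (\<Phi> Q u))"

abbreviation \<Psi>' :: "quiver \<Rightarrow> ('b list \<Rightarrow>\<^sub>0 'a) \<Rightarrow> 'b spoly"
  where "\<Psi>' Q w \<equiv> \<Psi> Q (pairs_only w)"

text \<open>The normal form of the outer operation: \<Lambda>_1 + \<Lambda>_2 is inserted for its
  first supervariable, and its second one, \<Lambda>_3, is eliminated. It thus has two variables
  left.\<close>

definition W :: "quiver \<Rightarrow> 'b \<Rightarrow> 'b \<Rightarrow> 'b spoly"
  where "W Q u v = vsub (\<lambda>_. {0, 1}) (opval X (co Q) u v)"

lemmas wv = sym_op_pair(4)[OF sym]

lemma bil_opval: "Q \<in> quivers 2 \<Longrightarrow> bil (opval X Q)"
proof -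
  assume "Q \<in> quivers 2"
  moreover have "X \<in> operations N M 2 1" using sym by (simp add: sym_op_def)
  note operations_iff[OF operations_well_valued[OF this], THEN iffD1, OF this, THEN bspec, THEN conjunct1]
  ultimately show ?thesis by blast
qed

lemma additive_\<Psi> [simp]: "additive (\<Psi> Q)"
  unfolding \<Psi>_def by (rule additive_lext) (simp add: additive_def pm.scale_left_distrib)

lemmas additive_\<Psi>_comp [simp] = additive_comp[OF additive_\<Psi>]

lemma \<Psi>_single: "\<Psi> Q (Poly_Mapping.single u c) = pscl (scl M) c (\<Phi> Q u)"
  unfolding \<Psi>_def by (simp add: lext_single)

lemma \<Phi>_over: "Q \<in> quivers 3 \<Longrightarrow> \<Phi> Q [u, v] \<in> over (vr N 3)"
  unfolding \<Phi>_def
proof (rule vsub_over[OF well_valuedD(1)[OF wv co_quivers]])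
  fix k l j assume kl: "(k, l) \<in> vr N 2" "j \<in> block nu k"
  then have "k = 0 \<or> k = 1" by auto
  then show "(j, l) \<in> vr N 3" using kl by auto
qed

lemma partition_21: "(\<Union>k<2. block nu k) = {..<3}" "disjoint_family_on (block nu) {..<2}"
  "k < 2 \<Longrightarrow> finite (block nu k)"
  by (auto simp: disjoint_family_on_def eval_nat_numeral less_Suc_eq lessThan_Suc block_def)

lemma W_over: "Q \<in> quivers 3 \<Longrightarrow> W Q u v \<in> over (vr N 2)"
  unfolding W_def by (rule vsub_over[OF well_valuedD(3)[OF wv co_quivers]]) auto

lemma nn_\<Phi>: "Q \<in> quivers 3 \<Longrightarrow> nn 3 (\<Phi> Q [u, v]) = W Q u v"
proof -
  assume Q: "Q \<in> quivers 3"
  note c = co_quivers[OF Q]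
  have "nn 3 (\<Phi> Q [u, v]) = nn 3 (vsub (block nu) (opval X (co Q) u v))"
    unfolding \<Phi>_def opval_def by (rule nn_vsub[symmetric, OF well_valuedD(1)[OF wv c]]) (use partition_21 in auto)
  also have "vsub (block nu) (opval X (co Q) u v) = W Q u v"
    unfolding W_def by (rule vsub_cong[OF well_valuedD(3)[OF wv c]]) auto
  also have "nn 3 (W Q u v) = W Q u v" using W_over[OF Q] by (intro nn_idem) simp
  finally show ?thesis .
qed

lemma \<Psi>'_over: "Q \<in> quivers 3 \<Longrightarrow> \<Psi>' Q w \<in> over (vr N 3)"
proof -
  assume Q: "Q \<in> quivers 3"
  have "\<Psi>' Q w = (\<Sum>u\<in>Poly_Mapping.keys w. \<Psi>' Q (Poly_Mapping.single u (Poly_Mapping.lookup w u)))"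
    by (subst poly_mapping_sum_singles[of w]) (rule additive.sum, simp)
  moreover have "\<Psi>' Q (Poly_Mapping.single u c) \<in> over (vr N 3)" for u c
    using \<Phi>_over[OF Q] by (auto simp: pairs_only_single \<Psi>_single additive.zero length_Suc_conv numeral_2_eq_2 intro!: pscl_over)
  ultimately show ?thesis by (simp add: over_sum)
qed

lemma \<Psi>'_fin: "Q \<in> quivers 3 \<Longrightarrow> \<Psi>' Q w \<in> fin"
  using \<Psi>'_over over_fin by blast

lemma nn_\<Psi>'_zero:
  assumes Q: "Q \<in> quivers 3" and z: "\<And>u v. W Q u v = 0"
  shows "nn 3 (\<Psi>' Q w) = 0"
proof -
  have "nn 3 (\<Psi>' Q w) = (\<Sum>u\<in>Poly_Mapping.keys w. nn 3 (\<Psi>' Q (Poly_Mapping.single u (Poly_Mapping.lookup w u))))"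
    by (subst poly_mapping_sum_singles[of w]) (rule additive.sum, simp)
  moreover have "nn 3 (\<Psi>' Q (Poly_Mapping.single u c)) = 0" for u c
    using \<Phi>_over[OF Q, THEN over_fin] z nn_\<Phi>[OF Q]
    by (auto simp: pairs_only_single \<Psi>_single additive.zero length_Suc_conv numeral_2_eq_2 pscl_sub)
  ultimately show ?thesis by simp
qed

lemma additive_W [simp]: "Q \<in> quivers 3 \<Longrightarrow> additive (W Q u)" "Q \<in> quivers 3 \<Longrightarrow> additive (\<lambda>u. W Q u v)"
  unfolding W_def using bilD(1,2)[OF bil_opval[OF co_quivers]]
  by (auto intro: additive_comp[OF additive_vsub])

text \<open>The Koszul sign that a letter of parity \<open>lpar l\<close> picks up when it passes
  the first tensor factor to act on the second.\<close>

definition ptw :: "nat option \<Rightarrow> 'b \<Rightarrow> 'b"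
  where "ptw l v = (if lpar l = 0 then v else parity_aut M v)"

lemma additive_ptw [simp]: "additive (ptw l)"
  unfolding ptw_def by (cases "lpar l = 0") simp_all

lemma ptw_nab: "ptw l (nab l' v) = ksgn (lpar l * lpar l') (nab l' (ptw l v))"
  by (cases l) (simp_all add: ptw_def nab_parity_aut)

text \<open>Along an edge \<nabla> obeys a Leibniz rule. For the odd directions it results from
  adding the rules for the two arguments, in which the terms with \<theta> cancel; the sign in front
  is the parity of the operation.\<close>

lemma W_edge:
  assumes Q: "Q \<in> quivers 3" "co Q \<noteq> {#}" and l: "lv N l"
  shows "coeff_op (lpar l) (nab l) (W Q u v) = ksgn (lpar l) (W Q (nab l u) v + W Q (ptw l u) (nab l v))"
proof -
  note c = co_quivers[OF Q(1)]
  note b = bilD[OF bil_opval[OF c]]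
  have f: "opval X (co Q) u v \<in> fin" using b(5) over_fin by blast
  have "opval X (co Q) (nab None u) v + opval X (co Q) u (nab None v) = coeff_op 0 (nab None) (opval X (co Q) u v)"
  proof -
    have o: "X \<in> operations N M 2 1" using sym by (simp add: sym_op_def)
    show ?thesis using operations_iff[OF operations_well_valued[OF o], THEN iffD1, OF o, THEN bspec, OF c,
      THEN conjunct2, THEN conjunct2, THEN conjunct1, THEN spec[of _ u], THEN spec[of _ v]] Q(2) by simp
  qed
  moreover have "opval X (co Q) (nab (Some i) u) v + opval X (co Q) (parity_aut M u) (nab (Some i) v) = - coeff_op 1 (nab (Some i)) (opval X (co Q) u v)"
    if "i < N" for i using b(7,8)[OF that, of u v] by simp
  ultimately have "coeff_op (lpar l) (nab l) (opval X (co Q) u v) = ksgn (lpar l) (opval X (co Q) (nab l u) v + opval X (co Q) (ptw l u) (nab l v))"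
    using l by (cases l) (simp_all add: ptw_def)
  then show ?thesis
    using f unfolding W_def by (simp add: additive.add[OF additive_vsub, symmetric] additive_ksgn_commute[OF additive_vsub, symmetric] vsub_coeff_op[symmetric])
qed

text \<open>The operator substituted for \<Lambda>_1 when the only block to be added is the second
  one: it consists of the variable with index 2, and \<nabla> acts in slot 1.\<close>

definition shiftC :: "nat option \<Rightarrow> ('b list \<Rightarrow>\<^sub>0 'a) spoly \<Rightarrow> ('b list \<Rightarrow>\<^sub>0 'a) spoly"
  where "shiftC l f = var 0 l f + (var 2 l f + coeff_op (lpar l) (tens_op (slot_op M (lpar l) (nab l) 1)) f)"

abbreviation shiftD :: "nat option \<Rightarrow> 'b spoly \<Rightarrow> 'b spoly"
  where "shiftD l \<equiv> sop UNIV {1} 0 l"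

lemma additive_shiftC [simp]: "additive (shiftC l)"
  unfolding shiftC_def by simp

lemma shiftC_fin: "f \<in> fin \<Longrightarrow> shiftC l f \<in> fin"
  unfolding shiftC_def by (auto intro!: over_add over_var coeff_op_over)

lemma foldr_shiftD_fin: "f \<in> fin \<Longrightarrow> foldr shiftD ws f \<in> fin"
  by (induction ws) (auto intro: sop_fin)

lemma var_shiftC:
  assumes f: "f \<in> fin"
  shows "var k l (shiftC l' f) = ksgn (lpar l * lpar l') (shiftC l' (var k l f))"
  unfolding shiftC_def
  using var_commute[OF f, of k l 0 l'] var_commute[OF f, of k l 2 l'] f
  by (simp add: additive.add[OF additive_var] ksgn_add coeff_op_var mult.commute)

lemma shiftC_pairs:
  assumes f: "f \<in> fin" "coeff_op 0 pairs_only f = f"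
  shows "coeff_op 0 pairs_only (shiftC l f) = shiftC l f"
proof -
  let ?t = "tens_op (slot_op M (lpar l) (nab l) 1) :: ('b list \<Rightarrow>\<^sub>0 'a) \<Rightarrow> _"
  have e: "pairs_only (?t (pairs_only w)) = ?t (pairs_only w)" for w
    by (rule additive_eq_on_singles[where f=w]) (auto simp: pairs_only_single slot_op_def additive.zero[OF additive_tens_op] additive.zero[OF additive_pairs_only])
  have "coeff_op 0 pairs_only (coeff_op (lpar l) ?t f) = coeff_op 0 pairs_only (coeff_op (lpar l) ?t (coeff_op 0 pairs_only f))"
    by (simp add: f)
  also have "\<dots> = coeff_op (lpar l) (\<lambda>w. pairs_only (?t (pairs_only w))) f"
    using f(1) by (simp add: coeff_op_coeff_op coeff_op_over)
  also have "\<dots> = coeff_op (lpar l) ?t (coeff_op 0 pairs_only f)"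
    unfolding e using f(1) by (simp add: coeff_op_coeff_op)
  finally have "coeff_op 0 pairs_only (coeff_op (lpar l) ?t f) = coeff_op (lpar l) ?t f" by (simp add: f)
  then show ?thesis using f unfolding shiftC_def by (simp add: additive.add[OF additive_coeff_op] coeff_op_var)
qed

lemma foldr_shiftC_pairs:
  "coeff_op 0 pairs_only (foldr shiftC ws (const (Poly_Mapping.single [u, v] 1))) = foldr shiftC ws (const (Poly_Mapping.single [u, v] 1)) \<and>
   foldr shiftC ws (const (Poly_Mapping.single [u, v] 1)) \<in> fin"
proof (induction ws)
  case Nil
  show ?case by (simp add: coeff_op_const pairs_only_single)
next
  case (Cons l ws)
  then show ?case using shiftC_pairs by (auto simp: shiftC_def intro!: over_add over_var coeff_op_over)
qed

lemma kext_\<Psi>_eq: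
  "kext 1 (\<Psi> Q) (foldr shiftC ws (const (Poly_Mapping.single [u, v] 1))) = kext 1 (\<Psi>' Q) (foldr shiftC ws (const (Poly_Mapping.single [u, v] 1)))"
  using foldr_shiftC_pairs[of ws u v] kext_coeff_op_0[of "\<Psi> Q" pairs_only "foldr shiftC ws (const (Poly_Mapping.single [u, v] 1))" 1]
  by simp

text \<open>Inside an operation along an edge, the shift of \<open>\<Lambda>\<^sub>1\<close> by \<open>\<Lambda>\<^sub>3 + \<nabla>\<^sup>(\<^sup>2\<^sup>)\<close> amounts to the substitution of
  \<open>- \<Lambda>\<^sub>2 - \<nabla>\<^sup>(\<^sup>1\<^sup>)\<close>. The innermost letter is treated first, since only there the vectors are explicit.\<close>

lemma nn_shift:
  assumes Q: "Q \<in> quivers 3" "co Q \<noteq> {#}" and ws: "\<forall>l\<in>set ws. lv N l"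
  shows "nn 3 (kext 1 (\<Psi>' Q) (foldr shiftC ws (const (Poly_Mapping.single [u, v] 1)))) =
    kext 1 (\<lambda>u. W Q u v) (foldr shiftD ws (const u))"
  using ws
proof (induction ws arbitrary: u v rule: rev_induct)
  case Nil
  have "additive (\<Psi>' Q)" by simp
  then show ?case using nn_\<Phi>[OF Q(1)] additive_W(2)[OF Q(1)]
    by (simp add: kext_const pairs_only_single \<Psi>_single)
next
  case (snoc l ws)
  then have l: "lv N l" and ws: "\<forall>l\<in>set ws. lv N l" by auto
  let ?s = "\<lambda>u v. const (Poly_Mapping.single [u, v] 1) :: ('b list \<Rightarrow>\<^sub>0 'a) spoly"
  let ?E = "\<lambda>u v. nn 3 (kext 1 (\<Psi>' Q) (foldr shiftC ws (?s u v)))"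
  \<comment> \<open>The exponent for moving the innermost letter past the rest of the word.\<close>
  let ?\<epsilon> = "lpar l * sum_list (map lpar ws)"
  let ?h = "foldr shiftD ws (const u)"
  let ?P = "kext 1 (\<lambda>u. W Q u v) ?h"
  note aW = additive_W[OF Q(1)]
  have fW: "W Q u v \<in> fin" for u v using W_over[OF Q(1)] over_fin by blast
  have aC: "additive (foldr shiftC ws)" by (rule additive_foldr) simp
  have aD: "additive (foldr shiftD ws)" by (rule additive_foldr) simp
  have hfin: "?h \<in> fin" by (rule foldr_shiftD_fin) simp
  have P: "?P \<in> over (vr N 2)"
  proof -
    have "?h \<in> over (vr N 2)" using ws by (induction ws) (auto intro!: sop_over)
    then show ?thesis using W_over[OF Q(1)] aW by (intro kext_over) auto
  qed
  have cv: "var k l (foldr shiftC ws (?s u v)) = ksgn ?\<epsilon> (foldr shiftC ws (var k l (?s u v))) \<and> foldr shiftC ws (?s u v) \<in> fin" for k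
    by (rule foldr_op_commute[where D=fin and H="var k l"]) (auto intro: var_shiftC shiftC_fin)
  have nv: "nn 3 (kext 1 (\<Psi>' Q) (foldr shiftC ws (var k l (?s u v)))) = ksgn (?\<epsilon> + lpar l) (sop {k. Suc k = 3} {j. Suc j < 3} k l (?E u v))" for k
  proof -
    have e: "foldr shiftC ws (var k l (?s u v)) = ksgn ?\<epsilon> (var k l (foldr shiftC ws (?s u v)))"
      using cv[of k] by simp
    have g: "foldr shiftC ws (?s u v) \<in> fin" using cv[of k] by simp
    have "kext 1 (\<Psi>' Q) (foldr shiftC ws (?s u v)) \<in> fin"
      using g \<Psi>'_fin[OF Q(1)] by (intro kext_fin) auto
    then show ?thesis
      unfolding e using g \<Psi>'_fin[OF Q(1)]
      by (simp add: additive_ksgn_commute[OF additive_kext] additive_ksgn_commute[OF additive_sub] additive_ksgn_commute[OF additive_sop] kext_var sub_var)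
  qed
  have "nn 3 (kext 1 (\<Psi>' Q) (foldr shiftC (ws @ [l]) (?s u v))) =
    nn 3 (kext 1 (\<Psi>' Q) (foldr shiftC ws (var 0 l (?s u v)))) + (nn 3 (kext 1 (\<Psi>' Q) (foldr shiftC ws (var 2 l (?s u v))))
      + ?E (ptw l u) (nab l v))"
  proof -
    have "shiftC l (?s u v) = var 0 l (?s u v) + (var 2 l (?s u v) + ?s (ptw l u) (nab l v))"
      by (simp add: shiftC_def coeff_op_const slot_op_def ptw_def)
    then show ?thesis by (simp add: additive.add[OF aC] additive.add[OF additive_kext] additive.add[OF additive_sub])
  qed
  also have "\<dots> = ksgn (?\<epsilon> + lpar l) (var 0 l ?P + sop {k. Suc k = 3} {j. Suc j < 3} 2 l ?P) + kext 1 (\<lambda>u. W Q u (nab l v)) (foldr shiftD ws (const (ptw l u)))"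
    unfolding nv snoc.IH[OF ws] by (simp add: sop_def ksgn_add)
  \<comment> \<open>Elimination of \<Lambda>_3 turns \<Lambda>_1 + \<Lambda>_3 into -\<Lambda>_2 -
    \<nabla>, where \<nabla> acts on the output of the outer operation.\<close>
  also have "var 0 l ?P + sop {k. Suc k = 3} {j. Suc j < 3} 2 l ?P = - var 1 l ?P - coeff_op (lpar l) (nab l) ?P"
  proof -
    have "{j. Suc j < 3} = {0, 1}" by auto
    then show ?thesis by (simp add: sop_def)
  qed
  \<comment> \<open>The Leibniz rule along the edge splits this \<nabla> into its actions on the two
    arguments.\<close>
  also have "coeff_op (lpar l) (nab l) ?P = ksgn (lpar l) (kext (1 + lpar l) (\<lambda>w. W Q (nab l w) v) ?h + kext (1 + lpar l) (\<lambda>w. W Q (ptw l w) (nab l v)) ?h)"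
  proof -
    have a1: "additive (\<lambda>w. W Q (nab l w) v)" "additive (\<lambda>w. W Q (ptw l w) (nab l v))"
      by (rule additive_comp[OF aW(2)], simp)+
    have "coeff_op (lpar l) (nab l) ?P = kext (1 + lpar l) (\<lambda>w. coeff_op (lpar l) (nab l) (W Q w v)) ?h"
      using aW fW hfin by (simp add: coeff_op_kext)
    also have "\<dots> = kext (1 + lpar l) (\<lambda>w. ksgn (lpar l) (W Q (nab l w) v + W Q (ptw l w) (nab l v))) ?h"
      by (simp only: W_edge[OF Q l])
    also have "\<dots> = ksgn (lpar l) (kext (1 + lpar l) (\<lambda>w. W Q (nab l w) v + W Q (ptw l w) (nab l v)) ?h)"
      using a1 by (intro kext_ksgn) simp
    finally show ?thesis by (simp add: kext_plus)
  qed
  also have "kext 1 (\<lambda>u. W Q u (nab l v)) (foldr shiftD ws (const (ptw l u))) = ksgn ?\<epsilon> (kext (1 + lpar l) (\<lambda>w. W Q (ptw l w) (nab l v)) ?h)"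
  proof -
    have "coeff_op (lpar l) (ptw l) ?h = ksgn ?\<epsilon> (foldr shiftD ws (coeff_op (lpar l) (ptw l) (const u)))"
      by (rule foldr_op_commute[where D=fin, THEN conjunct1]) (auto intro!: coeff_op_sop sop_fin ptw_nab)
    then have "foldr shiftD ws (const (ptw l u)) = ksgn ?\<epsilon> (coeff_op (lpar l) (ptw l) ?h)"
      by (simp add: coeff_op_const)
    then show ?thesis
      using aW fW hfin by (simp add: additive_ksgn_commute[OF additive_kext] kext_coeff_op)
  qed
  \<comment> \<open>The action on the second argument cancels against the term \<nabla>^(2) of the
    shift. What remains, -\<Lambda>_2 - \<nabla>^(1), is a substitution in the inner value.\<close>
  also have "ksgn (?\<epsilon> + lpar l) (- var 1 l ?P - ksgn (lpar l) (kext (1 + lpar l) (\<lambda>w. W Q (nab l w) v) ?h + kext (1 + lpar l) (\<lambda>w. W Q (ptw l w) (nab l v)) ?h))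
     + ksgn ?\<epsilon> (kext (1 + lpar l) (\<lambda>w. W Q (ptw l w) (nab l v)) ?h) =
     - ksgn ?\<epsilon> (ksgn (lpar l) (var 1 l ?P) + kext (1 + lpar l) (\<lambda>w. W Q (nab l w) v) ?h)"
    by (cases ?\<epsilon>; cases "lpar l") (simp_all add: ksgn_minus ksgn_add)
  also have "\<dots> = kext 1 (\<lambda>u. W Q u v) (foldr shiftD (ws @ [l]) (const u))"
  proof -
    have dv: "var 1 l ?h = ksgn ?\<epsilon> (foldr shiftD ws (var 1 l (const u)))"
      by (rule foldr_op_commute[where D=fin, THEN conjunct1]) (auto intro!: var_sop sop_fin)
    have dc: "coeff_op (lpar l) (nab l) ?h = ksgn ?\<epsilon> (foldr shiftD ws (coeff_op (lpar l) (nab l) (const u)))"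
      by (rule foldr_op_commute[where D=fin, THEN conjunct1]) (auto intro!: coeff_nab_sop sop_fin)
    have "foldr shiftD (ws @ [l]) (const u) = - ksgn ?\<epsilon> (var 1 l ?h + coeff_op (lpar l) (nab l) ?h)"
      unfolding dv dc by (simp add: sop_def additive.diff[OF aD[unfolded One_nat_def]] additive.minus[OF aD[unfolded One_nat_def]] ksgn_add)
    then show ?thesis
      using aW fW hfin
      by (simp add: additive.minus[OF additive_kext] additive_ksgn_commute[OF additive_kext] additive.add[OF additive_kext] kext_var kext_coeff_op)
  qed
  finally show ?case .
qed

end

text \<open>The word of a monomial in the single supervariable with index 0; only the directions are
  recorded, in the order in which \<open>monop\<close> composes them.\<close>

definition letters :: "mono \<Rightarrow> nat option list"
  where "letters m = map (\<lambda>_. None) (sorted_list_of_multiset (fst m)) @ map (\<lambda>(k, i). Some i) (sorted_list_of_set (snd m))"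

lemma monop_letters:
  assumes "\<forall>k\<in>#fst m. k = 0" "finite (snd m)" "\<forall>(k, i)\<in>snd m. k = 0"
  shows "monop L Od m x = foldr (opr L Od 0) (letters m) x"
proof -
  have "foldr (\<lambda>(k, i). Od k i) (sorted_list_of_set (snd m)) x = foldr (\<lambda>(k, i). Od 0 i) (sorted_list_of_set (snd m)) x"
    using assms by (intro foldr_cong) auto
  moreover have "foldr L (sorted_list_of_multiset (fst m)) y = foldr (\<lambda>_. L 0) (sorted_list_of_multiset (fst m)) y" for y
    using assms by (intro foldr_cong) auto
  ultimately show ?thesis
    by (simp add: monop_def letters_def foldr_map o_def case_prod_unfold)
qed

lemma sum_listset_2: "(\<Sum>as\<in>listset [A, B]. g as) = (\<Sum>x\<in>A. \<Sum>y\<in>B. g [x, y])"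
proof -
  have "listset [A, B] = (\<lambda>(x, y). [x, y]) ` (A \<times> B)"
    by (auto simp: set_Cons_def)
  then have "(\<Sum>as\<in>listset [A, B]. g as) = (\<Sum>(x, y)\<in>A \<times> B. g [x, y])"
    by (simp add: sum.reindex inj_on_def case_prod_unfold)
  then show ?thesis by (simp add: sum.cartesian_product)
qed

lemma keys_const: "Poly_Mapping.keys (const w) = (if w = 0 then {} else {({#}, {})})"
  by (simp add: const_def)

lemma mono_shift_simps [simp]: "mono_shift 0 m = m" "mono_shift d ({#}, {}) = ({#}, {})"
  by (simp_all add: mono_shift_def)

lemma monop_one [simp]: "monop L Od ({#}, {}) x = x"
  by (simp add: monop_def)

lemma sum_less_2: "(\<Sum>j<2. g j) = g 0 + g (Suc 0)"
  by (simp add: numeral_2_eq_2)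

lemma upt_2: "[0..<2] = [0, Suc 0]"
  by (simp add: numeral_2_eq_2)

lemma seg_21 [simp]: "seg nu 0 [a, b, c] = [a, b]" "seg nu (Suc 0) [a, b, c] = [c]"
  by (simp_all add: seg_def numeral_2_eq_2)

context hwmodule
begin

lemma by_parity_additive_3:
  assumes "\<And>a b. additive (F a b)" "\<And>a c. additive (\<lambda>b. F a b c)" "\<And>b c. additive (\<lambda>a. F a b c)"
  shows "by_parity M (\<lambda>ps us. F (us ! 0) (us ! 1) (us ! 2)) [a, b, c] = F a b c"
proof -
  have "by_parity M (\<lambda>ps us. F (us ! 0) (us ! 1) (us ! 2)) [a, b, c] =
    (\<Sum>p\<in>UNIV. by_parity M (\<lambda>ps us. F (proj M p a) (us ! 0) (us ! 1)) [b, c])"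
    by (simp add: numeral_2_eq_2)
  also have "\<dots> = (\<Sum>p\<in>UNIV. F (proj M p a) b c)"
    by (intro sum.cong refl by_parity_additive_2) (rule assms)+
  also have "\<dots> = F a b c"
    using additive.sum[OF assms(3)[of b c], of "\<lambda>p. proj M p a" UNIV] by (simp add: proj_sum)
  finally show ?thesis .
qed

end

context symmetric_operation
begin

abbreviation CE :: "quiver \<Rightarrow> nat \<Rightarrow> ('b list \<Rightarrow>\<^sub>0 'a) spoly \<Rightarrow> ('b list \<Rightarrow>\<^sub>0 'a) spoly" where "CE \<equiv> comp_even M nu"
abbreviation CO :: "quiver \<Rightarrow> nat \<Rightarrow> nat \<Rightarrow> ('b list \<Rightarrow>\<^sub>0 'a) spoly \<Rightarrow> ('b list \<Rightarrow>\<^sub>0 'a) spoly" where "CO \<equiv> comp_odd M nu"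
abbreviation Ys :: "('b operation \<times> bit) list" where "Ys \<equiv> [(X, 1), (id_operation N M, 0)]"
abbreviation tens :: "'b list \<Rightarrow> ('b list \<Rightarrow>\<^sub>0 'a) spoly" where "tens u \<equiv> const (Poly_Mapping.single u 1)"

text \<open>The identity in the second place contributes the constant \<open>c\<close>. Its only
  possible key is the trivial monomial, which is absent for c = 0; hence the case
  distinction.\<close>

lemma comp_arg_eq:
  assumes Q: "Q \<in> quivers 3"
  shows "comp_arg M nu Ys Q ps [a, b, c] = (if c = 0 then 0 else
    \<Sum>m\<in>Poly_Mapping.keys (opval X (sq Q) a b). by_parity M (\<lambda>ds us. monop (CE Q) (CO Q) m (tens us))
      [Poly_Mapping.lookup (opval X (sq Q) a b) m, c])"
proof -
  let ?f = "opval X (sq Q) a b"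
  have y0: "nf M 2 (rep (X (sq Q) [a, b])) = ?f"
    unfolding opval_def by (rule nf_eq[OF well_valuedD(1)[OF wv sq_quivers[OF Q]]])
  have y1: "nf M (Suc 0) (rep (id_operation N M {#} [c])) = const c"
  proof -
    have "id_operation N M {#} [c] = cls N M (Suc 0) (const c)" by (simp add: id_operation_def)
    then show ?thesis using rep_cls[of "Suc 0" "const c"] nf_eq[of "rep (cls N M (Suc 0) (const c))" "Suc 0" "Suc 0"] by simp
  qed
  have "comp_arg M nu Ys Q ps [a, b, c] = (\<Sum>as\<in>listset [Poly_Mapping.keys ?f, Poly_Mapping.keys (const c)].
    by_parity M (\<lambda>ds us. ksgn (ds ! 0 * odeg (as ! 1))
       (monop (CE Q) (CO Q) (as ! 0) (monop (CE Q) (CO Q) (mono_shift 2 (as ! 1)) (tens us))))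
      (map2 Poly_Mapping.lookup [?f, const c] as))"
    unfolding comp_arg_def by (simp add: upt_2 y0 y1 sq_1[OF Q] sum_less_2 del: listset.simps)
  also have "\<dots> = (if c = 0 then 0 else
    \<Sum>m\<in>Poly_Mapping.keys ?f. by_parity M (\<lambda>ds us. monop (CE Q) (CO Q) m (tens us)) [Poly_Mapping.lookup ?f m, c])"
    unfolding sum_listset_2 keys_const by (simp add: odeg_def) (simp add: const_def)
  finally show ?thesis .
qed

text \<open>The invariant of all operators from which \<open>comp_arg\<close> is built. It allows
  \<open>\<Psi>\<close> to be replaced by its truncation, which is finite everywhere.\<close>

definition good :: "('b list \<Rightarrow>\<^sub>0 'a) spoly \<Rightarrow> bool"
  where "good g \<longleftrightarrow> g \<in> over (vr N 3) \<and> coeff_op 0 pairs_only g = g"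

lemma good_fin: "good g \<Longrightarrow> g \<in> fin"
  by (auto simp: good_def over_fin)

lemma good_0 [simp]: "good 0"
  by (simp add: good_def additive.zero)

lemma good_add: "good f \<Longrightarrow> good g \<Longrightarrow> good (f + g)"
  by (simp add: good_def over_add additive.add[OF additive_coeff_op])

lemma good_sum: "(\<And>i. i \<in> I \<Longrightarrow> good (f i)) \<Longrightarrow> good (sum f I)"
  by (induction I rule: infinite_finite_induct) (auto intro: good_add)

lemma good_tens: "length u = 2 \<Longrightarrow> good (tens u)"
  by (simp add: good_def coeff_op_const pairs_only_single)

lemma good_var: "good f \<Longrightarrow> k < 3 \<Longrightarrow> lv N l \<Longrightarrow> good (var k l f)"
  using good_fin[of f] by (auto simp: good_def coeff_op_var intro!: over_var)

lemma good_slot: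
  assumes f: "good f" and j: "j < 2"
  shows "good (coeff_op s (tens_op (slot_op M p \<phi> j)) f)"
proof -
  let ?t = "tens_op (slot_op M p \<phi> j) :: ('b list \<Rightarrow>\<^sub>0 'a) \<Rightarrow> _"
  have fin: "f \<in> fin" using f by (rule good_fin)
  have "length (slot_op M p \<phi> j u) = 2" if "length u = 2" for u :: "'b list"
    using j that by (auto simp: slot_op_def length_Suc_conv numeral_2_eq_2 less_Suc_eq)
  then have e: "pairs_only (?t (pairs_only w)) = ?t (pairs_only w)" for w
    by (intro additive_eq_on_singles[where f=w and F="\<lambda>w. pairs_only (?t (pairs_only w))" and G="\<lambda>w. ?t (pairs_only w)"])
      (simp_all add: pairs_only_single additive.zero[OF additive_tens_op] additive.zero[OF additive_pairs_only])
  have t: "coeff_op s ?t f = coeff_op s (\<lambda>w. ?t (pairs_only w)) f"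
  proof -
    have "coeff_op s ?t f = coeff_op s ?t (coeff_op 0 pairs_only f)" using f by (simp add: good_def)
    then show ?thesis using fin by (simp add: coeff_op_coeff_op)
  qed
  have "coeff_op 0 pairs_only (coeff_op s ?t f) = coeff_op s (\<lambda>w. pairs_only (?t (pairs_only w))) f"
    unfolding t using fin by (simp add: coeff_op_coeff_op)
  then have "coeff_op 0 pairs_only (coeff_op s ?t f) = coeff_op s ?t f" unfolding e t .
  then show ?thesis using f by (simp add: good_def coeff_op_over)
qed

lemma reach_21: "i \<in> reach nu Q k \<Longrightarrow> i < 2"
  by (simp add: reach_def)

lemma block_21_less: "l \<in> block nu i \<Longrightarrow> i < 2 \<Longrightarrow> l < 3"
  by (auto simp: less_2_cases_iff)

lemma good_CE: "good f \<Longrightarrow> good (CE Q 0 f)"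
  unfolding comp_even_def
  using good_var[of f _ None] by (auto intro!: good_add good_sum good_slot reach_21 simp: block_21_less reach_21)

lemma good_CO: "good f \<Longrightarrow> i < N \<Longrightarrow> good (CO Q 0 i f)"
  unfolding comp_odd_def
  using good_var[of f _ "Some i"] by (auto intro!: good_add good_sum good_slot reach_21 simp: block_21_less reach_21)

lemma good_foldr: "good f \<Longrightarrow> \<forall>l\<in>set ws. lv N l \<Longrightarrow> good (foldr (opr (CE Q) (CO Q) 0) ws f)"
proof (induction ws)
  case (Cons l ws)
  then show ?case by (cases l) (auto intro: good_CE good_CO)
qed simp

lemma kext_good: "good g \<Longrightarrow> kext 1 (\<Psi> Q) g = kext 1 (\<Psi>' Q) g"
  using kext_coeff_op_0[of "\<Psi> Q" pairs_only g 1] good_fin[of g] by (simp add: good_def)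

lemma kext_good_over: "Q \<in> quivers 3 \<Longrightarrow> good g \<Longrightarrow> kext 1 (\<Psi> Q) g \<in> over (vr N 3)"
  unfolding kext_good by (rule kext_over) (auto simp: good_def intro: \<Psi>'_over)

lemma keys_letters:
  assumes "f \<in> over (vr N 1)" "m \<in> Poly_Mapping.keys f"
  shows "monop L Od m x = foldr (opr L Od 0) (letters m) x" "\<forall>l\<in>set (letters m). lv N l"
proof -
  obtain A J where m: "m = (A, J)" by (cases m)
  note k = over_keysD[OF assms(1) assms(2)[unfolded m]]
  show "monop L Od m x = foldr (opr L Od 0) (letters m) x"
    using k by (intro monop_letters) (auto simp: m)
  show "\<forall>l\<in>set (letters m). lv N l"
    using k by (auto simp: m letters_def)
qed

definition touch :: "quiver \<Rightarrow> bool"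
  where "touch Q \<longleftrightarrow> (\<exists>e\<in>#oe Q. fst e = 0 \<or> snd e = 0)"

text \<open>The normal form of the composite on \<open>Q\<close>. Two outer edges collapse to a
  double edge, where the outer operation vanishes; one outer edge at vertex 0 causes the shift,
  which has become a \<open>flip\<close> of the inner value; otherwise the inner value is inserted
  as it is.\<close>

definition K :: "quiver \<Rightarrow> 'b \<Rightarrow> 'b \<Rightarrow> 'b \<Rightarrow> 'b spoly"
  where "K Q a b c = (if 2 \<le> size (oe Q) then 0 else kext 1 (\<lambda>u. W Q u c)
    (if touch Q then flip 1 (opval X (sq Q) a b) else opval X (sq Q) a b))"

lemma nn_term:
  assumes Q: "Q \<in> quivers 3" and m: "m \<in> Poly_Mapping.keys (opval X (sq Q) a b)" and us: "length us = 2"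
  shows "nn 3 (kext 1 (\<Psi> Q) (monop (CE Q) (CO Q) m (tens us))) =
    (if 2 \<le> size (oe Q) then 0 else if touch Q
     then kext 1 (\<lambda>u. W Q u (us ! 1)) (monop (\<lambda>k. sop UNIV {1} k None) (\<lambda>k i. sop UNIV {1} k (Some i)) m (const (us ! 0)))
     else ksgn (odeg m) (monop lam tht m (W Q (us ! 0) (us ! 1))))"
proof -
  let ?f = "opval X (sq Q) a b"
  have f: "?f \<in> over (vr N 1)" by (rule well_valuedD(3)[OF wv sq_quivers[OF Q]])
  note ml = keys_letters(1)[OF f m] and lv = keys_letters(2)[OF f m]
  obtain u v where uv: "us = [u, v]" using us by (auto simp: length_Suc_conv numeral_2_eq_2)
  let ?g = "foldr (opr (CE Q) (CO Q) 0) (letters m) (tens us)"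
  have g: "good ?g" by (rule good_foldr[OF good_tens[OF us] lv])
  consider (zero) "2 \<le> size (oe Q)" | (shift) "\<not> 2 \<le> size (oe Q)" "touch Q"
    | (plain) "\<not> 2 \<le> size (oe Q)" "\<not> touch Q" by blast
  then show ?thesis
  proof cases
    case zero
    have "opval X (co Q) x y = 0" for x y
      using sym_op_pair(2)[OF sym co_quivers[OF Q], of x y] size_2_pval[of "co Q"] zero by (simp add: size_co)
    then have W0: "W Q x y = 0" for x y by (simp add: W_def)
    have "nn 3 (kext 1 (\<Psi>' Q) h) = 0" if "h \<in> fin" for h
      using that
    proof (rule over_additive_eq[where G="\<lambda>_. 0"])
      fix k l h assume h: "h \<in> fin" "nn 3 (kext 1 (\<Psi>' Q) h) = 0"
      then show "nn 3 (kext 1 (\<Psi>' Q) (var k l h)) = 0"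
        using \<Psi>'_fin[OF Q] by (simp add: kext_var additive_ksgn_commute[OF additive_sub] sub_var kext_fin additive.zero[OF additive_sop])
    next
      show "nn 3 (kext 1 (\<Psi>' Q) (const w)) = 0" for w
        by (subst kext_const) (rule additive_\<Psi>_comp additive_pairs_only nn_\<Psi>'_zero[OF Q W0])+
    qed simp_all
    then show ?thesis using zero good_fin[OF g] unfolding ml kext_good[OF g] by simp
  next
    case shift
    then obtain e where e: "e \<in># oe Q" "fst e = 0 \<or> snd e = 0" unfolding touch_def by blast
    then have "size (oe Q) \<noteq> 0" by auto
    then have "size (oe Q) = 1" using shift(1) by linarith
    then have oe: "oe Q = {#e#}" using e(1) by (metis size_1_singleton_mset singletonD set_mset_single)
    have r: "reach nu Q 0 = {1}" by (rule reach_single[OF Q oe e(2)])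
    have co: "co Q \<noteq> {#}" using size_co[of Q] oe by auto
    have "?g = foldr shiftC (letters m) (tens us)"
    proof (rule foldr_cong[OF refl refl])
      fix l x assume "l \<in> set (letters m)"
      then have "lv N l" using lv by blast
      then show "opr (CE Q) (CO Q) 0 l x = shiftC l x"
        by (cases l) (simp_all add: comp_even_def comp_odd_def r shiftC_def nab_def)
    qed
    moreover have "foldr (opr (\<lambda>k. sop UNIV {1} k None) (\<lambda>k i. sop UNIV {1} k (Some i)) 0) (letters m) (const u) = foldr shiftD (letters m) (const u)"
    proof (rule foldr_cong[OF refl refl])
      fix l x show "opr (\<lambda>k. sop UNIV {1} k None) (\<lambda>k i. sop UNIV {1} k (Some i)) 0 l x = shiftD l x" by (cases l) simp_all
    qed
    ultimately show ?thesis
      using shift nn_shift[OF Q co lv, of u v] unfolding ml uv by (simp add: kext_\<Psi>_eq)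
  next
    case plain
    have "reach nu Q 0 = {}" using plain(2) unfolding touch_def by (intro reach_empty) auto
    then have "?g = foldr (var 0) (letters m) (tens us)"
      by (intro foldr_cong refl) (auto simp: comp_even_def comp_odd_def opr_def split: option.splits)
    also have "\<dots> = monop lam tht m (tens us)" by (rule ml[symmetric])
    also have "\<dots> = Poly_Mapping.single m (Poly_Mapping.single us 1)"
      using over_keysD(1)[OF f, of "fst m" "snd m"] m by (intro mop_var_single) auto
    finally have "kext 1 (\<Psi> Q) ?g = ksgn (odeg m) (foldr (var 0) (letters m) (\<Phi> Q us))"
      by (simp add: kext_single \<Psi>_single ml)
    \<comment> \<open>The normal form eliminates the variable with index 2 and so commutes with
      multiplication by the one with index 0.\<close>
    moreover have "nn 3 (foldr (var 0) (letters m) (\<Phi> Q us)) = ksgn (0 * sum_list (map lpar (letters m))) (foldr (var 0) (letters m) (nn 3 (\<Phi> Q us)))"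
      using \<Phi>_over[OF Q, of u v] unfolding uv
      by (intro foldr_op_commute[where D=fin, THEN conjunct1]) (auto simp: sub_var sop_def over_fin intro: over_var)
    ultimately show ?thesis
      using plain nn_\<Phi>[OF Q, of u v] unfolding ml uv by (simp add: additive_ksgn_commute[OF additive_sub])
  qed
qed

lemma additive_term:
  assumes "Q \<in> quivers 3"
  shows "additive (K Q a b)" "additive (\<lambda>b. K Q a b c)" "additive (\<lambda>a. K Q a b c)"
proof -
  note b = bilD(1,2)[OF bil_opval[OF sq_quivers[OF assms]]]
  have p: "kext 1 (\<lambda>u. W Q u (c + c')) f = kext 1 (\<lambda>u. W Q u c) f + kext 1 (\<lambda>u. W Q u c') f" for c c' f
    by (simp add: additive.add[OF additive_W(1)[OF assms]] kext_plus)
  show "additive (K Q a b)" unfolding K_def additive_def by (simp add: p)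
  show "additive (\<lambda>b. K Q a b c)" "additive (\<lambda>a. K Q a b c)"
    unfolding K_def additive_def
    by (simp_all add: additive.add[OF b(1)] additive.add[OF b(2)] additive.add[OF additive_sub]
      additive.add[OF additive_kext[OF additive_W(2)[OF assms]]])
qed

lemma compose_eq:
  assumes Q: "Q \<in> quivers 3"
  obtains G where "G \<in> over (vr N 3)" "compose N M nu X 1 Ys Q [a, b, c] = cls N M 3 G" "nn 3 G = K Q a b c"
proof
  let ?t = "\<lambda>ps us. kext 1 (\<Psi> Q) (comp_arg M nu Ys Q ps us)"
  let ?G = "by_parity M ?t [a, b, c]"
  have gm: "good (monop (CE Q) (CO Q) m (tens us))" if "m \<in> Poly_Mapping.keys (opval X (sq Q) a b)" "length us = 2" for m us a b
    unfolding keys_letters(1)[OF well_valuedD(3)[OF wv sq_quivers[OF Q]] that(1)]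
    by (rule good_foldr[OF good_tens[OF that(2)] keys_letters(2)[OF well_valuedD(3)[OF wv sq_quivers[OF Q]] that(1)]])
  have "good (comp_arg M nu Ys Q ps [a, b, c])" for ps a b c
    unfolding comp_arg_eq[OF Q] by (auto simp: by_parity_def intro!: good_sum gm)
  then have "?t ps [a, b, c] \<in> over (vr N 3)" for ps a b c by (rule kext_good_over[OF Q])
  then show "?G \<in> over (vr N 3)" by (auto intro!: over_sum)
  show "compose N M nu X 1 Ys Q [a, b, c] = cls N M 3 ?G"
    using Q unfolding compose_def \<Psi>_def \<Phi>_def by simp
  have t: "nn 3 (?t ps [a, b, c]) = K Q a b c" for ps a b c
  proof (cases "c = 0")
    case True
    then show ?thesis unfolding comp_arg_eq[OF Q] by (simp add: additive.zero additive.zero[OF additive_term(1)[OF Q]])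
  next
    case False
    let ?f = "opval X (sq Q) a b"
    let ?D = "monop (\<lambda>k. sop UNIV {1} k None) (\<lambda>k i. sop UNIV {1} k (Some i))"
    let ?F = "\<lambda>m u v. if 2 \<le> size (oe Q) then 0 else if touch Q
     then kext 1 (\<lambda>u. W Q u v) (?D m (const u)) else ksgn (odeg m) (monop lam tht m (W Q u v))"
    have aF: "additive (?F m u)" "additive (\<lambda>u. ?F m u v)" for m u v
      using additive_W[OF Q]
      by (auto simp: additive_def kext_plus additive.add[OF additive_kext[OF additive_W(2)[OF Q]]] additive.add[OF sop.mop_additive]
        additive.add[OF mop_var_additive] additive.add[OF additive_const] ksgn_add)
    have "nn 3 (?t ps [a, b, c]) = (\<Sum>m\<in>Poly_Mapping.keys ?f. nn 3 (kext 1 (\<Psi> Q)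
        (by_parity M (\<lambda>ds us. monop (CE Q) (CO Q) m (tens us)) [Poly_Mapping.lookup ?f m, c])))"
      unfolding comp_arg_eq[OF Q] using False by (simp add: additive.sum[OF additive_kext] additive.sum[OF additive_sub])
    also have "\<dots> = (\<Sum>m\<in>Poly_Mapping.keys ?f. ?F m (Poly_Mapping.lookup ?f m) c)"
    proof (rule sum.cong[OF refl])
      fix m assume m: "m \<in> Poly_Mapping.keys ?f"
      have "nn 3 (kext 1 (\<Psi> Q) (by_parity M (\<lambda>ds us. monop (CE Q) (CO Q) m (tens us)) [Poly_Mapping.lookup ?f m, c])) =
        by_parity M (\<lambda>ds us. nn 3 (kext 1 (\<Psi> Q) (monop (CE Q) (CO Q) m (tens us)))) [Poly_Mapping.lookup ?f m, c]"
        by (rule additive_by_parity[where H="\<lambda>x. nn 3 (kext 1 (\<Psi> Q) x)"]) simp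
      also have "\<dots> = by_parity M (\<lambda>ds us. ?F m (us ! 0) (us ! 1)) [Poly_Mapping.lookup ?f m, c]"
        by (rule by_parity_cong, rule nn_term[OF Q m]) simp
      also have "\<dots> = ?F m (Poly_Mapping.lookup ?f m) c"
        by (rule by_parity_additive_2[of "?F m", OF aF])
      finally show "nn 3 (kext 1 (\<Psi> Q) (by_parity M (\<lambda>ds us. monop (CE Q) (CO Q) m (tens us)) [Poly_Mapping.lookup ?f m, c])) =
        ?F m (Poly_Mapping.lookup ?f m) c" .
    qed
    also have "\<dots> = K Q a b c"
    proof -
      have "kext 1 (\<lambda>u. W Q u c) (flip 1 ?f) = (\<Sum>m\<in>Poly_Mapping.keys ?f. kext 1 (\<lambda>u. W Q u c) (?D m (const (Poly_Mapping.lookup ?f m))))"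
        unfolding sub_def psubst_def lext_def by (rule additive.sum[OF additive_kext[OF additive_W(2)[OF Q]]])
      moreover have "kext 1 (\<lambda>u. W Q u c) ?f = (\<Sum>m\<in>Poly_Mapping.keys ?f. ksgn (odeg m) (monop lam tht m (W Q (Poly_Mapping.lookup ?f m) c)))"
        by (simp add: kext_def lext_def)
      ultimately show ?thesis unfolding K_def by simp
    qed
    finally show ?thesis .
  qed
  have "nn 3 ?G = by_parity M (\<lambda>ps us. nn 3 (?t ps us)) [a, b, c]"
    by (rule additive_by_parity) simp
  also have "\<dots> = by_parity M (\<lambda>ps us. K Q (us ! 0) (us ! 1) (us ! 2)) [a, b, c]"
  proof (rule by_parity_cong)
    fix ps :: "bit list" and us :: "'b list" assume "length us = length [a, b, c]"
    then obtain x y z where "us = [x, y, z]" by (auto simp: length_Suc_conv)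
    then show "nn 3 (?t ps us) = K Q (us ! 0) (us ! 1) (us ! 2)" using t by (simp add: numeral_2_eq_2)
  qed
  also have "\<dots> = K Q a b c" by (rule by_parity_additive_3) (rule additive_term[OF Q])+
  finally show "nn 3 ?G = K Q a b c" .
qed

end

subsection \<open>Permutations of three letters\<close>

definition perm :: "nat \<Rightarrow> nat \<Rightarrow> nat \<Rightarrow> nat \<Rightarrow> nat"
  where "perm i j k x = (if x = 0 then i else if x = 1 then j else if x = 2 then k else x)"

lemma perm_simps [simp]: "perm i j k 0 = i" "perm i j k (Suc 0) = j" "perm i j k 2 = k"
  by (simp_all add: perm_def)

lemma perm_comp: "perm i j k \<circ> perm 0 2 1 = perm i k j" "perm i j k \<circ> perm 1 2 0 = perm j k i"
    "perm i j k \<circ> perm 1 0 2 = perm j i k"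
  by (auto simp: perm_def fun_eq_iff)

lemma perm_id: "perm 0 1 2 = id"
  by (auto simp: perm_def fun_eq_iff)

definition valid3 :: "nat \<Rightarrow> nat \<Rightarrow> nat \<Rightarrow> bool"
  where "valid3 i j k \<longleftrightarrow> {i, j, k} = {0, 1, 2}"

lemma valid3_cases:
  assumes "valid3 i j k"
  obtains "i = 0" "j = 1" "k = 2" | "i = 0" "j = 2" "k = 1" | "i = 1" "j = 0" "k = 2"
    | "i = 1" "j = 2" "k = 0" | "i = 2" "j = 0" "k = 1" | "i = 2" "j = 1" "k = 0"
proof -
  have e: "{i, j, k} = {0, 1, 2}" using assms by (simp add: valid3_def)
  have "card {i, j, k} = 3" unfolding e by simp
  then have d: "i \<noteq> j" "i \<noteq> k" "j \<noteq> k" by (auto simp: card_insert_if split: if_splits)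
  have "i \<in> {0, 1, 2}" "j \<in> {0, 1, 2}" "k \<in> {0, 1, 2}" using e by blast+
  then show thesis by (elim insertE emptyE; use that d in simp)
qed

lemma valid3_simps [simp]: "valid3 0 (Suc 0) 2" "valid3 0 2 (Suc 0)" "valid3 (Suc 0) 0 2" "valid3 (Suc 0) 2 0" "valid3 2 0 (Suc 0)" "valid3 2 (Suc 0) 0"
  by (auto simp: valid3_def)

lemma perm_permutes: "valid3 i j k \<Longrightarrow> perm i j k permutes {..<3}"
proof -
  assume v: "valid3 i j k"
  have "inj_on (perm i j k) {..<3}"
    by (rule valid3_cases[OF v]) (auto simp: inj_on_def perm_def)
  moreover have "perm i j k ` {..<3} \<subseteq> {..<3}"
    by (rule valid3_cases[OF v]) (auto simp: perm_def)
  ultimately have "bij_betw (perm i j k) {..<3} {..<3}"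
    by (simp add: bij_betw_def endo_inj_surj)
  then show ?thesis by (rule bij_imp_permutes) (auto simp: perm_def)
qed

lemma permutes_3:
  assumes "\<sigma> permutes {..<3::nat}"
  shows "\<sigma> = perm (\<sigma> 0) (\<sigma> 1) (\<sigma> 2)" "valid3 (\<sigma> 0) (\<sigma> 1) (\<sigma> 2)"
proof -
  show "\<sigma> = perm (\<sigma> 0) (\<sigma> 1) (\<sigma> 2)"
    using assms by (auto simp: perm_def fun_eq_iff permutes_def)
  have "{..<3} = {0, 1, 2::nat}" by auto
  then show "valid3 (\<sigma> 0) (\<sigma> 1) (\<sigma> 2)"
    using permutes_image[OF assms] by (simp add: valid3_def)
qed

lemma shuffles_3: "{\<sigma>. \<sigma> permutes {..<3} \<and> \<sigma> 0 < \<sigma> (1::nat)} = {perm 0 1 2, perm 0 2 1, perm 1 2 0}"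
proof (intro equalityI subsetI)
  fix \<sigma> :: "nat \<Rightarrow> nat" assume s: "\<sigma> \<in> {\<sigma>. \<sigma> permutes {..<3} \<and> \<sigma> 0 < \<sigma> 1}"
  then have p: "\<sigma> permutes {..<3}" and l: "\<sigma> 0 < \<sigma> 1" by auto
  have "perm (\<sigma> 0) (\<sigma> 1) (\<sigma> 2) \<in> {perm 0 1 2, perm 0 2 1, perm 1 2 0}"
    by (rule valid3_cases[OF permutes_3(2)[OF p]]) (use l in simp_all)
  then show "\<sigma> \<in> {perm 0 1 2, perm 0 2 1, perm 1 2 0}" using permutes_3(1)[OF p] by simp
qed (auto intro!: perm_permutes)

lemma perm_distinct: "perm 0 1 2 \<noteq> perm 0 2 1" "perm 0 1 2 \<noteq> perm 1 2 0" "perm 0 2 1 \<noteq> perm 1 2 0"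
proof -
  have "perm 0 1 2 1 \<noteq> perm 0 2 1 1" "perm 0 1 2 0 \<noteq> perm 1 2 0 0" "perm 0 2 1 0 \<noteq> perm 1 2 0 0" by simp_all
  then show "perm 0 1 2 \<noteq> perm 0 2 1" "perm 0 1 2 \<noteq> perm 1 2 0" "perm 0 2 1 \<noteq> perm 1 2 0" by metis+
qed

lemma inv_perm: "inv (perm 0 1 2) = perm 0 1 2" "inv (perm 0 2 1) = perm 0 2 1" "inv (perm 1 2 0) = perm 2 0 1"
  by (rule inv_unique_comp; auto simp: fun_eq_iff perm_def)+

lemma perm_sign_3: "perm_sign 3 \<sigma> ps = (if \<sigma> 0 > \<sigma> 1 then ps ! 0 * ps ! 1 else 0) +
  ((if \<sigma> 0 > \<sigma> 2 then ps ! 0 * ps ! 2 else 0) + (if \<sigma> 1 > \<sigma> 2 then ps ! 1 * ps ! 2 else 0))"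
proof -
  have "{(k, l). k < l \<and> l < 3 \<and> \<sigma> k > \<sigma> l} = {x \<in> {(0, 1), (0, 2), (1, 2)}. \<sigma> (fst x) > \<sigma> (snd x :: nat)}"
    by (auto simp: eval_nat_numeral less_Suc_eq)
  then have "perm_sign 3 \<sigma> ps = (\<Sum>x\<in>{(0, 1), (0, 2), (1, 2)}. if \<sigma> (fst x) > \<sigma> (snd x) then ps ! fst x * ps ! snd x else 0)"
    unfolding perm_sign_def by (simp only: sum.inter_filter[symmetric] finite_insert finite.emptyI case_prod_unfold)
  then show ?thesis by simp
qed

abbreviation qmap :: "(nat \<Rightarrow> nat) \<Rightarrow> quiver \<Rightarrow> quiver"
  where "qmap \<sigma> Q \<equiv> image_mset (map_prod \<sigma> \<sigma>) Q"

lemma qmap_quivers: "\<sigma> permutes {..<n} \<Longrightarrow> Q \<in> quivers n \<Longrightarrow> qmap \<sigma> Q \<in> quivers n"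
proof -
  assume s: "\<sigma> permutes {..<n}" and Q: "Q \<in> quivers n"
  have "x < n \<and> y < n \<and> x \<noteq> y" if xy: "(x, y) \<in># qmap \<sigma> Q" for x y
  proof -
    obtain u v where uv: "(u, v) \<in># Q" "x = \<sigma> u" "y = \<sigma> v" using xy by auto
    then have "u < n \<and> v < n \<and> u \<noteq> v" using Q by (auto simp: quivers_def)
    then show ?thesis using uv permutes_in_image[OF s] permutes_inj[OF s] by (auto dest: injD)
  qed
  then show ?thesis unfolding quivers_def by blast
qed

lemma qmap_qmap: "qmap \<sigma> (qmap \<rho> Q) = qmap (\<sigma> \<circ> \<rho>) Q"
  by (induction Q) auto

lemma nat_upt_3: "[0..<3] = [0, Suc 0, 2]"
  by (simp add: eval_nat_numeral)

context symmetric_operation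
begin

abbreviation C :: "'b operation" where "C \<equiv> compose N M nu X 1 Ys"

lemma perm_partition: "\<sigma> permutes {..<3} \<Longrightarrow> (\<Union>k<3. {\<sigma> k}) = {..<3}" "\<sigma> permutes {..<3} \<Longrightarrow> disjoint_family_on (\<lambda>k. {\<sigma> k}) {..<3}"
  using permutes_image[of \<sigma> "{..<3}"] permutes_inj[of \<sigma> "{..<3}"] by (auto simp: disjoint_family_on_def dest: injD)

lemma perm_over: "\<sigma> permutes {..<3} \<Longrightarrow> f \<in> over (vr N 3) \<Longrightarrow> vsub (\<lambda>k. {\<sigma> k}) f \<in> over (vr N 3)"
  using permutes_in_image[of \<sigma> "{..<3}"] by (erule_tac vsub_over) auto

lemma nn_perm: "\<sigma> permutes {..<3} \<Longrightarrow> f \<in> over (vr N 3) \<Longrightarrow> nn 3 (vsub (\<lambda>k. {\<sigma> k}) (nn 3 f)) = nn 3 (vsub (\<lambda>k. {\<sigma> k}) f)"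
  using perm_partition[of \<sigma>] by (intro nn_vsub) auto

text \<open>The summand of X \<square> X belonging to \<sigma>, in normal form and without its
  Koszul sign. Since the inverse of \<sigma> acts, variables and arguments are relabelled by
  \<sigma> and the quiver by its inverse.\<close>

definition PP :: "quiver \<Rightarrow> (nat \<Rightarrow> nat) \<Rightarrow> 'b list \<Rightarrow> 'b spoly"
  where "PP Q \<sigma> vs = nn 3 (vsub (\<lambda>k. {\<sigma> k}) (K (qmap (inv \<sigma>) Q) (vs ! \<sigma> 0) (vs ! \<sigma> 1) (vs ! \<sigma> 2)))"

lemma compose_rep:
  assumes "Q \<in> quivers 3"
  shows "rep (C Q [a, b, c]) \<in> over (vr N 3)" "nn 3 (rep (C Q [a, b, c])) = K Q a b c"
proof -
  obtain G where "G \<in> over (vr N 3)" "C Q [a, b, c] = cls N M 3 G" "nn 3 G = K Q a b c" by (rule compose_eq[OF assms])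
  then show "rep (C Q [a, b, c]) \<in> over (vr N 3)" "nn 3 (rep (C Q [a, b, c])) = K Q a b c"
    using rep_cls[of 3 G] by auto
qed

lemma perm_act_rep:
  assumes s: "\<sigma> permutes {..<3}" and Q: "Q \<in> quivers 3"
  shows "rep (perm_act N M 3 C (inv \<sigma>) Q [a, b, c]) \<in> over (vr N 3)"
    "nn 3 (rep (perm_act N M 3 C (inv \<sigma>) Q [a, b, c])) = by_parity M (\<lambda>ps us. ksgn (perm_sign 3 (inv \<sigma>) ps) (PP Q \<sigma> us)) [a, b, c]"
proof -
  have ii: "inv (inv \<sigma>) = \<sigma>" by (rule permutes_inv_inv[OF s])
  have Q': "qmap (inv \<sigma>) Q \<in> quivers 3" by (rule qmap_quivers[OF permutes_inv[OF s] Q])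
  let ?f = "\<lambda>ps us. ksgn (perm_sign 3 (inv \<sigma>) ps) (vsub (\<lambda>k. {\<sigma> k}) (rep (C (qmap (inv \<sigma>) Q) [us ! \<sigma> 0, us ! \<sigma> 1, us ! \<sigma> 2])))"
  let ?G = "by_parity M ?f [a, b, c]"
  have e: "perm_act N M 3 C (inv \<sigma>) Q [a, b, c] = cls N M 3 ?G"
    using Q by (simp add: perm_act_def ii nat_upt_3)
  have G: "?G \<in> over (vr N 3)" using perm_over[OF s compose_rep(1)[OF Q']] by (auto intro!: over_sum)
  have n: "nn 3 ?G = by_parity M (\<lambda>ps us. ksgn (perm_sign 3 (inv \<sigma>) ps) (PP Q \<sigma> us)) [a, b, c]"
  proof -
    have "nn 3 (?f ps us) = ksgn (perm_sign 3 (inv \<sigma>) ps) (PP Q \<sigma> us)" for ps us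
      using nn_perm[OF s compose_rep(1)[OF Q']] unfolding PP_def compose_rep(2)[OF Q', symmetric]
      by (simp add: additive_ksgn_commute[OF additive_sub])
    then show ?thesis by (subst additive_by_parity[where H="nn 3"]) simp_all
  qed
  show "rep (perm_act N M 3 C (inv \<sigma>) Q [a, b, c]) \<in> over (vr N 3)"
    "nn 3 (rep (perm_act N M 3 C (inv \<sigma>) Q [a, b, c])) = by_parity M (\<lambda>ps us. ksgn (perm_sign 3 (inv \<sigma>) ps) (PP Q \<sigma> us)) [a, b, c]"
    unfolding e using rep_cls[OF _ G] n by auto
qed

text \<open>The value of X \<square> X on arguments of parities \<open>ps\<close>. The exponents are
  the Koszul signs of rearranging a, b, c into a, c, b and into b, c, a.\<close>

definition BX :: "quiver \<Rightarrow> bit list \<Rightarrow> 'b list \<Rightarrow> 'b spoly"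
  where "BX Q ps vs = PP Q (perm 0 1 2) vs + (ksgn (ps ! 1 * ps ! 2) (PP Q (perm 0 2 1) vs) +
    ksgn (ps ! 0 * ps ! 1 + ps ! 0 * ps ! 2) (PP Q (perm 1 2 0) vs))"

lemma PP_zero:
  assumes "Q \<in> quivers 3" "valid3 i j k" "0 \<in> set [a, b, c]"
  shows "PP Q (perm i j k) [a, b, c] = 0"
proof -
  have Q': "qmap (inv (perm i j k)) Q \<in> quivers 3" by (rule qmap_quivers[OF permutes_inv[OF perm_permutes[OF assms(2)]] assms(1)])
  show ?thesis
    using assms(3) additive.zero[OF additive_term(1)[OF Q']] additive.zero[OF additive_term(2)[OF Q']] additive.zero[OF additive_term(3)[OF Q']]
    by (cases rule: valid3_cases[OF assms(2)]) (auto simp: PP_def)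
qed

lemma box_iff:
  "box_square N M X = zero_operation N M 3 \<longleftrightarrow> (\<forall>Q\<in>quivers 3. \<forall>p q r. \<forall>a\<in>hpart M p. \<forall>b\<in>hpart M q. \<forall>c\<in>hpart M r.
    BX Q [p, q, r] [a, b, c] = 0)"
proof -
  have box: "box_square N M X = sum_operation N M 3 (\<lambda>\<sigma>. perm_act N M 3 C (inv \<sigma>)) {perm 0 1 2, perm 0 2 1, perm 1 2 0}"
    unfolding box_square_def nu_def shuffles_3[symmetric] ..
  have eq: "box_square N M X Q [a, b, c] = zero_operation N M 3 Q [a, b, c] \<longleftrightarrow> by_parity M (BX Q) [a, b, c] = 0"
    if Q: "Q \<in> quivers 3" for Q a b c
  proof -
    let ?r = "\<lambda>\<sigma>. rep (perm_act N M 3 C (inv \<sigma>) Q [a, b, c])"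
    let ?S = "\<Sum>\<sigma>\<in>{perm 0 1 2, perm 0 2 1, perm 1 2 0}. ?r \<sigma>"
    have v: "perm 0 1 2 permutes {..<3}" "perm 0 2 1 permutes {..<3}" "perm 1 2 0 permutes {..<3}"
      by (rule perm_permutes, simp)+
    have S: "?S \<in> over (vr N 3)" using perm_act_rep(1)[OF _ Q] v by (intro over_sum) auto
    have "nn 3 ?S = nn 3 (?r (perm 0 1 2)) + (nn 3 (?r (perm 0 2 1)) + nn 3 (?r (perm 1 2 0)))"
      using perm_distinct by (simp add: additive.add[OF additive_sub])
    also have "\<dots> = by_parity M (BX Q) [a, b, c]"
      unfolding perm_act_rep(2)[OF v(1) Q] perm_act_rep(2)[OF v(2) Q] perm_act_rep(2)[OF v(3) Q]
      unfolding inv_perm BX_def perm_sign_3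
      by (simp add: by_parity_def sum.distrib)
    finally have n: "nn 3 ?S = by_parity M (BX Q) [a, b, c]" .
    have "box_square N M X Q [a, b, c] = zero_operation N M 3 Q [a, b, c] \<longleftrightarrow> cls N M 3 ?S = cls N M 3 0"
      using Q unfolding box sum_operation_def zero_operation_def by simp
    also have "\<dots> \<longleftrightarrow> nn 3 ?S = nn 3 0" by (rule cls_eq_iff) (use S in auto)
    finally show ?thesis unfolding n by simp
  qed
  have ext: "box_square N M X = zero_operation N M 3 \<longleftrightarrow> (\<forall>Q\<in>quivers 3. \<forall>a b c. by_parity M (BX Q) [a, b, c] = 0)"
  proof
    assume h: "\<forall>Q\<in>quivers 3. \<forall>a b c. by_parity M (BX Q) [a, b, c] = 0"
    show "box_square N M X = zero_operation N M 3"
    proof (intro ext)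
      fix Q vs
      show "box_square N M X Q vs = zero_operation N M 3 Q vs"
      proof (cases "Q \<in> quivers 3 \<and> length vs = 3")
        case True
        then obtain a b c where "vs = [a, b, c]" by (auto simp: length_Suc_conv eval_nat_numeral)
        then show ?thesis using eq[of Q a b c] h True by blast
      next
        case False
        then show ?thesis unfolding box sum_operation_def zero_operation_def by (simp only: if_False)
      qed
    qed
  qed (use eq in metis)
  show ?thesis
  proof
    assume h: "box_square N M X = zero_operation N M 3"
    show "\<forall>Q\<in>quivers 3. \<forall>p q r. \<forall>a\<in>hpart M p. \<forall>b\<in>hpart M q. \<forall>c\<in>hpart M r. BX Q [p, q, r] [a, b, c] = 0"
    proof (intro ballI allI)
      fix Q p q r a b c assume Q: "Q \<in> quivers 3" and abc: "a \<in> hpart M p" "b \<in> hpart M q" "c \<in> hpart M r"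
      have "by_parity M (BX Q) [a, b, c] = BX Q [p, q, r] [a, b, c]"
      proof (rule by_parity_hom)
        fix qs :: "bit list" and us :: "'b list" assume "length us = length [a, b, c]" "0 \<in> set us"
        then obtain x y z where us: "us = [x, y, z]" "0 \<in> set [x, y, z]" by (auto simp: length_Suc_conv)
        then show "BX Q qs us = 0" using PP_zero[OF Q _ us(2)] unfolding BX_def us(1) by simp
      qed (use abc in simp)
      then show "BX Q [p, q, r] [a, b, c] = 0" using h Q unfolding ext by simp
    qed
  next
    assume h: "\<forall>Q\<in>quivers 3. \<forall>p q r. \<forall>a\<in>hpart M p. \<forall>b\<in>hpart M q. \<forall>c\<in>hpart M r. BX Q [p, q, r] [a, b, c] = 0"
    have "BX Q [p, q, r] [proj M p a, proj M q b, proj M r c] = 0" if "Q \<in> quivers 3" for Q p q r a b c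
      using h that proj_hpart by blast
    then show "box_square N M X = zero_operation N M 3" unfolding ext by simp
  qed
qed

end

section \<open>Symmetry of the square under relabelling of the vertices\<close>

abbreviation sw :: "nat \<Rightarrow> nat" where "sw \<equiv> transpose 0 (Suc 0)"

lemma sw_eq_perm: "perm 1 0 2 = sw"
  by (auto simp: perm_def transpose_def fun_eq_iff)

lemma block_of_sw: "x \<in> {0, 1, 2} \<Longrightarrow> block_of nu (sw x) = block_of nu x"
  by (auto simp: transpose_def)

lemma filter_qmap: "(\<And>e. e \<in># Q \<Longrightarrow> P (map_prod f f e) \<longleftrightarrow> P' e) \<Longrightarrow> filter_mset P (qmap f Q) = qmap f (filter_mset P' Q)"
  by (induction Q) auto

lemma oe_sw: "Q \<in> quivers 3 \<Longrightarrow> oe (qmap sw Q) = qmap sw (oe Q)"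
  unfolding outer_edges_def
proof (rule filter_qmap)
  fix e assume "Q \<in> quivers 3" "e \<in># Q"
  then show "(case map_prod sw sw e of (s, t) \<Rightarrow> block_of nu s \<noteq> block_of nu t) \<longleftrightarrow> (case e of (s, t) \<Rightarrow> block_of nu s \<noteq> block_of nu t)"
    using quivers_3_edge[of Q e] by (cases e) (simp add: block_of_sw)
qed

lemma co_sw: "Q \<in> quivers 3 \<Longrightarrow> co (qmap sw Q) = co Q"
proof -
  assume Q: "Q \<in> quivers 3"
  have "co (qmap sw Q) = image_mset (\<lambda>e. map_prod (block_of nu) (block_of nu) (map_prod sw sw e)) (oe Q)"
    unfolding collapse_def oe_sw[OF Q] by (simp add: multiset.map_comp o_def)
  also have "\<dots> = image_mset (map_prod (block_of nu) (block_of nu)) (oe Q)"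
  proof (rule image_mset_cong)
    fix e assume "e \<in># oe Q"
    then show "map_prod (block_of nu) (block_of nu) (map_prod sw sw e) = map_prod (block_of nu) (block_of nu) e"
      using oe_edge[OF Q, of e] by auto
  qed
  finally show ?thesis by (simp add: collapse_def)
qed

lemma size_sq_oe: "Q \<in> quivers 3 \<Longrightarrow> size (sq Q) + size (oe Q) = size Q"
proof -
  assume Q: "Q \<in> quivers 3"
  have "oe Q = filter_mset (\<lambda>e. \<not> (case e of (s, t) \<Rightarrow> s < 2 \<and> t < 2)) Q"
    unfolding outer_edges_def
  proof (rule filter_mset_cong[OF refl])
    fix e assume "e \<in># Q"
    then show "(case e of (s, t) \<Rightarrow> block_of nu s \<noteq> block_of nu t) \<longleftrightarrow> \<not> (case e of (s, t) \<Rightarrow> s < 2 \<and> t < 2)"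
      using quivers_3_edge[OF Q, of e] by (cases e) auto
  qed
  moreover have "size (filter_mset P Q) + size (filter_mset (\<lambda>e. \<not> P e) Q) = size Q" for P :: "nat \<times> nat \<Rightarrow> bool"
    by (induction Q) auto
  ultimately show ?thesis by (simp only: sq_eq[OF Q])
qed

context hwmodule
begin

lemma sq_sw: "Q \<in> quivers 3 \<Longrightarrow> sq (qmap sw Q) = qswap (sq Q)"
proof -
  assume Q: "Q \<in> quivers 3"
  have "qmap sw Q \<in> quivers 3"
    by (rule qmap_quivers[OF _ Q]) (auto intro: permutes_swap_id)
  moreover have "filter_mset (\<lambda>(s, t). s < 2 \<and> t < 2) (qmap sw Q) = qmap sw (filter_mset (\<lambda>(s, t). s < 2 \<and> t < 2) Q)"
  proof (rule filter_qmap)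
    fix e assume "e \<in># Q"
    then show "(case map_prod sw sw e of (s, t) \<Rightarrow> s < 2 \<and> t < 2) \<longleftrightarrow> (case e of (s, t) \<Rightarrow> s < 2 \<and> t < 2)"
      using quivers_3_edge[OF Q, of e] by (cases e) (auto simp: transpose_def)
  qed
  ultimately show ?thesis using Q by (simp add: sq_eq qswap_def)
qed

text \<open>The substitution is an involution, as -(-\<Lambda> - \<nabla>) - \<nabla> =
  \<Lambda>.\<close>

lemma flip_flip: "f \<in> over (vr N 1) \<Longrightarrow> flip 0 (flip 0 f) = f"
proof (erule over_additive_eq)
  fix k l and f :: "'v spoly" assume k: "(k, l) \<in> vr N 1" "f \<in> over (vr N 1)" "flip 0 (flip 0 f) = f"
  then have "k = 0" "f \<in> fin" by (auto simp: over_fin)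
  then show "flip 0 (flip 0 (var k l f)) = var k l f"
    using k(3) by (simp add: sub_var sop_def additive.diff[OF additive_sub] additive.minus[OF additive_sub] sub_coeff_nab)
qed simp_all

lemma vsub_flip:
  assumes "f \<in> fin" "B i = {j}"
  shows "vsub B (flip i f) = flip j f"
  using assms(1)
proof (rule over_additive_eq)
  fix k l and f :: "'v spoly" assume f: "f \<in> fin" "vsub B (flip i f) = flip j f"
  then show "vsub B (flip i (var k l f)) = flip j (var k l f)"
    by (simp add: sub_var sop_def assms(2) additive.diff[OF additive_vsub] additive.minus[OF additive_vsub] vsub_var vsub_coeff_op)
qed simp_all

lemma flip_over: "f \<in> over S \<Longrightarrow> (\<And>k l. (k, l) \<in> S \<Longrightarrow> (j, l) \<in> T) \<Longrightarrow> flip j f \<in> over T"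
  unfolding sub_def by (erule sop.psub_over) (auto intro!: sop_over)

text \<open>Eliminating the variable with index 2 from the sum of those with indices j and 2 leaves
  minus the third variable minus \<nabla>; that variable has the index 1 - j.\<close>

lemma nn_vsub_pair:
  assumes "f \<in> over (vr N 1)" "j \<in> {0, 1}"
  shows "nn 3 (vsub (\<lambda>_. {j, 2}) f) = flip (1 - j) f"
  using assms(1)
proof (rule over_additive_eq)
  fix k l and f :: "'v spoly"
  assume k: "(k, l) \<in> vr N 1" "f \<in> over (vr N 1)" "nn 3 (vsub (\<lambda>_. {j, 2}) f) = flip (1 - j) f"
  then have f: "k = 0" "f \<in> fin" by (auto simp: over_fin)
  have J: "{j. j < 2} = {0, Suc 0}" by auto
  show "nn 3 (vsub (\<lambda>_. {j, 2}) (var k l f)) = flip (1 - j) (var k l f)"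
    using f k(3) assms(2) by (auto simp: vsub_var sub_var sop_def J additive.add[OF additive_sub])
qed simp_all

end

context symmetric_operation
begin

lemma opval_over: "Q \<in> quivers 2 \<Longrightarrow> opval X Q a b \<in> over (vr N 1)"
  by (rule well_valuedD(3)[OF wv])

lemma opval_swap:
  assumes "Q \<in> quivers 2" "a \<in> hpart M p" "b \<in> hpart M q"
  shows "opval X (qswap Q) b a = ksgn (p * q) (flip 0 (opval X Q a b))"
proof -
  have v: "\<forall>Q\<in>quivers 2. \<forall>a b. opval X Q a b = pval (opval X {#}) (opval X {#(0, 1)#}) Q a b"
    using sym_op_pair(2)[OF sym] by blast
  have "skew 0 (opval X {#}) \<and> skew 1 (opval X {#(0, 1)#})"
    using sym_op_pair(1)[OF sym] unfolding coisson_pair_def by blast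
  then have s: "opval X Q b a = ksgn (q * p) (flip 0 (opval X (qswap Q) a b))" if "Q \<in> quivers 2" for Q
    using sym_iff_skew[OF v] that assms(2,3) by blast
  have "qswap (qswap Q) = Q" using assms(1) by (cases rule: quivers_2_cases) (auto simp: qswap_def multiset.map_comp o_def prod.map_comp)
  then show ?thesis using s[OF qswap_quivers[OF assms(1)]] by (simp add: mult.commute)
qed

lemma W_no_edge:
  assumes Q: "Q \<in> quivers 3" "co Q = {#}" and l: "lv N l"
  shows "W Q (nab l u) v = - ksgn (lpar l) (var 0 l (W Q u v) + var 1 l (W Q u v))"
proof -
  have c: "coisson_pair (opval X {#}) (opval X {#(0, 1)#})" by (rule sym_op_pair(1)[OF sym])
  note b = bilD[OF bil_opval[OF quivers_2_simps(1)]]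
  have f: "opval X {#} u v \<in> fin" using b(5) over_fin by blast
  have "opval X {#} (nab l u) v = - ksgn (lpar l) (var 0 l (opval X {#} u v))"
    using c l b(7) unfolding coisson_pair_def by (cases l) auto
  then show ?thesis
    unfolding W_def Q(2) using vsub_var[OF f, of "\<lambda>_. {0, 1}" 0 l]
    by (simp add: additive.minus[OF additive_vsub] additive_ksgn_commute[OF additive_vsub])
qed

lemma fW: "Q \<in> quivers 3 \<Longrightarrow> W Q u v \<in> fin"
  using W_over over_fin by blast

text \<open>Without an outer edge, \<nabla> on the first argument of the outer operation acts as
  -\<Lambda>_1 - \<Lambda>_2. Hence -\<Lambda>_2 - \<nabla> acts as \<Lambda>_1, and the flip is
  invisible.\<close>

lemma kext_W_flip:
  assumes Q: "Q \<in> quivers 3" "co Q = {#}" and f: "f \<in> over (vr N 1)"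
  shows "kext 1 (\<lambda>u. W Q u v) (flip 1 f) = kext 1 (\<lambda>u. W Q u v) f"
  using f
proof (rule over_additive_eq)
  note aW = additive_W[OF Q(1)]
  fix k l and f :: "'b spoly"
  assume k: "(k, l) \<in> vr N 1" "f \<in> over (vr N 1)" and IH: "kext 1 (\<lambda>u. W Q u v) (flip 1 f) = kext 1 (\<lambda>u. W Q u v) f"
  then have f: "f \<in> fin" and k0: "k = 0" and l: "lv N l" by (auto simp: over_fin)
  let ?g = "flip 1 f" let ?P = "kext 1 (\<lambda>u. W Q u v) ?g"
  have g: "?g \<in> fin" using f by simp
  have "kext 1 (\<lambda>u. W Q u v) (flip 1 (var k l f)) = - kext 1 (\<lambda>u. W Q u v) (var 1 l ?g) - kext 1 (\<lambda>u. W Q u v) (coeff_op (lpar l) (nab l) ?g)"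
    using f aW by (simp add: sub_var sop_def additive.diff[OF additive_kext] additive.minus[OF additive_kext])
  also have "kext 1 (\<lambda>u. W Q u v) (coeff_op (lpar l) (nab l) ?g) = kext (1 + lpar l) (\<lambda>u. - ksgn (lpar l) (var 0 l (W Q u v) + var 1 l (W Q u v))) ?g"
    using g aW fW[OF Q(1)] by (simp add: kext_coeff_op W_no_edge[OF Q l])
  also have "\<dots> = - ksgn (lpar l) (kext (1 + lpar l) (\<lambda>u. var 0 l (W Q u v)) ?g + kext (1 + lpar l) (\<lambda>u. var 1 l (W Q u v)) ?g)"
    using aW by (simp add: kext_uminus kext_ksgn kext_plus)
  also have "\<dots> = - ksgn (lpar l) (var 0 l ?P + var 1 l ?P)"
    using g aW fW[OF Q(1)] by (simp add: var_kext)
  also have "kext 1 (\<lambda>u. W Q u v) (var 1 l ?g) = ksgn (lpar l) (var 1 l ?P)"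
    using g aW fW[OF Q(1)] by (simp add: kext_var)
  finally show "kext 1 (\<lambda>u. W Q u v) (flip 1 (var k l f)) = kext 1 (\<lambda>u. W Q u v) (var k l f)"
    using f aW fW[OF Q(1)] IH by (simp add: k0 kext_var ksgn_add)
qed (use additive_W[OF Q(1)] in simp_all)

lemma K_over: "Q \<in> quivers 3 \<Longrightarrow> K Q a b c \<in> over (vr N 2)"
proof -
  assume Q: "Q \<in> quivers 3"
  have "opval X (sq Q) a b \<in> over (vr N 2)" by (rule over_1_2[OF opval_over[OF sq_quivers[OF Q]]])
  moreover have "flip 1 (opval X (sq Q) a b) \<in> over (vr N 2)"
    by (rule flip_over[OF opval_over[OF sq_quivers[OF Q]]]) auto
  ultimately show ?thesis
    unfolding K_def using W_over[OF Q] additive_W[OF Q] by (auto intro!: kext_over)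
qed

lemma touch_sw:
  assumes "Q \<in> quivers 3" "size (oe Q) = 1"
  shows "touch (qmap sw Q) \<longleftrightarrow> \<not> touch Q"
proof -
  obtain e where e: "oe Q = {#e#}" using assms(2) size_1_singleton_mset by blast
  have "e \<in> {(0, 2), (2, 0), (1, 2), (2, 1)}" using oe_edge[OF assms(1), of e] e by simp
  then show ?thesis unfolding touch_def oe_sw[OF assms(1)] e by auto
qed

text \<open>Exchanging the inner vertices flips the inner value by skew-symmetry. It also moves a
  single outer edge from one inner vertex to the other, which switches the shift on or off. As
  \<open>flip\<close> is an involution, the two effects agree; without an outer edge the flip does
  not matter.\<close>

lemma K_swap:
  assumes Q: "Q \<in> quivers 3" and ab: "a \<in> hpart M p" "b \<in> hpart M q"
  shows "K Q a b c = ksgn (p * q) (vsub (\<lambda>k. {sw k}) (K (qmap sw Q) b a c))"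
proof -
  have Q': "qmap sw Q \<in> quivers 3" by (rule qmap_quivers[OF _ Q]) (auto intro: permutes_swap_id)
  let ?f = "opval X (sq Q) a b"
  have f: "?f \<in> over (vr N 1)" by (rule opval_over[OF sq_quivers[OF Q]])
  have ff: "?f \<in> fin" using f by (rule over_fin)
  note aW = additive_W[OF Q] and fW' = fW[OF Q]
  have WW: "W (qmap sw Q) = W Q" by (simp add: W_def co_sw[OF Q] fun_eq_iff)
  have sx: "opval X (sq (qmap sw Q)) b a = ksgn (p * q) (flip 0 ?f)"
    unfolding sq_sw[OF Q] by (rule opval_swap[OF sq_quivers[OF Q] ab])
  have vW: "vsub (\<lambda>k. {sw k}) (W Q u v) = W Q u v" for u v
    unfolding W_def by (rule vsub_vsub[OF opval_over[OF co_quivers[OF Q]]]) (auto simp: disjoint_family_on_def)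
  have vk: "vsub (\<lambda>k. {sw k}) (kext 1 (\<lambda>u. W Q u c) g) = kext 1 (\<lambda>u. W Q u c) (vsub (\<lambda>k. {sw k}) g)" if "g \<in> fin" for g
    using that aW fW' by (simp add: vsub_kext vW)
  have v0: "vsub (\<lambda>k. {sw k}) (flip 0 g) = flip 1 g" "vsub (\<lambda>k. {sw k}) (flip 1 g) = flip 0 g" if "g \<in> fin" for g
    using that by (auto intro: vsub_flip)
  have plain: "vsub (\<lambda>k. {sw k}) (kext 1 (\<lambda>u. W Q u c) (ksgn (p * q) (flip 0 ?f))) = ksgn (p * q) (kext 1 (\<lambda>u. W Q u c) (flip 1 ?f))"
    using ff aW vk[of "flip 0 ?f"] v0(1)[OF ff] by (simp add: additive_ksgn_commute[OF additive_kext] additive_ksgn_commute[OF additive_vsub])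
  have shift: "vsub (\<lambda>k. {sw k}) (kext 1 (\<lambda>u. W Q u c) (flip 1 (ksgn (p * q) (flip 0 ?f)))) = ksgn (p * q) (kext 1 (\<lambda>u. W Q u c) ?f)"
    using ff aW vk[of "flip 1 (flip 0 ?f)"] v0(2)[of "flip 0 ?f"] flip_flip[OF f]
    by (simp add: additive_ksgn_commute[OF additive_kext] additive_ksgn_commute[OF additive_vsub] additive_ksgn_commute[OF additive_sub])
  consider "2 \<le> size (oe Q)" | "size (oe Q) = 1" "touch Q" | "size (oe Q) = 1" "\<not> touch Q" | "size (oe Q) = 0" by linarith
  then show ?thesis
  proof cases
    case 1
    then show ?thesis by (simp add: K_def oe_sw[OF Q])
  next
    case 2
    then have "\<not> touch (qmap sw Q)" using touch_sw[OF Q] by simp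
    then show ?thesis using 2 plain by (simp add: K_def oe_sw[OF Q] WW sx)
  next
    case 3
    then have "touch (qmap sw Q)" using touch_sw[OF Q] by simp
    then show ?thesis using 3 shift by (simp add: K_def oe_sw[OF Q] WW sx)
  next
    case 4
    then have "oe Q = {#}" by simp
    then have "\<not> touch Q" "\<not> touch (qmap sw Q)" "co Q = {#}" by (simp_all add: touch_def oe_sw[OF Q] collapse_def)
    then show ?thesis using 4 plain kext_W_flip[OF Q _ f] by (simp add: K_def oe_sw[OF Q] WW sx)
  qed
qed

text \<open>Up to a Koszul sign, a summand depends only on which argument stays outside the inner
  operation.\<close>

lemma PP_swap:
  assumes Q: "Q \<in> quivers 3" and s: "\<sigma> permutes {..<3}"
    and h: "vs ! \<sigma> 0 \<in> hpart M p" "vs ! \<sigma> 1 \<in> hpart M q"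
  shows "PP Q (\<sigma> \<circ> sw) vs = ksgn (p * q) (PP Q \<sigma> vs)"
proof -
  let ?Q = "qmap (inv \<sigma>) Q"
  have Q': "?Q \<in> quivers 3" by (rule qmap_quivers[OF permutes_inv[OF s] Q])
  have w: "sw permutes {..<3::nat}" by (auto intro: permutes_swap_id)
  have "inv (\<sigma> \<circ> sw) = sw \<circ> inv \<sigma>"
    using permutes_bij[OF s] permutes_bij[OF w] by (simp add: o_inv_distrib)
  then have "PP Q (\<sigma> \<circ> sw) vs = nn 3 (vsub (\<lambda>k. {\<sigma> (sw k)}) (K (qmap sw ?Q) (vs ! \<sigma> 1) (vs ! \<sigma> 0) (vs ! \<sigma> 2)))"
    unfolding PP_def qmap_qmap by simp
  also have "vsub (\<lambda>k. {\<sigma> (sw k)}) (K (qmap sw ?Q) (vs ! \<sigma> 1) (vs ! \<sigma> 0) (vs ! \<sigma> 2)) =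
    vsub (\<lambda>k. {\<sigma> k}) (vsub (\<lambda>k. {sw k}) (K (qmap sw ?Q) (vs ! \<sigma> 1) (vs ! \<sigma> 0) (vs ! \<sigma> 2)))"
    by (rule vsub_vsub[OF K_over[OF qmap_quivers[OF w Q']], symmetric]) (auto simp: disjoint_family_on_def)
  also have "vsub (\<lambda>k. {sw k}) (K (qmap sw ?Q) (vs ! \<sigma> 1) (vs ! \<sigma> 0) (vs ! \<sigma> 2)) = ksgn (p * q) (K ?Q (vs ! \<sigma> 0) (vs ! \<sigma> 1) (vs ! \<sigma> 2))"
    using K_swap[OF Q' h] by (simp add: ksgn_eq_iff)
  finally show ?thesis
    by (simp add: PP_def[of Q \<sigma> vs] o_def additive_ksgn_commute[OF additive_vsub] additive_ksgn_commute[OF additive_sub])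
qed

lemma PP_transport:
  assumes Q: "Q \<in> quivers 3" and s: "\<rho> permutes {..<3}" "\<sigma> permutes {..<3}"
  shows "PP Q (\<rho> \<circ> \<sigma>) vs = nn 3 (vsub (\<lambda>k. {\<rho> k}) (PP (qmap (inv \<rho>) Q) \<sigma> (map (\<lambda>k. vs ! \<rho> k) [0..<3])))"
proof -
  let ?Q = "qmap (inv \<sigma>) (qmap (inv \<rho>) Q)"
  have Q': "?Q \<in> quivers 3" by (intro qmap_quivers permutes_inv s Q)
  have i: "inv (\<rho> \<circ> \<sigma>) = inv \<sigma> \<circ> inv \<rho>"
    using permutes_bij[OF s(1)] permutes_bij[OF s(2)] by (simp add: o_inv_distrib)
  have lt: "\<sigma> k < 3" if "k < 3" for k using permutes_in_image[OF s(2), of k] that by simp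
  let ?K = "K ?Q (vs ! \<rho> (\<sigma> 0)) (vs ! \<rho> (\<sigma> 1)) (vs ! \<rho> (\<sigma> 2))"
  have Ko: "?K \<in> over (vr N 3)" by (rule vr_mono[OF _ K_over[OF Q']]) simp
  have "nn 3 (vsub (\<lambda>k. {\<rho> k}) (PP (qmap (inv \<rho>) Q) \<sigma> (map (\<lambda>k. vs ! \<rho> k) [0..<3]))) =
    nn 3 (vsub (\<lambda>k. {\<rho> k}) (nn 3 (vsub (\<lambda>k. {\<sigma> k}) ?K)))"
    unfolding PP_def using lt by simp
  also have "\<dots> = nn 3 (vsub (\<lambda>k. {\<rho> k}) (vsub (\<lambda>k. {\<sigma> k}) ?K))"
    by (rule nn_perm[OF s(1) perm_over[OF s(2) Ko]])
  also have "vsub (\<lambda>k. {\<rho> k}) (vsub (\<lambda>k. {\<sigma> k}) ?K) = vsub (\<lambda>k. {\<rho> (\<sigma> k)}) ?K"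
    by (rule vsub_vsub[OF Ko]) (auto simp: disjoint_family_on_def)
  finally show ?thesis unfolding PP_def i qmap_qmap by simp
qed

text \<open>The square sums over representatives of the cosets of the exchange of the inner pair. By
  \<open>PP_swap\<close> the choice of representatives does not matter, so the sum is symmetric
  under all permutations, and it vanishes on a quiver once it does on a relabelled one.\<close>

lemma BX_transport:
  assumes Q: "Q \<in> quivers 3" and v: "valid3 i j k"
    and h: "a \<in> hpart M p" "b \<in> hpart M q" "c \<in> hpart M r"
    and z: "BX (qmap (inv (perm i j k)) Q) [[p, q, r] ! i, [p, q, r] ! j, [p, q, r] ! k] [[a, b, c] ! i, [a, b, c] ! j, [a, b, c] ! k] = 0"
  shows "BX Q [p, q, r] [a, b, c] = 0"
proof -
  let ?vs = "[a, b, c]" and ?ps = "[p, q, r]" and ?\<rho> = "perm i j k"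
  have pm: "perm 0 1 2 permutes {..<3}" "perm 0 2 1 permutes {..<3}" "perm 1 2 0 permutes {..<3}" "?\<rho> permutes {..<3}"
    using perm_permutes v by auto
  let ?V = "\<lambda>f. nn 3 (vsub (\<lambda>k. {?\<rho> k}) f)"
  have map3: "map (\<lambda>x. ?vs ! ?\<rho> x) [0..<3] = [?vs ! i, ?vs ! j, ?vs ! k]" by (simp add: nat_upt_3)
  note t = PP_transport[OF Q pm(4), of _ ?vs, unfolded map3]
  have "?V (BX (qmap (inv ?\<rho>) Q) [?ps ! i, ?ps ! j, ?ps ! k] [?vs ! i, ?vs ! j, ?vs ! k]) =
    PP Q (perm i j k) ?vs + (ksgn (?ps ! j * ?ps ! k) (PP Q (perm i k j) ?vs) +
      ksgn (?ps ! i * ?ps ! j + ?ps ! i * ?ps ! k) (PP Q (perm j k i) ?vs))"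
    unfolding BX_def using t[OF pm(1)] t[OF pm(2)] t[OF pm(3)] unfolding perm_comp perm_id o_id
    by (simp add: additive.add[OF additive_sub] additive.add[OF additive_vsub] additive_ksgn_commute[OF additive_sub] additive_ksgn_commute[OF additive_vsub])
  then have s: "PP Q (perm i j k) ?vs + (ksgn (?ps ! j * ?ps ! k) (PP Q (perm i k j) ?vs) +
      ksgn (?ps ! i * ?ps ! j + ?ps ! i * ?ps ! k) (PP Q (perm j k i) ?vs)) = 0"
    unfolding z by simp
  have sw0: "PP Q (perm 1 0 2) ?vs = ksgn (p * q) (PP Q (perm 0 1 2) ?vs)"
    "PP Q (perm 2 0 1) ?vs = ksgn (p * r) (PP Q (perm 0 2 1) ?vs)"
    "PP Q (perm 2 1 0) ?vs = ksgn (q * r) (PP Q (perm 1 2 0) ?vs)"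
    using PP_swap[OF Q pm(1), of ?vs p q] PP_swap[OF Q pm(2), of ?vs p r] PP_swap[OF Q pm(3), of ?vs q r] h
    by (simp_all add: sw_eq_perm[symmetric] perm_comp[simplified])
  define A B D where "A = PP Q (perm 0 1 2) ?vs" and "B = PP Q (perm 0 2 1) ?vs" and "D = PP Q (perm 1 2 0) ?vs"
  have fold: "PP Q (perm 0 (Suc 0) 2) ?vs = A" "PP Q (perm 0 2 (Suc 0)) ?vs = B" "PP Q (perm (Suc 0) 2 0) ?vs = D"
    "PP Q (perm (Suc 0) 0 2) ?vs = ksgn (p * q) A" "PP Q (perm 2 0 (Suc 0)) ?vs = ksgn (p * r) B" "PP Q (perm 2 (Suc 0) 0) ?vs = ksgn (q * r) D"
    using sw0 by (simp_all add: A_def B_def D_def)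
  \<comment> \<open>The sign is the Koszul sign of rearranging a, b, c into the order given by i, j,
    k.\<close>
  have "\<exists>t. A + (ksgn (q * r) B + ksgn (p * q + p * r) D) = ksgn t (PP Q (perm i j k) ?vs + (ksgn (?ps ! j * ?ps ! k) (PP Q (perm i k j) ?vs) +
      ksgn (?ps ! i * ?ps ! j + ?ps ! i * ?ps ! k) (PP Q (perm j k i) ?vs)))"
  proof (cases rule: valid3_cases[OF v])
    case 1
    then show ?thesis by (intro exI[of _ 0]) (simp add: fold)
  next
    case 2
    then show ?thesis by (intro exI[of _ "q * r"]) (simp add: fold ksgn_add ac_simps)
  next
    case 3
    then show ?thesis by (intro exI[of _ "p * q"]) (simp add: fold ksgn_add ac_simps)
  next
    case 4
    then show ?thesis by (intro exI[of _ "p * q + p * r"]) (simp add: fold ksgn_add ac_simps)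
  next
    case 5
    then show ?thesis by (intro exI[of _ "p * r + q * r"]) (simp add: fold ksgn_add ac_simps)
  next
    case 6
    then show ?thesis by (intro exI[of _ "p * q + p * r + q * r"]) (simp add: fold ksgn_add ac_simps)
  qed
  then show ?thesis unfolding s by (simp add: BX_def fold)
qed

end

subsection \<open>The Maurer--Cartan equation\<close>

lemma qmap_id: "qmap id Q = Q"
  by (induction Q) auto

context hwmodule
begin

lemma parp_vsub:
  assumes "f \<in> fin" "parp M p f"
  shows "parp M p (vsub (\<lambda>_. {j}) f)"
  using assms(2,1)
proof (rule parp_additive[OF additive_vsub])
  fix m w assume m: "finite (snd m)" and w: "w \<in> hpart M (p + odeg m)"
  have Od: "parp M (q + of_nat (length js)) (foldr (\<lambda>(k, i). tht j i) js f) \<and> foldr (\<lambda>(k, i). tht j i) js f \<in> fin"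
    if "parp M q f" "f \<in> fin" for js :: "(nat \<times> nat) list" and q f
    using that
  proof (induction js)
    case (Cons x js)
    then show ?case
      using parp_var[of "foldr (\<lambda>(k, i). tht j i) js f" "q + of_nat (length js)" "Some (snd x)" j]
        over_var[of j "Some (snd x)" UNIV "foldr (\<lambda>(k, i). tht j i) js f"]
      by (simp add: case_prod_unfold ac_simps)
  qed simp
  have L: "parp M q (foldr (\<lambda>k. lam j) ks f) \<and> foldr (\<lambda>k. lam j) ks f \<in> fin" if "parp M q f" "f \<in> fin" for ks :: "nat list" and q f
    using that
  proof (induction ks)
    case (Cons k ks)
    then show ?case using parp_var[of "foldr (\<lambda>k. lam j) ks f" q None j] over_var[of j None UNIV "foldr (\<lambda>k. lam j) ks f"] by simp
  qed simp
  have "parp M ((p + odeg m) + of_nat (length js)) (foldr (\<lambda>k. lam j) ks (foldr (\<lambda>(k, i). tht j i) js (const w)))" for js :: "(nat \<times> nat) list" and ks :: "nat list"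
    using L[OF conjunct1[OF Od[OF parp_const[OF w] over_const]] conjunct2[OF Od[OF parp_const[OF w] over_const]]] by blast
  from this[of "sorted_list_of_set (snd m)" "sorted_list_of_multiset (fst m)"]
  have "parp M ((p + odeg m) + of_nat (length (sorted_list_of_set (snd m)))) (vsub (\<lambda>_. {j}) (Poly_Mapping.single m w))"
    unfolding vsub_eq superops.psub_single[OF superops_vsub] monop_def by simp
  then show "parp M p (vsub (\<lambda>_. {j}) (Poly_Mapping.single m w))"
    by (simp add: odeg_def ac_simps)
qed

text \<open>\<open>T1\<close>, \<open>T2\<close> and \<open>T3\<close> are the terms {{a b} c}, {b
  {a c}} and {a {b c}} of the Jacobi identity for odd operations, with outer operation
  \<open>F\<close> and inner operation \<open>G\<close>. Mixing \<beta> and y in these places gives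
  the Leibniz rule and associativity.\<close>

definition T1 :: "('v \<Rightarrow> 'v \<Rightarrow> 'v spoly) \<Rightarrow> ('v \<Rightarrow> 'v \<Rightarrow> 'v spoly) \<Rightarrow> 'v \<Rightarrow> 'v \<Rightarrow> 'v \<Rightarrow> 'v spoly"
  where "T1 F G a b c = kext 1 (\<lambda>u. vsub (\<lambda>_. {0, 1}) (F u c)) (G a b)"

definition T2 :: "bit \<Rightarrow> bit \<Rightarrow> ('v \<Rightarrow> 'v \<Rightarrow> 'v spoly) \<Rightarrow> ('v \<Rightarrow> 'v \<Rightarrow> 'v spoly) \<Rightarrow> 'v \<Rightarrow> 'v \<Rightarrow> 'v \<Rightarrow> 'v spoly"
  where "T2 p q F G a b c = ksgn (q * (1 + p)) (kext (1 + q) (\<lambda>u. vsub (\<lambda>_. {1}) (F b u)) (G a c))"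

definition T3 :: "bit \<Rightarrow> ('v \<Rightarrow> 'v \<Rightarrow> 'v spoly) \<Rightarrow> ('v \<Rightarrow> 'v \<Rightarrow> 'v spoly) \<Rightarrow> 'v \<Rightarrow> 'v \<Rightarrow> 'v \<Rightarrow> 'v spoly"
  where "T3 p F G a b c = ksgn p (kext (1 + p) (\<lambda>u. vsub (\<lambda>_. {0}) (F a u)) (vsub (\<lambda>_. {1}) (G b c)))"

text \<open>The equations belonging to the empty quiver, to one edge between the last two vertices
  and to a path with the last vertex in its middle. The third equation has no \<open>T1\<close>
  term, since both edges of the path are outer when a and b are grouped.\<close>

definition coisson_eqs :: "('v \<Rightarrow> 'v \<Rightarrow> 'v spoly) \<Rightarrow> ('v \<Rightarrow> 'v \<Rightarrow> 'v spoly) \<Rightarrow> bool"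
  where "coisson_eqs \<beta> y \<longleftrightarrow> (\<forall>p q r. \<forall>a\<in>hpart M p. \<forall>b\<in>hpart M q. \<forall>c\<in>hpart M r.
    T1 \<beta> \<beta> a b c + (T2 p q \<beta> \<beta> a b c + T3 p \<beta> \<beta> a b c) = 0 \<and>
    T1 y \<beta> a b c + (T2 p q y \<beta> a b c + T3 p \<beta> y a b c) = 0 \<and>
    T2 p q y y a b c + T3 p y y a b c = 0)"

end

context symmetric_operation
begin

text \<open>Two edges on two vertices form an undirected cycle, so either the inner or the outer
  factor vanishes.\<close>

lemma K_big:
  assumes "Q \<in> quivers 3" "2 \<le> size (sq Q) \<or> 2 \<le> size (oe Q)"
  shows "K Q a b c = 0"
proof (cases "2 \<le> size (oe Q)")
  case False
  then have "2 \<le> size (sq Q)" using assms(2) by blast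
  then have "opval X (sq Q) a b = 0"
    using sym_op_pair(2)[OF sym sq_quivers[OF assms(1)], of a b] size_2_pval[of "sq Q"] by simp
  then show ?thesis
    using additive.zero[OF additive_kext[OF additive_W(2)[OF assms(1)]]] by (simp add: K_def)
qed (simp add: K_def)

lemma PP_big:
  assumes "Q \<in> quivers 3" "\<sigma> permutes {..<3}"
    "2 \<le> size (sq (qmap (inv \<sigma>) Q)) \<or> 2 \<le> size (oe (qmap (inv \<sigma>) Q))"
  shows "PP Q \<sigma> vs = 0"
  unfolding PP_def using K_big[OF qmap_quivers[OF permutes_inv[OF assms(2)] assms(1)] assms(3)] by simp

lemma BX_big:
  assumes Q: "Q \<in> quivers 3" and b: "\<And>\<sigma>. \<sigma> permutes {..<3} \<Longrightarrow> 2 \<le> size (sq (qmap \<sigma> Q)) \<or> 2 \<le> size (oe (qmap \<sigma> Q))"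
  shows "BX Q ps vs = 0"
proof -
  have "PP Q \<sigma> vs = 0" if "\<sigma> permutes {..<3}" for \<sigma>
    using that b[OF permutes_inv[OF that]] by (intro PP_big[OF Q])
  then show ?thesis unfolding BX_def using perm_permutes by simp
qed

lemma K_plain: "\<not> touch Q \<Longrightarrow> size (oe Q) < 2 \<Longrightarrow> K Q a b c = T1 (opval X (co Q)) (opval X (sq Q)) a b c"
  by (simp add: K_def T1_def W_def)

lemma nn_W_pair:
  assumes Q: "Q \<in> quivers 3" and j: "j \<in> {0, 1}" and u: "u \<in> hpart M s" "v \<in> hpart M t"
  shows "nn 3 (vsub (\<lambda>_. {j, 2}) (opval X (co Q) u v)) = ksgn (s * t) (vsub (\<lambda>_. {1 - j}) (opval X (qswap (co Q)) v u))"
proof -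
  have o: "opval X (co Q) u v \<in> over (vr N 1)" by (rule opval_over[OF co_quivers[OF Q]])
  have "nn 3 (vsub (\<lambda>_. {j, 2}) (opval X (co Q) u v)) = flip (1 - j) (opval X (co Q) u v)"
    by (rule nn_vsub_pair[OF o j])
  also have "\<dots> = vsub (\<lambda>_. {1 - j}) (flip 0 (opval X (co Q) u v))"
    using over_fin[OF o] by (intro vsub_flip[symmetric]) auto
  also have "flip 0 (opval X (co Q) u v) = ksgn (s * t) (opval X (qswap (co Q)) v u)"
    using opval_swap[OF co_quivers[OF Q] u] by (simp add: ksgn_eq_iff)
  finally show ?thesis by (simp add: additive_ksgn_commute[OF additive_vsub])
qed

text \<open>The remaining argument is brought to the front by the symmetry of the outer operation.
  The sign of passing it depends on the parity of each inner coefficient and is absorbed by changing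
  the parity of the extension from 1 to 1 + r.\<close>

lemma PP_plain:
  assumes Q: "Q \<in> quivers 3" and \<sigma>: "\<sigma> permutes {..<3}" "\<sigma> 0 < 2" "{\<sigma> 1, \<sigma> 2} = {2, j}" "j < 2"
    and Q': "Q' = qmap (inv \<sigma>) Q" "\<not> touch Q'" "size (oe Q') < 2"
    and h: "vs ! \<sigma> 0 \<in> hpart M p" "vs ! \<sigma> 1 \<in> hpart M q" "vs ! \<sigma> 2 \<in> hpart M r" and j: "\<sigma> 2 \<noteq> 2"
  shows "PP Q \<sigma> vs = ksgn ((1 + p + q) * r) (kext (1 + r) (\<lambda>u. vsub (\<lambda>_. {1 - \<sigma> 0}) (opval X (qswap (co Q')) (vs ! \<sigma> 2) u))
      (vsub (\<lambda>_. {\<sigma> 0}) (opval X (sq Q') (vs ! \<sigma> 0) (vs ! \<sigma> 1))))"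
proof -
  have Q3: "Q' \<in> quivers 3" unfolding Q' by (rule qmap_quivers[OF permutes_inv[OF \<sigma>(1)] Q])
  have s1: "\<sigma> 1 = 2" using \<sigma>(3) j by (auto simp: doubleton_eq_iff)
  let ?a = "vs ! \<sigma> 0" and ?b = "vs ! \<sigma> 1" and ?c = "vs ! \<sigma> 2"
  let ?f = "opval X (sq Q') ?a ?b" and ?V = "vsub (\<lambda>k. {\<sigma> k})"
  have f: "?f \<in> over (vr N 1)" by (rule opval_over[OF sq_quivers[OF Q3]])
  note aW = additive_W[OF Q3] and fW' = fW[OF Q3]
  have x: "opval X (co Q') u v \<in> over (vr N 1)" for u v by (rule opval_over[OF co_quivers[OF Q3]])
  have VW: "?V (W Q' u v) = vsub (\<lambda>_. {\<sigma> 0, 2}) (opval X (co Q') u v)" for u v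
    unfolding W_def using s1 \<sigma>(2) by (intro vsub_vsub[OF x]) (auto simp: disjoint_family_on_def)
  have Vf: "?V ?f = vsub (\<lambda>_. {\<sigma> 0}) ?f" by (rule vsub_cong[OF f]) auto
  have ff: "?f \<in> fin" using f by (rule over_fin)
  have vf: "vsub (\<lambda>_. {\<sigma> 0}) ?f \<in> over (vr N 2)" using \<sigma>(2) by (intro vsub_over[OF f]) auto
  have par: "parp M (1 + p + q) ?f" by (rule bilD(6)[OF bil_opval[OF sq_quivers[OF Q3]] h(1,2)])
  have "PP Q \<sigma> vs = nn 3 (?V (kext 1 (\<lambda>u. W Q' u ?c) ?f))"
    unfolding PP_def using Q' by (simp add: K_def)
  also have "?V (kext 1 (\<lambda>u. W Q' u ?c) ?f) = kext 1 (\<lambda>u. ?V (W Q' u ?c)) (vsub (\<lambda>_. {\<sigma> 0}) ?f)"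
    using aW fW' ff by (simp add: vsub_kext Vf[unfolded One_nat_def])
  \<comment> \<open>The inner value does not contain the variable to be eliminated, so the normal
    form acts on the outer values only.\<close>
  also have "nn 3 \<dots> = kext (1 + 0) (\<lambda>u. nn 3 (?V (W Q' u ?c))) (vsub (\<lambda>_. {\<sigma> 0}) ?f)"
  proof (rule kext_op_commute[OF _ _ _ _ _ _ _ vf])
    show "additive (\<lambda>u. ?V (W Q' u ?c))" by (rule additive_comp[OF additive_vsub aW(2)])
    then show "additive (\<lambda>u. nn 3 (?V (W Q' u ?c)))" by simp
    show "nn 3 (var k l g) = ksgn (0 * lpar l) (var k l (nn 3 g))" if "(k, l) \<in> vr N 2" "g \<in> fin" for k l g
      using that by (simp add: sub_var sop_def)
  qed (use fW' in auto)
  also have "\<dots> = ksgn ((1 + p + q) * r) (kext (1 + r) (\<lambda>u. vsub (\<lambda>_. {1 - \<sigma> 0}) (opval X (qswap (co Q')) ?c u)) (vsub (\<lambda>_. {\<sigma> 0}) ?f))"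
  proof -
    have b: "additive (opval X (qswap (co Q')) ?c)" by (rule bilD(1)[OF bil_opval[OF qswap_quivers[OF co_quivers[OF Q3]]]])
    have "parp M (1 + p + q) (vsub (\<lambda>_. {\<sigma> 0}) ?f)" by (rule parp_vsub[OF ff par])
    then have "kext 1 (\<lambda>u. nn 3 (?V (W Q' u ?c))) (vsub (\<lambda>_. {\<sigma> 0}) ?f) =
      kext (1 + r) (\<lambda>u. ksgn ((1 + p + q) * r) (vsub (\<lambda>_. {1 - \<sigma> 0}) (opval X (qswap (co Q')) ?c u))) (vsub (\<lambda>_. {\<sigma> 0}) ?f)"
    proof (rule kext_cong_parp)
      fix d u assume u: "u \<in> hpart M (1 + p + q + d)"
      have "\<sigma> 0 \<in> {0, 1}" using \<sigma>(2) by auto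
      from nn_W_pair[OF Q3 this u h(3)]
      show "ksgn (1 * d) (nn 3 (?V (W Q' u ?c))) = ksgn ((1 + r) * d) (ksgn ((1 + p + q) * r) (vsub (\<lambda>_. {1 - \<sigma> 0}) (opval X (qswap (co Q')) ?c u)))"
        unfolding VW by (simp add: ring_distribs ac_simps)
    qed
    then show ?thesis using additive_comp[OF additive_vsub b] by (simp add: kext_ksgn)
  qed
  finally show ?thesis .
qed

text \<open>\<open>Q2\<close> and \<open>Q3\<close> are the quivers seen by the second and the third
  shuffle. If no outer edge of theirs meets vertex 0, both summands are free of the shift. The
  representative quivers below are chosen with this in mind.\<close>

lemma BX_plain:
  assumes Q: "Q \<in> quivers 3" and h: "a \<in> hpart M p" "b \<in> hpart M q" "c \<in> hpart M r"
    and Q2: "Q2 = qmap (perm 0 2 1) Q" "\<not> touch Q2" "size (oe Q2) < 2"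
    and Q3: "Q3 = qmap (perm 2 0 1) Q" "\<not> touch Q3" "size (oe Q3) < 2"
  shows "BX Q [p, q, r] [a, b, c] = K Q a b c +
    (T2 p q (opval X (qswap (co Q2))) (opval X (sq Q2)) a b c + T3 p (opval X (qswap (co Q3))) (opval X (sq Q3)) a b c)"
proof -
  have q2: "Q2 \<in> quivers 3" unfolding Q2 by (rule qmap_quivers[OF perm_permutes Q]) simp
  have f2: "opval X (sq Q2) a c \<in> over (vr N 1)" by (rule opval_over[OF sq_quivers[OF q2]])
  have "PP Q (perm 0 1 2) [a, b, c] = nn 3 (K Q a b c)"
    unfolding PP_def perm_id using vsub_id[OF K_over[OF Q], of "\<lambda>k. {k}"] by (simp add: inv_id qmap_id)
  also have "\<dots> = K Q a b c" using K_over[OF Q] by (intro nn_idem) simp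
  finally have 1: "PP Q (perm 0 1 2) [a, b, c] = K Q a b c" .
  have "PP Q (perm 0 2 1) [a, b, c] = ksgn ((1 + p + r) * q) (kext (1 + q) (\<lambda>u. vsub (\<lambda>_. {1}) (opval X (qswap (co Q2)) b u))
      (vsub (\<lambda>_. {0}) (opval X (sq Q2) a c)))"
    using PP_plain[OF Q, of "perm 0 2 1" 1 Q2 "[a, b, c]" p r q] perm_permutes[of 0 2 1] h Q2 inv_perm(2) by auto
  also have "vsub (\<lambda>_. {0}) (opval X (sq Q2) a c) = opval X (sq Q2) a c" by (rule vsub_id[OF f2]) auto
  finally have 2: "ksgn (q * r) (PP Q (perm 0 2 1) [a, b, c]) = T2 p q (opval X (qswap (co Q2))) (opval X (sq Q2)) a b c"
    by (simp add: T2_def ring_distribs ac_simps)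
  have "PP Q (perm 1 2 0) [a, b, c] = ksgn ((1 + q + r) * p) (kext (1 + p) (\<lambda>u. vsub (\<lambda>_. {0}) (opval X (qswap (co Q3)) a u))
      (vsub (\<lambda>_. {1}) (opval X (sq Q3) b c)))"
    using PP_plain[OF Q, of "perm 1 2 0" 0 Q3 "[a, b, c]" q r p] perm_permutes[of 1 2 0] h Q3 inv_perm(3) by auto
  then have 3: "ksgn (p * q + p * r) (PP Q (perm 1 2 0) [a, b, c]) = T3 p (opval X (qswap (co Q3))) (opval X (sq Q3)) a b c"
    by (simp add: T3_def ring_distribs ac_simps)
  show ?thesis unfolding BX_def 1 using 2 3 by simp
qed

abbreviation \<beta> where "\<beta> \<equiv> opval X {#}"
abbreviation y where "y \<equiv> opval X {#(0, Suc 0)#}"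

lemma opval_10: "opval X {#(Suc 0, 0)#} = (\<lambda>a b. - y a b)"
  using sym_op_pair(2)[OF sym quivers_2_simps(3)] by (simp add: pval_def fun_eq_iff)

lemma BX_empty:
  assumes "a \<in> hpart M p" "b \<in> hpart M q" "c \<in> hpart M r"
  shows "BX {#} [p, q, r] [a, b, c] = T1 \<beta> \<beta> a b c + (T2 p q \<beta> \<beta> a b c + T3 p \<beta> \<beta> a b c)"
  using BX_plain[OF quivers_2_simps(1) assms refl _ _ refl]
  by (simp add: K_plain touch_def outer_edges_def collapse_def subquiver_def)

lemma BX_edge:
  assumes "a \<in> hpart M p" "b \<in> hpart M q" "c \<in> hpart M r"
  shows "BX {#(1, 2)#} [p, q, r] [a, b, c] = T1 y \<beta> a b c + (T2 p q y \<beta> a b c + T3 p \<beta> y a b c)"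
proof -
  have "{#(1, 2)#} \<in> quivers 3" by (simp add: quivers_def)
  from BX_plain[OF this assms refl _ _ refl] show ?thesis
    by (simp add: K_plain touch_def outer_edges_def collapse_def subquiver_def)
qed

lemma T_minus: "T2 p q (\<lambda>a b. - F a b) G a b c = - T2 p q F G a b c"
  "T3 p (\<lambda>a b. - F a b) G a b c = - T3 p F G a b c"
  by (simp_all add: T2_def T3_def additive.minus[OF additive_vsub] kext_uminus ksgn_minus)

lemma T_minus_inner:
  assumes "\<And>a. additive (F a)"
  shows "T2 p q F (\<lambda>a b. - G a b) a b c = - T2 p q F G a b c" "T3 p F (\<lambda>a b. - G a b) a b c = - T3 p F G a b c"
  unfolding T2_def T3_def
  by (simp_all add: additive.minus[OF additive_vsub] additive.minus[OF additive_kext[OF additive_comp[OF additive_vsub assms]]] ksgn_minus)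

text \<open>The first summand vanishes because both edges are outer in it. Reversing an edge
  replaces y by its negative in both remaining terms, so all orientations of the path give the same
  equation.\<close>

lemma BX_path:
  assumes h: "a \<in> hpart M p" "b \<in> hpart M q" "c \<in> hpart M r"
    and e: "e = (0, 2) \<or> e = (2, 0)" "f = (1, 2) \<or> f = (2, 1)"
  shows "\<exists>t. BX {#e, f#} [p, q, r] [a, b, c] = ksgn t (T2 p q y y a b c + T3 p y y a b c)"
    "BX {#(0, 2), (1, 2)#} [p, q, r] [a, b, c] = T2 p q y y a b c + T3 p y y a b c"
proof -
  note T = T_minus T_minus_inner[OF bilD(1)[OF bil_opval[OF quivers_2_simps(2)]]]
  have b: "BX {#e, f#} [p, q, r] [a, b, c] = T2 p q (if f = (1, 2) then y else (\<lambda>a b. - y a b)) (if e = (0, 2) then y else (\<lambda>a b. - y a b)) a b c +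
      T3 p (if e = (0, 2) then y else (\<lambda>a b. - y a b)) (if f = (1, 2) then y else (\<lambda>a b. - y a b)) a b c"
    if e: "e = (0, 2) \<or> e = (2, 0)" "f = (1, 2) \<or> f = (2, 1)" for e f
  proof -
    have Q: "{#e, f#} \<in> quivers 3" using e by (auto simp: quivers_def)
    have "K {#e, f#} a b c = 0" using e by (intro K_big[OF Q]) (auto simp: outer_edges_def)
    then show ?thesis
      using e BX_plain[OF Q h refl _ _ refl]
      by (elim disjE) (simp_all add: touch_def outer_edges_def collapse_def subquiver_def opval_10)
  qed
  show "BX {#(0, 2), (1, 2)#} [p, q, r] [a, b, c] = T2 p q y y a b c + T3 p y y a b c"
    using b[of "(0, 2)" "(1, 2)"] by simp
  show "\<exists>t. BX {#e, f#} [p, q, r] [a, b, c] = ksgn t (T2 p q y y a b c + T3 p y y a b c)"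
    unfolding b[OF e] by (intro exI[of _ "(if e = (0, 2) then 0 else 1) + (if f = (1, 2) then 0 else 1)"]) (simp add: T)
qed

lemma edge_pairs:
  assumes "Q \<in> quivers 3" "size Q = 2"
  obtains e f where "Q = {#e, f#}" "f = e \<or> f = prod.swap e"
    | e f i j k where "Q = {#e, f#}" "valid3 i j k" "e = (i, k) \<or> e = (k, i)" "f = (j, k) \<or> f = (k, j)"
proof -
  obtain e Q' where "Q = add_mset e Q'" "size Q' = 1" using assms(2) by (cases Q) auto
  then obtain f where Q: "Q = {#e, f#}" using size_1_singleton_mset by blast
  obtain s t u v where ef: "e = (s, t)" "f = (u, v)" by (cases e, cases f)
  have "s \<in> {0, 1, 2}" "t \<in> {0, 1, 2}" "s \<noteq> t" "u \<in> {0, 1, 2}" "v \<in> {0, 1, 2}" "u \<noteq> v"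
    using quivers_3_edge[OF assms(1), of e] quivers_3_edge[OF assms(1), of f] Q ef by auto
  then have "(f = e \<or> f = prod.swap e) \<or> (\<exists>i j k. valid3 i j k \<and> (e = (i, k) \<or> e = (k, i)) \<and> (f = (j, k) \<or> f = (k, j)))"
  proof -
    assume a: "s \<in> {0, 1, 2}" "t \<in> {0, 1, 2}" "s \<noteq> t" "u \<in> {0, 1, 2}" "v \<in> {0, 1, 2}" "u \<noteq> v"
    \<comment> \<open>The candidate for a common endpoint; i and j are then the other ends of the
      two edges. On three vertices two edges always share a vertex, and if they share both, the
      first alternative holds.\<close>
    let ?k = "if s = u \<or> s = v then s else t"
    let ?i = "if ?k = s then t else s" and ?j = "if ?k = u then v else u"
    have "(f = e \<or> f = prod.swap e) \<or> (valid3 ?i ?j ?k \<and> (e = (?i, ?k) \<or> e = (?k, ?i)) \<and> (f = (?j, ?k) \<or> f = (?k, ?j)))"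
      using a unfolding ef by (elim insertE emptyE) simp_all
    then show ?thesis by blast
  qed
  then show thesis using that Q by blast
qed

lemma qmap_perm: "valid3 i j k \<Longrightarrow> inv (perm i j k) i = 0" "valid3 i j k \<Longrightarrow> inv (perm i j k) j = 1" "valid3 i j k \<Longrightarrow> inv (perm i j k) k = 2"
  using permutes_inv_eq[OF perm_permutes, of i j k] by simp_all

lemma box_zero_iff: "box_square N M X = zero_operation N M 3 \<longleftrightarrow> coisson_eqs \<beta> y"
  unfolding box_iff
proof
  assume h: "\<forall>Q\<in>quivers 3. \<forall>p q r. \<forall>a\<in>hpart M p. \<forall>b\<in>hpart M q. \<forall>c\<in>hpart M r. BX Q [p, q, r] [a, b, c] = 0"
  have Q: "{#} \<in> quivers 3" "{#(1, 2)#} \<in> quivers 3" "{#(0, 2), (1, 2)#} \<in> quivers 3" by (auto simp: quivers_def)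
  show "coisson_eqs \<beta> y"
    unfolding coisson_eqs_def
  proof (intro allI ballI conjI)
    fix p q r a b c assume a: "a \<in> hpart M p" "b \<in> hpart M q" "c \<in> hpart M r"
    have z: "BX Q [p, q, r] [a, b, c] = 0" if "Q \<in> quivers 3" for Q using h that a by blast
    show "T1 \<beta> \<beta> a b c + (T2 p q \<beta> \<beta> a b c + T3 p \<beta> \<beta> a b c) = 0" using z[OF Q(1)] unfolding BX_empty[OF a] .
    show "T1 y \<beta> a b c + (T2 p q y \<beta> a b c + T3 p \<beta> y a b c) = 0" using z[OF Q(2)] unfolding BX_edge[OF a] .
    show "T2 p q y y a b c + T3 p y y a b c = 0"
      using z[OF Q(3)] BX_path(2)[OF a disjI1[OF refl] disjI1[OF refl]] by metis
  qed
next
  assume h: "coisson_eqs \<beta> y"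
  have c0: "BX {#} [p, q, r] [a, b, c] = 0" "BX {#(1, 2)#} [p, q, r] [a, b, c] = 0"
    "e = (0, 2) \<or> e = (2, 0) \<Longrightarrow> f = (1, 2) \<or> f = (2, 1) \<Longrightarrow> BX {#e, f#} [p, q, r] [a, b, c] = 0"
    if a: "a \<in> hpart M p" "b \<in> hpart M q" "c \<in> hpart M r" for a b c p q r e f
  proof -
    have e: "T1 \<beta> \<beta> a b c + (T2 p q \<beta> \<beta> a b c + T3 p \<beta> \<beta> a b c) = 0" "T1 y \<beta> a b c + (T2 p q y \<beta> a b c + T3 p \<beta> y a b c) = 0"
      "T2 p q y y a b c + T3 p y y a b c = 0" using h a unfolding coisson_eqs_def by blast+
    show "BX {#} [p, q, r] [a, b, c] = 0" "BX {#(1, 2)#} [p, q, r] [a, b, c] = 0"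
      unfolding BX_empty[OF a] BX_edge[OF a] by (rule e)+
    show "BX {#e, f#} [p, q, r] [a, b, c] = 0" if "e = (0, 2) \<or> e = (2, 0)" "f = (1, 2) \<or> f = (2, 1)"
      using BX_path(1)[OF a that] unfolding e(3) by auto
  qed
  show "\<forall>Q\<in>quivers 3. \<forall>p q r. \<forall>a\<in>hpart M p. \<forall>b\<in>hpart M q. \<forall>c\<in>hpart M r. BX Q [p, q, r] [a, b, c] = 0"
  proof (intro ballI allI)
    fix Q p q r a b c assume Q: "Q \<in> quivers 3" and a: "a \<in> hpart M p" "b \<in> hpart M q" "c \<in> hpart M r"
    have hom: "[a, b, c] ! i \<in> hpart M ([p, q, r] ! i)" if "i < 3" for i
      using a that by (auto simp: eval_nat_numeral less_Suc_eq)
    have lt: "i < 3" "j < 3" "k < 3" if "valid3 i j k" for i j k by (cases rule: valid3_cases[OF that]; simp)+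
    consider "size Q = 0" | "size Q = 1" | "size Q = 2" | "3 \<le> size Q" by linarith
    then show "BX Q [p, q, r] [a, b, c] = 0"
    proof cases
      case 1
      then show ?thesis using c0(1)[OF a] by simp
    next
      case 2
      then obtain e where e: "Q = {#e#}" by (meson size_1_singleton_mset)
      obtain s t where st: "e = (s, t)" by (cases e)
      have "s \<in> {0, 1, 2}" "t \<in> {0, 1, 2}" "s \<noteq> t" using quivers_3_edge[OF Q, of e] e st by auto
      \<comment> \<open>The third vertex, as the three vertices 0, 1, 2 add up to 3.\<close>
      then have "valid3 (3 - s - t) s t" by (elim insertE emptyE) simp_all
      then obtain i where v: "valid3 i s t" by blast
      show ?thesis
        by (rule BX_transport[OF Q v a]) (simp add: e st qmap_perm[OF v] c0(2)[simplified, OF hom hom hom, OF lt[OF v]])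
    next
      case 3
      show ?thesis
      proof (cases rule: edge_pairs[OF Q 3])
        case (1 e f)
        show ?thesis
        proof (rule BX_big[OF Q])
          fix \<sigma> :: "nat \<Rightarrow> nat" assume s: "\<sigma> permutes {..<3}"
          let ?e = "map_prod \<sigma> \<sigma> e"
          have Q': "qmap \<sigma> Q \<in> quivers 3" by (rule qmap_quivers[OF s Q])
          \<comment> \<open>Edges with the same endpoints keep them in common under any relabelling,
            so both lie inside the block or both between the blocks.\<close>
          have q: "qmap \<sigma> Q = {#?e, ?e#} \<or> qmap \<sigma> Q = {#?e, prod.swap ?e#}" using 1 by (cases e) auto
          obtain u v where uv: "?e = (u, v)" by (cases ?e)
          have "?e \<in># qmap \<sigma> Q" using q by (metis union_single_eq_member)
          then have m: "u \<in> {0, 1, 2}" "v \<in> {0, 1, 2}" "u \<noteq> v" using quivers_3_edge[OF Q', of ?e] unfolding uv by auto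
          from q have q: "qmap \<sigma> Q = {#(u, v), (u, v)#} \<or> qmap \<sigma> Q = {#(u, v), (v, u)#}" unfolding uv by simp
          show "2 \<le> size (sq (qmap \<sigma> Q)) \<or> 2 \<le> size (oe (qmap \<sigma> Q))"
            unfolding sq_eq(1)[OF Q'] outer_edges_def using q
          proof (rule disjE)
            assume e: "qmap \<sigma> Q = {#(u, v), (u, v)#}"
            show "2 \<le> size {#(s, t) \<in># qmap \<sigma> Q. s < 2 \<and> t < 2#} \<or> 2 \<le> size {#(s, t) \<in># qmap \<sigma> Q. block_of nu s \<noteq> block_of nu t#}"
              unfolding e using m by (elim insertE emptyE) simp_all
          next
            assume e: "qmap \<sigma> Q = {#(u, v), (v, u)#}"
            show "2 \<le> size {#(s, t) \<in># qmap \<sigma> Q. s < 2 \<and> t < 2#} \<or> 2 \<le> size {#(s, t) \<in># qmap \<sigma> Q. block_of nu s \<noteq> block_of nu t#}"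
              unfolding e using m by (elim insertE emptyE) simp_all
          qed
        qed
      next
        case (2 e f i j k)
        note v = 2(2)
        have "qmap (inv (perm i j k)) Q = {#map_prod (inv (perm i j k)) (inv (perm i j k)) e, map_prod (inv (perm i j k)) (inv (perm i j k)) f#}"
          using 2(1) by simp
        moreover have "map_prod (inv (perm i j k)) (inv (perm i j k)) e = (0, 2) \<or> map_prod (inv (perm i j k)) (inv (perm i j k)) e = (2, 0)"
          "map_prod (inv (perm i j k)) (inv (perm i j k)) f = (1, 2) \<or> map_prod (inv (perm i j k)) (inv (perm i j k)) f = (2, 1)"
          using 2(3,4) qmap_perm[OF v] by auto
        ultimately show ?thesis
          using BX_transport[OF Q v a] c0(3)[OF hom hom hom, OF lt[OF v]] by metis
      qed
    next
      case 4
      show ?thesis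
      proof (rule BX_big[OF Q])
        fix \<sigma> :: "nat \<Rightarrow> nat" assume s: "\<sigma> permutes {..<3}"
        \<comment> \<open>Every edge is inner or outer, so of three or more edges at least two are
          of the same kind.\<close>
        have "size (sq (qmap \<sigma> Q)) + size (oe (qmap \<sigma> Q)) = size Q"
          using size_sq_oe[OF qmap_quivers[OF s Q]] by simp
        then show "2 \<le> size (sq (qmap \<sigma> Q)) \<or> 2 \<le> size (oe (qmap \<sigma> Q))" using 4 by linarith
      qed
    qed
  qed
qed

end

subsection \<open>Passing to residues\<close>

lemma const_eq_iff [simp]: "const u = const v \<longleftrightarrow> u = v"
  by (metis const_def lookup_single_eq)

lemma const_eq_0_iff [simp]: "const u = 0 \<longleftrightarrow> u = 0" for u :: "'w::ab_group_add"
  using const_eq_iff[of u 0] by (simp del: const_eq_iff)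

lemma sum_3_eq_0_iff: "x + z + c = 0 \<longleftrightarrow> x = - z - c" for x z c :: "'w::ab_group_add"
  unfolding eq_iff_diff_eq_0[of x "- z - c"] by (simp add: algebra_simps)

text \<open>The form in which \<open>frobenius_zero\<close> is applied: x is a tuple of arguments,
  \<open>E x\<close> the defect of an identity there, and x' the tuple with S^i applied to one of
  the arguments.\<close>

lemma resid_zero_iff:
  fixes E :: "'x \<Rightarrow> 'w::ab_group_add spoly"
  assumes "\<And>x i. x \<in> A \<Longrightarrow> i < N \<Longrightarrow> \<exists>x'\<in>A. \<exists>r. tht k i (E x) = ksgn r (E x')"
  shows "(\<forall>x\<in>A. E x = 0) \<longleftrightarrow> (\<forall>x\<in>A. resid N k (E x) = 0)"
proof
  assume z: "\<forall>x\<in>A. resid N k (E x) = 0"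
  show "\<forall>x\<in>A. E x = 0"
  proof
    fix x assume x: "x \<in> A"
    show "E x = 0"
    proof (rule frobenius_zero[where S = "{k} \<times> {..<N}" and D = "{ksgn r (E x) | r x. x \<in> A}"])
      fix f k' i assume f: "f \<in> {ksgn r (E x) | r x. x \<in> A}" and ki: "(k', i) \<in> {k} \<times> {..<N}"
      then obtain r x where x: "x \<in> A" "f = ksgn r (E x)" and k: "k' = k" "i < N" by auto
      obtain x' r' where "x' \<in> A" "tht k i (E x) = ksgn r' (E x')" using assms[OF x(1) k(2)] by blast
      then have "tht k i f = ksgn (r + r') (E x')" "x' \<in> A"
        by (simp_all add: x(2) additive_ksgn_commute[OF additive_tht])
      then show "tht k' i f \<in> {ksgn r (E x) | r x. x \<in> A} \<or> - tht k' i f \<in> {ksgn r (E x) | r x. x \<in> A}"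
        unfolding k(1) by blast
    next
      fix f A' J assume "f \<in> {ksgn r (E x) | r x. x \<in> A}" and J: "{k} \<times> {..<N} \<subseteq> J"
      then have "resid N k f = 0" using z by (auto simp: additive_ksgn_commute[OF additive_resid])
      from lookup_eq_0_if_resid[OF this J] show "Poly_Mapping.lookup f (A', J) = 0" .
    next
      show "E x \<in> {ksgn r (E x) | r x. x \<in> A}" using x by (intro CollectI exI[of _ 0] exI[of _ x]) simp
    qed simp
  qed
qed (simp add: additive.zero[OF additive_resid])

lemma resid_var:
  "f \<in> fin \<Longrightarrow> k' \<noteq> k \<Longrightarrow> resid N k (var k' l f) = ksgn (lpar l * of_nat N) (var k' l (resid N k f))"
proof (induction N)
  case (Suc N)
  then show ?case
    by (simp add: additive_ksgn_commute[OF additive_dth] dth_var resid_over ksgn_eq_iff algebra_simps)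
qed simp

lemma resid_coeff_op:
  assumes "additive \<phi>" "f \<in> fin"
  shows "resid N k (coeff_op s \<phi> f) = ksgn (s * of_nat N) (coeff_op s \<phi> (resid N k f))"
  unfolding coeff_op_def by (rule resid_kext_inner[where S = "{}"]) (use assms in simp_all)

lemma dth_coeff_op:
  assumes "additive \<phi>" "f \<in> fin"
  shows "dth k i (coeff_op s \<phi> f) = ksgn s (coeff_op s \<phi> (dth k i f))"
  unfolding coeff_op_def by (rule dth_kext_inner[where S = "{}"]) (use assms in simp_all)

context hwmodule
begin

lemma dth_flip:
  assumes "f \<in> over (vr N 1)"
  shows "dth 0 i (flip 0 f) = - flip 0 (dth 0 i f)"
proof (rule over_additive_eq[OF assms, where F = "\<lambda>f. dth 0 i (flip 0 f)" and G = "\<lambda>f. - flip 0 (dth 0 i f)"])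
  fix k l and f :: "'v spoly"
  assume *: "(k, l) \<in> vr N 1" "f \<in> over (vr N 1)" and IH: "dth 0 i (flip 0 f) = - flip 0 (dth 0 i f)"
  then have f: "f \<in> fin" "flip 0 f \<in> fin" "dth 0 i f \<in> fin" and k: "k = 0"
    using over_fin[OF *(2)] sub_fin[OF over_fin[OF *(2)]] dth_over[OF over_fin[OF *(2)]] by auto
  have s: "flip 0 (var 0 l g) = - var 0 l (flip 0 g) - coeff_op (lpar l) (nab l) (flip 0 g)" if "g \<in> fin" for g
    using sub_var[OF that, of UNIV "{0}" 0 l] by (simp add: sop_def)
  have m: "var 0 l (- g) = - var 0 l g" "coeff_op (lpar l) (nab l) (- g) = - coeff_op (lpar l) (nab l) g" for g :: "'v spoly"
    by (simp_all add: additive.minus[OF additive_var] additive.minus[OF additive_coeff_op[OF additive_nab]])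
  show "dth 0 i (flip 0 (var k l f)) = - flip 0 (dth 0 i (var k l f))"
    unfolding k s[OF f(1)] dth_var[OF f(1)] additive.add[OF additive_sub] additive_ksgn_commute[OF additive_sub] s[OF f(3)]
      additive.diff[OF additive_dth] additive.minus[OF additive_dth] dth_var[OF f(2)] dth_coeff_op[OF additive_nab f(2)] IH m
    by (cases l) (auto simp: algebra_simps additive.zero[OF additive_sub])
qed simp_all

lemma resid_flip:
  assumes "f \<in> over (vr N 1)"
  shows "resid n 0 (flip 0 f) = ksgn (of_nat n) (flip 0 (resid n 0 f))"
proof (induction n)
  case (Suc n)
  then show ?case
    using dth_flip[OF resid_over[OF assms]] by (simp add: additive_ksgn_commute[OF additive_dth] ksgn_minus)
qed simp

text \<open>The conditions on y that hold for the lift of any bilinear product \<mu>. They determine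
  y, and each of the other conditions on y is translated into one on \<mu> below.\<close>

definition ybase :: "('v \<Rightarrow> 'v \<Rightarrow> 'v spoly) \<Rightarrow> ('v \<Rightarrow> 'v \<Rightarrow> 'v) \<Rightarrow> bool"
  where "ybase y \<mu> \<longleftrightarrow> (\<forall>a. additive (y a)) \<and> (\<forall>b. additive (\<lambda>a. y a b)) \<and>
    (\<forall>a b. y a b \<in> over (even_free N)) \<and>
    (\<forall>i<N. \<forall>a b. y (nab (Some i) a) b = tht 0 i (y a b)) \<and>
    (\<forall>a b. resid N 0 (y a b) = const (\<mu> a b))"

lemma even_free_vr: "f \<in> over (even_free N) \<Longrightarrow> f \<in> over (vr N 1)"
  by (rule subsetD[OF over_mono]) (auto simp: even_free_def)

lemma ybaseD:
  assumes "ybase y \<mu>"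
  shows "additive (y a)" "additive (\<lambda>a. y a b)" "y a b \<in> over (even_free N)" "y a b \<in> over (vr N 1)" "y a b \<in> fin"
    "i < N \<Longrightarrow> y (nab (Some i) a) b = tht 0 i (y a b)" "resid N 0 (y a b) = const (\<mu> a b)"
  using assms even_free_vr over_fin unfolding ybase_def by blast+

lemma ybase_unique:
  assumes y: "ybase y \<mu>" and z: "ybase z \<mu>"
  shows "y = z"
proof -
  have "(\<forall>x\<in>UNIV. (\<lambda>(a, b). y a b - z a b) x = 0) \<longleftrightarrow> (\<forall>x\<in>UNIV. resid N 0 ((\<lambda>(a, b). y a b - z a b) x) = 0)"
  proof (rule resid_zero_iff)
    fix x :: "'v \<times> 'v" and i assume i: "i < N"
    obtain a b where "x = (a, b)" by (cases x)
    then show "\<exists>x'\<in>UNIV. \<exists>r. tht 0 i ((\<lambda>(a, b). y a b - z a b) x) = ksgn r ((\<lambda>(a, b). y a b - z a b) x')"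
      by (intro bexI[of _ "(nab (Some i) a, b)"] exI[of _ 0])
        (simp_all add: ybaseD(6)[OF y i] ybaseD(6)[OF z i] additive.diff[OF additive_tht])
  qed
  then have "\<forall>x\<in>UNIV. (\<lambda>(a, b). y a b - z a b) x = 0"
    by (simp add: additive.diff[OF additive_resid] ybaseD(7)[OF y] ybaseD(7)[OF z])
  then show ?thesis by (intro ext) auto
qed

lemma T_derivation_iff:
  assumes y: "ybase y \<mu>"
  shows "(\<forall>a b. y (nab None a) b + y a (nab None b) = coeff_op 0 (nab None) (y a b)) \<longleftrightarrow>
    (\<forall>a b. \<mu> (nab None a) b + \<mu> a (nab None b) = nab None (\<mu> a b))"
proof -
  let ?E = "\<lambda>(a, b). y (nab None a) b + y a (nab None b) - coeff_op 0 (nab None) (y a b)"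
  have *: "(\<forall>x\<in>UNIV. ?E x = 0) \<longleftrightarrow> (\<forall>x\<in>UNIV. resid N 0 (?E x) = 0)"
  proof (rule resid_zero_iff)
    fix x :: "'v \<times> 'v" and i assume i: "i < N"
    obtain a b where x: "x = (a, b)" by (cases x)
    have "tht 0 i (?E x) = ?E (nab (Some i) a, b)"
      using ybaseD(6)[OF y i] nab_commute[of None "Some i"] coeff_nab_var[OF ybaseD(5)[OF y, of a b], of None 0 "Some i"]
      by (simp add: x additive.diff[OF additive_tht] additive.add[OF additive_tht])
    then show "\<exists>x'\<in>UNIV. \<exists>r. tht 0 i (?E x) = ksgn r (?E x')"
      by (intro bexI[of _ "(nab (Some i) a, b)"] exI[of _ 0]) (simp_all only: ksgn_simps UNIV_I)
  qed
  have "resid N 0 (?E (a, b)) = const (\<mu> (nab None a) b + \<mu> a (nab None b) - nab None (\<mu> a b))" for a b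
    using resid_coeff_op[OF additive_nab ybaseD(5)[OF y], of N 0 0 None a b]
    by (simp add: additive.diff[OF additive_resid] additive.add[OF additive_resid] ybaseD(7)[OF y] coeff_op_const
      additive.diff[OF additive_const] additive.add[OF additive_const])
  then have 1: "resid N 0 (?E (a, b)) = 0 \<longleftrightarrow> \<mu> (nab None a) b + \<mu> a (nab None b) = nab None (\<mu> a b)" for a b
    by simp
  have 2: "?E (a, b) = 0 \<longleftrightarrow> y (nab None a) b + y a (nab None b) = coeff_op 0 (nab None) (y a b)" for a b
    by simp
  have "(\<forall>a b. ?E (a, b) = 0) \<longleftrightarrow> (\<forall>x\<in>UNIV. ?E x = 0)" by (simp only: ball_UNIV split_paired_All)
  also note *
  also have "(\<forall>x\<in>UNIV. resid N 0 (?E x) = 0) \<longleftrightarrow> (\<forall>a b. resid N 0 (?E (a, b)) = 0)" by (simp only: ball_UNIV split_paired_All)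
  finally show ?thesis by (simp only: 1 2)
qed

lemma S_derivation_iff:
  assumes y: "ybase y \<mu>"
  shows "(\<forall>i<N. \<forall>a b. y (parity_aut M a) (nab (Some i) b) = - tht 0 i (y a b) - coeff_op 1 (nab (Some i)) (y a b)) \<longleftrightarrow>
    (\<forall>i<N. \<forall>a b. \<mu> (parity_aut M a) (nab (Some i) b) + \<mu> (nab (Some i) a) b + ksgn (of_nat N) (nab (Some i) (\<mu> a b)) = 0)"
proof -
  have "(\<forall>a b. y (parity_aut M a) (nab (Some i) b) = - tht 0 i (y a b) - coeff_op 1 (nab (Some i)) (y a b)) \<longleftrightarrow>
    (\<forall>a b. \<mu> (parity_aut M a) (nab (Some i) b) + \<mu> (nab (Some i) a) b + ksgn (of_nat N) (nab (Some i) (\<mu> a b)) = 0)"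
    if i: "i < N" for i
  proof -
    \<comment> \<open>The term with \<theta>^i is written as y (S^i a) b, so that its residue is a
      value of \<mu>.\<close>
    let ?E = "\<lambda>(a, b). y (parity_aut M a) (nab (Some i) b) + y (nab (Some i) a) b + coeff_op 1 (nab (Some i)) (y a b)"
    have *: "(\<forall>x\<in>UNIV. ?E x = 0) \<longleftrightarrow> (\<forall>x\<in>UNIV. resid N 0 (?E x) = 0)"
    proof (rule resid_zero_iff)
      fix x :: "'v \<times> 'v" and j assume j: "j < N"
      obtain a b where x: "x = (a, b)" by (cases x)
      have 1: "tht 0 j (y (parity_aut M a) (nab (Some i) b)) = - y (parity_aut M (nab (Some j) a)) (nab (Some i) b)"
        using ybaseD(6)[OF y j, of "parity_aut M a"] nab_parity_aut[of "Some j" a]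
        by (simp add: additive.minus[OF ybaseD(2)[OF y]])
      have 2: "tht 0 j (y (nab (Some i) a) b) = - y (nab (Some i) (nab (Some j) a)) b"
        using ybaseD(6)[OF y j, of "nab (Some i) a" b] nab_commute[of "Some j" "Some i" a]
        by (simp add: additive.minus[OF ybaseD(2)[OF y]])
      have 3: "tht 0 j (coeff_op 1 (nab (Some i)) (y a b)) = - coeff_op 1 (nab (Some i)) (y (nab (Some j) a) b)"
        using coeff_nab_var[OF ybaseD(5)[OF y, of a b], of "Some i" 0 "Some j"] ybaseD(6)[OF y j, of a b] by simp
      have "tht 0 j (?E x) = ksgn 1 (?E (nab (Some j) a, b))"
        by (simp add: x additive.add[OF additive_tht] 1 2 3)
      then show "\<exists>x'\<in>UNIV. \<exists>r. tht 0 j (?E x) = ksgn r (?E x')" by blast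
    qed
    have "resid N 0 (?E (a, b)) = const (\<mu> (parity_aut M a) (nab (Some i) b) + \<mu> (nab (Some i) a) b + ksgn (of_nat N) (nab (Some i) (\<mu> a b)))" for a b
      using resid_coeff_op[OF additive_nab ybaseD(5)[OF y], of N 0 1 "Some i" a b]
      by (simp add: additive.add[OF additive_resid] ybaseD(7)[OF y] coeff_op_const
        additive.add[OF additive_const] additive_ksgn_commute[OF additive_const])
    then have 1: "resid N 0 (?E (a, b)) = 0 \<longleftrightarrow> \<mu> (parity_aut M a) (nab (Some i) b) + \<mu> (nab (Some i) a) b + ksgn (of_nat N) (nab (Some i) (\<mu> a b)) = 0" for a b
      by simp
    have 2: "?E (a, b) = 0 \<longleftrightarrow> y (parity_aut M a) (nab (Some i) b) = - tht 0 i (y a b) - coeff_op 1 (nab (Some i)) (y a b)" for a b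
      unfolding prod.case ybaseD(6)[OF y i] by (rule sum_3_eq_0_iff)
    have "(\<forall>a b. ?E (a, b) = 0) \<longleftrightarrow> (\<forall>x\<in>UNIV. ?E x = 0)" by (simp only: ball_UNIV split_paired_All)
    also note *
    also have "(\<forall>x\<in>UNIV. resid N 0 (?E x) = 0) \<longleftrightarrow> (\<forall>a b. resid N 0 (?E (a, b)) = 0)" by (simp only: ball_UNIV split_paired_All)
    finally show ?thesis by (simp only: 1 2)
  qed
  then show ?thesis by blast
qed

lemma skew_residue_iff:
  assumes y: "ybase y \<mu>"
    and S: "\<And>i a b p. i < N \<Longrightarrow> a \<in> hpart M p \<Longrightarrow>
      y a (nab (Some i) b) = ksgn p (- tht 0 i (y a b) - coeff_op 1 (nab (Some i)) (y a b))"
  shows "skew 1 y \<longleftrightarrow> (\<forall>p q. \<forall>a\<in>hpart M p. \<forall>b\<in>hpart M q. \<mu> b a = ksgn (p * q + 1 + of_nat N) (\<mu> a b))"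
proof -
  let ?A = "{(p, q, a, b). a \<in> hpart M p \<and> b \<in> hpart M q}"
  let ?E = "\<lambda>(p, q, a, b). y b a - ksgn (p * q + 1) (flip 0 (y a b))"
  have *: "(\<forall>x\<in>?A. ?E x = 0) \<longleftrightarrow> (\<forall>x\<in>?A. resid N 0 (?E x) = 0)"
  proof (rule resid_zero_iff)
    fix x i assume xA: "x \<in> ?A" and i: "i < N"
    obtain p q a b where x: "x = (p, q, a, b)" by (cases x)
    with xA have h: "a \<in> hpart M p" "b \<in> hpart M q" by auto
    \<comment> \<open>The flip exchanges the rules for the two arguments: the factor -\<theta>^i -
      S^i coming from S^i b turns into \<theta>^i, which matches the factor produced by y (S^i b)
      a.\<close>
    have "flip 0 (tht 0 i (y a b)) = - tht 0 i (flip 0 (y a b)) - coeff_op 1 (nab (Some i)) (flip 0 (y a b))"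
      using sub_var[OF ybaseD(5)[OF y, of a b], of UNIV "{0}" 0 "Some i"] by (simp add: sop_def)
    then have "flip 0 (y a (nab (Some i) b)) = ksgn p (tht 0 i (flip 0 (y a b)))"
      using sub_coeff_nab[OF ybaseD(5)[OF y, of a b], of UNIV "{0}" "Some i"]
      by (simp add: S[OF i h(1)] additive_ksgn_commute[OF additive_sub] additive.diff[OF additive_sub] additive.minus[OF additive_sub])
    then have "tht 0 i (?E x) = ksgn 0 (?E (p, q + 1, a, nab (Some i) b))"
      using ybaseD(6)[OF y i, of b a]
      by (simp add: x additive.diff[OF additive_tht] additive.add[OF additive_tht] additive_ksgn_commute[OF additive_tht] algebra_simps)
    moreover have "(p, q + 1, a, nab (Some i) b) \<in> ?A" using h nab_hpart[OF h(2), of "Some i"] by simp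
    ultimately show "\<exists>x'\<in>?A. \<exists>r. tht 0 i (?E x) = ksgn r (?E x')" by blast
  qed
  have "resid N 0 (?E (p, q, a, b)) = const (\<mu> b a - ksgn (p * q + 1 + of_nat N) (\<mu> a b))" for p q a b
    using resid_flip[OF ybaseD(4)[OF y], of N a b]
    by (simp add: additive.diff[OF additive_resid] additive.add[OF additive_resid] additive_ksgn_commute[OF additive_resid] ybaseD(7)[OF y]
      additive.diff[OF additive_const] additive.add[OF additive_const] additive_ksgn_commute[OF additive_const] algebra_simps)
  then have 1: "resid N 0 (?E (p, q, a, b)) = 0 \<longleftrightarrow> \<mu> b a = ksgn (p * q + 1 + of_nat N) (\<mu> a b)" for p q a b
    by simp
  have 2: "?E (p, q, a, b) = 0 \<longleftrightarrow> y b a = ksgn (p * q + 1) (flip 0 (y a b))" for p q a b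
    by (simp only: prod.case eq_iff_diff_eq_0[symmetric])
  have A: "(\<forall>p q. \<forall>a\<in>hpart M p. \<forall>b\<in>hpart M q. R (p, q, a, b)) \<longleftrightarrow> (\<forall>x\<in>?A. R x)" for R
    by auto
  have "(\<forall>p q. \<forall>a\<in>hpart M p. \<forall>b\<in>hpart M q. ?E (p, q, a, b) = 0) \<longleftrightarrow> (\<forall>x\<in>?A. ?E x = 0)" by (rule A)
  also note *
  also have "(\<forall>x\<in>?A. resid N 0 (?E x) = 0) \<longleftrightarrow>
      (\<forall>p q. \<forall>a\<in>hpart M p. \<forall>b\<in>hpart M q. resid N 0 (?E (p, q, a, b)) = 0)" by (rule A[symmetric])
  finally show ?thesis unfolding skew_def by (simp only: 1 2)
qed

section \<open>The three terms under the odd generators, and their residues\<close>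

lemma bil_S:
  assumes "bil G" "i < N" "a \<in> hpart M p"
  shows "G a (nab (Some i) b) = ksgn p (- tht 0 i (G a b) - coeff_op 1 (nab (Some i)) (G a b))"
  using bilD(8)[OF assms(1,2), of a b] additive_ksgn_commute[of "\<lambda>a. G a (nab (Some i) b)" p a, OF bilD(2)[OF assms(1)]]
  by (simp add: parity_aut_hom[OF assms(3)] ksgn_eq_iff)

lemma bil_fin: "bil F \<Longrightarrow> F a b \<in> fin"
  using bilD(5) over_fin by blast

lemmas additive_bil = bilD(1) bilD(2)

lemma vsub_tht: "f \<in> fin \<Longrightarrow> vsub (\<lambda>_. {j}) (tht k i f) = tht j i (vsub (\<lambda>_. {j}) f)"
  "f \<in> fin \<Longrightarrow> vsub (\<lambda>_. {0, 1}) (tht k i f) = tht 0 i (vsub (\<lambda>_. {0, 1}) f) + tht 1 i (vsub (\<lambda>_. {0, 1}) f)"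
  using vsub_var[of f _ k "Some i"] by simp_all

text \<open>In the inner operation S^i on b becomes -\<theta>_1^i - S^i, and the outer operation
  turns S^i on its first argument into \<theta>_1^i + \<theta>_2^i. The \<theta>_1^i cancel, leaving
  \<theta>_2^i with the same sign as for \<open>T2\<close> and \<open>T3\<close>; hence the sum of
  the three is stable.\<close>

lemma T1_shift:
  assumes F: "bil F" and G: "bil G" and i: "i < N" and a: "a \<in> hpart M p"
  shows "T1 F G a (nab (Some i) b) c = ksgn (1 + p) (tht 1 i (T1 F G a b c))"
proof -
  let ?H = "\<lambda>u. vsub (\<lambda>_. {0, 1}) (F u c)" and ?X = "G a b"
  have H: "additive ?H" "\<And>w. ?H w \<in> fin" using additive_bil(2)[OF F] bil_fin[OF F] by simp_all
  have X: "?X \<in> fin" by (rule bil_fin[OF G])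
  have 1: "kext 1 ?H (tht 0 i ?X) = - tht 0 i (kext 1 ?H ?X)"
    using kext_var[OF H X, of 1 0 "Some i"] by simp
  have "kext 1 ?H (coeff_op 1 (nab (Some i)) ?X) = kext 0 (\<lambda>w. tht 0 i (?H w) + tht 1 i (?H w)) ?X"
    using kext_coeff_op[OF H additive_nab X, of 1 1 "Some i"] bilD(7)[OF F i] vsub_tht(2)[OF bil_fin[OF F]] by simp
  then have 2: "kext 1 ?H (coeff_op 1 (nab (Some i)) ?X) = tht 0 i (kext 1 ?H ?X) + tht 1 i (kext 1 ?H ?X)"
    using var_kext[OF H X, of _ "Some i" 1] by (simp add: kext_plus)
  have K: "additive (kext 1 ?H)" using H by simp
  show ?thesis
    unfolding T1_def bil_S[OF G i a] additive_ksgn_commute[OF K] additive.diff[OF K] additive.minus[OF K] 1 2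
    by (simp add: ksgn_minus)
qed

lemma T2_shift:
  assumes F: "bil F" and G: "bil G" and i: "i < N"
  shows "T2 p (q + 1) F G a (nab (Some i) b) c = ksgn (1 + p) (tht 1 i (T2 p q F G a b c))"
proof -
  let ?H = "\<lambda>u. vsub (\<lambda>_. {1}) (F b u)" and ?X = "G a c"
  have H: "additive ?H" "\<And>w. ?H w \<in> fin" using additive_bil(1)[OF F] bil_fin[OF F] by simp_all
  have "tht 1 i (kext (1 + q) ?H ?X) = kext q (\<lambda>u. vsub (\<lambda>_. {1}) (F (nab (Some i) b) u)) ?X"
    using var_kext[OF H bil_fin[OF G], of 1 "Some i" "1 + q"] bilD(7)[OF F i] vsub_tht(1)[OF bil_fin[OF F]] by (simp add: ac_simps)
  then show ?thesis
    by (simp add: T2_def additive_ksgn_commute[OF additive_tht] algebra_simps)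
qed

lemma T3_shift:
  assumes F: "bil F" and G: "bil G" and i: "i < N"
  shows "T3 p F G a (nab (Some i) b) c = ksgn (1 + p) (tht 1 i (T3 p F G a b c))"
proof -
  let ?H = "\<lambda>u. vsub (\<lambda>_. {0}) (F a u)" and ?X = "vsub (\<lambda>_. {1}) (G b c)"
  have H: "additive ?H" "\<And>w. ?H w \<in> fin" using additive_bil(1)[OF F] bil_fin[OF F] by simp_all
  have "kext (1 + p) ?H (vsub (\<lambda>_. {1}) (G (nab (Some i) b) c)) = ksgn (1 + p) (tht 1 i (kext (1 + p) ?H ?X))"
    using kext_var[OF H vsub_fin[OF bil_fin[OF G]], of "1 + p" 1 "Some i"] bilD(7)[OF G i] vsub_tht(1)[OF bil_fin[OF G]] by simp
  then show ?thesis
    by (simp add: T3_def additive_ksgn_commute[OF additive_tht] ksgn_minus algebra_simps)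
qed

lemma T2_shift_left:
  assumes F: "bil F" and G: "bil G" and i: "i < N"
  shows "T2 (p + 1) q F G (nab (Some i) a) b c = - tht 0 i (T2 p q F G a b c)"
proof -
  let ?H = "\<lambda>u. vsub (\<lambda>_. {1}) (F b u)" and ?X = "G a c"
  have H: "additive ?H" "\<And>w. ?H w \<in> fin" using additive_bil(1)[OF F] bil_fin[OF F] by simp_all
  have "kext (1 + q) ?H (tht 0 i ?X) = ksgn (1 + q) (tht 0 i (kext (1 + q) ?H ?X))"
    using kext_var[OF H bil_fin[OF G], of "1 + q" 0 "Some i"] by simp
  then show ?thesis
    by (simp add: T2_def bilD(7)[OF G i] additive_ksgn_commute[OF additive_tht] ksgn_minus algebra_simps)
qed

lemma T3_shift_left:
  assumes F: "bil F" and G: "bil G" and i: "i < N"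
  shows "T3 (p + 1) F G (nab (Some i) a) b c = - tht 0 i (T3 p F G a b c)"
proof -
  let ?H = "\<lambda>u. vsub (\<lambda>_. {0}) (F a u)" and ?X = "vsub (\<lambda>_. {1}) (G b c)"
  have H: "additive ?H" "\<And>w. ?H w \<in> fin" using additive_bil(1)[OF F] bil_fin[OF F] by simp_all
  have "tht 0 i (kext (1 + p) ?H ?X) = kext p (\<lambda>u. vsub (\<lambda>_. {0}) (F (nab (Some i) a) u)) ?X"
    using var_kext[OF H vsub_fin[OF bil_fin[OF G]], of 0 "Some i" "1 + p"] bilD(7)[OF F i] vsub_tht(1)[OF bil_fin[OF F]] by (simp add: ac_simps)
  then show ?thesis
    by (simp add: T3_def additive_ksgn_commute[OF additive_tht] ksgn_minus algebra_simps)
qed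

lemma T_over:
  assumes F: "bil F" and G: "bil G"
  shows "T1 F G a b c \<in> fin" "T2 p q F G a b c \<in> fin" "T3 p F G a b c \<in> fin"
  unfolding T1_def T2_def T3_def
  by (simp_all add: kext_fin bil_fin[OF F] bil_fin[OF G] additive_bil(1)[OF F] additive_bil(2)[OF F])

lemma resid_vsub_y:
  assumes y: "ybase y \<mu>" and K: "finite K" "1 \<in> K"
  shows "resid N 1 (vsub (\<lambda>_. K) (y a b)) = const (\<mu> a b)"
  using resid_vsub[OF ybaseD(4)[OF y, of a b], of "\<lambda>_. K" 0 1 N] K ybaseD(7)[OF y] by simp

text \<open>The residue is taken in \<Lambda>_2. In the three terms of the Leibniz identity
  \<Lambda>_2 enters through y alone, so the residue turns y into \<mu> and leaves the bracket
  intact.\<close>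

lemma resid_T1:
  assumes y: "ybase y \<mu>" and G: "bil G"
  shows "resid N 1 (T1 y G a b c) = coeff_op (1 + of_nat N) (\<lambda>u. \<mu> u c) (G a b)"
  unfolding T1_def
  by (subst resid_kext_outer[OF _ _ bilD(5)[OF G]])
    (simp_all add: resid_vsub_y[OF y] coeff_op_def ybaseD(2)[OF y] ybaseD(5)[OF y] resid_vsub_y[OF y, simplified])

lemma resid_T2:
  assumes y: "ybase y \<mu>" and G: "bil G"
  shows "resid N 1 (T2 p q y G a b c) = ksgn (q * (1 + p)) (coeff_op (1 + q + of_nat N) (\<mu> b) (G a c))"
  unfolding T2_def additive_ksgn_commute[OF additive_resid]
  by (subst resid_kext_outer[OF _ _ bilD(5)[OF G]])
    (simp_all add: resid_vsub_y[OF y] coeff_op_def ybaseD(1)[OF y] ybaseD(5)[OF y] resid_vsub_y[OF y, simplified])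

lemma vsub_0_bil: "bil F \<Longrightarrow> vsub (\<lambda>_. {0}) (F a b) = F a b"
  by (rule vsub_id[OF bilD(5)]) auto

lemma resid_T3:
  assumes y: "ybase y \<mu>" and F: "bil F"
  shows "resid N 1 (T3 p F y a b c) = ksgn (p + (1 + p) * of_nat N) (F a (\<mu> b c))"
proof -
  have "resid N 1 (kext (1 + p) (\<lambda>u. F a u) (vsub (\<lambda>_. {1}) (y b c)))
      = ksgn ((1 + p) * of_nat N) (kext (1 + p) (\<lambda>u. F a u) (resid N 1 (vsub (\<lambda>_. {1}) (y b c))))"
    by (rule resid_kext_inner[where S = "vr N 1"]) (use bilD(1,5)[OF F] ybaseD(5)[OF y] in simp_all)
  then show ?thesis
    unfolding T3_def vsub_0_bil[OF F] additive_ksgn_commute[OF additive_resid]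
    using resid_vsub_y[OF y, of "{1}" b c] by (simp add: kext_const bilD(1)[OF F])
qed

definition hom3 :: "(bit \<times> bit \<times> bit \<times> 'v \<times> 'v \<times> 'v) set"
  where "hom3 = {(p, q, r, a, b, c). a \<in> hpart M p \<and> b \<in> hpart M q \<and> c \<in> hpart M r}"

lemma all_hom3: "(\<forall>p q r. \<forall>a\<in>hpart M p. \<forall>b\<in>hpart M q. \<forall>c\<in>hpart M r. R (p, q, r, a, b, c)) \<longleftrightarrow> (\<forall>x\<in>hom3. R x)"
  unfolding hom3_def by auto

lemma leibniz_iff:
  assumes y: "ybase y \<mu>" and b: "bil \<beta>" "bil y"
  shows "(\<forall>p q r. \<forall>a\<in>hpart M p. \<forall>b\<in>hpart M q. \<forall>c\<in>hpart M r. T1 y \<beta> a b c + (T2 p q y \<beta> a b c + T3 p \<beta> y a b c) = 0) \<longleftrightarrow>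
    (\<forall>p q r. \<forall>a\<in>hpart M p. \<forall>b\<in>hpart M q. \<forall>c\<in>hpart M r.
      coeff_op (1 + of_nat N) (\<lambda>u. \<mu> u c) (\<beta> a b) + (ksgn (q * (1 + p)) (coeff_op (1 + q + of_nat N) (\<mu> b) (\<beta> a c)) +
        ksgn (p + (1 + p) * of_nat N) (\<beta> a (\<mu> b c))) = 0)"
proof -
  let ?E = "\<lambda>(p, q, r, a, b, c). T1 y \<beta> a b c + (T2 p q y \<beta> a b c + T3 p \<beta> y a b c)"
  have *: "(\<forall>x\<in>hom3. ?E x = 0) \<longleftrightarrow> (\<forall>x\<in>hom3. resid N 1 (?E x) = 0)"
  proof (rule resid_zero_iff)
    fix x i assume xA: "x \<in> hom3" and i: "i < N"
    obtain p q r a b' c where x: "x = (p, q, r, a, b', c)" by (cases x)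
    with xA have h: "a \<in> hpart M p" "b' \<in> hpart M q" "c \<in> hpart M r" by (auto simp: hom3_def)
    have "?E (p, q + 1, r, a, nab (Some i) b', c) = ksgn (1 + p) (tht 1 i (?E x))"
      by (simp only: x prod.case T1_shift[OF b(2,1) i h(1)] T2_shift[OF b(2,1) i] T3_shift[OF b i]
        additive.add[OF additive_tht] ksgn_add)
    then have "tht 1 i (?E x) = ksgn (1 + p) (?E (p, q + 1, r, a, nab (Some i) b', c))" by (rule ksgn_eq_iff[THEN iffD1, OF sym])
    moreover have "(p, q + 1, r, a, nab (Some i) b', c) \<in> hom3" using h nab_hpart[OF h(2), of "Some i"] by (simp add: hom3_def)
    ultimately show "\<exists>x'\<in>hom3. \<exists>r. tht 1 i (?E x) = ksgn r (?E x')" by blast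
  qed
  have 1: "resid N 1 (?E (p, q, r, a, b, c)) = coeff_op (1 + of_nat N) (\<lambda>u. \<mu> u c) (\<beta> a b) +
      (ksgn (q * (1 + p)) (coeff_op (1 + q + of_nat N) (\<mu> b) (\<beta> a c)) + ksgn (p + (1 + p) * of_nat N) (\<beta> a (\<mu> b c)))" for p q r a b c
    unfolding prod.case additive.add[OF additive_resid] resid_T1[OF y b(1)] resid_T2[OF y b(1)] resid_T3[OF y b(1)] ..
  have "(\<forall>p q r. \<forall>a\<in>hpart M p. \<forall>b\<in>hpart M q. \<forall>c\<in>hpart M r. ?E (p, q, r, a, b, c) = 0) \<longleftrightarrow> (\<forall>x\<in>hom3. ?E x = 0)"
    by (rule all_hom3)
  also note *
  also have "(\<forall>x\<in>hom3. resid N 1 (?E x) = 0) \<longleftrightarrow>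
      (\<forall>p q r. \<forall>a\<in>hpart M p. \<forall>b\<in>hpart M q. \<forall>c\<in>hpart M r. resid N 1 (?E (p, q, r, a, b, c)) = 0)" by (rule all_hom3[symmetric])
  finally show ?thesis unfolding 1 unfolding prod.case .
qed

lemma assoc_iff:
  assumes y: "ybase y \<mu>" and b: "bil y"
  shows "(\<forall>p q r. \<forall>a\<in>hpart M p. \<forall>b\<in>hpart M q. \<forall>c\<in>hpart M r. T2 p q y y a b c + T3 p y y a b c = 0) \<longleftrightarrow>
    (\<forall>p q r. \<forall>a\<in>hpart M p. \<forall>b\<in>hpart M q. \<forall>c\<in>hpart M r.
      ksgn (q * (1 + p) + q * of_nat N) (\<mu> b (\<mu> a c)) + ksgn (p + (1 + p) * of_nat N) (\<mu> a (\<mu> b c)) = 0)"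
proof -
  let ?E = "\<lambda>(p, q, r, a, b, c). T2 p q y y a b c + T3 p y y a b c"
  have fE: "?E x \<in> fin" for x using T_over[OF b b] by (auto intro: over_add split: prod.split)
  have "(\<forall>p q r. \<forall>a\<in>hpart M p. \<forall>b\<in>hpart M q. \<forall>c\<in>hpart M r. ?E (p, q, r, a, b, c) = 0) \<longleftrightarrow> (\<forall>x\<in>hom3. ?E x = 0)"
    by (rule all_hom3)
  also have "\<dots> \<longleftrightarrow> (\<forall>x\<in>hom3. resid N 1 (?E x) = 0)"
  proof (rule resid_zero_iff)
    fix x i assume xA: "x \<in> hom3" and i: "i < N"
    obtain p q r a b' c where x: "x = (p, q, r, a, b', c)" by (cases x)
    with xA have h: "a \<in> hpart M p" "b' \<in> hpart M q" "c \<in> hpart M r" by (auto simp: hom3_def)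
    have "?E (p, q + 1, r, a, nab (Some i) b', c) = ksgn (1 + p) (tht 1 i (?E x))"
      by (simp only: x prod.case T2_shift[OF b b i] T3_shift[OF b b i] additive.add[OF additive_tht] ksgn_add)
    then have "tht 1 i (?E x) = ksgn (1 + p) (?E (p, q + 1, r, a, nab (Some i) b', c))" by (rule ksgn_eq_iff[THEN iffD1, OF sym])
    moreover have "(p, q + 1, r, a, nab (Some i) b', c) \<in> hom3" using h nab_hpart[OF h(2), of "Some i"] by (simp add: hom3_def)
    ultimately show "\<exists>x'\<in>hom3. \<exists>r. tht 1 i (?E x) = ksgn r (?E x')" by blast
  qed
  \<comment> \<open>One y is left, in the variable \<Lambda>_1. Stability under its odd variables
    now comes from S^i applied to a.\<close>
  also have "\<dots> \<longleftrightarrow> (\<forall>x\<in>hom3. resid N 0 (resid N 1 (?E x)) = 0)"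
  proof (rule resid_zero_iff)
    fix x i assume xA: "x \<in> hom3" and i: "i < N"
    obtain p q r a b' c where x: "x = (p, q, r, a, b', c)" by (cases x)
    with xA have h: "a \<in> hpart M p" "b' \<in> hpart M q" "c \<in> hpart M r" by (auto simp: hom3_def)
    have "?E (p + 1, q, r, nab (Some i) a, b', c) = - tht 0 i (?E x)"
      by (simp only: x prod.case T2_shift_left[OF b b i] T3_shift_left[OF b b i] additive.add[OF additive_tht]) simp
    then have "resid N 1 (?E (p + 1, q, r, nab (Some i) a, b', c)) = - resid N 1 (tht 0 i (?E x))"
      by (simp only: additive.minus[OF additive_resid])
    also have "resid N 1 (tht 0 i (?E x)) = ksgn (of_nat N) (tht 0 i (resid N 1 (?E x)))"
      using resid_var[OF fE, of 0 1 N "Some i" x] by simp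
    finally have "tht 0 i (resid N 1 (?E x)) = ksgn (1 + of_nat N) (resid N 1 (?E (p + 1, q, r, nab (Some i) a, b', c)))"
      by (simp add: ksgn_minus ac_simps)
    moreover have "(p + 1, q, r, nab (Some i) a, b', c) \<in> hom3" using h nab_hpart[OF h(1), of "Some i"] by (simp add: hom3_def)
    ultimately show "\<exists>x'\<in>hom3. \<exists>r. tht 0 i (resid N 1 (?E x)) = ksgn r (resid N 1 (?E x'))" by blast
  qed
  also have "\<dots> \<longleftrightarrow> (\<forall>p q r. \<forall>a\<in>hpart M p. \<forall>b\<in>hpart M q. \<forall>c\<in>hpart M r. resid N 0 (resid N 1 (?E (p, q, r, a, b, c))) = 0)"
    by (rule all_hom3[symmetric])
  finally have *: "(\<forall>p q r. \<forall>a\<in>hpart M p. \<forall>b\<in>hpart M q. \<forall>c\<in>hpart M r. ?E (p, q, r, a, b, c) = 0) \<longleftrightarrow>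
    (\<forall>p q r. \<forall>a\<in>hpart M p. \<forall>b\<in>hpart M q. \<forall>c\<in>hpart M r. resid N 0 (resid N 1 (?E (p, q, r, a, b, c))) = 0)" .
  have \<mu>: "additive (\<mu> b)" for b
  proof
    fix u v
    have "const (\<mu> b (u + v)) = const (\<mu> b u + \<mu> b v)"
      unfolding additive.add[OF additive_const] ybaseD(7)[OF y, symmetric] additive.add[OF ybaseD(1)[OF y]] additive.add[OF additive_resid] ..
    then show "\<mu> b (u + v) = \<mu> b u + \<mu> b v" by simp
  qed
  have 1: "resid N 0 (coeff_op (1 + q + of_nat N) (\<mu> b) (y a c)) = ksgn (q * of_nat N) (const (\<mu> b (\<mu> a c)))" for q a b c
    using resid_coeff_op[OF \<mu>[of b] ybaseD(5)[OF y, of a c], of N 0 "1 + q + of_nat N"]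
    by (simp add: ybaseD(7)[OF y] coeff_op_const[OF \<mu>] algebra_simps)
  have 2: "resid N 0 (resid N 1 (?E (p, q, r, a, b, c))) = const (ksgn (q * (1 + p) + q * of_nat N) (\<mu> b (\<mu> a c)) + ksgn (p + (1 + p) * of_nat N) (\<mu> a (\<mu> b c)))" for p q r a b c
    unfolding prod.case additive.add[OF additive_resid] resid_T2[OF y b] resid_T3[OF y b] additive_ksgn_commute[OF additive_resid] ybaseD(7)[OF y] 1
      additive.add[OF additive_const] additive_ksgn_commute[OF additive_const] ksgn_simps ..
  show ?thesis using * unfolding 2 const_eq_0_iff unfolding prod.case .
qed

end

subsection \<open>Change of parity\<close>

lemma bit_cases: "(p::bit) = 0 \<or> p = 1"
  using UNIV_bit by auto

lemma ksgn_cancel: "ksgn p x = ksgn q y \<longleftrightarrow> x = ksgn (p + q) y" for x y :: "'a::ab_group_add"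
  unfolding ksgn_eq_iff[of p x] by simp

lemma ksgn_three:
  fixes x1 x2 x3 :: "'a::ab_group_add"
  assumes "f2 = e1 + e2" "f3 = e1 + e3 + 1"
  shows "ksgn e3 x3 = ksgn e1 x1 + ksgn e2 x2 \<longleftrightarrow> x1 + (ksgn f2 x2 + ksgn f3 x3) = 0"
proof -
  have "x1 + (ksgn f2 x2 + ksgn f3 x3) = ksgn (e1 + 1) (ksgn e3 x3 - (ksgn e1 x1 + ksgn e2 x2))"
    unfolding assms using bit_cases[of e1] bit_cases[of e2] bit_cases[of e3] by (elim disjE) (simp_all add: algebra_simps)
  then show ?thesis by (simp only: ksgn_eq_0_iff eq_iff_diff_eq_0[symmetric])
qed

context hwmodule
begin

definition sN :: bit where "sN = of_nat (Suc N)"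

lemma of_nat_N: "of_nat N = 1 + sN"
  by (simp add: sN_def)

text \<open>As \<open>M\<close> stands for \<Pi>^{N+1} V, the second shift gives back V.\<close>

abbreviation "P \<equiv> Pi_pow (Suc N) M"

lemma hpart_P: "hpart P p = hpart M (p + sN)"
  by (simp add: sN_def)

lemma proj_P: "proj P p v = proj M (p + sN) v"
  unfolding proj_def hpart_P by (simp add: ac_simps)

lemma parp_P: "parp P r f \<longleftrightarrow> parp M (r + sN) f"
  unfolding parp_def hpart_P by (simp add: ac_simps)

text \<open>The sign (-1)^{p(a)(N+1)} of the theorem, with p the parity of V, made into a linear
  operator on the first argument. It is an involution, so nothing is lost by composing with
  it.\<close>

definition sg :: "'v \<Rightarrow> 'v"
  where "sg a = (\<Sum>p\<in>UNIV. ksgn (p * sN) (proj P p a))"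

lemma sg_eq: "sg a = proj M sN a + ksgn sN (proj M (1 + sN) a)"
  unfolding sg_def UNIV_bit proj_P by simp

lemma additive_sg [simp]: "additive sg"
proof -
  have "sg = (\<lambda>a. proj M sN a + ksgn sN (proj M (1 + sN) a))" by (rule ext) (rule sg_eq)
  then show ?thesis by simp
qed

lemma sg_hom: "a \<in> hpart M p \<Longrightarrow> sg a = ksgn (p * sN + sN) a"
  unfolding sg_eq using bit_cases[of p] bit_cases[of sN]
  by (elim disjE) (simp_all add: proj_id proj_other)

lemma sg_sg: "sg (sg a) = a"
proof (rule hom_eqI[of "\<lambda>a. sg (sg a)" "\<lambda>a. a"])
  fix p a assume "a \<in> hpart M p"
  then show "sg (sg a) = a" by (simp add: sg_hom additive_ksgn_commute[OF additive_sg])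
qed (simp_all add: additive_comp[OF additive_sg])

lemma sg_scl: "sg (scl M c a) = scl M c (sg a)"
  unfolding sg_eq by (simp add: proj_scl vs.scale_right_distrib additive_ksgn_commute[OF additive_scl])

lemma sg_nab: "sg (nab l v) = ksgn (lpar l * sN) (nab l (sg v))"
proof (rule hom_eqI[of "\<lambda>v. sg (nab l v)" "\<lambda>v. ksgn (lpar l * sN) (nab l (sg v))"])
  fix p a assume a: "a \<in> hpart M p"
  show "sg (nab l a) = ksgn (lpar l * sN) (nab l (sg a))"
    unfolding sg_hom[OF a] sg_hom[OF nab_hpart[OF a]] additive_ksgn_commute[OF additive_nab]
    by (simp add: algebra_simps)
qed (simp_all add: additive_comp[OF additive_sg])

lemma all_sg: "(\<forall>a. Q (sg a)) \<longleftrightarrow> (\<forall>a. Q a)"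
proof
  assume h: "\<forall>a. Q (sg a)"
  show "\<forall>a. Q a"
  proof
    fix a
    from h have "Q (sg (sg a))" by blast
    then show "Q a" by (simp only: sg_sg)
  qed
qed blast

definition lin :: "('k \<Rightarrow> 'w \<Rightarrow> 'w::ab_group_add) \<Rightarrow> ('v \<Rightarrow> 'v \<Rightarrow> 'w) \<Rightarrow> bool"
  where "lin t F \<longleftrightarrow> (\<forall>a. additive (F a)) \<and> (\<forall>b. additive (\<lambda>a. F a b)) \<and>
    (\<forall>c a b. F (scl M c a) b = t c (F a b) \<and> F a (scl M c b) = t c (F a b))"

lemma linD:
  assumes "lin t F"
  shows "additive (F a)" "additive (\<lambda>a. F a b)" "F (scl M c a) b = t c (F a b)" "F a (scl M c b) = t c (F a b)"
  using assms unfolding lin_def by blast+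

lemma bilinear_sg:
  assumes t: "vector_space t"
  shows "bilinear_map (scl M) t (\<lambda>a b. F (sg a) b) \<longleftrightarrow> lin t F"
proof -
  have L: "Vector_Spaces.linear (scl M) t f \<longleftrightarrow> additive f \<and> (\<forall>c x. f (scl M c x) = t c (f x))" for f
    unfolding Vector_Spaces.linear_iff additive_def using t vs by blast
  have 1: "(\<forall>a. additive (F (sg a)) \<and> (\<forall>c x. F (sg a) (scl M c x) = t c (F (sg a) x))) \<longleftrightarrow>
      (\<forall>a. additive (F a) \<and> (\<forall>c x. F a (scl M c x) = t c (F a x)))"
    by (rule all_sg[of "\<lambda>a. additive (F a) \<and> (\<forall>c x. F a (scl M c x) = t c (F a x))"])
  have 2: "additive (\<lambda>a. F (sg a) b) \<and> (\<forall>c x. F (sg (scl M c x)) b = t c (F (sg x) b)) \<longleftrightarrow>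
      additive (\<lambda>a. F a b) \<and> (\<forall>c x. F (scl M c x) b = t c (F x b))" (is "?l \<longleftrightarrow> ?r") for b
  proof
    assume l: ?l
    have "F (u + v) b = F u b + F v b" for u v
      using additive.add[of "\<lambda>a. F (sg a) b" "sg u" "sg v"] l by (simp add: additive.add[OF additive_sg] sg_sg)
    moreover have "F (scl M c x) b = t c (F x b)" for c x
      using l[THEN conjunct2, rule_format, of c "sg x"] by (simp add: sg_scl sg_sg)
    ultimately show ?r by (simp add: additive_def)
  next
    assume r: ?r
    then have "additive (\<lambda>a. F (sg a) b)" using additive_comp[OF _ additive_sg, of "\<lambda>a. F a b"] by simp
    with r show ?l by (simp add: sg_scl)
  qed
  show ?thesis unfolding bilinear_map_def L 1 2 lin_def by blast
qed

lemma lin_sg: "lin t F \<Longrightarrow> a \<in> hpart M p \<Longrightarrow> F (sg a) b = ksgn (p * sN + sN) (F a b)"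
  using additive_ksgn_commute[of "\<lambda>a. F a b" "p * sN + sN" a] linD(2)[of t F b] by (simp add: sg_hom)

lemma vector_space_pscl: "vector_space (pscl (scl M))"
  using module_pscl by (simp add: module_iff_vector_space)

lemma bil_iff_lin: "bil F \<longleftrightarrow> lin (pscl (scl M)) F \<and> (\<forall>a b. F a b \<in> over (vr N 1)) \<and>
    (\<forall>p q. \<forall>a\<in>hpart M p. \<forall>b\<in>hpart M q. parp M (1 + p + q) (F a b)) \<and>
    (\<forall>i<N. \<forall>a b. F (nab (Some i) a) b = tht 0 i (F a b) \<and>
       F (parity_aut M a) (nab (Some i) b) = - tht 0 i (F a b) - coeff_op 1 (nab (Some i)) (F a b))"
  unfolding bil_def lin_def by (simp only: conj_assoc)

lemma nab_op: "opT M = nab None" "i < N \<Longrightarrow> opS M i = nab (Some i)"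
  by (simp_all add: nab_def)

lemma hpart_P_shift: "hpart P (p + sN) = hpart M p" "a \<in> hpart P p \<Longrightarrow> a \<in> hpart M (p + sN)"
  by (simp_all only: hpart_P add.assoc bit_add_self add_0_right)

lemma bit_shift2: "(p::bit) + s + s = p"
  by (simp add: add.assoc)

text \<open>Rules of this kind turn statements about V-homogeneous vectors into statements about
  vectors homogeneous in \<open>M\<close>, at the price of adding \<open>sN\<close> to each
  parity.\<close>

lemma all_P1: "(\<forall>p. \<forall>a\<in>hpart P p. R p a) \<longleftrightarrow> (\<forall>p. \<forall>a\<in>hpart M p. R (p + sN) a)"
proof (intro iffI allI ballI)
  fix p a assume "\<forall>p. \<forall>a\<in>hpart P p. R p a" "a \<in> hpart M p"
  then show "R (p + sN) a" using hpart_P_shift(1) by blast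
next
  fix p a assume h: "\<forall>p. \<forall>a\<in>hpart M p. R (p + sN) a" "a \<in> hpart P p"
  from h(1) hpart_P_shift(2)[OF h(2)] have "R (p + sN + sN) a" by blast
  then show "R p a" by (simp only: bit_shift2)
qed

lemma all_P2: "(\<forall>p q. \<forall>a\<in>hpart P p. \<forall>b\<in>hpart P q. R p q a b) \<longleftrightarrow>
    (\<forall>p q. \<forall>a\<in>hpart M p. \<forall>b\<in>hpart M q. R (p + sN) (q + sN) a b)"
proof (intro iffI allI ballI)
  fix p q a b assume "\<forall>p q. \<forall>a\<in>hpart P p. \<forall>b\<in>hpart P q. R p q a b" "a \<in> hpart M p" "b \<in> hpart M q"
  then show "R (p + sN) (q + sN) a b" using hpart_P_shift(1) by blast
next
  fix p q a b assume h: "\<forall>p q. \<forall>a\<in>hpart M p. \<forall>b\<in>hpart M q. R (p + sN) (q + sN) a b" "a \<in> hpart P p" "b \<in> hpart P q"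
  from h(1) hpart_P_shift(2)[OF h(2)] hpart_P_shift(2)[OF h(3)] have "R (p + sN + sN) (q + sN + sN) a b" by blast
  then show "R p q a b" by (simp only: bit_shift2)
qed

lemma all_P3: "(\<forall>p q r. \<forall>a\<in>hpart P p. \<forall>b\<in>hpart P q. \<forall>c\<in>hpart P r. R p q r a b c) \<longleftrightarrow>
    (\<forall>p q r. \<forall>a\<in>hpart M p. \<forall>b\<in>hpart M q. \<forall>c\<in>hpart M r. R (p + sN) (q + sN) (r + sN) a b c)"
proof (intro iffI allI ballI)
  fix p q r a b c assume "\<forall>p q r. \<forall>a\<in>hpart P p. \<forall>b\<in>hpart P q. \<forall>c\<in>hpart P r. R p q r a b c"
    "a \<in> hpart M p" "b \<in> hpart M q" "c \<in> hpart M r"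
  then show "R (p + sN) (q + sN) (r + sN) a b c" using hpart_P_shift(1) by blast
next
  fix p q r a b c assume h: "\<forall>p q r. \<forall>a\<in>hpart M p. \<forall>b\<in>hpart M q. \<forall>c\<in>hpart M r. R (p + sN) (q + sN) (r + sN) a b c"
    "a \<in> hpart P p" "b \<in> hpart P q" "c \<in> hpart P r"
  from h(1) hpart_P_shift(2)[OF h(2)] hpart_P_shift(2)[OF h(3)] hpart_P_shift(2)[OF h(4)]
  have "R (p + sN + sN) (q + sN + sN) (r + sN + sN) a b c" by blast
  then show "R p q r a b c" by (simp only: bit_shift2)
qed

definition Trel :: "('v \<Rightarrow> 'v \<Rightarrow> 'v spoly) \<Rightarrow> bool"
  where "Trel \<beta> \<longleftrightarrow> (\<forall>a b. \<beta> (nab None a) b = - lam 0 (\<beta> a b) \<and>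
    \<beta> a (nab None b) = lam 0 (\<beta> a b) + coeff_op 0 (nab None) (\<beta> a b))"

definition jac :: "('v \<Rightarrow> 'v \<Rightarrow> 'v spoly) \<Rightarrow> bool"
  where "jac \<beta> \<longleftrightarrow> (\<forall>p q r. \<forall>a\<in>hpart M p. \<forall>b\<in>hpart M q. \<forall>c\<in>hpart M r.
    T1 \<beta> \<beta> a b c + (T2 p q \<beta> \<beta> a b c + T3 p \<beta> \<beta> a b c) = 0)"

text \<open>The axiom of the bracket carries a sign depending on the parity of a, and so it is
  stated for homogeneous a. On the side of the operad the same sign is contained in
  \<open>parity_aut\<close>, which makes the condition additive in a.\<close>

lemma bracket_S_iff:
  assumes l: "lin (pscl (scl M)) \<beta>" and i: "i < N"
  shows "(\<forall>p. \<forall>a\<in>hpart P p. \<forall>b. \<beta> (sg (opS P i a)) b = - ksgn (of_nat N) (tht 0 i (\<beta> (sg a) b)) \<and>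
      \<beta> (sg a) (opS P i b) = ksgn (p + of_nat N) (tht 0 i (\<beta> (sg a) b) + coeff_op 1 (opS P i) (\<beta> (sg a) b))) \<longleftrightarrow>
    (\<forall>a b. \<beta> (nab (Some i) a) b = tht 0 i (\<beta> a b) \<and>
       \<beta> (parity_aut M a) (nab (Some i) b) = - tht 0 i (\<beta> a b) - coeff_op 1 (nab (Some i)) (\<beta> a b))"
    (is "?L \<longleftrightarrow> (\<forall>a b. ?R a b)")
proof -
  have c: "additive (coeff_op 1 (nab (Some i)))" by simp
  have R: "(\<beta> (sg (nab (Some i) a)) b = - ksgn (1 + sN) (tht 0 i (\<beta> (sg a) b)) \<and>
      \<beta> (sg a) (nab (Some i) b) = ksgn (p + sN + (1 + sN)) (tht 0 i (\<beta> (sg a) b) + coeff_op 1 (nab (Some i)) (\<beta> (sg a) b))) \<longleftrightarrow> ?R a b"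
    if a: "a \<in> hpart M p" for p a b
  proof -
    have "nab (Some i) a \<in> hpart M (p + 1)" using nab_hpart[OF a, of "Some i"] by simp
    note b = lin_sg[OF l this] lin_sg[OF l a]
    have "\<beta> (parity_aut M a) (nab (Some i) b) = ksgn p (\<beta> a (nab (Some i) b))"
      using additive_ksgn_commute[OF linD(2)[OF l]] by (simp add: parity_aut_hom[OF a])
    moreover have "ksgn ((p + 1) * sN + sN) x = - ksgn (1 + sN) (tht 0 i (ksgn (p * sN + sN) y)) \<longleftrightarrow> x = tht 0 i y" for x y :: "'v spoly"
      using bit_cases[of p] bit_cases[of sN] by (elim disjE) (simp_all add: additive.minus[OF additive_tht])
    moreover have "ksgn (p * sN + sN) x = ksgn (p + sN + (1 + sN)) (tht 0 i (ksgn (p * sN + sN) y) + coeff_op 1 (nab (Some i)) (ksgn (p * sN + sN) y))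
        \<longleftrightarrow> ksgn p x = - tht 0 i y - coeff_op 1 (nab (Some i)) y" for x y :: "'v spoly"
      using bit_cases[of p] bit_cases[of sN]
      by (elim disjE) (auto simp: additive.minus[OF additive_tht] additive.minus[OF c] minus_equation_iff[of x] eq_commute[of x] algebra_simps)
    ultimately show ?thesis unfolding b by simp
  qed
  have S: "opS P i = nab (Some i)" using nab_op(2)[OF i] by simp
  have "?L \<longleftrightarrow> (\<forall>p. \<forall>a\<in>hpart M p. \<forall>b. ?R a b)"
    unfolding S all_P1 of_nat_N by (intro all_cong1 ball_cong refl R)
  also have "\<dots> \<longleftrightarrow> (\<forall>a b. ?R a b)"
  proof
    assume h: "\<forall>p. \<forall>a\<in>hpart M p. \<forall>b. ?R a b"
    show "\<forall>a b. ?R a b"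
    proof (intro allI conjI)
      fix a b
      show "\<beta> (nab (Some i) a) b = tht 0 i (\<beta> a b)"
        by (rule hom_eqI[of "\<lambda>a. \<beta> (nab (Some i) a) b" "\<lambda>a. tht 0 i (\<beta> a b)"])
          (use h in \<open>auto intro: additive_comp[OF linD(2)[OF l]] additive_comp[OF additive_tht linD(2)[OF l]]\<close>)
      show "\<beta> (parity_aut M a) (nab (Some i) b) = - tht 0 i (\<beta> a b) - coeff_op 1 (nab (Some i)) (\<beta> a b)"
        by (rule hom_eqI[of "\<lambda>a. \<beta> (parity_aut M a) (nab (Some i) b)" "\<lambda>a. - tht 0 i (\<beta> a b) - coeff_op 1 (nab (Some i)) (\<beta> a b)"])
          (use h in \<open>auto intro!: additive_simps additive_comp[OF linD(2)[OF l]] additive_comp[OF additive_tht linD(2)[OF l]] additive_comp[OF c linD(2)[OF l]]\<close>)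
    qed
  qed blast
  finally show ?thesis .
qed

lemma bracket_skew_iff:
  assumes l: "lin (pscl (scl M)) \<beta>" and o: "\<forall>a b. \<beta> a b \<in> over (vr N 1)"
  shows "(\<forall>p q. \<forall>a\<in>hpart P p. \<forall>b\<in>hpart P q. \<beta> (sg b) a = - ksgn (p * q + of_nat N)
        (psubst (\<lambda>_ f. - lam 0 f - coeff_op 0 (opT P) f) (\<lambda>_ i f. - tht 0 i f - coeff_op 1 (opS P i) f) (\<beta> (sg a) b))) \<longleftrightarrow> skew 0 \<beta>"
proof -
  have f: "psubst (\<lambda>_ f. - lam 0 f - coeff_op 0 (opT M) f) (\<lambda>_ i f. - tht 0 i f - coeff_op 1 (opS M i) f) (\<beta> a b) = flip 0 (\<beta> a b)" for a b
    using o by (intro flip_eq[of _ 1]) blast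
  have e: "\<beta> (sg b) a = - ksgn ((p + sN) * (q + sN) + (1 + sN)) (flip 0 (\<beta> (sg a) b)) \<longleftrightarrow> \<beta> b a = ksgn (p * q + 0) (flip 0 (\<beta> a b))"
    if "a \<in> hpart M p" "b \<in> hpart M q" for p q a b
  proof -
    have "- ksgn ((p + sN) * (q + sN) + (1 + sN)) (ksgn (p * sN + sN) y) = ksgn (q * sN + sN) (ksgn (p * q) y)" for y :: "'v spoly"
      using bit_cases[of p] bit_cases[of q] bit_cases[of sN] by (elim disjE) simp_all
    then show ?thesis
      unfolding lin_sg[OF l that(1)] lin_sg[OF l that(2)] additive_ksgn_commute[OF additive_sub] ksgn_eq_iff[of _ "\<beta> b a"] by simp
  qed
  show ?thesis unfolding Pi_pow_simps(1-3) f all_P2 skew_def of_nat_N by (intro all_cong1 ball_cong refl e)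
qed

lemma bracket_jacobi_iff:
  assumes b: "bil \<beta>"
  shows "(\<forall>p q r. \<forall>a\<in>hpart P p. \<forall>b\<in>hpart P q. \<forall>c\<in>hpart P r.
      kext (p + of_nat N) (\<lambda>d. vsub (\<lambda>_. {0}) (\<beta> (sg a) d)) (vsub (\<lambda>_. {1}) (\<beta> (sg b) c)) =
        ksgn ((p + of_nat N) * of_nat N)
          (kext (of_nat N) (\<lambda>d. vsub (\<lambda>_. {0, 1}) (\<beta> (sg d) c)) (vsub (\<lambda>_. {0}) (\<beta> (sg a) b))) +
        ksgn ((p + of_nat N) * (q + of_nat N))
          (kext (q + of_nat N) (\<lambda>d. vsub (\<lambda>_. {1}) (\<beta> (sg b) d)) (vsub (\<lambda>_. {0}) (\<beta> (sg a) c)))) \<longleftrightarrow> jac \<beta>"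
proof -
  have l: "lin (pscl (scl M)) \<beta>" using b bil_iff_lin by blast
  have e: "kext (p + sN + (1 + sN)) (\<lambda>d. vsub (\<lambda>_. {0}) (\<beta> (sg a) d)) (vsub (\<lambda>_. {1}) (\<beta> (sg b) c)) =
        ksgn ((p + sN + (1 + sN)) * (1 + sN))
          (kext (1 + sN) (\<lambda>d. vsub (\<lambda>_. {0, 1}) (\<beta> (sg d) c)) (vsub (\<lambda>_. {0}) (\<beta> (sg a) b))) +
        ksgn ((p + sN + (1 + sN)) * (q + sN + (1 + sN)))
          (kext (q + sN + (1 + sN)) (\<lambda>d. vsub (\<lambda>_. {1}) (\<beta> (sg b) d)) (vsub (\<lambda>_. {0}) (\<beta> (sg a) c)))
      \<longleftrightarrow> T1 \<beta> \<beta> a b c + (T2 p q \<beta> \<beta> a b c + T3 p \<beta> \<beta> a b c) = 0"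
    if a: "a \<in> hpart M p" and b': "b \<in> hpart M q" for p q a b c
  proof -
    have s: "p + sN + (1 + sN) = 1 + p" "q + sN + (1 + sN) = 1 + q" by (simp_all add: ac_simps)
    have A: "additive (\<lambda>d. vsub (\<lambda>_. {0}) (\<beta> a d))" "additive (\<lambda>d. vsub (\<lambda>_. {1}) (\<beta> b d))" "additive (\<lambda>d. vsub (\<lambda>_. {0, 1}) (\<beta> d c))"
      using linD(1,2)[OF l] by simp_all
    have 3: "kext (1 + p) (\<lambda>d. vsub (\<lambda>_. {0}) (\<beta> (sg a) d)) (vsub (\<lambda>_. {1}) (\<beta> (sg b) c)) = ksgn (p * sN + q * sN + p) (T3 p \<beta> \<beta> a b c)"
      unfolding lin_sg[OF l a] lin_sg[OF l b'] additive_ksgn_commute[OF additive_vsub] kext_ksgn[OF A(1)]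
        additive_ksgn_commute[OF additive_kext[OF A(1)]] T3_def by (simp add: ac_simps)
    have 2: "kext (1 + q) (\<lambda>d. vsub (\<lambda>_. {1}) (\<beta> (sg b) d)) (\<beta> (sg a) c) = ksgn (p * sN + q * sN + q * (1 + p)) (T2 p q \<beta> \<beta> a b c)"
      unfolding lin_sg[OF l a] lin_sg[OF l b'] additive_ksgn_commute[OF additive_vsub] kext_ksgn[OF A(2)]
        additive_ksgn_commute[OF additive_kext[OF A(2)]] T2_def by (simp add: ac_simps)
    \<comment> \<open>Here \<open>sg\<close> meets the coefficients of the inner bracket, whose
      parity varies with the monomial; the variation is moved into the parity of the
      extension.\<close>
    have "kext (1 + sN) (\<lambda>d. vsub (\<lambda>_. {0, 1}) (\<beta> (sg d) c)) (\<beta> a b) = kext 1 (\<lambda>d. ksgn ((p + q) * sN) (vsub (\<lambda>_. {0, 1}) (\<beta> d c))) (\<beta> a b)"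
    proof (rule kext_cong_parp[OF bilD(6)[OF b a b']])
      fix d u assume u: "u \<in> hpart M (1 + p + q + d)"
      show "ksgn ((1 + sN) * d) (vsub (\<lambda>_. {0, 1}) (\<beta> (sg u) c)) = ksgn (1 * d) (ksgn ((p + q) * sN) (vsub (\<lambda>_. {0, 1}) (\<beta> u c)))"
        unfolding lin_sg[OF l u] additive_ksgn_commute[OF additive_vsub] by (simp add: algebra_simps)
    qed
    then have "kext (1 + sN) (\<lambda>d. vsub (\<lambda>_. {0, 1}) (\<beta> (sg d) c)) (\<beta> a b) = ksgn ((p + q) * sN) (T1 \<beta> \<beta> a b c)"
      unfolding kext_ksgn[OF A(3)] T1_def .
    moreover have "additive (kext (1 + sN) (\<lambda>d. vsub (\<lambda>_. {0, 1}) (\<beta> (sg d) c)))"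
      using additive_comp[OF linD(2)[OF l] additive_sg] by simp
    ultimately have 1: "kext (1 + sN) (\<lambda>d. vsub (\<lambda>_. {0, 1}) (\<beta> (sg d) c)) (\<beta> (sg a) b) = ksgn (p * sN + sN + (p + q) * sN) (T1 \<beta> \<beta> a b c)"
      unfolding lin_sg[OF l a] by (simp add: additive_ksgn_commute)
    \<comment> \<open>The exponents that \<open>ksgn_three\<close> needs to match; they agree for
      each choice of the parities p, q and N + 1.\<close>
    have "0 = (1 + p) * (1 + sN) + (p * sN + sN + (p + q) * sN) + ((1 + p) * (1 + q) + (p * sN + q * sN + q * (1 + p)))"
      "0 = (1 + p) * (1 + sN) + (p * sN + sN + (p + q) * sN) + (p * sN + q * sN + p) + 1"
      using bit_cases[of p] bit_cases[of q] bit_cases[of sN] by (elim disjE; simp)+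
    from ksgn_three[OF this, of "T3 p \<beta> \<beta> a b c" "T1 \<beta> \<beta> a b c" "T2 p q \<beta> \<beta> a b c"]
    show ?thesis unfolding s 3 unfolding vsub_0_bil[OF b] 1 2 ksgn_simps .
  qed
  show ?thesis unfolding of_nat_N all_P3 jac_def by (intro all_cong1 ball_cong refl e)
qed

lemma LCA_iff: "SUSY_LCA N P (\<lambda>a b. \<beta> (sg a) b) \<longleftrightarrow> bil \<beta> \<and> skew 0 \<beta> \<and> Trel \<beta> \<and> jac \<beta>"
proof -
  \<comment> \<open>The translations of the later axioms use linearity and the range of the bracket,
    hence a congruence in which earlier conjuncts are available for later ones.\<close>
  have conj7: "\<lbrakk>A0 = B0; A1 = B1; B0 \<Longrightarrow> B1 \<Longrightarrow> A2 = B2; A3 = B3; B0 \<Longrightarrow> A4 = B4; B0 \<Longrightarrow> B1 \<Longrightarrow> A5 = B5;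
      B0 \<and> B1 \<and> B2 \<and> B4 \<Longrightarrow> A6 = B6\<rbrakk> \<Longrightarrow>
    (A0 \<and> A1 \<and> A2 \<and> A3 \<and> A4 \<and> A5 \<and> A6) = ((B0 \<and> B1 \<and> B2 \<and> B4) \<and> B5 \<and> B3 \<and> B6)" for A0 A1 A2 A3 A4 A5 A6 B0 B1 B2 B3 B4 B5 B6
    by blast
  show ?thesis
    unfolding SUSY_LCA_def bil_iff_lin
  proof (rule conj7)
    show "bilinear_map (scl P) (pscl (scl P)) (\<lambda>a b. \<beta> (sg a) b) = lin (pscl (scl M)) \<beta>"
      unfolding Pi_pow_simps(1) by (rule bilinear_sg[OF vector_space_pscl])
    show "(\<forall>a b. \<beta> (sg a) b \<in> Vpoly N 1) = (\<forall>a b. \<beta> a b \<in> over (vr N 1))"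
      unfolding Vpoly_eq by (rule all_sg[of "\<lambda>a. \<forall>b. \<beta> a b \<in> over (vr N 1)"])
    have "(\<forall>a b. \<beta> (nab None (sg a)) b = - lam 0 (\<beta> (sg a) b) \<and> \<beta> (sg a) (nab None b) = lam 0 (\<beta> (sg a) b) + coeff_op 0 (nab None) (\<beta> (sg a) b)) = Trel \<beta>"
      unfolding Trel_def
      by (rule all_sg[of "\<lambda>a. \<forall>b. \<beta> (nab None a) b = - lam 0 (\<beta> a b) \<and> \<beta> a (nab None b) = lam 0 (\<beta> a b) + coeff_op 0 (nab None) (\<beta> a b)"])
    moreover have "sg (nab None a) = nab None (sg a)" for a using sg_nab[of None] by simp
    ultimately show "(\<forall>a b. \<beta> (sg (opT P a)) b = - lam 0 (\<beta> (sg a) b) \<and>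
        \<beta> (sg a) (opT P b) = lam 0 (\<beta> (sg a) b) + coeff_op 0 (opT P) (\<beta> (sg a) b)) = Trel \<beta>"
      unfolding Pi_pow_simps(2) nab_op(1) by simp
  next
    assume l: "lin (pscl (scl M)) \<beta>" and o: "\<forall>a b. \<beta> a b \<in> over (vr N 1)"
    have "\<beta> (sg a) b \<in> Vpoly_par N P 1 (p + sN + (q + sN) + (1 + sN)) \<longleftrightarrow> parp M (1 + p + q) (\<beta> a b)"
      if "a \<in> hpart M p" for p q a b
    proof -
      have e: "p + sN + (q + sN) + (1 + sN) + sN = 1 + p + q" by (simp add: ac_simps)
      show ?thesis unfolding Vpoly_par_eq mem_Collect_eq lin_sg[OF l that] parp_P e parp_ksgn over_ksgn using o by blast
    qed
    then show "(\<forall>p q. \<forall>a\<in>hpart P p. \<forall>b\<in>hpart P q. \<beta> (sg a) b \<in> Vpoly_par N P 1 (p + q + of_nat N)) =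
        (\<forall>p q. \<forall>a\<in>hpart M p. \<forall>b\<in>hpart M q. parp M (1 + p + q) (\<beta> a b))"
      unfolding all_P2 of_nat_N by (intro all_cong1 ball_cong refl)
  next
    assume l: "lin (pscl (scl M)) \<beta>"
    show "(\<forall>i<N. \<forall>p. \<forall>a\<in>hpart P p. \<forall>b. \<beta> (sg (opS P i a)) b = - ksgn (of_nat N) (tht 0 i (\<beta> (sg a) b)) \<and>
      \<beta> (sg a) (opS P i b) = ksgn (p + of_nat N) (tht 0 i (\<beta> (sg a) b) + coeff_op 1 (opS P i) (\<beta> (sg a) b))) =
      (\<forall>i<N. \<forall>a b. \<beta> (nab (Some i) a) b = tht 0 i (\<beta> a b) \<and>
       \<beta> (parity_aut M a) (nab (Some i) b) = - tht 0 i (\<beta> a b) - coeff_op 1 (nab (Some i)) (\<beta> a b))"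
      by (intro all_cong bracket_S_iff[OF l])
  qed (rule bracket_skew_iff, assumption, assumption, rule bracket_jacobi_iff[OF iffD2[OF bil_iff_lin]], assumption)
qed

end

subsection \<open>The Poisson vertex algebra axioms\<close>

lemma ksgn_swap:
  fixes x y :: "'a::ab_group_add"
  assumes "r = p + q"
  shows "ksgn p x = ksgn q y \<longleftrightarrow> y = ksgn r x"
  unfolding ksgn_cancel assms using ksgn_eq_iff[of "p + q" y x] by auto

lemma ksgn_two:
  fixes x y :: "'a::ab_group_add"
  assumes "p + q = p' + q' + 1"
  shows "ksgn p x = ksgn q y \<longleftrightarrow> ksgn p' x + ksgn q' y = 0"
proof -
  have "ksgn p' x + ksgn q' y = ksgn (p + p') (ksgn p x - ksgn q y)"
    using assms bit_cases[of p] bit_cases[of q] bit_cases[of p'] bit_cases[of q'] by (elim disjE) simp_all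
  then show ?thesis by (simp only: ksgn_eq_0_iff eq_iff_diff_eq_0[symmetric])
qed

context hwmodule
begin

definition muN :: "('v \<Rightarrow> 'v \<Rightarrow> 'v) \<Rightarrow> bool"
  where "muN \<mu> \<longleftrightarrow> (\<forall>p q. \<forall>a\<in>hpart M p. \<forall>b\<in>hpart M q. \<mu> a b \<in> hpart M (p + q + sN))"

definition muC :: "('v \<Rightarrow> 'v \<Rightarrow> 'v) \<Rightarrow> bool"
  where "muC \<mu> \<longleftrightarrow> (\<forall>p q. \<forall>a\<in>hpart M p. \<forall>b\<in>hpart M q. \<mu> b a = ksgn (p * q + 1 + of_nat N) (\<mu> a b))"

text \<open>Associativity in the form in which the Maurer-Cartan equation delivers it. In the
  presence of commutativity it says that the left multiplications by a and b commute up to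
  sign.\<close>

definition muA :: "('v \<Rightarrow> 'v \<Rightarrow> 'v) \<Rightarrow> bool"
  where "muA \<mu> \<longleftrightarrow> (\<forall>p q r. \<forall>a\<in>hpart M p. \<forall>b\<in>hpart M q. \<forall>c\<in>hpart M r.
    ksgn (q * (1 + p) + q * of_nat N) (\<mu> b (\<mu> a c)) + ksgn (p + (1 + p) * of_nat N) (\<mu> a (\<mu> b c)) = 0)"

definition muT :: "('v \<Rightarrow> 'v \<Rightarrow> 'v) \<Rightarrow> bool"
  where "muT \<mu> \<longleftrightarrow> (\<forall>a b. \<mu> (nab None a) b + \<mu> a (nab None b) = nab None (\<mu> a b))"

definition muS :: "('v \<Rightarrow> 'v \<Rightarrow> 'v) \<Rightarrow> bool"
  where "muS \<mu> \<longleftrightarrow> (\<forall>i<N. \<forall>a b. \<mu> (parity_aut M a) (nab (Some i) b) + \<mu> (nab (Some i) a) b +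
    ksgn (of_nat N) (nab (Some i) (\<mu> a b)) = 0)"

definition muL :: "('v \<Rightarrow> 'v \<Rightarrow> 'v spoly) \<Rightarrow> ('v \<Rightarrow> 'v \<Rightarrow> 'v) \<Rightarrow> bool"
  where "muL \<beta> \<mu> \<longleftrightarrow> (\<forall>p q r. \<forall>a\<in>hpart M p. \<forall>b\<in>hpart M q. \<forall>c\<in>hpart M r.
      coeff_op (1 + of_nat N) (\<lambda>u. \<mu> u c) (\<beta> a b) + (ksgn (q * (1 + p)) (coeff_op (1 + q + of_nat N) (\<mu> b) (\<beta> a c)) +
        ksgn (p + (1 + p) * of_nat N) (\<beta> a (\<mu> b c))) = 0)"

definition poisson :: "('v \<Rightarrow> 'v \<Rightarrow> 'v spoly) \<Rightarrow> ('v \<Rightarrow> 'v \<Rightarrow> 'v) \<Rightarrow> bool"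
  where "poisson \<beta> \<mu> \<longleftrightarrow> (bil \<beta> \<and> skew 0 \<beta> \<and> Trel \<beta> \<and> jac \<beta>) \<and>
    lin (scl M) \<mu> \<and> muN \<mu> \<and> muC \<mu> \<and> muA \<mu> \<and> muT \<mu> \<and> muS \<mu> \<and> muL \<beta> \<mu>"

lemma product_parity_iff:
  assumes l: "lin (scl M) \<mu>"
  shows "(\<forall>p q. \<forall>a\<in>hpart P p. \<forall>b\<in>hpart P q. \<mu> (sg a) b \<in> hpart P (p + q)) \<longleftrightarrow> muN \<mu>"
proof -
  have "\<mu> (sg a) b \<in> hpart P (p + sN + (q + sN)) \<longleftrightarrow> \<mu> a b \<in> hpart M (p + q + sN)" if "a \<in> hpart M p" for p q a b
  proof -
    have e: "p + sN + (q + sN) + sN = p + q + sN" by (simp add: ac_simps)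
    show ?thesis unfolding hpart_P lin_sg[OF l that] e hpart_ksgn ..
  qed
  then show ?thesis unfolding all_P2 muN_def by (intro all_cong1 ball_cong refl)
qed

lemma product_commute_iff:
  assumes l: "lin (scl M) \<mu>"
  shows "(\<forall>p q. \<forall>a\<in>hpart P p. \<forall>b\<in>hpart P q. \<mu> (sg a) b = ksgn (p * q) (\<mu> (sg b) a)) \<longleftrightarrow> muC \<mu>"
proof -
  have "\<mu> (sg a) b = ksgn ((p + sN) * (q + sN)) (\<mu> (sg b) a) \<longleftrightarrow> \<mu> b a = ksgn (p * q + 1 + (1 + sN)) (\<mu> a b)"
    if "a \<in> hpart M p" "b \<in> hpart M q" for p q a b
  proof -
    have "p * q + 1 + (1 + sN) = (p * sN + sN) + ((p + sN) * (q + sN) + (q * sN + sN))"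
      using bit_cases[of p] bit_cases[of q] bit_cases[of sN] by (elim disjE) simp_all
    then show ?thesis unfolding lin_sg[OF l that(1)] lin_sg[OF l that(2)] ksgn_simps(4) by (rule ksgn_swap)
  qed
  then show ?thesis unfolding all_P2 muC_def of_nat_N by (intro all_cong1 ball_cong refl)
qed

lemma product_T_iff: "(\<forall>a b. opT P (\<mu> (sg a) b) = \<mu> (sg (opT P a)) b + \<mu> (sg a) (opT P b)) \<longleftrightarrow> muT \<mu>"
proof -
  have s: "sg (nab None a) = nab None (sg a)" for a using sg_nab[of None] by simp
  show ?thesis unfolding muT_def Pi_pow_simps(2) nab_op(1) s
    unfolding eq_commute[of "nab None (\<mu> _ _)"]
    by (rule all_sg[of "\<lambda>a. \<forall>b. \<mu> (nab None a) b + \<mu> a (nab None b) = nab None (\<mu> a b)"])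
qed

lemma product_S_iff:
  assumes l: "lin (scl M) \<mu>"
  shows "(\<forall>i<N. \<forall>p. \<forall>a\<in>hpart P p. \<forall>b. opS P i (\<mu> (sg a) b) = \<mu> (sg (opS P i a)) b + ksgn p (\<mu> (sg a) (opS P i b))) \<longleftrightarrow> muS \<mu>"
  unfolding muS_def
proof (intro all_cong)
  fix i assume i: "i < N"
  let ?F = "\<lambda>a b. \<mu> (parity_aut M a) (nab (Some i) b) + \<mu> (nab (Some i) a) b + ksgn (1 + sN) (nab (Some i) (\<mu> a b))"
  have e: "nab (Some i) (\<mu> (sg a) b) = \<mu> (sg (nab (Some i) a)) b + ksgn (p + sN) (\<mu> (sg a) (nab (Some i) b)) \<longleftrightarrow> ?F a b = 0"
    if a: "a \<in> hpart M p" for p a b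
  proof -
    have "nab (Some i) a \<in> hpart M (p + 1)" using nab_hpart[OF a, of "Some i"] by simp
    note b = lin_sg[OF l this] lin_sg[OF l a]
    have m: "\<mu> (parity_aut M a) (nab (Some i) b) = ksgn p (\<mu> a (nab (Some i) b))"
      using additive_ksgn_commute[OF linD(2)[OF l]] by (simp add: parity_aut_hom[OF a])
    have "p = ((p + 1) * sN + sN) + (p + sN + (p * sN + sN))" "1 + sN = ((p + 1) * sN + sN) + (p * sN + sN) + 1"
      using bit_cases[of p] bit_cases[of sN] by (elim disjE; simp)+
    from ksgn_three[OF this, of "nab (Some i) (\<mu> a b)" "\<mu> (nab (Some i) a) b" "\<mu> a (nab (Some i) b)"]
    show ?thesis unfolding b m additive_ksgn_commute[OF additive_nab] ksgn_simps(4)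
      by (simp only: ac_simps)
  qed
  have S: "opS P i = nab (Some i)" using nab_op(2)[OF i] by simp
  have A: "additive (\<lambda>a. ?F a b)" for b
    by (intro additive_simps additive_comp[OF linD(2)[OF l]] additive_ksgn_comp additive_comp[OF additive_nab linD(2)[OF l]] additive_nab additive_parity_aut)
  have "(\<forall>p. \<forall>a\<in>hpart P p. \<forall>b. opS P i (\<mu> (sg a) b) = \<mu> (sg (opS P i a)) b + ksgn p (\<mu> (sg a) (opS P i b))) \<longleftrightarrow>
      (\<forall>p. \<forall>a\<in>hpart M p. \<forall>b. ?F a b = 0)"
    unfolding S all_P1 by (intro all_cong1 ball_cong refl e)
  also have "\<dots> \<longleftrightarrow> (\<forall>a b. ?F a b = 0)"
  proof
    assume h: "\<forall>p. \<forall>a\<in>hpart M p. \<forall>b. ?F a b = 0"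
    show "\<forall>a b. ?F a b = 0"
    proof (intro allI)
      fix a b
      show "?F a b = 0" by (rule hom_eqI[OF A additive_simps(2)]) (use h in blast)
    qed
  qed blast
  finally show "(\<forall>p. \<forall>a\<in>hpart P p. \<forall>b. opS P i (\<mu> (sg a) b) = \<mu> (sg (opS P i a)) b + ksgn p (\<mu> (sg a) (opS P i b))) \<longleftrightarrow>
    (\<forall>a b. \<mu> (parity_aut M a) (nab (Some i) b) + \<mu> (nab (Some i) a) b + ksgn (of_nat N) (nab (Some i) (\<mu> a b)) = 0)"
    unfolding of_nat_N .
qed

lemma product_leibniz_iff:
  assumes l: "lin (scl M) \<mu>" and b: "bil \<beta>"
  shows "(\<forall>p q. \<forall>a\<in>hpart P p. \<forall>b\<in>hpart P q. \<forall>c.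
      \<beta> (sg a) (\<mu> (sg b) c) = coeff_op 0 (\<lambda>d. \<mu> (sg d) c) (\<beta> (sg a) b) +
        ksgn ((p + of_nat N) * q) (coeff_op q (\<mu> (sg b)) (\<beta> (sg a) c))) \<longleftrightarrow> muL \<beta> \<mu>"
proof -
  have lb: "lin (pscl (scl M)) \<beta>" using b bil_iff_lin by blast
  let ?F = "\<lambda>p q a b c. coeff_op (1 + (1 + sN)) (\<lambda>u. \<mu> u c) (\<beta> a b) + (ksgn (q * (1 + p)) (coeff_op (1 + q + (1 + sN)) (\<mu> b) (\<beta> a c)) +
        ksgn (p + (1 + p) * (1 + sN)) (\<beta> a (\<mu> b c)))"
  have e: "\<beta> (sg a) (\<mu> (sg b) c) = coeff_op 0 (\<lambda>d. \<mu> (sg d) c) (\<beta> (sg a) b) +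
        ksgn ((p + sN + (1 + sN)) * (q + sN)) (coeff_op (q + sN) (\<mu> (sg b)) (\<beta> (sg a) c)) \<longleftrightarrow> ?F p q a b c = 0"
    if a: "a \<in> hpart M p" and b': "b \<in> hpart M q" for p q a b c
  proof -
    have "coeff_op 0 (\<lambda>d. \<mu> (sg d) c) (\<beta> a b) = coeff_op sN (\<lambda>d. ksgn ((p + q) * sN) (\<mu> d c)) (\<beta> a b)"
      unfolding coeff_op_def
    proof (rule kext_cong_parp[OF bilD(6)[OF b a b']])
      fix d u assume u: "u \<in> hpart M (1 + p + q + d)"
      show "ksgn (0 * d) (const (\<mu> (sg u) c)) = ksgn (sN * d) (const (ksgn ((p + q) * sN) (\<mu> u c)))"
        unfolding lin_sg[OF l u] additive_ksgn_commute[OF additive_const] by (simp add: algebra_simps)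
    qed
    moreover have "additive (coeff_op 0 (\<lambda>d. \<mu> (sg d) c))"
      using additive_comp[OF linD(2)[OF l] additive_sg] by simp
    ultimately have 1: "coeff_op 0 (\<lambda>d. \<mu> (sg d) c) (\<beta> (sg a) b) = ksgn (p * sN + sN + (p + q) * sN) (coeff_op sN (\<lambda>u. \<mu> u c) (\<beta> a b))"
      unfolding lin_sg[OF lb a] by (simp add: additive_ksgn_commute coeff_op_ksgn linD(2)[OF l])
    have "\<mu> (sg b) = (\<lambda>d. ksgn (q * sN + sN) (\<mu> b d))" by (rule ext) (rule lin_sg[OF l b'])
    then have 2: "coeff_op (q + sN) (\<mu> (sg b)) (\<beta> (sg a) c) = ksgn (p * sN + sN + (q * sN + sN)) (coeff_op (q + sN) (\<mu> b) (\<beta> a c))"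
      unfolding lin_sg[OF lb a] using coeff_op_ksgn[OF linD(1)[OF l], of "q + sN" "q * sN + sN" b]
        additive_ksgn_commute[OF additive_coeff_op[OF linD(1)[OF l]]] by (simp add: ac_simps)
    have 3: "\<beta> (sg a) (\<mu> (sg b) c) = ksgn (p * sN + sN + (q * sN + sN)) (\<beta> a (\<mu> b c))"
      unfolding lin_sg[OF lb a] lin_sg[OF l b'] additive_ksgn_commute[OF linD(1)[OF lb]] ksgn_simps(4) by (simp only: ac_simps)
    have s: "1 + (1 + sN) = sN" "1 + q + (1 + sN) = q + sN" by (simp_all add: ac_simps)
    have "q * (1 + p) = (p * sN + sN + (p + q) * sN) + ((p + sN + (1 + sN)) * (q + sN) + (p * sN + sN + (q * sN + sN)))"
      "p + (1 + p) * (1 + sN) = (p * sN + sN + (p + q) * sN) + (p * sN + sN + (q * sN + sN)) + 1"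
      using bit_cases[of p] bit_cases[of q] bit_cases[of sN] by (elim disjE; simp)+
    from ksgn_three[OF this, of "\<beta> a (\<mu> b c)" "coeff_op sN (\<lambda>u. \<mu> u c) (\<beta> a b)" "coeff_op (q + sN) (\<mu> b) (\<beta> a c)"]
    show ?thesis unfolding 1 2 3 s ksgn_simps(4) .
  qed
  have A: "additive (\<lambda>c. ?F p q a b c)" for p q a b
  proof -
    have "additive (\<lambda>c. coeff_op s (\<lambda>u. \<mu> u c) f)" for s f
      unfolding additive_def additive.add[OF linD(1)[OF l]] coeff_op_plus by simp
    then show ?thesis
      by (intro additive_simps additive_ksgn_comp additive_comp[OF additive_coeff_op[OF linD(1)[OF l]] linD(1)[OF lb]]
        additive_comp[OF linD(1)[OF lb] linD(1)[OF l]])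
  qed
  have "(\<forall>p q. \<forall>a\<in>hpart P p. \<forall>b\<in>hpart P q. \<forall>c.
      \<beta> (sg a) (\<mu> (sg b) c) = coeff_op 0 (\<lambda>d. \<mu> (sg d) c) (\<beta> (sg a) b) +
        ksgn ((p + (1 + sN)) * q) (coeff_op q (\<mu> (sg b)) (\<beta> (sg a) c))) \<longleftrightarrow>
    (\<forall>p q. \<forall>a\<in>hpart M p. \<forall>b\<in>hpart M q. \<forall>c. ?F p q a b c = 0)"
    unfolding all_P2 by (intro all_cong1 ball_cong refl e)
  \<comment> \<open>The axiom of the vertex algebra has an arbitrary c, the equation of the operad a
    homogeneous one; additivity in c closes the gap.\<close>
  also have "\<dots> \<longleftrightarrow> (\<forall>p q r. \<forall>a\<in>hpart M p. \<forall>b\<in>hpart M q. \<forall>c\<in>hpart M r. ?F p q a b c = 0)"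
  proof
    assume h: "\<forall>p q r. \<forall>a\<in>hpart M p. \<forall>b\<in>hpart M q. \<forall>c\<in>hpart M r. ?F p q a b c = 0"
    show "\<forall>p q. \<forall>a\<in>hpart M p. \<forall>b\<in>hpart M q. \<forall>c. ?F p q a b c = 0"
    proof (intro allI ballI)
      fix p q a b c assume ab: "a \<in> hpart M p" "b \<in> hpart M q"
      show "?F p q a b c = 0" by (rule hom_eqI[OF A additive_simps(2)]) (use h ab in blast)
    qed
  qed blast
  finally show ?thesis unfolding of_nat_N muL_def .
qed

lemma product_assoc_iff:
  assumes l: "lin (scl M) \<mu>" and n: "muN \<mu>" and c: "muC \<mu>"
  shows "(\<forall>a b c. \<mu> (sg (\<mu> (sg a) b)) c = \<mu> (sg a) (\<mu> (sg b) c)) \<longleftrightarrow> muA \<mu>"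
proof -
  let ?F = "\<lambda>a b c. \<mu> (sg (\<mu> (sg a) b)) c" and ?G = "\<lambda>a b c. \<mu> (sg a) (\<mu> (sg b) c)"
  have e: "?F a b c = ?G a b c \<longleftrightarrow>
      ksgn (r * (1 + p) + r * (1 + sN)) (\<mu> c (\<mu> a b)) + ksgn (p + (1 + p) * (1 + sN)) (\<mu> a (\<mu> c b)) = 0"
    if a: "a \<in> hpart M p" and b: "b \<in> hpart M q" and c': "c \<in> hpart M r" for p q r a b c
  proof -
    have ab: "\<mu> a b \<in> hpart M (p + q + sN)" using n a b by (simp add: muN_def)
    \<comment> \<open>Commutativity brings c to the front on both sides, which produces the nested
      form of \<open>muA\<close>. The sign on the left needs the parity of the product a b.\<close>
    have 1: "\<mu> (\<mu> a b) c = ksgn (r * (p + q + sN) + 1 + (1 + sN)) (\<mu> c (\<mu> a b))" "\<mu> b c = ksgn (r * q + 1 + (1 + sN)) (\<mu> c b)"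
      using c ab b c' unfolding muC_def of_nat_N by blast+
    have F: "?F a b c = ksgn ((p * sN + sN) + (((p + q + sN) * sN + sN) + (r * (p + q + sN) + 1 + (1 + sN)))) (\<mu> c (\<mu> a b))"
      unfolding lin_sg[OF l a] additive_ksgn_commute[OF additive_sg] additive_ksgn_commute[OF linD(2)[OF l]] lin_sg[OF l ab] 1 ksgn_simps(4) ..
    have G: "?G a b c = ksgn ((p * sN + sN) + ((q * sN + sN) + (r * q + 1 + (1 + sN)))) (\<mu> a (\<mu> c b))"
      unfolding lin_sg[OF l a] lin_sg[OF l b] additive_ksgn_commute[OF linD(1)[OF l]] 1 ksgn_simps(4) by (simp only: ac_simps)
    show ?thesis unfolding F G
      by (rule ksgn_two, insert bit_cases[of p] bit_cases[of q] bit_cases[of r] bit_cases[of sN], elim disjE) simp_all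
  qed
  have "(\<forall>a b c. ?F a b c = ?G a b c) \<longleftrightarrow> (\<forall>p q r. \<forall>a\<in>hpart M p. \<forall>b\<in>hpart M q. \<forall>c\<in>hpart M r. ?F a b c = ?G a b c)"
  proof
    assume h: "\<forall>p q r. \<forall>a\<in>hpart M p. \<forall>b\<in>hpart M q. \<forall>c\<in>hpart M r. ?F a b c = ?G a b c"
    have 1: "?F a b c = ?G a b c" if "a \<in> hpart M p" "b \<in> hpart M q" for p q a b c
      by (rule hom_eqI[OF linD(1)[OF l] additive_comp[OF linD(1)[OF l] linD(1)[OF l]]]) (use h that in blast)
    have 2: "?F a b c = ?G a b c" if "a \<in> hpart M p" for p a b c
      by (rule hom_eqI[OF additive_comp[OF linD(2)[OF l] additive_comp[OF additive_sg linD(1)[OF l]]] additive_comp[OF linD(1)[OF l] additive_comp[OF linD(2)[OF l] additive_sg]]]) (use 1 that in blast)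
    have "?F a b c = ?G a b c" for a b c
      by (rule hom_eqI[OF additive_comp[OF linD(2)[OF l] additive_comp[OF additive_sg additive_comp[OF linD(2)[OF l] additive_sg]]] additive_comp[OF linD(2)[OF l] additive_sg]]) (use 2 in blast)
    then show "\<forall>a b c. ?F a b c = ?G a b c" by blast
  qed blast
  also have "\<dots> \<longleftrightarrow> (\<forall>p q r. \<forall>a\<in>hpart M p. \<forall>b\<in>hpart M q. \<forall>c\<in>hpart M r.
      ksgn (r * (1 + p) + r * (1 + sN)) (\<mu> c (\<mu> a b)) + ksgn (p + (1 + p) * (1 + sN)) (\<mu> a (\<mu> c b)) = 0)"
    by (intro all_cong1 ball_cong refl e)
  \<comment> \<open>The two conditions differ only by renaming b and c together with their
    parities.\<close>
  also have "\<dots> \<longleftrightarrow> muA \<mu>" unfolding muA_def of_nat_N by blast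
  finally show ?thesis .
qed

lemma PVA_iff: "SUSY_PVA N P (\<lambda>a b. \<beta> (sg a) b) (\<lambda>a b. \<mu> (sg a) b) \<longleftrightarrow> poisson \<beta> \<mu>"
proof -
  have conj8: "\<lbrakk>A0 = (B0 \<and> C0); A1 = B1; B1 \<Longrightarrow> A2 = B2; B1 \<Longrightarrow> A3 = B3; B1 \<Longrightarrow> B2 \<Longrightarrow> B3 \<Longrightarrow> A4 = B4; A5 = B5; B1 \<Longrightarrow> A6 = B6;
      B1 \<Longrightarrow> B0 \<Longrightarrow> A7 = B7\<rbrakk> \<Longrightarrow>
    (A0 \<and> A1 \<and> A2 \<and> A3 \<and> A4 \<and> A5 \<and> A6 \<and> A7) = ((B0 \<and> C0) \<and> B1 \<and> B2 \<and> B3 \<and> B4 \<and> B5 \<and> B6 \<and> B7)"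
    for A0 A1 A2 A3 A4 A5 A6 A7 B0 C0 B1 B2 B3 B4 B5 B6 B7
    by blast
  show ?thesis
    unfolding SUSY_PVA_def poisson_def
    by (rule conj8[OF LCA_iff _ product_parity_iff product_commute_iff product_assoc_iff product_T_iff product_S_iff product_leibniz_iff])
      (simp_all only: Pi_pow_simps(1) bilinear_sg[OF vs])
qed

end

subsection \<open>Lifting a product\<close>

lemma dth_not_over: "f \<in> over S \<Longrightarrow> (k, Some i) \<notin> S \<Longrightarrow> dth k i f = 0"
proof (rule over_additive_eq[where F = "dth k i" and G = "\<lambda>_. 0"])
  fix k' l and f :: "'a spoly"
  assume "(k, Some i) \<notin> S" "(k', l) \<in> S" "f \<in> over S" "dth k i f = 0"
  then show "dth k i (var k' l f) = 0"
    using dth_var[OF over_fin, of f S k i k' l] by (auto simp: additive.zero[OF additive_var])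
qed simp_all

context hwmodule
begin

text \<open>The \<open>y\<close> with \<open>Res (\<lambda>\<^sup>-\<^sup>1 y) = \<mu>\<close> and \<open>y (S\<^sup>i a) b = \<theta>\<^sup>i y a b\<close>, built up one odd direction at a time.\<close>

primrec ylift :: "('v \<Rightarrow> 'v \<Rightarrow> 'v) \<Rightarrow> nat list \<Rightarrow> 'v \<Rightarrow> 'v \<Rightarrow> 'v spoly" where
  "ylift \<mu> [] a b = const (\<mu> a b)"
| "ylift \<mu> (k # ks) a b = tht 0 k (ylift \<mu> ks a b) +
    ksgn (of_nat N + of_nat (length ks) + 1) (ylift \<mu> ks (nab (Some k) a) b)"

context
  fixes \<mu> :: "'v \<Rightarrow> 'v \<Rightarrow> 'v"
  assumes l: "lin (scl M) \<mu>"
begin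

lemma ylift_over: "ylift \<mu> ks a b \<in> over {(0, Some i) | i. i \<in> set ks}"
proof (induction ks arbitrary: a)
  case (Cons k ks)
  have m: "ylift \<mu> ks a b \<in> over {(0, Some i) | i. i \<in> set (k # ks)}" for a
    by (rule subsetD[OF over_mono Cons.IH]) auto
  have "var 0 (Some k) (ylift \<mu> ks a b) \<in> over {(0, Some i) | i. i \<in> set (k # ks)}"
    by (rule over_var[OF _ m]) simp
  then have "tht 0 k (ylift \<mu> ks a b) \<in> over {(0, Some i) | i. i \<in> set (k # ks)}" by (simp only: opr_simps)
  then show ?case unfolding ylift.simps by (intro over_add over_ksgn[THEN iffD2] m)
qed simp

lemma ylift_fin: "ylift \<mu> ks a b \<in> fin"
  by (rule over_fin[OF ylift_over])

lemma ylift_additive: "additive (ylift \<mu> ks a)" "additive (\<lambda>a. ylift \<mu> ks a b)"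
proof (induction ks arbitrary: a)
  case Nil
  { case 1 show ?case using linD(1)[OF l] by (simp add: additive_def additive.add[OF additive_const]) }
  { case 2 show ?case using linD(2)[OF l, of b] by (simp add: additive_def additive.add[OF additive_const]) }
next
  case (Cons k ks)
  { case 1 show ?case
      unfolding additive_def ylift.simps additive.add[OF Cons.IH(1)] additive.add[OF additive_tht] ksgn_add by (simp add: algebra_simps) }
  { case 2 show ?case
      unfolding additive_def ylift.simps additive.add[OF additive_nab] additive.add[OF Cons.IH(2)] additive.add[OF additive_tht] ksgn_add
      by (simp add: algebra_simps) }
qed

lemma pscl_const: "pscl (scl M) c (const w) = const (scl M c w)"
  by (simp add: pscl_eq coeff_op_const)

lemma pscl_tht_ksgn: "f \<in> fin \<Longrightarrow> pscl (scl M) c (tht 0 k f + ksgn p g) = tht 0 k (pscl (scl M) c f) + ksgn p (pscl (scl M) c g)"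
proof -
  assume "f \<in> fin"
  moreover have "additive (pscl (scl M) c)" by (simp add: additive_def pm.scale_right_distrib)
  ultimately show ?thesis
    using pscl_var[of f 0 "Some k" c] by (simp add: pm.scale_right_distrib additive_ksgn_commute)
qed

lemma ylift_scl: "ylift \<mu> ks (scl M c a) b = pscl (scl M) c (ylift \<mu> ks a b)" "ylift \<mu> ks a (scl M c b) = pscl (scl M) c (ylift \<mu> ks a b)"
proof (induction ks arbitrary: a)
  case Nil
  { case 1 show ?case by (simp add: linD(3)[OF l] pscl_const) }
  { case 2 show ?case by (simp add: linD(4)[OF l] pscl_const) }
next
  case (Cons k ks)
  { case 1 show ?case unfolding ylift.simps pscl_tht_ksgn[OF ylift_fin] nab_scl Cons.IH(1) .. }
  { case 2 show ?case unfolding ylift.simps pscl_tht_ksgn[OF ylift_fin] Cons.IH(2) .. }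
qed

text \<open>Each further direction k reverses the sign of the rule, because \<theta>^j anticommutes
  with \<theta>^k and S^j with S^k; for j = k the squares vanish. The exponent in
  \<open>ylift\<close> starts at N, so that the sign is trivial once all N directions are
  present.\<close>

lemma ylift_tht: "j \<in> set ks \<Longrightarrow> tht 0 j (ylift \<mu> ks a b) = ksgn (of_nat N + of_nat (length ks)) (ylift \<mu> ks (nab (Some j) a) b)"
proof (induction ks arbitrary: a)
  case (Cons k ks)
  let ?e = "of_nat N + of_nat (length ks) + 1 :: bit"
  have z: "ylift \<mu> ks 0 b = 0" by (rule additive.zero[OF ylift_additive(2)])
  have e: "of_nat N + of_nat (length (k # ks)) = ?e" by (simp add: ac_simps)
  show ?case
  proof (cases "j \<in> set ks")
    case True
    note IH = Cons.IH[OF True]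
    have "tht 0 j (tht 0 k (ylift \<mu> ks a b)) = - tht 0 k (tht 0 j (ylift \<mu> ks a b))"
      using var_commute[OF ylift_fin, of 0 "Some j" 0 "Some k"] by simp
    moreover have "ylift \<mu> ks (nab (Some j) (nab (Some k) a)) b = - ylift \<mu> ks (nab (Some k) (nab (Some j) a)) b"
      using nab_commute[of "Some j" "Some k" a] by (simp add: additive.minus[OF ylift_additive(2)])
    ultimately show ?thesis
      unfolding e by (simp add: additive.add[OF additive_tht] additive_ksgn_commute[OF additive_tht] additive.minus[OF additive_tht]
        additive.diff[OF additive_tht] additive.diff[OF additive_ksgn] IH ksgn_add ksgn_minus)
  next
    case False
    then have "j = k" using Cons.prems by simp
    then show ?thesis
      unfolding e by (simp add: additive.add[OF additive_tht] additive_ksgn_commute[OF additive_tht] additive.minus[OF additive_tht]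
        additive.diff[OF additive_tht] additive.diff[OF additive_ksgn] nab_square z)
  qed
qed simp

text \<open>The variable \<theta>^k occurs only in the first of the two terms, so its derivative
  removes one step of the recursion.\<close>

lemma ylift_resid: "distinct ks \<Longrightarrow> fold (dth 0) ks (ylift \<mu> ks a b) = const (\<mu> a b)"
proof (induction ks)
  case (Cons k ks)
  have z: "dth 0 k (ylift \<mu> ks a b) = 0" for a
    by (rule dth_not_over[OF ylift_over]) (use Cons.prems in auto)
  have "dth 0 k (ylift \<mu> (k # ks) a b) = ylift \<mu> ks a b"
    using dth_var[OF ylift_fin, of 0 k 0 "Some k" ks a b]
    by (simp add: additive.add[OF additive_dth] additive.diff[OF additive_dth] additive.minus[OF additive_dth] additive_ksgn_commute[OF additive_dth] z)
  then show ?case using Cons by simp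
qed simp

lemma ylift_parp:
  assumes n: "muN \<mu>" and b: "b \<in> hpart M q"
  shows "a \<in> hpart M p \<Longrightarrow> parp M (p + q + sN + of_nat (length ks)) (ylift \<mu> ks a b)"
proof (induction ks arbitrary: a p)
  case Nil
  then show ?case using n b by (simp add: muN_def parp_const)
next
  case (Cons k ks)
  have "parp M (p + q + sN + of_nat (length ks) + 1) (tht 0 k (ylift \<mu> ks a b))"
    using parp_var[OF ylift_fin Cons.IH[OF Cons.prems], of "Some k" 0] by simp
  moreover have "parp M (p + 1 + q + sN + of_nat (length ks)) (ylift \<mu> ks (nab (Some k) a) b)"
    using Cons.IH nab_hpart[OF Cons.prems, of "Some k"] by simp
  moreover have "p + q + sN + of_nat (length (k # ks)) = p + q + sN + of_nat (length ks) + 1"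
    "p + 1 + q + sN + of_nat (length ks) = p + q + sN + of_nat (length ks) + 1" by (simp_all add: ac_simps)
  ultimately show ?case unfolding ylift.simps by (metis parp_add parp_ksgn)
qed

lemma ylift_ybase: "ybase (ylift \<mu> [0..<N]) \<mu>"
proof -
  have "{(0, Some i) | i. i \<in> set [0..<N]} = even_free N" by (auto simp: even_free_def)
  then have "ylift \<mu> [0..<N] a b \<in> over (even_free N)" for a b using ylift_over[of "[0..<N]" a b] by simp
  moreover have "ylift \<mu> [0..<N] (nab (Some i) a) b = tht 0 i (ylift \<mu> [0..<N] a b)" if "i < N" for i a b
    using ylift_tht[of i "[0..<N]" a b] that by simp
  ultimately show ?thesis
    unfolding ybase_def using ylift_additive ylift_resid[of "[0..<N]"] by (simp add: resid_def)
qed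

end

text \<open>The condition \<open>muS\<close> needs no counterpart on the left, as it is the residue
  of the rule for the second argument contained in \<open>bil y\<close>.\<close>

lemma coisson_iff_poisson:
  assumes y: "ybase y \<mu>" "bil y" and l: "lin (scl M) \<mu>" "muN \<mu>"
  shows "coisson_pair \<beta> y \<and> coisson_eqs \<beta> y \<longleftrightarrow> poisson \<beta> \<mu>"
proof -
  have skew: "skew 1 y \<longleftrightarrow> muC \<mu>"
    unfolding muC_def by (rule skew_residue_iff[OF y(1)]) (rule bil_S[OF y(2)])
  have T: "(\<forall>a b. y (nab None a) b + y a (nab None b) = coeff_op 0 (nab None) (y a b)) \<longleftrightarrow> muT \<mu>"
    unfolding muT_def by (rule T_derivation_iff[OF y(1)])
  have S: "muS \<mu>"
    unfolding muS_def using S_derivation_iff[OF y(1)] bilD(8)[OF y(2)] by blast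
  have A: "(\<forall>p q r. \<forall>a\<in>hpart M p. \<forall>b\<in>hpart M q. \<forall>c\<in>hpart M r. T2 p q y y a b c + T3 p y y a b c = 0) \<longleftrightarrow> muA \<mu>"
    unfolding muA_def by (rule assoc_iff[OF y])
  have L: "(\<forall>p q r. \<forall>a\<in>hpart M p. \<forall>b\<in>hpart M q. \<forall>c\<in>hpart M r. T1 y \<beta> a b c + (T2 p q y \<beta> a b c + T3 p \<beta> y a b c) = 0) \<longleftrightarrow> muL \<beta> \<mu>"
    if "bil \<beta>" unfolding muL_def by (rule leibniz_iff[OF y(1) that y(2)])
  have "\<forall>a b. y a b \<in> over (even_free N)" using ybaseD(3)[OF y(1)] by blast
  then have p: "coisson_pair \<beta> y \<longleftrightarrow> bil \<beta> \<and> skew 0 \<beta> \<and> muC \<mu> \<and> Trel \<beta> \<and> muT \<mu>"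
    unfolding coisson_pair_def skew T Trel_def using y(2) by (simp only: simp_thms)
  have e: "coisson_eqs \<beta> y \<longleftrightarrow> jac \<beta> \<and> muL \<beta> \<mu> \<and> muA \<mu>" if "bil \<beta>"
    unfolding coisson_eqs_def L[OF that, symmetric] A[symmetric] jac_def by blast
  show ?thesis unfolding p poisson_def using e y l S by blast
qed

lemma bil_ylift:
  assumes l: "lin (scl M) \<mu>" and n: "muN \<mu>" and S: "muS \<mu>"
  shows "bil (ylift \<mu> [0..<N])"
proof -
  let ?y = "ylift \<mu> [0..<N]"
  note y = ylift_ybase[OF l]
  have par: "parp M (1 + p + q) (?y a b)" if "a \<in> hpart M p" "b \<in> hpart M q" for a b p q
  proof -
    have e: "p + q + sN + of_nat (length [0..<N]) = 1 + p + q" by (simp add: of_nat_N ac_simps)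
    show ?thesis using ylift_parp[OF l n that(2,1), of "[0..<N]"] unfolding e .
  qed
  have S': "?y (parity_aut M a) (nab (Some i) b) = - tht 0 i (?y a b) - coeff_op 1 (nab (Some i)) (?y a b)" if "i < N" for i a b
    using that S S_derivation_iff[OF y] unfolding muS_def by blast
  show ?thesis
    unfolding bil_def
    by (intro conjI allI ballI impI)
      (rule ylift_additive[OF l] ylift_scl[OF l] ybaseD(4)[OF y] par ybaseD(6)[OF y] S'; assumption)+
qed

lemma Res_ybase: "ybase y \<mu> \<Longrightarrow> Res_inv N (y a b) = \<mu> a b"
  using resid_eq_const[of "y a b" N] ybaseD(3,7)[of y \<mu> a b] unfolding even_free_def by simp

lemma pair_residue:
  assumes y: "bil y" "\<forall>a b. y a b \<in> over (even_free N)"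
  defines "\<mu> \<equiv> \<lambda>a b. Res_inv N (y a b)"
  shows "ybase y \<mu>" "lin (scl M) \<mu>" "muN \<mu>"
proof -
  show "ybase y \<mu>"
    unfolding ybase_def \<mu>_def using y(2) bilD(1,2,7)[OF y(1)] resid_eq_const unfolding even_free_def by blast
  show "lin (scl M) \<mu>"
    unfolding lin_def additive_def \<mu>_def Res_inv_def additive.add[OF bilD(1)[OF y(1)]] additive.add[OF bilD(2)[OF y(1)]] bilD(3,4)[OF y(1)]
    by (simp add: Poly_Mapping.lookup_add lookup_pscl)
  \<comment> \<open>The residue reads the coefficient of a monomial of odd degree N, and this shifts
    the odd parity of y to N + 1.\<close>
  have "odeg ({#}, {0::nat} \<times> {..<N}) = 1 + sN" by (simp add: odeg_def card_cartesian_product of_nat_N)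
  then have "\<mu> a b \<in> hpart M (1 + p + q + (1 + sN))" if "a \<in> hpart M p" "b \<in> hpart M q" for a b p q
    using bilD(6)[OF y(1) that] unfolding parp_def \<mu>_def Res_inv_def by metis
  moreover have "1 + p + q + (1 + sN) = p + q + sN" for p q by (simp add: ac_simps)
  ultimately show "muN \<mu>" unfolding muN_def by metis
qed

lemma MC_odd_iff: "X \<in> MC_odd N M \<longleftrightarrow> sym_op X \<and> coisson_eqs (opval X {#}) (opval X {#(0, Suc 0)#})"
proof -
  have "box_square N M X = zero_operation N M 3 \<longleftrightarrow> coisson_eqs (opval X {#}) (opval X {#(0, Suc 0)#})" if "sym_op X"
    using symmetric_operation.box_zero_iff[OF symmetric_operation.intro[OF hwmodule_axioms symmetric_operation_axioms.intro[OF that]]] .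
  then show ?thesis unfolding MC_odd_def sym_op_def by blast
qed

lemma sym_op_bil:
  assumes "sym_op X"
  shows "bil (opval X {#})" "bil (opval X {#(0, Suc 0)#})" "\<forall>a b. opval X {#(0, Suc 0)#} a b \<in> over (even_free N)"
  using sym_op_pair(1)[OF assms] unfolding coisson_pair_def by auto

lemma nf_P: "well_valued X \<Longrightarrow> Q \<in> quivers 2 \<Longrightarrow> nf P 2 (rep (X Q [a, b])) = opval X Q a b"
  using nf_eq[OF well_valuedD(1)] unfolding nf_def Pi_pow_simps opval_def by blast

lemma bil_sg: "bil F \<Longrightarrow> F (sg a) b = (\<Sum>p\<in>UNIV. ksgn (p * sN) (F (proj P p a) b))"
  unfolding sg_def UNIV_bit
  by (simp add: additive.add[OF bilD(2)] additive_ksgn_commute[of "\<lambda>a. F a b"] bilD(2))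

lemma op_bracket_eq: "sym_op X \<Longrightarrow> op_bracket N P X = (\<lambda>a b. opval X {#} (sg a) b)"
  unfolding op_bracket_def sN_def[symmetric] bil_sg[OF sym_op_bil(1)]
  by (intro ext) (simp only: nf_P[OF sym_op_pair(4) quivers_2_simps(1)])

lemma op_product_eq: "sym_op X \<Longrightarrow> op_product N P X = (\<lambda>a b. Res_inv N (opval X {#(0, Suc 0)#} (sg a) b))"
proof (intro ext)
  fix a b assume X: "sym_op X"
  have R: "additive (\<lambda>f. Res_inv N (f :: 'v spoly))" by (simp add: additive_def Res_inv_def Poly_Mapping.lookup_add)
  show "op_product N P X a b = Res_inv N (opval X {#(0, Suc 0)#} (sg a) b)"
    unfolding op_product_def sN_def[symmetric] bil_sg[OF sym_op_bil(2)[OF X]] UNIV_bit One_nat_def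
      nf_P[OF sym_op_pair(4)[OF X] quivers_2_simps(2)]
    by (simp add: additive.add[OF R] additive_ksgn_commute[OF R])
qed

lemma MC_odd_poisson:
  assumes "X \<in> MC_odd N M"
  shows "poisson (opval X {#}) (\<lambda>a b. Res_inv N (opval X {#(0, Suc 0)#} a b))"
    "SUSY_PVA N P (op_bracket N P X) (op_product N P X)"
proof -
  have X: "sym_op X" "coisson_eqs (opval X {#}) (opval X {#(0, Suc 0)#})" using assms MC_odd_iff by blast+
  note r = pair_residue[OF sym_op_bil(2,3)[OF X(1)]]
  show p: "poisson (opval X {#}) (\<lambda>a b. Res_inv N (opval X {#(0, Suc 0)#} a b))"
    using coisson_iff_poisson[OF r(1) sym_op_bil(2)[OF X(1)] r(2,3), of "opval X {#}"] X(2) sym_op_pair(1)[OF X(1)] by simp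
  then show "SUSY_PVA N P (op_bracket N P X) (op_product N P X)"
    unfolding op_bracket_eq[OF X(1)] op_product_eq[OF X(1)] PVA_iff[symmetric] .
qed

lemma MC_odd_inj:
  assumes X: "X \<in> MC_odd N M" and Y: "Y \<in> MC_odd N M"
    and b: "op_bracket N P X = op_bracket N P Y" and m: "op_product N P X = op_product N P Y"
  shows "X = Y"
proof -
  have s: "sym_op X" "sym_op Y" using X Y MC_odd_iff by blast+
  have 1: "opval X {#} = opval Y {#}"
  proof (intro ext)
    fix a b'
    show "opval X {#} a b' = opval Y {#} a b'"
      using fun_cong[OF fun_cong[OF b, of "sg a"], of b'] unfolding op_bracket_eq[OF s(1)] op_bracket_eq[OF s(2)] sg_sg .
  qed
  have "(\<lambda>a b. Res_inv N (opval X {#(0, Suc 0)#} a b)) = (\<lambda>a b. Res_inv N (opval Y {#(0, Suc 0)#} a b))"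
  proof (intro ext)
    fix a b'
    show "Res_inv N (opval X {#(0, Suc 0)#} a b') = Res_inv N (opval Y {#(0, Suc 0)#} a b')"
      using fun_cong[OF fun_cong[OF m, of "sg a"], of b'] unfolding op_product_eq[OF s(1)] op_product_eq[OF s(2)] sg_sg .
  qed
  then have "opval X {#(0, Suc 0)#} = opval Y {#(0, Suc 0)#}"
    using ybase_unique[OF pair_residue(1)[OF sym_op_bil(2,3)[OF s(1)]]] pair_residue(1)[OF sym_op_bil(2,3)[OF s(2)]] by simp
  with 1 show ?thesis using sym_op_pair(3)[OF s(1)] sym_op_pair(3)[OF s(2)] by simp
qed

text \<open>The preimage is explicit: the sign twist is undone by \<open>sg\<close> itself, the
  product is lifted by \<open>ylift\<close>, and the pair is assembled by
  \<open>pair_op\<close>.\<close>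

lemma MC_odd_surj:
  assumes "SUSY_PVA N P br mu"
  shows "\<exists>X\<in>MC_odd N M. op_bracket N P X = br \<and> op_product N P X = mu"
proof -
  define \<beta> where "\<beta> = (\<lambda>a b. br (sg a) b)"
  define \<mu> where "\<mu> = (\<lambda>a b. mu (sg a) b)"
  have eq: "(\<lambda>a b. \<beta> (sg a) b) = br" "(\<lambda>a b. \<mu> (sg a) b) = mu" by (simp_all add: \<beta>_def \<mu>_def sg_sg)
  have p: "poisson \<beta> \<mu>" using assms unfolding PVA_iff[symmetric] eq .
  then have l: "lin (scl M) \<mu>" "muN \<mu>" "muS \<mu>" unfolding poisson_def by blast+
  let ?y = "ylift \<mu> [0..<N]"
  note y = ylift_ybase[OF l(1)] bil_ylift[OF l]
  have c: "coisson_pair \<beta> ?y" "coisson_eqs \<beta> ?y" using coisson_iff_poisson[OF y l(1,2)] p by blast+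
  let ?X = "pair_op \<beta> ?y"
  have s: "sym_op ?X" by (rule pair_op_sym(1)[OF c(1)])
  have v: "opval ?X {#} = \<beta>" "opval ?X {#(0, Suc 0)#} = ?y"
    using pair_op_sym(2)[OF c(1) quivers_2_simps(1)] pair_op_sym(2)[OF c(1) quivers_2_simps(2)]
    unfolding pval_simps by (intro ext; blast)+
  have "?X \<in> MC_odd N M" unfolding MC_odd_iff v using s c(2) by blast
  moreover have "op_bracket N P ?X = br" unfolding op_bracket_eq[OF s] v by (rule eq(1))
  moreover have "op_product N P ?X = mu" unfolding op_product_eq[OF s] v Res_ybase[OF y(1)] by (rule eq(2))
  ultimately show ?thesis by blast
qed

end

lemma Pi_pow_Pi_pow: "Pi_pow n (Pi_pow n M) = M"
  by (simp add: Pi_pow_def add.assoc)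

theorem theorem2p2p10:
  fixes N :: nat and M :: "('k::field_char_0, 'v::ab_group_add) hw_module"
  assumes "HW_supermodule N M"
  shows "(\<forall>X\<in>MC_odd N (Pi_pow (N + 1) M).
      SUSY_PVA N M (op_bracket N M X) (op_product N M X)) \<and>
    bij_betw (\<lambda>X. (op_bracket N M X, op_product N M X))
      (MC_odd N (Pi_pow (N + 1) M))
      {(br, mu). SUSY_PVA N M br mu}"
proof -
  interpret W: hwmodule N "Pi_pow (N + 1) M"
    by (rule hwmodule.intro[OF HW_supermodule_Pi_pow[OF assms]])
  \<comment> \<open>The locale works with the shifted module, and its second shift is the module of
    the theorem.\<close>
  have P: "Pi_pow (Suc N) (Pi_pow (N + 1) M) = M"
    unfolding Suc_eq_plus1 by (rule Pi_pow_Pi_pow)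
  note poisson = W.MC_odd_poisson(2)[unfolded P]
  have "bij_betw (\<lambda>X. (op_bracket N M X, op_product N M X)) (MC_odd N (Pi_pow (N + 1) M)) {(br, mu). SUSY_PVA N M br mu}"
    unfolding bij_betw_def
  proof (intro conjI)
    show "inj_on (\<lambda>X. (op_bracket N M X, op_product N M X)) (MC_odd N (Pi_pow (N + 1) M))"
      by (rule inj_onI) (use W.MC_odd_inj[unfolded P] in blast)
    show "(\<lambda>X. (op_bracket N M X, op_product N M X)) ` MC_odd N (Pi_pow (N + 1) M) = {(br, mu). SUSY_PVA N M br mu}"
      using poisson W.MC_odd_surj[unfolded P] by (fastforce simp: image_iff)
  qed
  with poisson show ?thesis by blast
qed

end
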